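(* Let $\epsilon>0$ be a sufficiently small fixed number, and for large $T$ put $H=T^{1/6+2\epsilon}$. With the sets $G_1(x)=G_1(x;T,H)$ and $G_2(y)=G_2(y;T,H)$ defined in the context, one has, as $T\to\infty$, $$\int_{G_1(x)}Z(t)\,dt=\frac{2}{\pi}H\sin x+\mathcal{O}\left(xT^{1/6+\epsilon}\right),\qquad \int_{G_2(y)}Z(t)\,dt=-\frac{2}{\pi}H\sin y+\mathcal{O}\left(yT^{1/6+\epsilon}\right),$$ for $x,y\in\left(0,\frac{\pi}{2}\right]$, where the implied constants depend only on $\epsilon$ (they are uniform in $x,y$).
   Context: Let $\vartheta(t)=-\frac t2\ln\pi+\operatorname{Im}\ln\Gamma\left(\frac14+i\frac t2\right)$ (the continuous branch of the logarithm that is real at $t=0$) be the Riemann-Siegel theta function, and let $Z(t)=e^{i\vartheta(t)}\zeta\left(\frac12+it\right)$, which is real for real $t$; $\zeta$ is the Riemann zeta-function. For $\tau\in[-\pi,\pi]$ and positive integers $\nu$, $t_\nu(\tau)$ is defined by $\vartheta[t_\nu(\tau)]=\pi\nu+\tau$ (the solution taken in the range where $\vartheta$ is increasing; only large $t$ matter), and $t_\nu=t_\nu(0)$. For $0<x,y\le\frac\pi2$ define $$G_1(x;T,H)=\bigcup_{T\le t_{2\nu}\le T+H}\{t:\ t_{2\nu}(-x)<t<t_{2\nu}(x)\},$$ $$G_2(y;T,H)=\bigcup_{T\le t_{2\nu+1}\le T+H}\{t:\ t_{2\nu+1}(-y)<t<t_{2\nu+1}(y)\},$$ with the convention that these sets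 are replaced by their intersections with $[T,T+H]$, so that $G_1(x),G_2(y)\subset[T,T+H]$. *)

theory Defs
  imports "HOL-Complex_Analysis.Complex_Analysis"
begin

text \<open>
  The Riemann zeta-function as the analytic continuation of its Dirichlet series.  By the identity
  theorem the value is determined for all \<open>s \<noteq> 1\<close>; the value at the pole is arbitrary.
\<close>
definition zeta :: "complex \<Rightarrow> complex" where
  "zeta = (SOME f. f holomorphic_on (- {1}) \<and>
             (\<forall>s. Re s > 1 \<longrightarrow> f s = (\<Sum>n. of_nat (Suc n) powr (- s))))"

text \<open>
  The library function \<^const>\<open>ln_Gamma\<close> is holomorphic off the non-positive real axis,
  is a logarithm of \<^const>\<open>Gamma\<close> there and is real on the positive axis.  Along the line
  \<open>1/4 + it/2\<close> it is therefore the continuous branch that is real at \<open>t = 0\<close>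
  (and not the principal logarithm of \<open>Gamma\<close>).
\<close>
definition theta :: "real \<Rightarrow> real" where
  "theta t = - (t / 2) * ln pi + Im (ln_Gamma (Complex (1 / 4) (t / 2)))"

text \<open>
  The values are real by the functional equation; the complex type keeps the defining formula as is.
\<close>
definition Z :: "real \<Rightarrow> complex" where
  "Z t = exp (\<i> * complex_of_real (theta t)) * zeta (Complex (1 / 2) t)"

text \<open>
  As \<^const>\<open>theta\<close> decreases on \<open>[0, c]\<close> and increases on \<open>[c, \<infinity>)\<close> (\<open>c\<close> about 6.29), the condition
  \<open>strict_mono_on {t..} theta\<close> says exactly \<open>t \<ge> c\<close>, and there is at most one solution.
\<close>
definition gram :: "nat \<Rightarrow> real \<Rightarrow> real" where
  "gram \<nu> \<tau> = (THE t. strict_mono_on {t..} theta \<and> theta t = pi * real \<nu> + \<tau>)"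

definition G1 :: "real \<Rightarrow> real \<Rightarrow> real \<Rightarrow> real set" where
  "G1 x T H =
     (\<Union>\<nu>\<in>{\<nu>. 1 \<le> \<nu> \<and> T \<le> gram (2 * \<nu>) 0 \<and> gram (2 * \<nu>) 0 \<le> T + H}.
        {t. gram (2 * \<nu>) (- x) < t \<and> t < gram (2 * \<nu>) x}) \<inter> {T..T + H}"

definition G2 :: "real \<Rightarrow> real \<Rightarrow> real \<Rightarrow> real set" where
  "G2 y T H =
     (\<Union>\<nu>\<in>{\<nu>. 1 \<le> \<nu> \<and> T \<le> gram (2 * \<nu> + 1) 0 \<and> gram (2 * \<nu> + 1) 0 \<le> T + H}.
        {t. gram (2 * \<nu> + 1) (- y) < t \<and> t < gram (2 * \<nu> + 1) y}) \<inter> {T..T + H}"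

end

theory Submission
  imports Defs "HOL-Real_Asymp.Real_Asymp"
begin

text \<open>
  Write \<open>F(s) = \<zeta>(s) e\<^bsup>A(s)\<^esup>\<close>, where \<open>A\<close> continues \<open>i\<vartheta>\<close> off the critical line; the functional
  equation becomes \<open>F(1 - cnj s) = cnj (F s)\<close>.  On an interval of length \<open>H\<close> around \<open>T\<close> the phase \<open>\<vartheta>\<close> is
  linear with slope \<open>L = \<vartheta>'(T)\<close> up to \<open>H\<^sup>2/T\<close>, so the points where \<open>\<vartheta>\<close> is congruent to \<open>\<tau>\<close> modulo \<open>2\<pi>\<close> are, up to
  a negligible shift, the zeros of \<open>1 - w\<close> with \<open>w = exp (-i\<beta> - L(s - 1/2))\<close>.  The residue theorem for
  \<open>F w / (1 - w)\<close> on a rectangle symmetric about the critical line turns the sum of \<open>Z\<close> over these points into the main term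
  \<open>2N cos \<tau>\<close> (from the constant term of the Dirichlet series on \<open>Re s = 3/2\<close>, \<open>N\<close> being the number of points),
  horizontal sides bounded by the van der Corput estimate \<open>\<zeta>(1/2 + it) \<lless> t\<^bsup>1/6 + \<delta>\<^esup>\<close>,
  and the integral of \<open>Z\<close> itself, which is an exponential integral whose stationary terms lie near
  \<open>n = e\<^sup>L\<close>, and which the third-derivative test bounds by the same power.  Integrating over
  \<open>\<tau> \<in> (-x, x)\<close> gives both claims, with error proportional to \<open>x\<close>.
\<close>

text \<open>Adding F/2 to F w / (1 - w) gives (F/2)(1 + w)/(1 - w), which turns into minus its
  conjugate under s -> 1 - cnj s; so the left half of the rectangle contributes minus the conjugate
  of the right half, and the added F/2, moved back to the critical line by Cauchy's theorem, is the
  source of the integral of Z. The length N = T^(4/3 + \<epsilon>) of the Dirichlet polynomial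
  balances two errors: the second-order Euler-Maclaurin remainder T^2 N^(-3/2) must stay small after
  multiplication by H, while the longest dyadic block costs sqrt (N/T). Terms within T^(1/3 -
  2\<epsilon>) of e^L are bounded pointwise instead of integrated; what their short range saves is
  what the factor H spends. Logarithms are absorbed into small powers of T, and all exponents end at
  1/6 + 5\<epsilon>/8. As \<open>zeta\<close> is chosen by its defining properties, a function with
  these properties has to be constructed, along with the functional equation. The latter is proved
  for real s in (-1, 0) by evaluating the Mellin integral of one positive kernel in two ways, and
  then continued.\<close>

section \<open>Exponential sums: partial summation, the Kusmin-Landau bound, van der Corput's second
  and third derivative tests\<close>

text \<open>Partial summation. For monotone weights the sum of
  \<open>\<bar>c n - c (Suc n)\<bar>\<close> collapses to \<open>\<bar>c 0 - c k\<bar>\<close>, so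
  that together with the boundary term the weights cost at most 2 C.\<close>

lemma abel_summation_bound:
  fixes y :: "nat \<Rightarrow> complex" and c :: "nat \<Rightarrow> real"
  assumes part: "\<And>k. k \<le> K \<Longrightarrow> norm (\<Sum>n<k. y n) \<le> B"
    and mono: "(\<forall>n. Suc n < K \<longrightarrow> c n \<le> c (Suc n)) \<or> (\<forall>n. Suc n < K \<longrightarrow> c (Suc n) \<le> c n)"
    and bnd: "\<And>n. n < K \<Longrightarrow> 0 \<le> c n \<and> c n \<le> C" and "0 \<le> C"
  shows "norm (\<Sum>n<K. c n * y n) \<le> 2 * C * B"
proof -
  have B0: "0 \<le> B" using part[of 0] by simp
  define Y where "Y k = (\<Sum>n<k. y n)" for k
  have parts: "(\<Sum>n<Suc k. c n * y n) = c k * Y (Suc k) + (\<Sum>n<k. complex_of_real (c n - c (Suc n)) * Y (Suc n))" for k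
    by (induction k) (auto simp: Y_def algebra_simps)
  show ?thesis
  proof (cases K)
    case 0 then show ?thesis using B0 \<open>0 \<le> C\<close> by simp
  next
    case (Suc k)
    have YB: "norm (Y n) \<le> B" if "n \<le> K" for n using part[OF that] by (simp add: Y_def)
    have "norm (\<Sum>n<K. c n * y n) \<le> norm (c k * Y (Suc k)) + norm (\<Sum>n<k. complex_of_real (c n - c (Suc n)) * Y (Suc n))"
      unfolding Suc parts by (rule norm_triangle_ineq)
    also have "norm (c k * Y (Suc k)) \<le> c k * B"
      using bnd[of k] YB[of "Suc k"] Suc by (auto simp: norm_mult intro!: mult_left_mono)
    also have "norm (\<Sum>n<k. complex_of_real (c n - c (Suc n)) * Y (Suc n)) \<le> (\<Sum>n<k. \<bar>c n - c (Suc n)\<bar> * B)"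
    proof (rule sum_norm_le)
      fix n assume "n \<in> {..<k}"
      then show "norm (complex_of_real (c n - c (Suc n)) * Y (Suc n)) \<le> \<bar>c n - c (Suc n)\<bar> * B"
        using YB[of "Suc n"] Suc unfolding norm_mult norm_of_real by (intro mult_left_mono) auto
    qed
    also have "(\<Sum>n<k. \<bar>c n - c (Suc n)\<bar> * B) = (\<Sum>n<k. \<bar>c n - c (Suc n)\<bar>) * B"
      by (simp add: sum_distrib_right)
    also have "(\<Sum>n<k. \<bar>c n - c (Suc n)\<bar>) = \<bar>c 0 - c k\<bar>"
      using mono
    proof
      assume m: "\<forall>n. Suc n < K \<longrightarrow> c n \<le> c (Suc n)"
      have "(\<Sum>n<j. \<bar>c n - c (Suc n)\<bar>) = c j - c 0" if "j \<le> k" for j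
        using that
      proof (induction j)
        case (Suc j)
        have "c  j \<le> c (Suc j)" using m Suc.prems \<open>K = Suc k\<close> by auto
        with Suc show ?case by simp
      qed simp
      from this[of k] have *: "(\<Sum>n<k. \<bar>c n - c (Suc n)\<bar>) = c k - c 0" by simp
      moreover have "(\<Sum>n<k. \<bar>c n - c (Suc n)\<bar>) \<ge> 0" by (rule sum_nonneg) auto
      ultimately show ?thesis by linarith
    next
      assume m: "\<forall>n. Suc n < K \<longrightarrow> c (Suc n) \<le> c n"
      have "(\<Sum>n<j. \<bar>c n - c (Suc n)\<bar>) = c 0 - c j" if "j \<le> k" for j
        using that
      proof (induction j)
        case (Suc j)
        have "c (Suc j) \<le> c  j" using m Suc.prems \<open>K = Suc k\<close> by auto
        with Suc show ?case by simp
      qed simp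
      from this[of k] have *: "(\<Sum>n<k. \<bar>c n - c (Suc n)\<bar>) = c 0 - c k" by simp
      moreover have "(\<Sum>n<k. \<bar>c n - c (Suc n)\<bar>) \<ge> 0" by (rule sum_nonneg) auto
      ultimately show ?thesis by linarith
    qed
    also have "c k * B + \<bar>c 0 - c k\<bar> * B = (c k + \<bar>c 0 - c k\<bar>) * B" by (simp add: algebra_simps)
    also have "\<dots> \<le> (2 * C) * B"
      using bnd[of 0] bnd[of k] Suc by (intro mult_right_mono B0) auto
    finally show ?thesis by simp
  qed
qed

text \<open>With phase increment d, \<open>cis (f n)\<close> equals (1 + i cot (d/2))/2 times the
  difference \<open>cis (f n) - cis (f (Suc n))\<close>. The differences telescope, and the
  cotangents are non-negative, at most 2/\<delta>, and monotone because the increments decrease, so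
  partial summation applies. Increments are confined to at most pi rather than 2 pi, which keeps the
  cotangents from changing sign.\<close>

lemma kusmin_landau:
  fixes f :: "nat \<Rightarrow> real"
  assumes "0 < \<delta>"
    and d: "\<And>n. n < K \<Longrightarrow> \<delta> \<le> f (Suc n) - f n \<and> f (Suc n) - f n \<le> pi"
    and mono: "\<And>n. Suc n < K \<Longrightarrow> f (Suc (Suc n)) - f (Suc n) \<le> f (Suc n) - f n"
  shows "norm (\<Sum>n<K. cis (f n)) \<le> 1 + 4 / \<delta>"
proof -
  define c where "c n = cot ((f (Suc n) - f n) / 2)" for n
  define y where "y n = cis (f n) - cis (f (Suc n))" for n
  have tele: "(\<Sum>n<k. y n) = cis (f 0) - cis (f k)" for k
    by (induction k) (auto simp: y_def)
  have tele2: "norm (\<Sum>n<k. y n) \<le> 2" for k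
    unfolding tele using norm_triangle_ineq4[of "cis (f 0)" "cis (f k)"] by simp
  have cis_y: "cis (f n) = (1 + \<i> * c n) / 2 * y n" if "n < K" for n
  proof -
    define a where "a = (f (Suc n) - f n) / 2"
    have a: "0 < a" "a \<le> pi/2" using d[OF that] \<open>0 < \<delta>\<close> by (auto simp: a_def)
    then have s: "sin a \<noteq> 0" using sin_gt_zero[of a] pi_gt_zero by linarith
    have "f (Suc n) = f n + 2 * a" by (simp add: a_def field_simps)
    then have y: "y n = cis (f n) * (1 - cis (2*a))" by (simp add: y_def cis_mult algebra_simps)
    have e: "1 - cis (2*a) = - 2 * \<i> * sin a * cis a"
      by (auto simp: complex_eq_iff cos_double sin_double power2_eq_square)
         (metis cos_squared_eq power2_eq_square sin_cos_squared_add3 add_diff_cancel_left' cos_double_sin cos_double mult_2 add.commute diff_add_eq diff_diff_eq2)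
    have c: "1 + \<i> * c n = \<i> / sin a * cis (-a)"
      using s by (auto simp: c_def a_def[symmetric] complex_eq_iff cot_def field_simps Re_divide Im_divide power2_eq_square)
    have "(1 + \<i> * c n) / 2 * y n = cis (f n) * (cis (-a) * cis a)"
      unfolding y e c using s by (simp add: mult_ac)
    then show ?thesis by (simp add: cis_mult)
  qed
  have cb: "0 \<le> c n \<and> c n \<le> 2 / \<delta>" if "n < K" for n
  proof -
    define a where "a = (f (Suc n) - f n) / 2"
    have a: "\<delta>/2 \<le> a" "a \<le> pi/2" using d[OF that] by (auto simp: a_def)
    then have a0: "0 < a" using \<open>0 < \<delta>\<close> by simp
    show ?thesis
    proof (cases "a = pi/2")
      case True show ?thesis unfolding c_def a_def[symmetric] True using \<open>0 < \<delta>\<close> by (simp add: cot_def)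
    next
      case False
      then have "a < pi/2" using a by simp
      have t: "a \<le> tan a" using tan_gt_zero[of a] a0 \<open>a < pi/2\<close>
      proof -
        have "\<exists>z>0. z < a \<and> tan a - tan 0 = (a - 0) * inverse ((cos z)^2)"
          using a0 \<open>a < pi/2\<close> by (intro MVT2) (auto intro!: DERIV_tan simp: cos_gt_zero_pi less_imp_neq[symmetric] cos_gt_zero)
        then obtain z where z: "z > 0" "z < a" "tan a = a * inverse ((cos z)^2)" by auto
        have "(cos z)^2 \<le> 1" "cos z > 0" using z \<open>a < pi/2\<close> by (auto simp: cos_gt_zero abs_square_le_1)
        then have "1 \<le> inverse ((cos z)^2)" by (simp add: one_le_inverse)
        then show ?thesis unfolding z using a0 by simp
      qed
      have "c n = inverse (tan a)" by (simp add: c_def a_def[symmetric] cot_altdef)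
      moreover have "inverse (tan a) \<le> inverse (\<delta>/2)" using t a \<open>0 < \<delta>\<close> by (intro le_imp_inverse_le) auto
      moreover have "0 \<le> inverse (tan a)" using t a0 by simp
      ultimately show ?thesis by simp
    qed
  qed
  have cm: "c n \<le> c (Suc n)" if "Suc n < K" for n
  proof -
    define a b where "a = (f (Suc n) - f n) / 2" and "b = (f (Suc (Suc n)) - f (Suc n)) / 2"
    have ab: "0 < b" "b \<le> a" "a \<le> pi/2" using d[of n] d[of "Suc n"] mono[OF that] that \<open>0 < \<delta>\<close> by (auto simp: a_def b_def)
    have "c n = cot a" "c (Suc n) = cot b" by (auto simp: c_def a_def b_def)
    moreover have "cot a \<le> cot b"
    proof (cases "a < pi/2")
      case True
      have "tan b \<le> tan a" using ab True by (intro tan_mono_le) (auto intro: less_trans[of _ 0])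
      moreover have "0 < tan b" using ab True by (intro tan_gt_zero) auto
      ultimately show ?thesis unfolding cot_altdef by (intro le_imp_inverse_le)
    next
      case False
      then have "a = pi/2" using ab by simp
      then have "cot a = 0" unfolding \<open>a = pi/2\<close> by (simp add: cot_def)
      moreover have "cot b \<ge> 0" using ab by (auto simp: cot_def intro!: divide_nonneg_nonneg cos_ge_zero sin_ge_zero)
      ultimately show ?thesis by simp
    qed
    ultimately show ?thesis by simp
  qed
  have "(\<Sum>n<K. cis (f n)) = (\<Sum>n<K. (1 + \<i> * c n) / 2 * y n)" by (intro sum.cong) (auto simp: cis_y)
  also have "\<dots> = (\<Sum>n<K. y n)/2 + \<i>/2 * (\<Sum>n<K. c n * y n)"
    by (simp add: sum_divide_distrib sum_distrib_left field_simps flip: sum.distrib)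
  also have "norm \<dots> \<le> norm ((\<Sum>n<K. y n)/2) + norm (\<i>/2 * (\<Sum>n<K. c n * y n))" by (rule norm_triangle_ineq)
  also have "\<dots> = norm (\<Sum>n<K. y n) / 2 + norm (\<Sum>n<K. c n * y n) / 2" by (simp add: norm_mult norm_divide)
  also have "\<dots> \<le> 2/2 + (2 * (2/\<delta>) * 2)/2"
    using cb cm \<open>0 < \<delta>\<close> by (intro add_mono divide_right_mono abel_summation_bound tele2) auto
  finally show ?thesis by simp
qed

text \<open>Van der Corput's form of Weyl differencing: q times the sum is a sum, over K + q
  positions, of q consecutive terms of the zero-padded sequence. Cauchy-Schwarz and expansion of the
  square leave correlations that depend only on the distance of the two shifts. The leading 2 K
  comes from K + q <= 2 K.\<close>

lemma weyl_van_der_corput: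
  fixes z :: "nat \<Rightarrow> complex" and c :: "nat \<Rightarrow> real"
  assumes "1 \<le> q" "q \<le> K"
    and z: "\<And>n. n < K \<Longrightarrow> norm (z n) \<le> 1"
    and corr: "\<And>h. 1 \<le> h \<Longrightarrow> h < q \<Longrightarrow> norm (\<Sum>n<K-h. z (n + h) * cnj (z n)) \<le> c h"
  shows "(norm (\<Sum>n<K. z n))\<^sup>2 \<le> 2 * real K / real q * (real K + 2 * (\<Sum>h=1..<q. c h))"
proof -
  \<comment> \<open>The sequence is placed at offset q with zeros on both sides, so that a shift by
    any j < q keeps its whole support inside the range m < K + q.\<close>
  define Z where "Z m = (if q \<le> m \<and> m < q + K then z (m - q) else 0)" for m
  define S where "S = (\<Sum>n<K. z n)"
  have shift: "(\<Sum>m<K+q. Z (m + j)) = S" if "j < q" for j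
  proof -
    have "(\<Sum>m<K+q. Z (m + j)) = (\<Sum>m\<in>{q-j..<q-j+K}. Z (m + j))"
      using that by (intro sum.mono_neutral_right) (auto simp: Z_def)
    also have "\<dots> = (\<Sum>n\<in>{0..<K}. Z (n + (q - j) + j))"
      by (rule sum.reindex_bij_witness[of _ "\<lambda>n. n + (q-j)" "\<lambda>n. n - (q-j)"]) auto
    also have "\<dots> = (\<Sum>n<K. z n)" using that by (intro sum.cong) (auto simp: Z_def)
    finally show ?thesis by (simp add: S_def)
  qed
  define R where "R j j' = (\<Sum>m<K+q. Z (m + j) * cnj (Z (m + j')))" for j j'
  have R: "norm (R j j') \<le> (if j = j' then real K else c (j - j'))" if "j < q" "j' \<le> j" for j j'
  proof -
    define h where "h = j - j'"
    have "R j j' = (\<Sum>m\<in>{q-j'..<q-j'+(K-h)}. Z (m + j) * cnj (Z (m + j')))"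
      unfolding R_def using that by (intro sum.mono_neutral_right) (auto simp: Z_def h_def)
    also have "\<dots> = (\<Sum>n\<in>{0..<K-h}. Z (n + (q - j') + j) * cnj (Z (n + (q - j') + j')))"
      by (rule sum.reindex_bij_witness[of _ "\<lambda>n. n + (q-j')" "\<lambda>n. n - (q-j')"]) auto
    also have "\<dots> = (\<Sum>n<K-h. z (n + h) * cnj (z n))" using that by (intro sum.cong) (auto simp: Z_def h_def)
    finally have *: "R j j' = (\<Sum>n<K-h. z (n + h) * cnj (z n))" .
    show ?thesis
    proof (cases "j = j'")
      case True
      have "norm (R j j') \<le> (\<Sum>n<K-h. 1)"
        unfolding * by (rule sum_norm_le) (use True z in \<open>auto simp: norm_mult h_def intro!: mult_le_one\<close>)
      then show ?thesis using True by (simp add: h_def)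
    next
      case False
      then show ?thesis using corr[of h] that * by (auto simp: h_def)
    qed
  qed
  have c0: "0 \<le> c h" if "1 \<le> h" "h < q" for h using corr[OF that] norm_ge_zero order_trans by blast
  \<comment> \<open>Distance 0 is the diagonal and gets the trivial value K; other distances get the
    assumed correlation bound.\<close>
  define r where "r h = (if h = 0 then real K else c h)" for h :: nat
  have Rsym: "norm (R j j') = norm (R j' j)" for j j'
  proof -
    have "R j j' = cnj (R j' j)" unfolding R_def by (simp add: cnj_sum mult.commute)
    then show ?thesis by simp
  qed
  have R': "norm (R j j') \<le> r (if j' \<le> j then j - j' else j' - j)" if "j < q" "j' < q" for j j'
    using R[of j j'] R[of j' j] Rsym[of j j'] that by (auto simp: r_def split: if_splits)
  \<comment> \<open>A row contains each distance h >= 1 at most once on either side of the diagonal,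
    hence the factor 2.\<close>
  have row: "(\<Sum>j'<q. r (if j' \<le> j then j - j' else j' - j)) \<le> real K + 2 * (\<Sum>h=1..<q. c h)" if "j < q" for j
  proof -
    have "(\<Sum>j'<q. r (if j' \<le> j then j - j' else j' - j)) =
       (\<Sum>j'\<in>{..<j}. r (j - j')) + r 0 + (\<Sum>j'\<in>{j<..<q}. r (j' - j))"
    proof -
      have eq: "{..<q} = insert j ({..<j} \<union> {j<..<q})" using that by auto
      have split: "sum f {..<q} = f j + (sum f {..<j} + sum f {j<..<q})" for f :: "nat \<Rightarrow> real"
      proof -
        have "sum f {..<q} = f j + sum f ({..<j} \<union> {j<..<q})" unfolding eq by (rule sum.insert) auto
        also have "sum f ({..<j} \<union> {j<..<q}) = sum f {..<j} + sum f {j<..<q}" by (rule sum.union_disjoint) auto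
        finally show ?thesis .
      qed
      note split[of "\<lambda>j'. r (if j' \<le> j then j - j' else j' - j)"]
      moreover have "(\<Sum>j'\<in>{..<j}. r (if j' \<le> j then j - j' else j' - j)) = (\<Sum>j'\<in>{..<j}. r (j - j'))"
        "(\<Sum>j'\<in>{j<..<q}. r (if j' \<le> j then j - j' else j' - j)) = (\<Sum>j'\<in>{j<..<q}. r (j' - j))"
        by (auto intro!: sum.cong)
      ultimately show ?thesis by simp
    qed
    also have "(\<Sum>j'\<in>{..<j}. r (j - j')) = (\<Sum>h\<in>{1..j}. r h)"
      by (rule sum.reindex_bij_witness[of _ "\<lambda>h. j - h" "\<lambda>h. j - h"]) auto
    also have "\<dots> = (\<Sum>h\<in>{1..j}. c h)" by (intro sum.cong) (auto simp: r_def)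
    also have "\<dots> \<le> (\<Sum>h=1..<q. c h)" using that by (intro sum_mono2) (auto intro: c0)
    also have "(\<Sum>j'\<in>{j<..<q}. r (j' - j)) = (\<Sum>h\<in>{1..<q-j}. r h)"
      by (rule sum.reindex_bij_witness[of _ "\<lambda>h. j + h" "\<lambda>h. h - j"]) auto
    also have "\<dots> = (\<Sum>h\<in>{1..<q-j}. c h)" by (intro sum.cong) (auto simp: r_def)
    also have "\<dots> \<le> (\<Sum>h=1..<q. c h)" using that by (intro sum_mono2) (auto intro: c0)
    finally show ?thesis by (simp add: r_def)
  qed
  have qS: "of_nat q * S = (\<Sum>m<K+q. \<Sum>j<q. Z (m + j))"
  proof -
    have "(\<Sum>m<K+q. \<Sum>j<q. Z (m + j)) = (\<Sum>j<q. \<Sum>m<K+q. Z (m + j))" by (rule sum.swap)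
    then show ?thesis by (simp add: shift)
  qed
  have B: "(\<Sum>m<K+q. (norm (\<Sum>j<q. Z (m + j)))\<^sup>2) \<le> real q * (real K + 2 * (\<Sum>h=1..<q. c h))"
  proof -
    have "complex_of_real (\<Sum>m<K+q. (norm (\<Sum>j<q. Z (m + j)))\<^sup>2) = (\<Sum>m<K+q. \<Sum>j<q. \<Sum>j'<q. Z (m + j) * cnj (Z (m + j')))"
      by (simp only: of_real_sum complex_norm_square cnj_sum sum_product)
    also have "\<dots> = (\<Sum>j<q. \<Sum>m<K+q. \<Sum>j'<q. Z (m + j) * cnj (Z (m + j')))" by (rule sum.swap)
    also have "\<dots> = (\<Sum>j<q. \<Sum>j'<q. R j j')"
    proof (rule sum.cong[OF refl])
      fix j
      show "(\<Sum>m<K+q. \<Sum>j'<q. Z (m + j) * cnj (Z (m + j'))) = (\<Sum>j'<q. R j j')"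
        unfolding R_def by (rule sum.swap)
    qed
    finally have eq: "complex_of_real (\<Sum>m<K+q. (norm (\<Sum>j<q. Z (m + j)))\<^sup>2) = (\<Sum>j<q. \<Sum>j'<q. R j j')" .
    have "(\<Sum>m<K+q. (norm (\<Sum>j<q. Z (m + j)))\<^sup>2) \<le> norm (\<Sum>j<q. \<Sum>j'<q. R j j')"
      unfolding eq[symmetric] norm_of_real by (rule abs_ge_self)
    also have "\<dots> \<le> (\<Sum>j<q. \<Sum>j'<q. r (if j' \<le> j then j - j' else j' - j))"
      by (intro sum_norm_le R') auto
    also have "\<dots> \<le> (\<Sum>j<q. real K + 2 * (\<Sum>h=1..<q. c h))" by (intro sum_mono row) auto
    finally show ?thesis by simp
  qed
  have "(real q * norm S)\<^sup>2 = (norm (\<Sum>m<K+q. \<Sum>j<q. Z (m + j)))\<^sup>2"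
    unfolding qS[symmetric] by (simp add: norm_mult)
  also have "\<dots> \<le> (\<Sum>m<K+q. norm (\<Sum>j<q. Z (m + j)))\<^sup>2" by (intro power_mono norm_sum) auto
  also have "\<dots> \<le> real (card {..<K+q}) * (\<Sum>m<K+q. (norm (\<Sum>j<q. Z (m + j)))\<^sup>2)"
    using sum_squared_le_sum_of_squares[of "\<lambda>m. norm (\<Sum>j<q. Z (m + j))" "{..<K+q}"] by (simp add: mult.commute)
  also have "\<dots> \<le> real (card {..<K+q}) * (real q * (real K + 2 * (\<Sum>h=1..<q. c h)))"
    by (intro mult_left_mono B) auto
  also have "\<dots> \<le> (2 * real K) * (real q * (real K + 2 * (\<Sum>h=1..<q. c h)))"
    using \<open>q \<le> K\<close> by (intro mult_right_mono mult_nonneg_nonneg add_nonneg_nonneg sum_nonneg) (auto intro: c0)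
  finally have "(real q)\<^sup>2 * (norm S)\<^sup>2 \<le> real q * (2 * real K * (real K + 2 * (\<Sum>h=1..<q. c h)))"
    by (simp add: power_mult_distrib algebra_simps)
  then have "real q * (norm S)\<^sup>2 \<le> (2 * real K * (real K + 2 * (\<Sum>h=1..<q. c h)))"
    using \<open>1 \<le> q\<close> by (simp add: power2_eq_square)
  then show ?thesis using \<open>1 \<le> q\<close> by (simp add: S_def field_simps)
qed

lemma mean_value_le:
  fixes f :: "real \<Rightarrow> real"
  assumes "a \<le> b" and "\<And>x. a \<le> x \<Longrightarrow> x \<le> b \<Longrightarrow> (f has_real_derivative f' x) (at x)"
    and "\<And>x. a \<le> x \<Longrightarrow> x \<le> b \<Longrightarrow> l \<le> f' x \<and> f' x \<le> u"
  shows "l * (b - a) \<le> f b - f a \<and> f b - f a \<le> u * (b - a)"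
proof (cases "a = b")
  case False
  then obtain z where z: "a < z" "z < b" "f b - f a = (b - a) * f' z"
    using MVT2[of a b f f'] assms by fastforce
  then show ?thesis using assms(3)[of z] \<open>a \<le> b\<close> by (auto simp: mult.commute intro!: mult_left_mono)
qed simp

lemma sum_inverse_le:
  assumes "1 \<le> q"
  shows "(\<Sum>h=1..<q. 1 / real h) \<le> 1 + ln (real q)"
proof -
  have "(\<Sum>h=1..<Suc n. 1 / real h) \<le> 1 + ln (real n)" if "1 \<le> n" for n
    using that
  proof (induction n rule: dec_induct)
    case (step n)
    have "ln (real n / real (Suc n)) \<le> real n / real (Suc n) - 1" using step by (intro ln_le_minus_one) auto
    also have "\<dots> = - (1 / real (Suc n))" by (simp add: field_simps)
    finally have "ln (real n) - ln (real (Suc n)) \<le> - (1 / real (Suc n))" using step by (simp add: ln_div)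
    then show ?case using step by simp
  qed simp
  note * = this
  show ?thesis
  proof (cases "q = 1")
    case False
    then obtain n where n: "q = Suc n" "1 \<le> n" using assms by (cases q) auto
    have "ln (real n) \<le> ln (real q)" using n by simp
    then show ?thesis using *[of n] n(2) unfolding n(1) by linarith
  qed simp
qed

text \<open>Differencing by h gives a phase whose increments lie between h \<mu> and 8 h \<mu> and
  decrease, because \<open>F3\<close> is non-positive; Kusmin-Landau then bounds each correlation by
  a multiple of 1/(h \<mu>), and the sum over h costs the logarithm. The range is never split at
  multiples of 2 pi: the shifts are limited to 1/(4 \<mu>), where all increments stay below
  pi.\<close>

lemma van_der_corput_second:
  fixes F F1 F2 F3 :: "real \<Rightarrow> real" and a \<mu> :: real and K :: nat
  assumes D1: "\<And>u. a \<le> u \<Longrightarrow> u \<le> a + K \<Longrightarrow> (F has_real_derivative F1 u) (at u)"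
    and D2: "\<And>u. a \<le> u \<Longrightarrow> u \<le> a + K \<Longrightarrow> (F1 has_real_derivative F2 u) (at u)"
    and D3: "\<And>u. a \<le> u \<Longrightarrow> u \<le> a + K \<Longrightarrow> (F2 has_real_derivative F3 u) (at u)"
    and l: "0 < \<mu>" and F2: "\<And>u. a \<le> u \<Longrightarrow> u \<le> a + K \<Longrightarrow> \<mu> \<le> F2 u \<and> F2 u \<le> 8 * \<mu>"
    and F3: "\<And>u. a \<le> u \<Longrightarrow> u \<le> a + K \<Longrightarrow> F3 u \<le> 0"
    and K: "1 \<le> K"
  shows "(norm (\<Sum>n<K. cis (F (a + n))))\<^sup>2 \<le> 300 * (K\<^sup>2 * \<mu> + 1 / \<mu>) * (1 + ln K)"
proof -
  define S where "S = norm (\<Sum>n<K. cis (F (a + n)))"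
  have S0: "0 \<le> S" by (simp add: S_def)
  have SK: "S \<le> K" unfolding S_def using sum_norm_le[of "{..<K}" "\<lambda>n. cis (F (a + n))" "\<lambda>_. 1"] by simp
  have lnK: "0 \<le> ln K" using K by simp
  \<comment> \<open>Arithmetic-geometric mean: it disposes of the cross term in K that appears when
    the product is expanded at the end.\<close>
  have amgm: "real K \<le> K\<^sup>2 * \<mu> + 1 / \<mu>"
  proof -
    have "0 \<le> (K * \<mu> - 1)\<^sup>2 + K * \<mu>" using l by simp
    also have "\<dots> = (K * \<mu>)\<^sup>2 + 1 - K * \<mu>" by (simp add: power2_eq_square algebra_simps)
    also have "(K * \<mu>)\<^sup>2 + 1 = (K\<^sup>2 * \<mu> + 1 / \<mu>) * \<mu>" using l
      by (simp add: power2_eq_square field_simps)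
    finally have "real K * \<mu> \<le> (K\<^sup>2 * \<mu> + 1 / \<mu>) * \<mu>" by simp
    then show ?thesis using l by (simp add: mult_le_cancel_right)
  qed
  show ?thesis
  \<comment> \<open>For \<mu> > 1/4 the claim already exceeds the trivial bound K^2.\<close>
  proof (cases "\<mu> \<le> 1/4")
    case False
    have "S\<^sup>2 \<le> (real K)\<^sup>2" using SK S0 by (intro power_mono)
    also have "\<dots> \<le> 300 * (K\<^sup>2 * \<mu>) * 1"
      using mult_left_mono[of "1" "300 * \<mu>" "(real K)\<^sup>2"] False by (simp add: mult_ac)
    also have "\<dots> \<le> 300 * (K\<^sup>2 * \<mu> + 1 / \<mu>) * (1 + ln K)" using l lnK by (intro mult_mono) auto
    finally show ?thesis by (simp add: S_def)
  next
    case True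
    \<comment> \<open>Shifts up to 1/(4 \<mu>) have 8 h \<mu> <= 2 < pi, the range allowed in
      Kusmin-Landau.\<close>
    define Q where "Q = nat \<lfloor>1 / (4 * \<mu>)\<rfloor>"
    have q1: "1 \<le> 1 / (4 * \<mu>)" using True l by (simp add: field_simps)
    then have Q1: "1 \<le> Q" by (simp add: Q_def le_nat_floor)
    have Qle: "real Q \<le> 1 / (4 * \<mu>)" unfolding Q_def using l by (intro of_nat_floor) simp
    have "1 / (4 * \<mu>) < real Q + 1" using q1 unfolding Q_def by linarith
    \<comment> \<open>Rounding down loses at most a factor 2, because 1/(4 \<mu>) >= 1.\<close>
    then have Qge: "1 / (8 * \<mu>) \<le> real Q" using Q1 by simp
    define q where "q = min K Q"
    have q: "1 \<le> q" "q \<le> K" "q \<le> Q" using Q1 K by (auto simp: q_def)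
    have iq: "1 / real q \<le> 1 / K + 8 * \<mu>"
    proof (cases "K \<le> Q")
      case True then show ?thesis using l by (simp add: q_def)
    next
      case False
      then have "1 / real q = 1 / real Q" by (simp add: q_def)
      also have "\<dots> \<le> 8 * \<mu>" using Qge l Q1 by (simp add: field_simps)
      also have "\<dots> \<le> 1 / K + 8 * \<mu>" by simp
      finally show ?thesis .
    qed
    have corr: "norm (\<Sum>n<K-h. cis (F (a + real (n + h))) * cnj (cis (F (a + n)))) \<le> 6 / \<mu> * (1 / h)"
      if h: "1 \<le> h" "h < q" for h
    proof -
      define g where "g n = F (a + real (n + h)) - F (a + n)" for n
      have G: "((\<lambda>u. F (u + h) - F u) has_real_derivative (F1 (u + h) - F1 u)) (at u)"
        "((\<lambda>u. F1 (u + h) - F1 u) has_real_derivative (F2 (u + h) - F2 u)) (at u)"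
        if "a \<le> u" "u + h \<le> a + K" for u :: real
        using that by (auto intro!: DERIV_diff DERIV_shift[THEN iffD1] D1 D2)
      have F1b: "\<mu> * h \<le> F1 (u + h) - F1 u \<and> F1 (u + h) - F1 u \<le> 8 * \<mu> * h" if "a \<le> u" "u + h \<le> a + K" for u :: real
        using mean_value_le[of u "u + h" F1 F2 \<mu> "8*\<mu>"] D2 F2 that by auto
      have F2b: "F2 (u + h) - F2 u \<le> 0" if "a \<le> u" "u + h \<le> a + K" for u :: real
      proof (rule DERIV_nonpos_imp_nonincreasing[of u "u + h" F2, THEN iffD2[OF diff_le_0_iff_le]])
        fix x assume "u \<le> x" "x \<le> u + h"
        then show "\<exists>y. (F2 has_real_derivative y) (at x) \<and> y \<le> 0" using D3[of x] F3[of x] that by auto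
      qed auto
      have d: "\<mu> * h \<le> g (Suc n) - g n \<and> g (Suc n) - g n \<le> 8 * \<mu> * h" if "n < K - h" for n
      proof -
        have "real n + 1 + real h \<le> K" using that by linarith
        then have "\<mu> * h * (a + n + 1 - (a + n)) \<le> F (a + n + 1 + h) - F (a + n + 1) - (F (a + n + h) - F (a + n))
          \<and> F (a + n + 1 + h) - F (a + n + 1) - (F (a + n + h) - F (a + n)) \<le> 8 * \<mu> * h * (a + n + 1 - (a + n))"
          using G(1) F1b by (intro mean_value_le[of _ _ "\<lambda>u. F (u + h) - F u" "\<lambda>u. F1 (u + h) - F1 u"]) auto
        moreover have "g (Suc n) = F (a + n + 1 + h) - F (a + n + 1)" "g n = F (a + n + h) - F (a + n)"
        proof -
          have "a + real (Suc n + h) = a + n + 1 + h" "a + real (Suc n) = a + n + 1" "a + real (n + h) = a + n + h" by simp_all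
          then show "g (Suc n) = F (a + n + 1 + h) - F (a + n + 1)" "g n = F (a + n + h) - F (a + n)"
            unfolding g_def by (simp_all only:)
        qed
        moreover have "a + n + 1 - (a + n) = (1::real)" by (rule add_diff_cancel_left')
        ultimately show ?thesis by (simp only: mult_1_right)
      qed
      \<comment> \<open>The second difference of g is a value of \<open>D\<close> at a + n + 1 minus
        its value at a + n. \<open>D\<close> is non-increasing, as its derivative is the unit-step
        increment of \<open>F1 (u + h) - F1 u\<close>, whose own derivative
        \<open>F2 (u + h) - F2 u\<close> is non-positive.\<close>
      have m: "g (Suc (Suc n)) - g (Suc n) \<le> g (Suc n) - g n" if "Suc n < K - h" for n
      proof -
        define D where "D u = F (u + 1 + h) - F (u + 1) - (F (u + h) - F u)" for u :: real
        have "real n + 2 + real h \<le> K" using that by linarith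
        then have "D (a + n + 1) \<le> D (a + n)"
        proof (intro DERIV_nonpos_imp_nonincreasing[of "a + n" "a + n + 1" D])
          fix u assume u: "a + n \<le> u" "u \<le> a + n + 1"
          have D: "(D has_real_derivative ((F1 (u + 1 + h) - F1 (u + 1)) - (F1 (u + h) - F1 u))) (at u)"
          proof -
            have "((\<lambda>u. F (u + h) - F u) has_real_derivative F1 (u + 1 + h) - F1 (u + 1)) (at (u + 1))"
              by (rule G(1)) (use u \<open>real n + 2 + real h \<le> K\<close> in auto)
            then have "((\<lambda>u. F (u + 1 + h) - F (u + 1)) has_real_derivative F1 (u + 1 + h) - F1 (u + 1)) (at u)"
              by (subst (asm) DERIV_shift)
            moreover have "((\<lambda>u. F (u + h) - F u) has_real_derivative F1 (u + h) - F1 u) (at u)"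
              by (rule G(1)) (use u \<open>real n + 2 + real h \<le> K\<close> in auto)
            ultimately show ?thesis unfolding D_def by (rule DERIV_diff)
          qed
          have "F1 (u + 1 + h) - F1 (u + 1) \<le> F1 (u + h) - F1 u"
          proof (rule DERIV_nonpos_imp_nonincreasing[of u "u+1" "\<lambda>u. F1 (u + h) - F1 u"])
            fix x assume "u \<le> x" "x \<le> u + 1"
            then have "a \<le> x" "x + h \<le> a + K" using u \<open>real n + 2 + real h \<le> K\<close> by auto
            from G(2)[OF this] F2b[OF this]
            show "\<exists>y. ((\<lambda>u. F1 (u + h) - F1 u) has_real_derivative y) (at x) \<and> y \<le> 0" by blast
          qed simp
          with D show "\<exists>y. (D has_real_derivative y) (at u) \<and> y \<le> 0" by (intro exI[of _ "(F1 (u + 1 + h) - F1 (u + 1)) - (F1 (u + h) - F1 u)"]) simp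
        qed simp
        moreover have "g (Suc (Suc n)) - g (Suc n) = D (a + n + 1)" "g (Suc n) - g n = D (a + n)"
          unfolding g_def D_def by (simp_all add: algebra_simps)
        ultimately show ?thesis by simp
      qed
      have hl: "h * \<mu> \<le> 1 / 4"
      proof -
        have "real h * \<mu> \<le> real Q * \<mu>" using h q l by (intro mult_right_mono) auto
        also have "\<dots> \<le> 1 / (4 * \<mu>) * \<mu>" using Qle l by (intro mult_right_mono) auto
        finally show ?thesis using l by simp
      qed
      have "(\<Sum>n<K-h. cis (F (a + real (n + h))) * cnj (cis (F (a + n)))) = (\<Sum>n<K-h. cis (g n))"
        by (simp add: g_def cis_cnj cis_mult)
      also have "norm \<dots> \<le> 1 + 4 / (h * \<mu>)"
      proof (rule kusmin_landau)
        show "0 < h * \<mu>" using h l by simp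
        fix n assume "n < K - h"
        from d[OF this] have "h * \<mu> \<le> g (Suc n) - g n" "g (Suc n) - g n \<le> 8 * (h * \<mu>)" by (simp_all add: mult_ac)
        then show "h * \<mu> \<le> g (Suc n) - g n \<and> g (Suc n) - g n \<le> pi"
          using hl pi_gt3 by linarith
      qed (use m in auto)
      also have "\<dots> \<le> 6 / (h * \<mu>)"
      proof -
        have "1 \<le> 2 / (h * \<mu>)" using hl h l by (simp add: field_simps)
        then show ?thesis by (simp add: field_simps)
      qed
      finally show ?thesis using h l by (simp add: mult.commute)
    qed
    have SB: "(\<Sum>h=1..<q. 6 / \<mu> * (1 / h)) \<le> 6 / \<mu> * (1 + ln K)"
    proof -
      have "(\<Sum>h=1..<q. 1 / real h) \<le> 1 + ln K"
      proof -
        have "ln (real q) \<le> ln (real K)" using q by (intro ln_mono) auto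
        then show ?thesis using sum_inverse_le[OF q(1)] by linarith
      qed
      then show ?thesis unfolding sum_distrib_left[symmetric] using l by (intro mult_left_mono) auto
    qed
    have "S\<^sup>2 \<le> 2 * real K / real q * (real K + 2 * (\<Sum>h=1..<q. 6 / \<mu> * (1 / h)))"
      unfolding S_def using q corr by (intro weyl_van_der_corput) auto
    also have "\<dots> \<le> 2 * real K / real q * (real K + 2 * (6 / \<mu> * (1 + ln K)))"
      by (intro mult_left_mono add_left_mono SB) auto
    also have "\<dots> \<le> 2 * real K * (1 / K + 8 * \<mu>) * ((real K + 12 / \<mu>) * (1 + ln K))"
    proof -
      have "2 * real K / real q = 2 * real K * (1 / real q)" by simp
      also have "\<dots> \<le> 2 * real K * (1 / K + 8 * \<mu>)" using iq by (intro mult_left_mono) auto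
      finally have 1: "2 * real K / real q \<le> 2 * real K * (1 / K + 8 * \<mu>)" .
      have 2: "real K + 2 * (6 / \<mu> * (1 + ln K)) \<le> (real K + 12 / \<mu>) * (1 + ln K)"
        using lnK K by (simp add: algebra_simps)
      show ?thesis by (intro mult_mono 1 2) (use l lnK in auto)
    qed
    also have "2 * real K * (1 / K + 8 * \<mu>) * ((real K + 12 / \<mu>) * (1 + ln K)) = (16 * (K\<^sup>2 * \<mu>) + 24 / \<mu> + 194 * K) * (1 + ln K)"
      using K l by (simp add: field_simps power2_eq_square)
    also have "\<dots> \<le> 300 * (K\<^sup>2 * \<mu> + 1 / \<mu>) * (1 + ln K)"
    proof (intro mult_right_mono)
      have "0 \<le> 1 / \<mu>" "0 \<le> K\<^sup>2 * \<mu>" using l by auto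
      then show "16 * (K\<^sup>2 * \<mu>) + 24 / \<mu> + 194 * K \<le> 300 * (K\<^sup>2 * \<mu> + 1 / \<mu>)"
        using amgm by (simp only: distrib_left divide_inverse)
    qed (use lnK in auto)
    finally show ?thesis by (simp add: S_def mult_left_mono)
  qed
qed

lemma sum_sqrt_le: "(\<Sum>h=1..<q. sqrt (real h)) \<le> q * sqrt q"
proof -
  have "(\<Sum>h=1..<q. sqrt (real h)) \<le> (\<Sum>h=1..<q. sqrt q)" by (intro sum_mono) auto
  also have "\<dots> = real (q - 1) * sqrt q" by simp
  also have "\<dots> \<le> q * sqrt q" by (intro mult_right_mono) auto
  finally show ?thesis .
qed

lemma sum_inverse_sqrt_le: "(\<Sum>h=1..<q. 1 / sqrt (real h)) \<le> 2 * sqrt q"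
proof -
  have "(\<Sum>h=1..<Suc n. 1 / sqrt (real h)) \<le> 2 * sqrt n" for n
  proof (induction n)
    case (Suc n)
    define r s where "r = sqrt n" and "s = sqrt (Suc n)"
    have rs: "0 \<le> r" "r \<le> s" "0 < s" "s\<^sup>2 = r\<^sup>2 + 1" by (auto simp: r_def s_def)
    then have "1 = (s - r) * (s + r)" by (simp add: algebra_simps power2_eq_square)
    also have "\<dots> \<le> (s - r) * (2 * s)" using rs by (intro mult_left_mono) auto
    finally have "1 / s \<le> (s - r) * (2 * s) / s" using rs by (intro divide_right_mono) auto
    then have "1 / s \<le> 2 * s - 2 * r" using rs by simp
    then show ?case using Suc by (simp add: r_def s_def del: of_nat_Suc)
  qed simp
  from this[of "q - 1"] have "(\<Sum>h=1..<q. 1 / sqrt (real h)) \<le> 2 * sqrt (real (q - 1))"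
    by (cases q) auto
  also have "\<dots> \<le> 2 * sqrt q" by simp
  finally show ?thesis .
qed

text \<open>One differencing step with shift h makes a third derivative of size \<mu> into a second
  derivative of size h \<mu>, to which the second derivative test applies. The number q of shifts
  stays a parameter: K^2/q asks for a large q, K^2 sqrt (q \<mu>) for a small one, and the best
  choice depends on where the block lies.\<close>

lemma van_der_corput_third:
  fixes F F1 F2 F3 F4 :: "real \<Rightarrow> real" and a \<mu> :: real and K q :: nat
  assumes D1: "\<And>u. a \<le> u \<Longrightarrow> u \<le> a + K \<Longrightarrow> (F has_real_derivative F1 u) (at u)"
    and D2: "\<And>u. a \<le> u \<Longrightarrow> u \<le> a + K \<Longrightarrow> (F1 has_real_derivative F2 u) (at u)"
    and D3: "\<And>u. a \<le> u \<Longrightarrow> u \<le> a + K \<Longrightarrow> (F2 has_real_derivative F3 u) (at u)"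
    and D4: "\<And>u. a \<le> u \<Longrightarrow> u \<le> a + K \<Longrightarrow> (F3 has_real_derivative F4 u) (at u)"
    and l: "0 < \<mu>" and F3: "\<And>u. a \<le> u \<Longrightarrow> u \<le> a + K \<Longrightarrow> - 8 * \<mu> \<le> F3 u \<and> F3 u \<le> - \<mu>"
    and F4: "\<And>u. a \<le> u \<Longrightarrow> u \<le> a + K \<Longrightarrow> 0 \<le> F4 u"
    and q: "1 \<le> q" "q \<le> K"
  shows "(norm (\<Sum>n<K. cis (F (a + n))))\<^sup>2 \<le>
    200 * (K\<^sup>2 / q + K\<^sup>2 * sqrt (q * \<mu>) + K / sqrt (q * \<mu>)) * (1 + ln K)"
proof -
  define l where "l = 1 + ln K"
  have l1: "1 \<le> l" using q by (simp add: l_def)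
  have "sqrt l * 1 \<le> sqrt l * sqrt l" using l1 by (intro mult_left_mono) auto
  then have sl: "sqrt l \<le> l" using l1 by simp
  have corr: "norm (\<Sum>n<K-h. cis (F (a + real (n + h))) * cnj (cis (F (a + n)))) \<le> 18 * l * (K * sqrt \<mu> * sqrt h + 1 / sqrt \<mu> * (1 / sqrt h))"
    if h: "1 \<le> h" "h < q" for h
  proof -
    have Kh: "1 \<le> K - h" using h q by auto
    \<comment> \<open>The difference is taken in this order because \<open>F3\<close> is negative
      and the second derivative test asks for a positive second derivative; the correlation is the
      conjugate of the sum with phase \<open>G\<close>.\<close>
    define G where "G u = F u - F (u + h)" for u
    define C where "C = (\<Sum>n<K-h. cis (F (a + real (n + h))) * cnj (cis (F (a + n))))"
    have "C = cnj (\<Sum>n<K-h. cis (G (a + n)))"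
      by (simp add: C_def G_def cis_cnj cis_mult cnj_sum add_ac)
    then have "norm C = norm (\<Sum>n<K-h. cis (G (a + n)))" by (simp del: cnj_sum)
    moreover have "(norm (\<Sum>n<K-h. cis (G (a + n))))\<^sup>2 \<le> 300 * ((K-h)\<^sup>2 * (h * \<mu>) + 1 / (h * \<mu>)) * (1 + ln (K-h))"
    proof (rule van_der_corput_second[where ?F1.0 = "\<lambda>u. F1 u - F1 (u + h)" and ?F2.0 = "\<lambda>u. F2 u - F2 (u + h)" and ?F3.0 = "\<lambda>u. F3 u - F3 (u + h)"])
      fix u assume u: "a \<le> u" "u \<le> a + real (K - h)"
      then have u2: "u + h \<le> a + K" using h q by auto
      show "(G has_real_derivative F1 u - F1 (u + h)) (at u)"
        unfolding G_def using u u2 by (auto intro!: DERIV_diff DERIV_shift[THEN iffD1] D1)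
      show "((\<lambda>u. F1 u - F1 (u + h)) has_real_derivative F2 u - F2 (u + h)) (at u)"
        using u u2 by (auto intro!: DERIV_diff DERIV_shift[THEN iffD1] D2)
      show "((\<lambda>u. F2 u - F2 (u + h)) has_real_derivative F3 u - F3 (u + h)) (at u)"
        using u u2 by (auto intro!: DERIV_diff DERIV_shift[THEN iffD1] D3)
      show "h * \<mu> \<le> F2 u - F2 (u + h) \<and> F2 u - F2 (u + h) \<le> 8 * (h * \<mu>)"
      proof -
        have "- 8 * \<mu> * (u + h - u) \<le> F2 (u + h) - F2 u \<and> F2 (u + h) - F2 u \<le> - \<mu> * (u + h - u)"
          by (rule mean_value_le[of _ _ _ F3]) (use D3 F3 u u2 in auto)
        then show ?thesis by (simp add: mult_ac)
      qed
      have "F3 u \<le> F3 (u + h)"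
      proof (rule DERIV_nonneg_imp_nondecreasing[of u "u + h" F3])
        fix x assume "u \<le> x" "x \<le> u + h"
        then show "\<exists>y. (F3 has_real_derivative y) (at x) \<and> 0 \<le> y" using D4[of x] F4[of x] u u2 by auto
      qed auto
      then show "F3 u - F3 (u + h) \<le> 0" by simp
    qed (use h l Kh in auto)
    moreover have "300 * ((K-h)\<^sup>2 * (h * \<mu>) + 1 / (h * \<mu>)) * (1 + ln (K-h)) \<le> 300 * (K\<^sup>2 * (h * \<mu>) + 1 / (h * \<mu>)) * l"
      unfolding l_def using h l Kh q by (intro mult_mono mult_left_mono add_mono mult_right_mono power_mono) auto
    ultimately have "(norm C)\<^sup>2 \<le> 300 * (K\<^sup>2 * (h * \<mu>) + 1 / (h * \<mu>)) * l" by simp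
    \<comment> \<open>324 = 18^2: the bound is enlarged to a form whose root splits into the two
      terms of the claim.\<close>
    also have "\<dots> \<le> 324 * (K\<^sup>2 * (h * \<mu>) + 1 / (h * \<mu>)) * l\<^sup>2"
      using l1 h l by (intro mult_mono self_le_power) auto
    also have "\<dots> \<le> (18 * l * (K * sqrt \<mu> * sqrt h + 1 / sqrt \<mu> * (1 / sqrt h)))\<^sup>2"
    proof -
      have "K\<^sup>2 * (h * \<mu>) + 1 / (h * \<mu>) = (K * sqrt \<mu> * sqrt h)\<^sup>2 + (1 / sqrt \<mu> * (1 / sqrt h))\<^sup>2"
        using l h by (simp add: power_mult_distrib power_divide)
      also have "\<dots> \<le> (K * sqrt \<mu> * sqrt h + 1 / sqrt \<mu> * (1 / sqrt h))\<^sup>2"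
        using l h by (simp add: power2_sum)
      finally have "324 * (K\<^sup>2 * (h * \<mu>) + 1 / (h * \<mu>)) * l\<^sup>2 \<le> 324 * (K * sqrt \<mu> * sqrt h + 1 / sqrt \<mu> * (1 / sqrt h))\<^sup>2 * l\<^sup>2"
        by (intro mult_right_mono mult_left_mono) auto
      then show ?thesis unfolding power_mult_distrib[of "18 * l"] power_mult_distrib[of 18 l] by (simp add: mult_ac)
    qed
    finally show ?thesis unfolding C_def by (rule power2_le_imp_le) (use l l1 in auto)
  qed
  have "(\<Sum>h=1..<q. 18 * l * (K * sqrt \<mu> * sqrt h + 1 / sqrt \<mu> * (1 / sqrt h))) =
      18 * l * (K * sqrt \<mu> * (\<Sum>h=1..<q. sqrt h) + 1 / sqrt \<mu> * (\<Sum>h=1..<q. 1 / sqrt h))"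
  proof -
    have "(\<Sum>h=1..<q. 18 * l * (K * sqrt \<mu> * sqrt h + 1 / sqrt \<mu> * (1 / sqrt h))) =
        (\<Sum>h=1..<q. (18 * l * (K * sqrt \<mu>)) * sqrt h) + (\<Sum>h=1..<q. (18 * l * (1 / sqrt \<mu>)) * (1 / sqrt h))"
      by (simp only: distrib_left mult.assoc sum.distrib)
    also have "\<dots> = (18 * l * (K * sqrt \<mu>)) * (\<Sum>h=1..<q. sqrt h) + (18 * l * (1 / sqrt \<mu>)) * (\<Sum>h=1..<q. 1 / sqrt h)"
      by (simp only: sum_distrib_left)
    finally show ?thesis by (simp only: distrib_left mult.assoc)
  qed
  also have "\<dots> \<le> 18 * l * (K * sqrt \<mu> * (q * sqrt q) + 1 / sqrt \<mu> * (2 * sqrt q))"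
    using l l1 sum_sqrt_le[of q] sum_inverse_sqrt_le[of q] by (intro mult_left_mono add_mono) auto
  finally have SB: "(\<Sum>h=1..<q. 18 * l * (K * sqrt \<mu> * sqrt h + 1 / sqrt \<mu> * (1 / sqrt h))) \<le> 18 * l * (K * sqrt \<mu> * (q * sqrt q) + 1 / sqrt \<mu> * (2 * sqrt q))" .
  have "(norm (\<Sum>n<K. cis (F (a + n))))\<^sup>2 \<le> 2 * real K / real q *
      (real K + 2 * (\<Sum>h=1..<q. 18 * l * (K * sqrt \<mu> * sqrt h + 1 / sqrt \<mu> * (1 / sqrt h))))"
    using q corr by (intro weyl_van_der_corput) auto
  also have "\<dots> \<le> 2 * real K / real q * (real K + 2 * (18 * l * (K * sqrt \<mu> * (q * sqrt q) + 1 / sqrt \<mu> * (2 * sqrt q))))"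
    by (intro mult_left_mono add_left_mono SB) auto
  also have "\<dots> = 2 * (K\<^sup>2 / q) + (72 * (K\<^sup>2 * sqrt (q * \<mu>)) + 144 * (K / sqrt (q * \<mu>))) * l"
  proof -
    have alg: "2 * k / (s * s) * (k + 2 * (18 * l * (k * t * (s * s * s) + 1 / t * (2 * s)))) =
        2 * (k\<^sup>2 / (s * s)) + (72 * (k\<^sup>2 * (s * t)) + 144 * (k / (s * t))) * l" if "0 < s" "0 < t" for s t k l :: real
      using that by (simp add: field_simps power2_eq_square)
    show ?thesis using alg[of "sqrt q" "sqrt \<mu>" K l] l q by (simp add: real_sqrt_mult)
  qed
  also have "\<dots> \<le> 200 * (K\<^sup>2 / q) * l + (200 * (K\<^sup>2 * sqrt (q * \<mu>)) + 200 * (K / sqrt (q * \<mu>))) * l"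
  proof (intro add_mono mult_right_mono)
    have "2 * (K\<^sup>2 / q) * 1 \<le> 200 * (K\<^sup>2 / q) * l" using l1 by (intro mult_mono) auto
    then show "2 * (K\<^sup>2 / q) \<le> 200 * (K\<^sup>2 / q) * l" by simp
  qed (use l l1 in auto)
  also have "\<dots> = 200 * (K\<^sup>2 / q + K\<^sup>2 * sqrt (q * \<mu>) + K / sqrt (q * \<mu>)) * l"
    by (simp only: distrib_left distrib_right add.assoc)
  finally show ?thesis unfolding l_def .
qed

lemma cis_log_block_second:
  fixes t M :: real and a b :: nat
  assumes "0 < t" "1 \<le> M" "M \<le> a" "b \<le> 2 * M"
  shows "(norm (\<Sum>n=a..<b. cis (- t * ln n)))\<^sup>2 \<le> 1200 * (t + M\<^sup>2 / t) * (1 + ln M)"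
proof (cases "a < b")
  case True
  define K where "K = b - a"
  have K: "1 \<le> K" "real K \<le> M" using True assms by (auto simp: K_def of_nat_diff)
  have range: "M \<le> u \<and> u \<le> 2 * M" if "a \<le> u" "u \<le> real a + real K" for u :: real
    using that assms True by (auto simp: K_def of_nat_diff)
  define \<mu> where "\<mu> = t / (4 * M\<^sup>2)"
  have \<mu>: "0 < \<mu>" using assms by (simp add: \<mu>_def)
  have "(\<Sum>n=a..<b. cis (- t * ln n)) = (\<Sum>n<K. cis (- t * ln (real a + n)))"
    by (rule sum.reindex_bij_witness[of _ "\<lambda>n. n + a" "\<lambda>n. n - a"]) (auto simp: K_def)
  also have "(norm \<dots>)\<^sup>2 \<le> 300 * (K\<^sup>2 * \<mu> + 1 / \<mu>) * (1 + ln K)"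
  proof (rule van_der_corput_second[where F = "\<lambda>u. - t * ln u" and ?F1.0 = "\<lambda>u. - t / u" and ?F2.0 = "\<lambda>u. t / u\<^sup>2" and ?F3.0 = "\<lambda>u. - 2 * t / u^3"])
    fix u :: real assume u: "a \<le> u" "u \<le> real a + real K"
    note r = range[OF u]
    have u0: "u > 0" using r assms by linarith
    show "((\<lambda>u. - t * ln u) has_real_derivative - t / u) (at u)"
      using u0 by (auto intro!: derivative_eq_intros)
    show "((\<lambda>u. - t / u) has_real_derivative t / u\<^sup>2) (at u)"
      using u0 by (auto intro!: derivative_eq_intros simp: power2_eq_square)
    show "((\<lambda>u. t / u\<^sup>2) has_real_derivative - 2 * t / u^3) (at u)"
      using u0 by (auto intro!: derivative_eq_intros simp: power2_eq_square power3_eq_cube field_simps)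
    have "M\<^sup>2 \<le> u\<^sup>2" "u\<^sup>2 \<le> (2*M)\<^sup>2" using r assms u0 by (blast intro: power_mono order_trans[OF zero_le_one] less_imp_le)+
    then have "t / (2*M)\<^sup>2 \<le> t / u\<^sup>2" "t / u\<^sup>2 \<le> t / M\<^sup>2" using assms u0 by (auto intro!: divide_left_mono)
    moreover have "t / M\<^sup>2 \<le> 8 * \<mu>" "t / (2*M)\<^sup>2 = \<mu>" using assms by (auto simp: \<mu>_def field_simps)
    ultimately show "\<mu> \<le> t / u\<^sup>2 \<and> t / u\<^sup>2 \<le> 8 * \<mu>" by linarith
    show "- 2 * t / u^3 \<le> 0" using u0 assms by simp
  qed (use \<mu> K in auto)
  also have "\<dots> \<le> 300 * (M\<^sup>2 * \<mu> + 1 / \<mu>) * (1 + ln M)"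
    using K \<mu> by (intro mult_mono add_mono mult_left_mono power_mono mult_right_mono ln_mono) auto
  also have "\<dots> = (75 * t + 1200 * (M\<^sup>2 / t)) * (1 + ln M)" using assms by (simp add: \<mu>_def field_simps)
  also have "\<dots> \<le> 1200 * (t + M\<^sup>2 / t) * (1 + ln M)" using assms by (intro mult_right_mono) auto
  finally show ?thesis .
qed (use assms in auto)

text \<open>With \<mu> = t/(4 M^3) the quantity 2 t/u^3 runs through [\<mu>, 8 \<mu>] as u runs
  through [M, 2 M]; this is the source of the factor 8 in both derivative tests. The bound X for the
  length is kept apart from M, since short blocks inside a dyadic interval occur later, and the term
  \<open>(real q)\<^sup>2\<close> covers blocks shorter than q.\<close>

lemma cis_log_block_third:
  fixes t M X :: real and a b q :: nat
  assumes "0 < t" "1 \<le> M" "M \<le> a" "b \<le> 2 * M" "1 \<le> q" "real (b - a) \<le> X"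
  shows "(norm (\<Sum>n=a..<b. cis (- t * ln n)))\<^sup>2 \<le>
    400 * ((real q)\<^sup>2 + X\<^sup>2 / q + X\<^sup>2 * sqrt (q * t / M^3) + X / sqrt (q * t / M^3)) * (1 + ln M)"
    (is "_ \<le> ?R")
proof -
  define K where "K = b - a"
  define S where "S = norm (\<Sum>n=a..<b. cis (- t * ln n))"
  have S0: "0 \<le> S" by (simp add: S_def)
  have X: "0 \<le> X" "real K \<le> X" using assms by (auto simp: K_def intro: order_trans[of 0 "real (b - a)"])
  have SK: "S \<le> K" unfolding S_def
    using sum_norm_le[of "{a..<b}" "\<lambda>n. cis (- t * ln n)" "\<lambda>_. 1"] by (simp add: K_def)
  have lnM: "0 \<le> ln M" using assms by simp
  show ?thesis
  proof (cases "q \<le> K")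
    case False
    have "S\<^sup>2 \<le> (real K)\<^sup>2" using SK S0 by (intro power_mono)
    also have "\<dots> \<le> (real q)\<^sup>2" using False by (intro power_mono) auto
    also have "\<dots> \<le> 400 * (real q)\<^sup>2 * 1" by simp
    also have "\<dots> \<le> ?R" using X assms by (intro mult_mono mult_left_mono) auto
    finally show ?thesis by (simp add: S_def)
  next
    case True
    then have "a < b" using assms by (auto simp: K_def)
    have K: "1 \<le> K" "real K \<le> M" using True \<open>a < b\<close> assms by (auto simp: K_def of_nat_diff)
    have range: "M \<le> u \<and> u \<le> 2 * M" if "a \<le> u" "u \<le> real a + real K" for u :: real
      using that assms True \<open>a < b\<close> by (auto simp: K_def of_nat_diff)
    define \<mu> where "\<mu> = t / (4 * M^3)"
    have \<mu>: "0 < \<mu>" using assms by (simp add: \<mu>_def)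
    have "(\<Sum>n=a..<b. cis (- t * ln n)) = (\<Sum>n<K. cis (- t * ln (real a + n)))"
      by (rule sum.reindex_bij_witness[of _ "\<lambda>n. n + a" "\<lambda>n. n - a"]) (auto simp: K_def)
    also have "(norm \<dots>)\<^sup>2 \<le> 200 * (K\<^sup>2 / q + K\<^sup>2 * sqrt (q * \<mu>) + K / sqrt (q * \<mu>)) * (1 + ln K)"
    proof (rule van_der_corput_third[where F = "\<lambda>u. - t * ln u" and ?F1.0 = "\<lambda>u. - t / u" and ?F2.0 = "\<lambda>u. t / u\<^sup>2" and ?F3.0 = "\<lambda>u. - 2 * t / u^3"
          and ?F4.0 = "\<lambda>u. 6 * t / u^4"])
      fix u :: real assume u: "a \<le> u" "u \<le> real a + real K"
      note r = range[OF u]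
      have u0: "u > 0" using r assms by linarith
      show "((\<lambda>u. - t * ln u) has_real_derivative - t / u) (at u)"
        using u0 by (auto intro!: derivative_eq_intros)
      show "((\<lambda>u. - t / u) has_real_derivative t / u\<^sup>2) (at u)"
        using u0 by (auto intro!: derivative_eq_intros simp: power2_eq_square)
      show "((\<lambda>u. t / u\<^sup>2) has_real_derivative - 2 * t / u^3) (at u)"
        using u0 by (auto intro!: derivative_eq_intros simp: power2_eq_square power3_eq_cube field_simps)
      show "((\<lambda>u. - 2 * t / u^3) has_real_derivative 6 * t / u^4) (at u)"
        using u0 by (auto intro!: derivative_eq_intros simp: power2_eq_square power3_eq_cube power4_eq_xxxx field_simps)
      have "M^3 \<le> u^3" "u^3 \<le> (2*M)^3" using r assms u0 by (blast intro: power_mono order_trans[OF zero_le_one] less_imp_le)+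
      then have "2 * t / (2*M)^3 \<le> 2 * t / u^3" "2 * t / u^3 \<le> 2 * t / M^3"
        using assms u0 by (intro divide_left_mono mult_pos_pos zero_less_power; simp)+
      moreover have "2 * t / M^3 \<le> 8 * \<mu>" "2 * t / (2*M)^3 = \<mu>" using assms by (auto simp: \<mu>_def field_simps)
      ultimately show "- 8 * \<mu> \<le> - 2 * t / u^3 \<and> - 2 * t / u^3 \<le> - \<mu>" by auto
      show "0 \<le> 6 * t / u^4" using u0 assms by simp
    qed (use \<mu> True assms in auto)
    also have "q * \<mu> = q * t / M^3 / 4" by (simp add: \<mu>_def)
    also have "sqrt \<dots> = sqrt (q * t / M^3) / 2" by (simp only: real_sqrt_divide real_sqrt_four)
    also have "200 * (K\<^sup>2 / q + K\<^sup>2 * (sqrt (q * t / M^3) / 2) + K / (sqrt (q * t / M^3) / 2)) * (1 + ln K) =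
       (200 * (K\<^sup>2 / q) + 100 * (K\<^sup>2 * sqrt (q * t / M^3)) + 400 * (K / sqrt (q * t / M^3))) * (1 + ln K)"
      by (simp add: distrib_left)
    also have "\<dots> \<le> (400 * (X\<^sup>2 / q) + 400 * (X\<^sup>2 * sqrt (q * t / M^3)) + 400 * (X / sqrt (q * t / M^3))) * (1 + ln M)"
      using K X assms by (intro mult_mono add_mono power_mono divide_right_mono ln_mono) auto
    also have "\<dots> \<le> (400 * (real q)\<^sup>2 + 400 * (X\<^sup>2 / q) + 400 * (X\<^sup>2 * sqrt (q * t / M^3)) + 400 * (X / sqrt (q * t / M^3))) * (1 + ln M)"
      using X lnM by (intro mult_right_mono) auto
    also have "\<dots> = ?R" by (simp only: distrib_left)
    finally show ?thesis .
  qed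
qed

section \<open>Continuation of the Dirichlet series by trapezoidal errors, and its approximation by
  finite sums\<close>

text \<open>Twice the error of the trapezoidal rule for x^(-s) on [a, a + 1].\<close>

definition trap :: "real \<Rightarrow> complex \<Rightarrow> complex" where
  "trap a s = of_real a powr (-s) + of_real (a + 1) powr (-s)
     - 2 * (of_real (a + 1) powr (1 - s) - of_real a powr (1 - s)) / (1 - s)"

text \<open>Integration by parts twice against the Peano kernel v (1 - v), which vanishes at both
  ends; \<open>G\<close> in the proof is the resulting antiderivative. This form makes the decay
  a^(-Re s - 2) visible.\<close>

lemma trap_has_integral:
  fixes a :: real and s :: complex
  assumes a: "0 < a" and s: "s \<noteq> 1"
  shows "((\<lambda>v. of_real (v * (1 - v)) * (s * (s + 1) * of_real (a + v) powr (- s - 2))) has_integral trap a s) {0..1}"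
proof -
  define f where "f p v = of_real (a + v) powr p" for p :: complex and v :: real
  have df: "((\<lambda>v. f p v) has_vector_derivative p * f (p - 1) v) (at v within {0..1})" if "v \<in> {0..1}" for v p
  proof -
    have nn: "complex_of_real (a + v) \<notin> \<real>\<^sub>\<le>\<^sub>0" using a that
      by (auto simp: complex_nonpos_Reals_iff)
    have "((\<lambda>z. (of_real a + z) powr p) has_field_derivative p * (of_real a + of_real v) powr (p - 1)) (at (of_real v))"
      using nn by (auto intro!: derivative_eq_intros)
    from has_vector_derivative_real_field[OF this, of "{0..1}"] show ?thesis by (simp add: f_def)
  qed
  define G where "G v = of_real (v * (1 - v)) * (- s * f (- s - 1) v) - of_real (1 - 2 * v) * f (- s) v - 2 * (f (1 - s) v / (1 - s))" for v
  have dp: "((\<lambda>v. complex_of_real (v * (1 - v))) has_vector_derivative of_real (1 - 2 * v)) (at v within {0..1})" for v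
    by (rule has_vector_derivative_of_real) (auto intro!: derivative_eq_intros simp flip: has_real_derivative_iff_has_vector_derivative)
  have dq: "((\<lambda>v. complex_of_real (1 - 2 * v)) has_vector_derivative of_real (- 2)) (at v within {0..1})" for v
    by (rule has_vector_derivative_of_real) (auto intro!: derivative_eq_intros simp flip: has_real_derivative_iff_has_vector_derivative)
  have s1: "1 - s \<noteq> 0" using s by auto
  have dG: "(G has_vector_derivative of_real (v * (1 - v)) * (s * (s + 1) * f (- s - 2) v)) (at v within {0..1})" if "v \<in> {0..1}" for v
  proof -
    have "(G has_vector_derivative
        (of_real (v * (1 - v)) * (- s * ((- s - 1) * f (- s - 1 - 1) v)) + of_real (1 - 2 * v) * (- s * f (- s - 1) v))
        - (of_real (1 - 2 * v) * ((- s) * f (- s - 1) v) + of_real (- 2) * f (- s) v) - 2 * ((1 - s) * f (1 - s - 1) v / (1 - s))) (at v within {0..1})"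
      unfolding G_def
      by (intro has_vector_derivative_diff has_vector_derivative_mult has_vector_derivative_mult_right has_vector_derivative_divide dp dq df that)
    also have "(of_real (v * (1 - v)) * (- s * ((- s - 1) * f (- s - 1 - 1) v)) + of_real (1 - 2 * v) * (- s * f (- s - 1) v))
        - (of_real (1 - 2 * v) * ((- s) * f (- s - 1) v) + of_real (- 2) * f (- s) v) - 2 * ((1 - s) * f (1 - s - 1) v / (1 - s))
        = of_real (v * (1 - v)) * (s * (s + 1) * f (- s - 2) v)"
    proof -
      have "2 * ((1 - s) * f (1 - s - 1) v / (1 - s)) = 2 * f (- s) v" using s1 by simp
      then show ?thesis by (simp only:) (simp add: algebra_simps)
    qed
    finally show ?thesis .
  qed
  have "((\<lambda>v. of_real (v * (1 - v)) * (s * (s + 1) * f (- s - 2) v)) has_integral (G 1 - G 0)) {0..1}"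
    by (rule fundamental_theorem_of_calculus) (use dG in auto)
  also have "G 1 - G 0 = trap a s" by (simp add: G_def f_def trap_def diff_divide_distrib algebra_simps)
  finally show ?thesis by (simp add: f_def)
qed

lemma norm_trap_le:
  fixes a :: real and s :: complex
  assumes a: "0 < a" and s: "s \<noteq> 1" "- 2 \<le> Re s"
  shows "norm (trap a s) \<le> norm s * norm (s + 1) * a powr (- Re s - 2)"
proof -
  have "norm (trap a s) \<le> norm s * norm (s + 1) * a powr (- Re s - 2) * measure lborel {0..1::real}"
  proof (rule has_integral_bound[OF _ trap_has_integral[OF a s(1), unfolded cbox_interval[symmetric]], unfolded cbox_interval])
    fix v :: real assume v: "v \<in> {0..1}"
    have "v * (1 - v) \<le> 1 * 1" using v by (intro mult_mono) auto
    moreover have "norm (complex_of_real (a + v) powr (- s - 2)) \<le> a powr (- Re s - 2)"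
    proof -
      have "norm (complex_of_real (a + v) powr (- s - 2)) = (a + v) powr (- Re s - 2)"
        using a v by (subst norm_powr_real_powr) auto
      also have "\<dots> \<le> a powr (- Re s - 2)" using a v s by (intro powr_mono2') auto
      finally show ?thesis .
    qed
    moreover have "0 \<le> v * (1 - v)" using v by simp
    ultimately have "(v * (1 - v)) * (norm (s * (s + 1)) * norm (complex_of_real (a + v) powr (- s - 2))) \<le> 1 * (norm (s * (s + 1)) * a powr (- Re s - 2))"
      by (intro mult_mono) auto
    then show "norm (of_real (v * (1 - v)) * (s * (s + 1) * of_real (a + v) powr (- s - 2))) \<le> norm s * norm (s + 1) * a powr (- Re s - 2)"
      using v by (simp add: norm_mult abs_mult del: of_real_mult of_real_diff)
  qed auto
  then show ?thesis by simp
qed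

lemma holomorphic_trap: "trap a holomorphic_on S" if "0 < a" "1 \<notin> S"
  unfolding trap_def using that
  by (auto intro!: holomorphic_intros)

text \<open>For Re s > 1 each term n^(-s) is split evenly between the two adjacent unit intervals:
  1/2 is the unmatched half of the term n = 1, 1/(s - 1) is the integral of x^(-s) over x >= 1, and
  the rest are trapezoidal errors. These are smaller than the terms by two powers of n, so the
  series continues to Re s > -1.\<close>

definition zeta1 :: "complex \<Rightarrow> complex" where
  "zeta1 s = 1 / (s - 1) + 1 / 2 + (\<Sum>n. trap (Suc n) s / 2)"

lemma summable_trap: "summable (\<lambda>n. trap (Suc n) s / 2)" if "s \<noteq> 1" "- 1 < Re s"
proof (rule summable_comparison_test'[where N = 0])
  show "summable (\<lambda>n. norm s * norm (s + 1) * (real (Suc n)) powr (- Re s - 2))"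
    using that by (intro summable_mult, subst summable_Suc_iff) (auto simp: summable_real_powr_iff)
  fix n
  have "norm (trap (Suc n) s / 2) \<le> norm (trap (Suc n) s)" by (simp add: norm_divide)
  also have "\<dots> \<le> norm s * norm (s + 1) * (real (Suc n)) powr (- Re s - 2)" using that by (intro norm_trap_le) auto
  finally show "norm (trap (Suc n) s / 2) \<le> norm s * norm (s + 1) * (real (Suc n)) powr (- Re s - 2)" .
qed

lemma holomorphic_zeta1: "zeta1 holomorphic_on ({s. - 1 < Re s} - {1})"
proof -
  let ?S = "{s. - 1 < Re s} - {1::complex}"
  have op: "open ?S" by (intro open_Diff open_halfspace_Re_gt) auto
  have "(\<lambda>s. \<Sum>n. trap (Suc n) s / 2) holomorphic_on ?S"
  proof (rule holomorphic_uniform_sequence[OF op, where f = "\<lambda>N s. \<Sum>n<N. trap (Suc n) s / 2"])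
    show "(\<lambda>s. \<Sum>n<N. trap (Suc n) s / 2) holomorphic_on ?S" for N
      by (intro holomorphic_intros holomorphic_trap) auto
    fix x assume x: "x \<in> ?S"
    obtain e where e: "0 < e" "cball x e \<subseteq> ?S" using op x open_contains_cball by blast
    \<comment> \<open>The radius is at most half the distance to the line Re s = -1, so that the
      exponents in the majorant stay below -1 on the whole disc.\<close>
    define d where "d = min e ((Re x + 1) / 2)"
    have d: "0 < d" "d \<le> e" "d \<le> (Re x + 1) / 2"
      using e x min.cobounded2[of e "(Re x + 1) / 2"] unfolding d_def by (simp_all del: min.cobounded2)
    have sub: "cball x d \<subseteq> ?S" using e d by (meson subset_cball order_trans)
    define R where "R = norm x + d + 1"
    define r where "r = (Re x - 1) / 2"
    have bound: "norm (trap (Suc n) s / 2) \<le> R * R * (Suc n) powr (- r - 2)" if "s \<in> cball x d" for n s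
    proof -
      have "norm s \<le> norm x + d" using that norm_triangle_sub[of s x] by (auto simp: dist_norm norm_minus_commute)
      then have n: "norm s \<le> R" "norm (s + 1) \<le> R" using norm_triangle_ineq[of s 1] d by (auto simp: R_def)
      have "\<bar>Re (x - s)\<bar> \<le> d" using that abs_Re_le_cmod[of "x - s"] by (auto simp: dist_norm)
      then have r: "r \<le> Re s" "- 2 \<le> Re s" "s \<noteq> 1" using d sub that x by (auto simp: r_def field_simps abs_le_iff)
      have "norm (trap (Suc n) s / 2) \<le> norm (trap (Suc n) s)" by (simp add: norm_divide)
      also have "\<dots> \<le> norm s * norm (s + 1) * (Suc n) powr (- Re s - 2)" using r by (intro norm_trap_le) auto
      also have "\<dots> \<le> R * R * (Suc n) powr (- r - 2)" using n r order_trans[OF norm_ge_zero n(1)]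
        by (intro mult_mono powr_mono) auto
      finally show ?thesis .
    qed
    have "uniform_limit (cball x d) (\<lambda>N s. \<Sum>n<N. trap (Suc n) s / 2) (\<lambda>s. \<Sum>n. trap (Suc n) s / 2) sequentially"
    proof (rule Weierstrass_m_test)
      show "summable (\<lambda>n. R * R * real (Suc n) powr (- r - 2))"
        using x by (intro summable_mult, subst summable_Suc_iff) (auto simp: summable_real_powr_iff r_def)
    qed (use bound in auto)
    then show "\<exists>d>0. cball x d \<subseteq> ?S \<and> uniform_limit (cball x d) (\<lambda>N s. \<Sum>n<N. trap (Suc n) s / 2) (\<lambda>s. \<Sum>n. trap (Suc n) s / 2) sequentially"
      using d sub by blast
  qed
  then show ?thesis unfolding zeta1_def by (auto intro!: holomorphic_intros)
qed

text \<open>Telescoping the trapezoidal errors up to N trades them for the first N - 1 terms of the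
  Dirichlet series and the two boundary terms at N.\<close>

lemma zeta1_partial:
  assumes s: "s \<noteq> 1" "- 1 < Re s" and N: "1 \<le> N"
  shows "zeta1 s = (\<Sum>n=1..<N. of_nat n powr (- s)) + of_nat N powr (- s) / 2 + of_nat N powr (1 - s) / (s - 1)
    + (\<Sum>n. trap (real (n + N)) s / 2)"
proof -
  have "(\<Sum>n=1..<M. trap (real n) s / 2) = (\<Sum>n=1..<M. of_nat n powr (- s)) + of_nat M powr (- s) / 2 - 1 / 2
     + (of_nat M powr (1 - s) - 1) / (s - 1)" if "1 \<le> M" for M
    using that
  proof (induction M rule: dec_induct)
    case (step M)
    have *: "x / (1 - s) = - (x / (s - 1))" for x by (metis minus_diff_eq minus_divide_right)
    define X where "X = (of_nat (Suc M) powr (1 - s) - of_nat M powr (1 - s)) / (s - 1)"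
    have "trap (real M) s = of_nat M powr (- s) + of_nat (Suc M) powr (- s) + 2 * X"
      unfolding trap_def X_def *[of "2 * _"] by (simp add: add_ac)
    then have t: "trap (real M) s / 2 = of_nat M powr (- s) / 2 + of_nat (Suc M) powr (- s) / 2 + X" by simp
    have "(\<Sum>n=1..<Suc M. trap (real n) s / 2) = (\<Sum>n=1..<M. trap (real n) s / 2) + trap (real M) s / 2"
      using step by simp
    also have "\<dots> = (\<Sum>n=1..<M. of_nat n powr (- s)) + of_nat M powr (- s) / 2 - 1 / 2 + (of_nat M powr (1 - s) - 1) / (s - 1)
        + (of_nat M powr (- s) / 2 + of_nat (Suc M) powr (- s) / 2 + X)" unfolding step.IH t ..
    also have "\<dots> = (\<Sum>n=1..<Suc M. of_nat n powr (- s)) + of_nat (Suc M) powr (- s) / 2 - 1 / 2 + (of_nat (Suc M) powr (1 - s) - 1) / (s - 1)"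
      using step.hyps by (simp add: X_def diff_divide_distrib)
    finally show ?case .
  qed auto
  note fin = this[OF N]
  have "(\<Sum>n. trap (real (Suc n)) s / 2) = (\<Sum>n<N-1. trap (real (Suc n)) s / 2) + (\<Sum>n. trap (real (Suc (n + (N - 1)))) s / 2)"
    using suminf_split_initial_segment[OF summable_trap[OF s], of "N - 1"] by (simp add: add_ac)
  also have "(\<Sum>n<N-1. trap (real (Suc n)) s / 2) = (\<Sum>n=1..<N. trap (real n) s / 2)"
    by (rule sum.reindex_bij_witness[of _ "\<lambda>n. n - 1" Suc]) auto
  also have "(\<lambda>n. trap (real (Suc (n + (N - 1)))) s / 2) = (\<lambda>n. trap (real (n + N)) s / 2)"
    using N by (intro ext) (simp add: of_nat_diff)
  finally show ?thesis unfolding zeta1_def fin by (simp add: diff_divide_distrib)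
qed

text \<open>Euler-Maclaurin with a second-order remainder. On the critical line a first-order
  remainder |s| N^(-1/2) would call for N beyond T^2, too long for the exponential sum bounds that
  follow.\<close>

lemma zeta1_approx:
  assumes s: "s \<noteq> 1" "0 \<le> Re s" and N: "1 \<le> N"
  shows "norm (zeta1 s - ((\<Sum>n=1..<N. of_nat n powr (- s)) + of_nat N powr (- s) / 2 + of_nat N powr (1 - s) / (s - 1)))
    \<le> norm s * norm (s + 1) * real N powr (- Re s - 1)"
proof -
  have sm: "summable (\<lambda>n. 1 / (real n + N)\<^sup>2)" "(\<Sum>n. 1 / (real n + N)\<^sup>2) \<le> 2 / N"
  proof -
    have t: "(\<lambda>n. 1 / (real n + N) - 1 / (real (Suc n) + N)) sums (1 / (real 0 + N) - 0)"
    proof (rule telescope_sums')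
      show "(\<lambda>n. 1 / (real n + N)) \<longlonglongrightarrow> 0"
        by (rule tendsto_divide_0[OF tendsto_const]) (auto intro!: filterlim_at_top_imp_at_infinity filterlim_tendsto_add_at_top filterlim_real_sequentially filterlim_at_top_add_at_top[of real] simp: add.commute[of _ "real N"])
    qed
    have le: "1 / (real n + N)\<^sup>2 \<le> 2 * (1 / (real n + N) - 1 / (real (Suc n) + N))" for n
    proof -
      define w where "w = real n + N"
      have w: "1 \<le> w" using N by (simp add: w_def)
      have "1 / w\<^sup>2 = 2 / (2 * w\<^sup>2)" by simp
      also have "\<dots> \<le> 2 / (w * (w + 1))"
      proof (rule divide_left_mono)
        show "w * (w + 1) \<le> 2 * w\<^sup>2" using w by (simp add: power2_eq_square algebra_simps)
        show "0 < 2 * w\<^sup>2 * (w * (w + 1))" using w by (intro mult_pos_pos) auto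
      qed auto
      also have "\<dots> = 2 * (1 / w - 1 / (w + 1))" using w by (simp add: field_simps)
      finally show ?thesis by (simp add: w_def add_ac)
    qed
    show "summable (\<lambda>n. 1 / (real n + N)\<^sup>2)"
      by (rule summable_comparison_test'[OF summable_mult[OF sums_summable[OF t], of 2]]) (use le in auto)
    then have "(\<Sum>n. 1 / (real n + N)\<^sup>2) \<le> (\<Sum>n. 2 * (1 / (real n + N) - 1 / (real (Suc n) + N)))"
      by (intro suminf_le le summable_mult sums_summable[OF t])
    also have "\<dots> = 2 * (1 / (real 0 + N) - 0)" by (rule sums_unique[OF sums_mult[OF t], symmetric])
    also have "\<dots> = 2 / N" by simp
    finally show "(\<Sum>n. 1 / (real n + N)\<^sup>2) \<le> 2 / N" .
  qed
  have b: "norm (trap (real (n + N)) s / 2) \<le> norm s * norm (s + 1) * real N powr (- Re s) / 2 * (1 / (real n + N)\<^sup>2)" for n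
  proof -
    have "norm (trap (real (n + N)) s) \<le> norm s * norm (s + 1) * real (n + N) powr (- Re s - 2)"
      using s N by (intro norm_trap_le) auto
    also have "real (n + N) powr (- Re s - 2) = real (n + N) powr (- Re s) * (1 / (real n + N)\<^sup>2)"
      using N by (simp add: powr_diff powr_numeral field_simps)
    also have "norm s * norm (s + 1) * (real (n + N) powr (- Re s) * (1 / (real n + N)\<^sup>2)) \<le> norm s * norm (s + 1) * (real N powr (- Re s) * (1 / (real n + N)\<^sup>2))"
      using s N by (intro mult_left_mono mult_right_mono powr_mono2') auto
    finally show ?thesis by (simp add: norm_divide)
  qed
  have "norm (\<Sum>n. trap (real (n + N)) s / 2) \<le> (\<Sum>n. norm s * norm (s + 1) * real N powr (- Re s) / 2 * (1 / (real n + N)\<^sup>2))"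
    by (intro norm_suminf_le summable_mult sm b)
  also have "\<dots> = norm s * norm (s + 1) * real N powr (- Re s) / 2 * (\<Sum>n. 1 / (real n + N)\<^sup>2)"
    by (rule suminf_mult[OF sm(1)])
  also have "\<dots> \<le> norm s * norm (s + 1) * real N powr (- Re s) / 2 * (2 / N)"
    by (intro mult_left_mono sm) auto
  also have "\<dots> = norm s * norm (s + 1) * real N powr (- Re s - 1)" using N by (simp add: powr_diff)
  finally show ?thesis using zeta1_partial[of s N] assms by simp
qed

text \<open>For Re s > 1 the boundary terms and the error in \<open>zeta1_approx\<close> all tend to
  0 with growing N.\<close>

lemma zeta1_eq_suminf:
  assumes "1 < Re s"
  shows "zeta1 s = (\<Sum>n. of_nat (Suc n) powr (- s))"
proof -
  have s: "s \<noteq> 1" using assms by auto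
  have lim0: "(\<lambda>N. real (Suc N) powr p) \<longlonglongrightarrow> 0" if "p < 0" for p
    using that by (intro tendsto_neg_powr filterlim_compose[OF filterlim_real_sequentially filterlim_Suc])
  have c0: "(\<lambda>N. of_nat (Suc N) powr p :: complex) \<longlonglongrightarrow> 0" if "Re p < 0" for p
    by (rule tendsto_norm_zero_cancel) (use lim0[OF that] in \<open>simp add: norm_powr_real_powr del: of_nat_Suc\<close>)
  have "(\<lambda>N. zeta1 s - ((\<Sum>n=1..<Suc N. of_nat n powr (- s)) + of_nat (Suc N) powr (- s) / 2 + of_nat (Suc N) powr (1 - s) / (s - 1))) \<longlonglongrightarrow> 0"
  proof (rule tendsto_norm_zero_cancel, rule tendsto_sandwich[OF _ _ tendsto_const])
    show "\<forall>\<^sub>F N in sequentially. norm (zeta1 s - ((\<Sum>n=1..<Suc N. of_nat n powr (- s)) + of_nat (Suc N) powr (- s) / 2 + of_nat (Suc N) powr (1 - s) / (s - 1)))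
      \<le> norm s * norm (s + 1) * real (Suc N) powr (- Re s - 1)"
      using s assms by (intro always_eventually allI zeta1_approx) auto
    show "(\<lambda>N. norm s * norm (s + 1) * real (Suc N) powr (- Re s - 1)) \<longlonglongrightarrow> 0"
      using assms by (intro tendsto_mult_right_zero lim0) auto
  qed auto
  moreover have "(\<lambda>N. of_nat (Suc N) powr (- s) / 2 + of_nat (Suc N) powr (1 - s) / (s - 1)) \<longlonglongrightarrow> 0 / 2 + 0 / (s - 1)"
    using assms s by (intro tendsto_intros c0) auto
  ultimately have "(\<lambda>N. (zeta1 s - ((\<Sum>n=1..<Suc N. of_nat n powr (- s)) + of_nat (Suc N) powr (- s) / 2 + of_nat (Suc N) powr (1 - s) / (s - 1)))
      + (of_nat (Suc N) powr (- s) / 2 + of_nat (Suc N) powr (1 - s) / (s - 1))) \<longlonglongrightarrow> 0 + (0 / 2 + 0 / (s - 1))"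
    by (rule tendsto_add)
  then have "(\<lambda>N. zeta1 s - (\<Sum>n=1..<Suc N. of_nat n powr (- s))) \<longlonglongrightarrow> 0" by (simp add: algebra_simps)
  then have "(\<lambda>N. zeta1 s - (zeta1 s - (\<Sum>n=1..<Suc N. of_nat n powr (- s)))) \<longlonglongrightarrow> zeta1 s - 0"
    by (intro tendsto_intros)
  then have "(\<lambda>N. \<Sum>n=1..<Suc N. of_nat n powr (- s)) \<longlonglongrightarrow> zeta1 s" by simp
  also have "(\<lambda>N. \<Sum>n=1..<Suc N. of_nat n powr (- s)) = (\<lambda>N. \<Sum>n<N. of_nat (Suc n) powr (- s))"
    by (intro ext sum.reindex_bij_witness[of _ Suc "\<lambda>n. n - 1"]) auto
  finally have "(\<lambda>n. of_nat (Suc n) powr (- s)) sums zeta1 s" by (simp add: sums_def)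
  then show ?thesis by (simp add: sums_iff)
qed

section \<open>The functional equation, from two evaluations of one Mellin integral\<close>

text \<open>Differentiation of the reflection formula for Gamma, divided by the formula itself; off
  the real axis neither a pole of Gamma nor a zero of the sine interferes.\<close>

lemma Digamma_reflection_imaginary:
  fixes z :: complex
  assumes "Im z \<noteq> 0"
  shows "Digamma z - Digamma (1 - z) = - of_real pi * cos (of_real pi * z) / sin (of_real pi * z)"
proof -
  have ni: "z \<notin> \<int>\<^sub>\<le>\<^sub>0" "1 - z \<notin> \<int>\<^sub>\<le>\<^sub>0"
    using assms by (auto elim!: nonpos_Ints_cases simp: complex_eq_iff)
  have snz: "sin (of_real pi * z) \<noteq> 0"
  proof
    assume "sin (of_real pi * z) = 0"
    then obtain n :: int where "of_real pi * z = of_int n * of_real pi" by (auto simp: sin_eq_0)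
    then have "Im (of_real pi * z) = Im (of_int n * of_real pi)" by simp
    then show False using assms by simp
  qed
  have "((\<lambda>w. Gamma w * Gamma (1 - w)) has_field_derivative
      Gamma z * Digamma z * Gamma (1 - z) - Gamma z * (Gamma (1 - z) * Digamma (1 - z))) (at z)"
    using ni by (auto intro!: derivative_eq_intros)
  moreover have "((\<lambda>w. of_real pi / sin (of_real pi * w)) has_field_derivative
      - of_real pi * (of_real pi * cos (of_real pi * z)) / (sin (of_real pi * z))\<^sup>2) (at z)"
    using snz by (auto intro!: derivative_eq_intros simp: power2_eq_square)
  ultimately have "Gamma z * Digamma z * Gamma (1 - z) - Gamma z * (Gamma (1 - z) * Digamma (1 - z)) =
      - of_real pi * (of_real pi * cos (of_real pi * z)) / (sin (of_real pi * z))\<^sup>2"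
    unfolding Gamma_reflection_complex by (rule DERIV_unique)
  moreover have "Gamma z * Digamma z * Gamma (1 - z) - Gamma z * (Gamma (1 - z) * Digamma (1 - z)) =
      Gamma z * Gamma (1 - z) * (Digamma z - Digamma (1 - z))" by (simp add: algebra_simps)
  ultimately have "of_real pi / sin (of_real pi * z) * (Digamma z - Digamma (1 - z)) =
      - of_real pi * (of_real pi * cos (of_real pi * z)) / (sin (of_real pi * z))\<^sup>2"
    by (simp add: Gamma_reflection_complex)
  note eq = this
  have "Digamma z - Digamma (1 - z) = sin (of_real pi * z) / of_real pi * (of_real pi / sin (of_real pi * z) * (Digamma z - Digamma (1 - z)))"
    using snz by simp
  also have "\<dots> = - of_real pi * cos (of_real pi * z) / sin (of_real pi * z)"
    unfolding eq using snz by (simp add: power2_eq_square)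
  finally show ?thesis .
qed

text \<open>The values of \<open>Digamma\<close> at iy and at 1 - iy are limits of sums of 1/(n +
  iy) and 1/(n + 1 - iy), and their difference is known from the reflection formula. In its
  imaginary part every n >= 1 is counted twice and n = 0 once, hence the subtracted 1/y and the
  final halving.\<close>

lemma coth_partial_fractions:
  fixes y :: real
  assumes "0 < y"
  shows "(\<lambda>n. y / ((real (Suc n))\<^sup>2 + y\<^sup>2)) sums ((pi * cosh (pi * y) / sinh (pi * y) - 1 / y) / 2)"
proof -
  define z where "z = Complex 0 y"
  have z: "Im z \<noteq> 0" "z \<noteq> 0" "1 - z \<noteq> 0" using assms by (auto simp: z_def complex_eq_iff)
  have "(\<lambda>m. (of_real (ln (real m)) - (\<Sum>n<m. inverse (z + of_nat n))) - (of_real (ln (real m)) - (\<Sum>n<m. inverse (1 - z + of_nat n)))) \<longlonglongrightarrow> Digamma z - Digamma (1 - z)"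
    by (intro tendsto_diff Digamma_LIMSEQ z)
  then have "(\<lambda>m. (\<Sum>n<m. inverse (1 - z + of_nat n) - inverse (z + of_nat n))) \<longlonglongrightarrow> Digamma z - Digamma (1 - z)"
    by (simp add: sum_subtractf)
  then have "(\<lambda>n. inverse (1 - z + of_nat n) - inverse (z + of_nat n)) sums (Digamma z - Digamma (1 - z))"
    by (simp add: sums_def)
  from sums_Im[OF this] have S: "(\<lambda>n. y / ((real (Suc n))\<^sup>2 + y\<^sup>2) + y / ((real n)\<^sup>2 + y\<^sup>2)) sums Im (Digamma z - Digamma (1 - z))"
    by (simp add: z_def add_ac)
  have "of_real pi * z = \<i> * of_real (pi * y)" by (simp add: z_def complex_eq_iff)
  then have "Digamma z - Digamma (1 - z) = - of_real pi * cosh (of_real (pi * y)) / (\<i> * sinh (of_real (pi * y)))"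
    unfolding Digamma_reflection_imaginary[OF z(1)] by (simp only: cosh_conv_cos sinh_conv_sin) simp
  also have "\<dots> = \<i> * of_real (pi * cosh (pi * y) / sinh (pi * y))"

  proof -
    have c: "cosh (complex_of_real a) = of_real (cosh a)" "sinh (complex_of_real a) = of_real (sinh a)" for a
      by (simp_all add: cosh_def sinh_def scaleR_conv_of_real flip: exp_of_real)
    have s: "sinh (pi * y) \<noteq> 0" using assms by simp
    show ?thesis unfolding c using s by (simp add: field_simps)
  qed
  finally have I: "Im (Digamma z - Digamma (1 - z)) = pi * cosh (pi * y) / sinh (pi * y)" by simp
  define b where "b n = y / ((real n)\<^sup>2 + y\<^sup>2)" for n
  have b0: "0 \<le> b n" for n using assms by (simp add: b_def)
  \<comment> \<open>Convergence of one half follows from that of the doubled series by comparison,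
    all terms being non-negative.\<close>
  have "summable (\<lambda>n. b (Suc n))"
    by (rule summable_comparison_test'[OF sums_summable[OF S]]) (use b0 assms in \<open>auto simp: b_def\<close>)
  then obtain A where A: "(\<lambda>n. b (Suc n)) sums A" by blast
  then have "b sums (A + b 0)" by (simp add: sums_Suc)
  from sums_add[OF A this] have "(\<lambda>n. b (Suc n) + b n) sums (A + (A + b 0))" .
  moreover have "(\<lambda>n. b (Suc n) + b n) sums (pi * cosh (pi * y) / sinh (pi * y))"
    using S unfolding I by (simp add: b_def)
  ultimately have "A + (A + b 0) = pi * cosh (pi * y) / sinh (pi * y)" by (rule sums_unique2)
  moreover have "b 0 = 1 / y" using assms by (simp add: b_def power2_eq_square)
  ultimately have "A = (pi * cosh (pi * y) / sinh (pi * y) - 1 / y) / 2" by simp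
  with A show ?thesis by (simp add: b_def)
qed

text \<open>The sum is 1/(e^x - 1) + 1/2 - 1/x, obtained from the partial fractions of the
  hyperbolic cotangent at x/(2 pi). All terms are positive, so its Mellin transform can be taken
  term by term in the extended non-negative reals.\<close>

lemma bose_kernel_sums:
  fixes x :: real
  assumes "0 < x"
  shows "(\<lambda>n. 2 * x / (x\<^sup>2 + (2 * pi * real (Suc n))\<^sup>2)) sums
    ((1 + exp (- x)) / (2 * (1 - exp (- x))) - 1 / x)"
proof -
  have e: "exp (- x) \<noteq> 1" using assms by simp
  have "(\<lambda>n. 1 / pi * ((x / (2 * pi)) / ((real (Suc n))\<^sup>2 + (x / (2 * pi))\<^sup>2))) sums
     (1 / pi * ((pi * cosh (pi * (x / (2 * pi))) / sinh (pi * (x / (2 * pi))) - 1 / (x / (2 * pi))) / 2))"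
    using assms by (intro sums_mult coth_partial_fractions) auto
  also have "1 / pi * ((pi * cosh (pi * (x / (2 * pi))) / sinh (pi * (x / (2 * pi))) - 1 / (x / (2 * pi))) / 2)
     = cosh (x / 2) / sinh (x / 2) / 2 - 1 / x"
    using assms by (simp add: field_simps)
  also have "cosh (x / 2) / sinh (x / 2) = (1 + exp (- x)) / (1 - exp (- x))"
  proof -
    have "cosh (x / 2) = exp (x / 2) * (1 + exp (- x)) / 2" "sinh (x / 2) = exp (x / 2) * (1 - exp (- x)) / 2"
      by (simp_all add: cosh_def sinh_def algebra_simps flip: exp_add)
    note cs = this
    show ?thesis unfolding cs by simp
  qed
  also have "(\<lambda>n. 1 / pi * ((x / (2 * pi)) / ((real (Suc n))\<^sup>2 + (x / (2 * pi))\<^sup>2))) = (\<lambda>n. 2 * x / (x\<^sup>2 + (2 * pi * real (Suc n))\<^sup>2))"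
  proof
    fix n
    have "1 / pi * ((x / (2 * pi)) / (k\<^sup>2 + (x / (2 * pi))\<^sup>2)) = 2 * x / (x\<^sup>2 + (2 * pi * k)\<^sup>2)" if "0 < k" for k :: real
    proof -
      have "k\<^sup>2 + (x / (2 * pi))\<^sup>2 = (x\<^sup>2 + (2 * pi * k)\<^sup>2) / (4 * pi\<^sup>2)"
        by (simp add: field_simps power2_eq_square)
      then show ?thesis by (simp add: power2_eq_square)
    qed
    from this[of "real (Suc n)"] show "1 / pi * ((x / (2 * pi)) / ((real (Suc n))\<^sup>2 + (x / (2 * pi))\<^sup>2)) = 2 * x / (x\<^sup>2 + (2 * pi * real (Suc n))\<^sup>2)" by simp
  qed
  finally show ?thesis by (simp only: divide_divide_eq_left mult.commute[of 2])
qed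

lemma nn_integral_power_exp:
  fixes p w :: real
  assumes "0 < p" "0 < w"
  shows "(\<integral>\<^sup>+x. ennreal (indicator {0..} x * x powr (p - 1) * exp (- (w * x))) \<partial>lborel) = ennreal (Gamma p * w powr (- p))"
proof -
  let ?f = "\<lambda>x::real. indicator {0..} x * x powr (p - 1) * exp (- (w * x))"
  have "ennreal (Gamma p) = (\<integral>\<^sup>+t. ennreal (indicator {0..} t * t powr (p - 1) / exp t) \<partial>lborel)"
    by (rule Gamma_conv_nn_integral_real[OF assms(1)])
  also have "\<dots> = ennreal \<bar>w\<bar> * (\<integral>\<^sup>+x. ennreal (indicator {0..} (0 + w * x) * (0 + w * x) powr (p - 1) / exp (0 + w * x)) \<partial>lborel)"
    using assms by (intro nn_integral_real_affine) auto
  also have "(\<integral>\<^sup>+x. ennreal (indicator {0..} (0 + w * x) * (0 + w * x) powr (p - 1) / exp (0 + w * x)) \<partial>lborel)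
     = (\<integral>\<^sup>+x. ennreal (w powr (p - 1)) * ennreal (?f x) \<partial>lborel)"
  proof (intro nn_integral_cong)
    fix x :: real
    have "indicator {0..} (0 + w * x) * (0 + w * x) powr (p - 1) / exp (0 + w * x) = w powr (p - 1) * ?f x"
      using assms by (cases "0 \<le> x") (auto simp: powr_mult exp_minus field_simps zero_le_mult_iff split: split_indicator)
    then show "ennreal (indicator {0..} (0 + w * x) * (0 + w * x) powr (p - 1) / exp (0 + w * x)) = ennreal (w powr (p - 1)) * ennreal (?f x)"
      by (simp add: ennreal_mult')
  qed
  also have "\<dots> = ennreal (w powr (p - 1)) * (\<integral>\<^sup>+x. ennreal (?f x) \<partial>lborel)" by (rule nn_integral_cmult) auto
  also have "ennreal \<bar>w\<bar> * (ennreal (w powr (p - 1)) * (\<integral>\<^sup>+x. ennreal (?f x) \<partial>lborel)) = ennreal (w powr p) * (\<integral>\<^sup>+x. ennreal (?f x) \<partial>lborel)"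
    using assms by (simp add: powr_diff flip: mult.assoc ennreal_mult'')
  finally have "ennreal (w powr (- p)) * ennreal (Gamma p) = (ennreal (w powr (- p)) * ennreal (w powr p)) * (\<integral>\<^sup>+x. ennreal (?f x) \<partial>lborel)"
    by (simp add: mult.assoc)
  also have "ennreal (w powr (- p)) * ennreal (w powr p) = 1"
    using assms by (simp add: powr_minus flip: ennreal_mult'')
  finally show ?thesis by (simp add: mult.commute flip: ennreal_mult'')
qed

lemma nn_integral_gauss_power:
  fixes s w :: real
  assumes "- 1 < s" "0 < w"
  shows "(\<integral>\<^sup>+x. ennreal (indicator {0<..} x * (2 * x powr s * exp (- (w * x\<^sup>2)))) \<partial>lborel) = ennreal (Gamma ((s + 1) / 2) * w powr (- ((s + 1) / 2)))"
proof -
  define p where "p = (s + 1) / 2"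
  have p: "0 < p" using assms by (simp add: p_def)
  define f where "f t = t powr (p - 1) / exp t" for t :: real
  have "(f has_integral Gamma p) {0..}" unfolding f_def by (rule Gamma_integral_real[OF p])
  then have "(f has_integral Gamma p) {0<..}"
    by (subst (asm) has_integral_spike_set_eq[of _ "{0<..}"]) (auto intro: negligible_subset[of "{0}"])
  then have f: "f absolutely_integrable_on {0<..}" "integral {0<..} f = Gamma p"
    by (auto simp: f_def intro!: nonnegative_absolutely_integrable_1 simp: has_integral_iff)
  have img: "(\<lambda>x. w * x\<^sup>2) ` {0<..} = {0<..}"
  proof (intro equalityI subsetI)
    fix t :: real assume "t \<in> {0<..}"
    then have "t = w * (sqrt (t / w))\<^sup>2" "sqrt (t / w) \<in> {0<..}" using assms by auto
    then show "t \<in> (\<lambda>x. w * x\<^sup>2) ` {0<..}" by blast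
  qed (use assms in auto)
  have "(\<lambda>x. \<bar>2 * w * x\<bar> * f (w * x\<^sup>2)) absolutely_integrable_on {0<..} \<and>
      integral {0<..} (\<lambda>x. \<bar>2 * w * x\<bar> * f (w * x\<^sup>2)) = Gamma p"
  proof (subst has_absolute_integral_change_of_variables_1'[where g = "\<lambda>x. w * x\<^sup>2"])
    show "inj_on (\<lambda>x. w * x\<^sup>2) {0<..}"
      using assms by (auto simp: inj_on_def power2_eq_iff_nonneg)
    show "f absolutely_integrable_on (\<lambda>x. w * x\<^sup>2) ` {0<..} \<and> integral ((\<lambda>x. w * x\<^sup>2) ` {0<..}) f = Gamma p"
      unfolding img using f by simp
  qed (auto intro!: derivative_eq_intros)
  then have "((\<lambda>x. \<bar>2 * w * x\<bar> * f (w * x\<^sup>2)) has_integral Gamma p) {0<..}"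
    by (simp add: has_integral_iff set_lebesgue_integral_eq_integral)
  also have "?this \<longleftrightarrow> ((\<lambda>x. w powr p * (2 * x powr s * exp (- (w * x\<^sup>2)))) has_integral Gamma p) {0<..}"
  proof (rule has_integral_cong)
    fix x :: real assume "x \<in> {0<..}"
    then have x: "0 < x" by simp
    have "(w * x\<^sup>2) powr (p - 1) = w powr (p - 1) * x powr (s - 1)"
    proof -
      have e: "2 * (p - 1) = s - 1" by (simp add: p_def field_simps)
      have "x\<^sup>2 = x powr 2" using x by (simp add: powr_numeral)
      then have "(w * x\<^sup>2) powr (p - 1) = w powr (p - 1) * (x powr 2) powr (p - 1)" using x assms by (simp add: powr_mult)
      also have "(x powr 2) powr (p - 1) = x powr (s - 1)" by (simp only: powr_powr e)
      finally show ?thesis .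
    qed
    then have "\<bar>2 * w * x\<bar> * f (w * x\<^sup>2) = (w * w powr (p - 1)) * (2 * (x * x powr (s - 1)) * exp (- (w * x\<^sup>2)))"
      using x assms by (simp add: f_def exp_minus field_simps)
    also have "w * w powr (p - 1) = w powr p" using assms by (simp add: powr_diff)
    also have "x * x powr (s - 1) = x powr s" using x by (simp add: powr_diff)
    finally show "\<bar>2 * w * x\<bar> * f (w * x\<^sup>2) = w powr p * (2 * x powr s * exp (- (w * x\<^sup>2)))" .
  qed
  finally have "(\<integral>\<^sup>+x. ennreal (indicator {0<..} x * (w powr p * (2 * x powr s * exp (- (w * x\<^sup>2))))) \<partial>lborel) = ennreal (Gamma p)"
    by (rule nn_integral_has_integral_lebesgue[rotated]) auto
  then have "ennreal (Gamma p) = (\<integral>\<^sup>+x. ennreal (w powr p) * ennreal (indicator {0<..} x * (2 * x powr s * exp (- (w * x\<^sup>2)))) \<partial>lborel)"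
    by (simp add: mult_ac flip: ennreal_mult'')
  also have "\<dots> = ennreal (w powr p) * (\<integral>\<^sup>+x. ennreal (indicator {0<..} x * (2 * x powr s * exp (- (w * x\<^sup>2)))) \<partial>lborel)"
    by (rule nn_integral_cmult) auto
  finally have "ennreal (w powr (- p)) * ennreal (Gamma p) = (ennreal (w powr (- p)) * ennreal (w powr p)) * (\<integral>\<^sup>+x. ennreal (indicator {0<..} x * (2 * x powr s * exp (- (w * x\<^sup>2)))) \<partial>lborel)"
    by (simp add: mult.assoc)
  also have "ennreal (w powr (- p)) * ennreal (w powr p) = 1"
    using assms by (simp add: powr_minus flip: ennreal_mult'')
  finally show ?thesis by (simp add: p_def mult.commute flip: ennreal_mult'')
qed

text \<open>1/(x^2 + a^2) is written as the integral of exp (-w (x^2 + a^2)) over w > 0, and Tonelli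
  exchanges the two integrals. Each becomes a Gamma integral with a half argument, the shape in
  which the functional equation is stated.\<close>

lemma nn_integral_mellin_lorentz:
  fixes s a :: real
  assumes s: "- 1 < s" "s < 1" and a: "0 < a"
  shows "(\<integral>\<^sup>+x. ennreal (indicator {0<..} x * (2 * x powr s / (x\<^sup>2 + a\<^sup>2))) \<partial>lborel)
    = ennreal (Gamma ((1 + s) / 2) * Gamma ((1 - s) / 2) * a powr (s - 1))"
proof -
  have "(\<integral>\<^sup>+x. ennreal (indicator {0<..} x * (2 * x powr s / (x\<^sup>2 + a\<^sup>2))) \<partial>lborel)
    = (\<integral>\<^sup>+x. (\<integral>\<^sup>+w. ennreal (indicator {0<..} x * (2 * x powr s * exp (- (w * x\<^sup>2)))) * ennreal (indicator {0..} w * exp (- (w * a\<^sup>2))) \<partial>lborel) \<partial>lborel)"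
  proof (intro nn_integral_cong)
    fix x :: real
    have e: "exp (- ((x\<^sup>2 + a\<^sup>2) * w)) = exp (- (w * x\<^sup>2)) * exp (- (w * a\<^sup>2))" for w
      by (simp add: algebra_simps flip: exp_add)
    have e': "exp (- (w * (x\<^sup>2 + a\<^sup>2))) = exp (- (w * x\<^sup>2)) * exp (- (w * a\<^sup>2))" for w
      by (simp add: algebra_simps flip: exp_add)
    have "(\<integral>\<^sup>+w. ennreal (indicator {0<..} x * (2 * x powr s * exp (- (w * x\<^sup>2)))) * ennreal (indicator {0..} w * exp (- (w * a\<^sup>2))) \<partial>lborel)
      = (\<integral>\<^sup>+w. ennreal (indicator {0<..} x * 2 * x powr s) * ennreal (indicator {0..} w * w powr (1 - 1) * exp (- ((x\<^sup>2 + a\<^sup>2) * w))) \<partial>lborel)"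
      using AE_lborel_singleton[of 0]
      by (intro nn_integral_cong_AE, eventually_elim)
         (auto simp: e e' mult_ac split: split_indicator simp flip: ennreal_mult'')
    also have "\<dots> = ennreal (indicator {0<..} x * 2 * x powr s) * ennreal (Gamma 1 * (x\<^sup>2 + a\<^sup>2) powr (- 1))"
      using nn_integral_power_exp[of 1 "x\<^sup>2 + a\<^sup>2"] a by (simp add: nn_integral_cmult sum_power2_gt_zero_iff del: powr_zero_eq_one)
    also have "\<dots> = ennreal (indicator {0<..} x * (2 * x powr s / (x\<^sup>2 + a\<^sup>2)))"
      using a by (simp add: powr_minus_divide sum_power2_gt_zero_iff flip: ennreal_mult'')
    finally show "ennreal (indicator {0<..} x * (2 * x powr s / (x\<^sup>2 + a\<^sup>2))) =
       (\<integral>\<^sup>+w. ennreal (indicator {0<..} x * (2 * x powr s * exp (- (w * x\<^sup>2)))) * ennreal (indicator {0..} w * exp (- (w * a\<^sup>2))) \<partial>lborel)" ..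
  qed
  also have "\<dots> = (\<integral>\<^sup>+w. (\<integral>\<^sup>+x. ennreal (indicator {0<..} x * (2 * x powr s * exp (- (w * x\<^sup>2)))) * ennreal (indicator {0..} w * exp (- (w * a\<^sup>2))) \<partial>lborel) \<partial>lborel)"
    by (rule lborel_pair.Fubini') (auto simp: case_prod_unfold)
  also have "\<dots> = (\<integral>\<^sup>+w. ennreal (Gamma ((s + 1) / 2)) * ennreal (indicator {0..} w * w powr ((1 - s) / 2 - 1) * exp (- (a\<^sup>2 * w))) \<partial>lborel)"
  proof (rule nn_integral_cong_AE, use AE_lborel_singleton[of 0] in eventually_elim)
    fix w :: real assume "w \<noteq> 0"
    show "(\<integral>\<^sup>+x. ennreal (indicator {0<..} x * (2 * x powr s * exp (- (w * x\<^sup>2)))) * ennreal (indicator {0..} w * exp (- (w * a\<^sup>2))) \<partial>lborel)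
      = ennreal (Gamma ((s + 1) / 2)) * ennreal (indicator {0..} w * w powr ((1 - s) / 2 - 1) * exp (- (a\<^sup>2 * w)))"
    proof (cases "0 < w")
      case True
      have "(\<integral>\<^sup>+x. ennreal (indicator {0<..} x * (2 * x powr s * exp (- (w * x\<^sup>2)))) * ennreal (indicator {0..} w * exp (- (w * a\<^sup>2))) \<partial>lborel)
        = ennreal (Gamma ((s + 1) / 2) * w powr (- ((s + 1) / 2))) * ennreal (indicator {0..} w * exp (- (w * a\<^sup>2)))"
        using nn_integral_gauss_power[OF s(1) True] by (subst nn_integral_multc) auto
      also have "- ((s + 1) / 2) = (1 - s) / 2 - 1" by (simp add: field_simps)
      finally show ?thesis using s True by (simp add: mult_ac Gamma_real_nonneg flip: ennreal_mult'' ennreal_mult')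
    next
      case False
      then show ?thesis using \<open>w \<noteq> 0\<close> by simp
    qed
  qed
  also have "\<dots> = ennreal (Gamma ((s + 1) / 2)) * ennreal (Gamma ((1 - s) / 2) * (a\<^sup>2) powr (- ((1 - s) / 2)))"
    using nn_integral_power_exp[of "(1 - s) / 2" "a\<^sup>2"] s a by (simp add: nn_integral_cmult)
  also have "(a\<^sup>2) powr (- ((1 - s) / 2)) = a powr (s - 1)"
  proof -
    have "a\<^sup>2 = a powr 2" using a by (simp add: powr_numeral)
    moreover have "2 * (- ((1 - s) / 2)) = s - 1" by (simp add: field_simps)
    ultimately show ?thesis by (simp only: powr_powr)
  qed
  finally show ?thesis using s by (simp add: add.commute mult_ac Gamma_real_nonneg flip: ennreal_mult'' ennreal_mult')
qed

lemma summable_zeta_real: "summable (\<lambda>n. real (Suc n) powr (- p))" if "1 < p"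
  using that by (subst summable_Suc_iff) (auto simp: summable_real_powr_iff)

text \<open>First evaluation of the Mellin integral: the partial fractions of the kernel lead to the
  Dirichlet series at 1 - s, which converges because s < 0.\<close>

lemma nn_integral_bose_kernel:
  fixes s :: real
  assumes s: "- 1 < s" "s < 0"
  shows "(\<integral>\<^sup>+x. ennreal (indicator {0<..} x * (x powr (s - 1) * ((1 + exp (- x)) / (2 * (1 - exp (- x))) - 1 / x))) \<partial>lborel)
    = ennreal (Gamma ((1 + s) / 2) * Gamma ((1 - s) / 2) * (2 * pi) powr (s - 1) * (\<Sum>n. real (Suc n) powr (- (1 - s))))"
proof -
  let ?C = "Gamma ((1 + s) / 2) * Gamma ((1 - s) / 2) * (2 * pi) powr (s - 1)"
  have C0: "0 \<le> ?C" using s by (simp add: Gamma_real_nonneg)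
  have "(\<integral>\<^sup>+x. ennreal (indicator {0<..} x * (x powr (s - 1) * ((1 + exp (- x)) / (2 * (1 - exp (- x))) - 1 / x))) \<partial>lborel)
     = (\<integral>\<^sup>+x. (\<Sum>n. ennreal (indicator {0<..} x * (2 * x powr s / (x\<^sup>2 + (2 * pi * real (Suc n))\<^sup>2)))) \<partial>lborel)"
  proof (intro nn_integral_cong)
    fix x :: real
    show "ennreal (indicator {0<..} x * (x powr (s - 1) * ((1 + exp (- x)) / (2 * (1 - exp (- x))) - 1 / x)))
       = (\<Sum>n. ennreal (indicator {0<..} x * (2 * x powr s / (x\<^sup>2 + (2 * pi * real (Suc n))\<^sup>2))))"
    proof (cases "0 < x")
      case True
      have "(\<lambda>n. x powr (s - 1) * (2 * x / (x\<^sup>2 + (2 * pi * real (Suc n))\<^sup>2))) sums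
         (x powr (s - 1) * ((1 + exp (- x)) / (2 * (1 - exp (- x))) - 1 / x))"
        by (intro sums_mult bose_kernel_sums True)
      also have "(\<lambda>n. x powr (s - 1) * (2 * x / (x\<^sup>2 + (2 * pi * real (Suc n))\<^sup>2))) = (\<lambda>n. 2 * x powr s / (x\<^sup>2 + (2 * pi * real (Suc n))\<^sup>2))"
        using True by (intro ext) (simp add: powr_diff)
      finally have S: "(\<lambda>n. 2 * x powr s / (x\<^sup>2 + (2 * pi * real (Suc n))\<^sup>2)) sums
         (x powr (s - 1) * ((1 + exp (- x)) / (2 * (1 - exp (- x))) - 1 / x))" .
      have ind: "indicator {0<..} x = (1::real)" using True by simp
      show ?thesis unfolding ind mult_1_left
        by (rule suminf_ennreal_eq[OF _ S, symmetric]) (use True in auto)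
    qed simp
  qed
  also have "\<dots> = (\<Sum>n. \<integral>\<^sup>+x. ennreal (indicator {0<..} x * (2 * x powr s / (x\<^sup>2 + (2 * pi * real (Suc n))\<^sup>2))) \<partial>lborel)"
    by (intro nn_integral_suminf) auto
  also have "\<dots> = (\<Sum>n. ennreal (?C * real (Suc n) powr (- (1 - s))))"
  proof (intro suminf_cong)
    fix n
    have "(\<integral>\<^sup>+x. ennreal (indicator {0<..} x * (2 * x powr s / (x\<^sup>2 + (2 * pi * real (Suc n))\<^sup>2))) \<partial>lborel)
      = ennreal (Gamma ((1 + s) / 2) * Gamma ((1 - s) / 2) * (2 * pi * real (Suc n)) powr (s - 1))"
      using s by (intro nn_integral_mellin_lorentz) auto
    also have "(2 * pi * real (Suc n)) powr (s - 1) = (2 * pi) powr (s - 1) * real (Suc n) powr (- (1 - s))"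
      by (subst powr_mult) auto
    finally show "(\<integral>\<^sup>+x. ennreal (indicator {0<..} x * (2 * x powr s / (x\<^sup>2 + (2 * pi * real (Suc n))\<^sup>2))) \<partial>lborel) = ennreal (?C * real (Suc n) powr (- (1 - s)))"
      by (simp add: mult_ac)
  qed
  also have "\<dots> = ennreal (?C * (\<Sum>n. real (Suc n) powr (- (1 - s))))"
    using C0 s by (intro suminf_ennreal_eq sums_mult summable_sums summable_zeta_real) auto
  finally show ?thesis .
qed

text \<open>The right-hand side is the trapezoidal error of the function e^(-u x) of u on
  [n, n + 1], here with its Peano kernel. Summed over n >= 0 as a geometric series it becomes the
  kernel of \<open>bose_kernel_sums\<close>.\<close>

lemma trap_kernel_has_integral:
  fixes n x :: real
  assumes "0 < x"
  shows "((\<lambda>v. v * (1 - v) / 2 * x\<^sup>2 * exp (- ((n + v) * x))) has_integral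
    exp (- n * x) * ((1 + exp (- x)) / 2 - (1 - exp (- x)) / x)) {0..1}"
proof -
  define G where "G v = exp (- n * x) / 2 * (v * (1 - v) * (- x * exp (- v * x)) - (1 - 2 * v) * exp (- v * x) + 2 * exp (- v * x) / x)" for v
  have "((\<lambda>v. v * (1 - v) / 2 * x\<^sup>2 * exp (- ((n + v) * x))) has_integral (G 1 - G 0)) {0..1}"
  proof (rule fundamental_theorem_of_calculus)
    fix v :: real assume "v \<in> {0..1}"
    have "(G has_real_derivative exp (- n * x) / 2 * (v * (1 - v) * x\<^sup>2 * exp (- v * x))) (at v within {0..1})"
      unfolding G_def using assms by (auto intro!: derivative_eq_intros simp: field_simps power2_eq_square)
    also have "exp (- n * x) / 2 * (v * (1 - v) * x\<^sup>2 * exp (- v * x)) = v * (1 - v) / 2 * x\<^sup>2 * exp (- ((n + v) * x))"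
      by (simp add: algebra_simps flip: exp_add)
    finally show "(G has_vector_derivative v * (1 - v) / 2 * x\<^sup>2 * exp (- ((n + v) * x))) (at v within {0..1})"
      by (simp add: has_real_derivative_iff_has_vector_derivative)
  qed simp
  also have "G 1 - G 0 = exp (- n * x) * ((1 + exp (- x)) / 2 - (1 - exp (- x)) / x)"
    using assms by (simp add: G_def field_simps)
  finally show ?thesis .
qed

lemma nn_integral_mellin_trap:
  fixes n v s :: real
  assumes s: "- 1 < s" "s < 0" and nv: "0 \<le> v" "v \<le> 1" "0 < n + v"
  shows "(\<integral>\<^sup>+x. ennreal (indicator {0<..} x * (x powr (s - 1) * (v * (1 - v) / 2 * x\<^sup>2 * exp (- ((n + v) * x))))) \<partial>lborel)
    = ennreal (Gamma (s + 2) * (v * (1 - v) / 2 * (n + v) powr (- s - 2)))"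
proof -
  have "(\<integral>\<^sup>+x. ennreal (indicator {0<..} x * (x powr (s - 1) * (v * (1 - v) / 2 * x\<^sup>2 * exp (- ((n + v) * x))))) \<partial>lborel)
    = (\<integral>\<^sup>+x. ennreal (v * (1 - v) / 2) * ennreal (indicator {0..} x * x powr (s + 2 - 1) * exp (- ((n + v) * x))) \<partial>lborel)"
  proof (rule nn_integral_cong_AE, use AE_lborel_singleton[of 0] in eventually_elim)
    fix x :: real assume "x \<noteq> 0"
    have "x powr (s - 1) * x\<^sup>2 = x powr (s + 2 - 1)" if "0 < x"
      using that by (simp add: powr_diff powr_add powr_numeral power2_eq_square field_simps)
    then have "indicator {0<..} x * (x powr (s - 1) * (v * (1 - v) / 2 * x\<^sup>2 * exp (- ((n + v) * x)))) =
       v * (1 - v) / 2 * (indicator {0..} x * x powr (s + 2 - 1) * exp (- ((n + v) * x)))"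
      using \<open>x \<noteq> 0\<close> by (auto split: split_indicator simp: mult_ac)
    note eq = this
    show "ennreal (indicator {0<..} x * (x powr (s - 1) * (v * (1 - v) / 2 * x\<^sup>2 * exp (- ((n + v) * x))))) =
      ennreal (v * (1 - v) / 2) * ennreal (indicator {0..} x * x powr (s + 2 - 1) * exp (- ((n + v) * x)))"
      unfolding eq using nv by (intro ennreal_mult') auto
  qed
  also have "\<dots> = ennreal (v * (1 - v) / 2) * ennreal (Gamma (s + 2) * (n + v) powr (- (s + 2)))"
    using nn_integral_power_exp[of "s + 2" "n + v"] s nv by (simp add: nn_integral_cmult)
  also have "\<dots> = ennreal (Gamma (s + 2) * (v * (1 - v) / 2 * (n + v) powr (- s - 2)))"
    using s nv by (subst ennreal_mult''[symmetric]) (auto simp: Gamma_real_nonneg mult_ac)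
  finally show ?thesis .
qed

text \<open>Second evaluation: the kernel is expanded into trapezoidal errors of e^(-u x) on the
  intervals [n, n + 1], n >= 0. Formally the Mellin transform of e^(-u x) in x is Gamma(s) u^(-s),
  so each error becomes Gamma(s) times the trapezoidal error of u^(-s), and these add up to the
  zeta-function. The factor x^2 in the Peano form makes this legitimate for -1 < s < 0, with Gamma(s
  + 2) in place of Gamma(s).\<close>

lemma zeta1_real_mellin:
  fixes s :: real
  assumes s: "- 1 < s" "s < 0"
  obtains r where "zeta1 (of_real s) = of_real r"
    "(\<integral>\<^sup>+x. ennreal (indicator {0<..} x * (x powr (s - 1) * ((1 + exp (- x)) / (2 * (1 - exp (- x))) - 1 / x))) \<partial>lborel)
      = ennreal (Gamma s * r)" "0 \<le> Gamma s * r"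
proof -
  let ?K = "\<lambda>n x v. indicator {0..1} v * (v * (1 - v) / 2 * x\<^sup>2 * exp (- ((real n + v) * x)))"
  \<comment> \<open>Integration over v alone gives the trapezoidal error of e^(-u x), over x alone
    the Peano form of the error of u^(-s); the whole proof compares the two orders.\<close>
  let ?J = "\<lambda>n x v. ennreal (indicator {0<..} x * x powr (s - 1)) * ennreal (?K n x v)"
  \<comment> \<open>This is Gamma(s), written through the positive Gamma(s + 2); the divisor s (s +
    1) is the factor in the integral form of \<open>trap\<close>.\<close>
  define g where "g = Gamma (s + 2) / (s * (s + 1))"
  have g: "g = Gamma s"
  proof -
    have ni: "s \<notin> \<int>\<^sub>\<le>\<^sub>0" using s by (auto elim!: nonpos_Ints_cases)
    have ni1: "s + 1 \<notin> \<int>\<^sub>\<le>\<^sub>0" using s by (auto elim!: nonpos_Ints_cases)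
    have "Gamma (s + 2) = (s + 1) * (s * Gamma s)"
      using Gamma_plus1[OF ni] Gamma_plus1[OF ni1] by (simp add: add_ac)
    then show ?thesis using s by (simp add: g_def)
  qed
  \<comment> \<open>The interval [0, 1] contributes (0 + 1)/2 - 1/(1 - s), the trapezoidal error of
    u^(-s), where the value 0 at u = 0 is due to s < 0. This produces the two terms of
    \<open>zeta1\<close> that stand outside its series.\<close>
  define t where "t n = (if n = 0 then 1 / (s - 1) + 1 / 2 else Re (trap (real n) (of_real s)) / 2)" for n :: nat
  have G2: "0 < Gamma (s + 2)" using s by (intro Gamma_real_pos) auto
  have inner_x: "(\<integral>\<^sup>+x. ?J n x v \<partial>lborel) = ennreal (indicator {0..1} v * (Gamma (s + 2) * (v * (1 - v) / 2 * (real n + v) powr (- s - 2))))"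
    if "v \<noteq> 0" for n v
  proof (cases "v \<in> {0..1}")
    case True
    have "(\<integral>\<^sup>+x. ?J n x v \<partial>lborel) = (\<integral>\<^sup>+x. ennreal (indicator {0<..} x * (x powr (s - 1) * (v * (1 - v) / 2 * x\<^sup>2 * exp (- ((real n + v) * x))))) \<partial>lborel)"
      using True by (intro nn_integral_cong) (auto simp flip: ennreal_mult' split: split_indicator)
    also have "\<dots> = ennreal (Gamma (s + 2) * (v * (1 - v) / 2 * (real n + v) powr (- s - 2)))"
      using True that by (intro nn_integral_mellin_trap s) auto
    finally show ?thesis using True by simp
  qed simp
  have int_t: "((\<lambda>v. Gamma (s + 2) * (v * (1 - v) / 2 * (real n + v) powr (- s - 2))) has_integral (g * t n)) {0..1}" for n
  proof (cases "n = 0")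
    case True
    have p: "((\<lambda>v. v powr (- s - 1)) has_integral (1 / (- s))) {0..1}" "((\<lambda>v. v powr (- s)) has_integral (1 / (1 - s))) {0..1}"
      using has_integral_powr_from_0[of "- s - 1" 1] has_integral_powr_from_0[of "- s" 1] s by auto
    have "((\<lambda>v. Gamma (s + 2) / 2 * (v powr (- s - 1) - v powr (- s))) has_integral (Gamma (s + 2) / 2 * (1 / (- s) - 1 / (1 - s)))) {0..1}"
      by (intro has_integral_mult_right has_integral_diff p)
    also have "Gamma (s + 2) / 2 * (1 / (- s) - 1 / (1 - s)) = g * t n"
    proof -
      have "1 / (- s) - 1 / (1 - s) = 1 / (s * (s - 1))" "1 / (s - 1) + 1 / 2 = (s + 1) / (2 * (s - 1))"
        using s by (simp_all add: field_simps)
      then show ?thesis using True s by (simp add: g_def t_def)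
    qed
    finally show ?thesis
    proof (rule has_integral_spike_finite[of "{0}", rotated 2])
      fix v :: real assume "v \<in> {0..1} - {0}"
      then have v: "0 < v" by auto
      have "v powr (- s - 1) = v * v powr (- s - 2)" "v powr (- s) = v * (v * v powr (- s - 2))"
        using v by (simp_all add: powr_diff powr_numeral power2_eq_square)
      then show "Gamma (s + 2) * (v * (1 - v) / 2 * (real n + v) powr (- s - 2)) = Gamma (s + 2) / 2 * (v powr (- s - 1) - v powr (- s))"
        using True by (simp add: field_simps)
    qed auto
  next
    case False
    have "((\<lambda>v. Re (of_real (v * (1 - v)) * (of_real s * (of_real s + 1) * of_real (real n + v) powr (- of_real s - 2)))) has_integral Re (trap (real n) (of_real s))) {0..1}"
      using trap_has_integral[of "real n" "of_real s"] False s by (intro has_integral_Re) auto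
    then have "((\<lambda>v. Gamma (s + 2) / (s * (s + 1)) / 2 * Re (of_real (v * (1 - v)) * (of_real s * (of_real s + 1) * of_real (real n + v) powr (- of_real s - 2)))) has_integral Gamma (s + 2) / (s * (s + 1)) / 2 * Re (trap (real n) (of_real s))) {0..1}"
      by (rule has_integral_mult_right)
    also have "Gamma (s + 2) / (s * (s + 1)) / 2 * Re (trap (real n) (of_real s)) = g * t n" using False by (simp add: g_def t_def)
    finally show ?thesis
    proof (rule has_integral_eq[rotated])
      fix v :: real assume v: "v \<in> {0..1}"
      have "of_real (real n + v) powr (- of_real s - 2) = complex_of_real ((real n + v) powr (- s - 2))"
        using False v powr_of_real[of "real n + v" "- s - 2"] by simp
      then have "of_real (v * (1 - v)) * (of_real s * (of_real s + 1) * of_real (real n + v) powr (- of_real s - 2)) = complex_of_real (v * (1 - v) * (s * (s + 1) * (real n + v) powr (- s - 2)))"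
        by simp
      note eq = this
      have alg: "G / c / 2 * (u * (c * W)) = G * (u / 2 * W)" if "c \<noteq> 0" for G c u W :: real using that by simp
      show "Gamma (s + 2) / (s * (s + 1)) / 2 * Re (of_real (v * (1 - v)) * (of_real s * (of_real s + 1) * of_real (real n + v) powr (- of_real s - 2))) = Gamma (s + 2) * (v * (1 - v) / 2 * (real n + v) powr (- s - 2))"
        unfolding eq Re_complex_of_real by (rule alg) (use s in auto)
    qed
  qed
  have tn: "(\<integral>\<^sup>+v. (\<integral>\<^sup>+x. ?J n x v \<partial>lborel) \<partial>lborel) = ennreal (g * t n)" for n
  proof -
    have "(\<integral>\<^sup>+v. (\<integral>\<^sup>+x. ?J n x v \<partial>lborel) \<partial>lborel) = (\<integral>\<^sup>+v. ennreal (indicator {0..1} v * (Gamma (s + 2) * (v * (1 - v) / 2 * (real n + v) powr (- s - 2)))) \<partial>lborel)"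
      by (rule nn_integral_cong_AE, use AE_lborel_singleton[of 0] in eventually_elim) (rule inner_x)
    also have "\<dots> = ennreal (g * t n)"
      by (rule nn_integral_has_integral_lebesgue[OF _ int_t]) (use G2 in auto)
    finally show ?thesis .
  qed
  have gt0: "0 \<le> g * t n" for n
    by (rule has_integral_nonneg[OF int_t]) (use G2 in auto)
  have tz: "(\<lambda>n. complex_of_real (t n)) sums zeta1 (of_real s)"
  proof -
    have tr: "trap (real (Suc n)) (of_real s) / 2 = of_real (t (Suc n))" for n
    proof -
      have "trap (real (Suc n)) (of_real s) \<in> \<real>"
        unfolding trap_def by (intro Reals_diff Reals_add Reals_divide Reals_mult Reals_powr) auto
      then show ?thesis by (auto simp: t_def elim!: Reals_cases simp del: of_nat_Suc)
    qed
    have "(\<lambda>n. complex_of_real (t (Suc n))) sums (\<Sum>n. trap (real (Suc n)) (of_real s) / 2)"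
      using summable_sums[OF summable_trap[of "of_real s"]] s unfolding tr by auto
    then have "(\<lambda>n. complex_of_real (t n)) sums ((\<Sum>n. trap (real (Suc n)) (of_real s) / 2) + of_real (t 0))"
      by (rule sums_Suc)
    then show ?thesis by (simp add: zeta1_def t_def add_ac)
  qed
  then have ts: "t sums Re (zeta1 (of_real s))" using sums_Re by fastforce
  have z: "zeta1 (of_real s) = of_real (Re (zeta1 (of_real s)))"
    using sums_unique2[OF tz sums_of_real[OF ts]] .
  have main: "(\<integral>\<^sup>+x. ennreal (indicator {0<..} x * (x powr (s - 1) * ((1 + exp (- x)) / (2 * (1 - exp (- x))) - 1 / x))) \<partial>lborel)
     = (\<integral>\<^sup>+x. (\<Sum>n. \<integral>\<^sup>+v. ?J n x v \<partial>lborel) \<partial>lborel)"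
  proof (intro nn_integral_cong)
    fix x :: real
    show "ennreal (indicator {0<..} x * (x powr (s - 1) * ((1 + exp (- x)) / (2 * (1 - exp (- x))) - 1 / x)))
       = (\<Sum>n. \<integral>\<^sup>+v. ?J n x v \<partial>lborel)"
    proof (cases "0 < x")
      case True
      define c where "c = (1 + exp (- x)) / 2 - (1 - exp (- x)) / x"
      have "(\<integral>\<^sup>+v. ?J n x v \<partial>lborel) = ennreal (x powr (s - 1)) * ennreal (exp (- real n * x) * c)" for n
      proof -
        have "(\<integral>\<^sup>+v. ennreal (?K n x v) \<partial>lborel) = ennreal (exp (- real n * x) * c)"
          unfolding c_def by (rule nn_integral_has_integral_lebesgue[OF _ trap_kernel_has_integral[OF True]]) auto
        then show ?thesis using True by (simp add: nn_integral_cmult)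
      qed
      also have "\<dots> n = ennreal (x powr (s - 1) * c * exp (- x) ^ n)" for n
      proof -
        have e: "exp (- real n * x) = exp (- x) ^ n" by (simp flip: exp_of_nat_mult)
        show ?thesis unfolding e by (subst ennreal_mult'[symmetric]) (auto simp: mult_ac)
      qed
      finally have J: "(\<integral>\<^sup>+v. ?J n x v \<partial>lborel) = ennreal (x powr (s - 1) * c * exp (- x) ^ n)" for n .
      have c0: "0 \<le> c"
      proof -
        have "0 \<le> exp (- 0 * x) * c"
          unfolding c_def by (rule has_integral_nonneg[OF trap_kernel_has_integral[OF True]]) auto
        then show ?thesis by simp
      qed
      have "(\<lambda>n. x powr (s - 1) * c * exp (- x) ^ n) sums (x powr (s - 1) * c * (1 / (1 - exp (- x))))"
        using True by (intro sums_mult geometric_sums) auto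
      note S = this
      have "(\<Sum>n. \<integral>\<^sup>+v. ?J n x v \<partial>lborel) = ennreal (x powr (s - 1) * c * (1 / (1 - exp (- x))))"
        unfolding J by (rule suminf_ennreal_eq[OF _ S]) (use c0 in auto)
      also have "x powr (s - 1) * c * (1 / (1 - exp (- x))) = x powr (s - 1) * ((1 + exp (- x)) / (2 * (1 - exp (- x))) - 1 / x)"
      proof -
        have "c * (1 / (1 - exp (- x))) = (1 + exp (- x)) / (2 * (1 - exp (- x))) - 1 / x"
          using True by (simp add: c_def field_simps)
        then show ?thesis by (simp only: mult.assoc)
      qed
      finally have J': "(\<Sum>n. \<integral>\<^sup>+v. ?J n x v \<partial>lborel) = ennreal (x powr (s - 1) * ((1 + exp (- x)) / (2 * (1 - exp (- x))) - 1 / x))" .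
      have ind: "indicator {0<..} x = (1::real)" using True by simp
      show ?thesis unfolding J' unfolding ind mult_1_left ..
    qed simp
  qed
  also have "\<dots> = (\<Sum>n. \<integral>\<^sup>+x. (\<integral>\<^sup>+v. ?J n x v \<partial>lborel) \<partial>lborel)"
    by (intro nn_integral_suminf) auto
  also have "\<dots> = (\<Sum>n. \<integral>\<^sup>+v. (\<integral>\<^sup>+x. ?J n x v \<partial>lborel) \<partial>lborel)"
  proof (rule suminf_cong)
    fix n
    have "(\<lambda>(x, v). ?J n x v) \<in> borel_measurable (lborel \<Otimes>\<^sub>M lborel)" by measurable
    then show "(\<integral>\<^sup>+x. (\<integral>\<^sup>+v. ?J n x v \<partial>lborel) \<partial>lborel) = (\<integral>\<^sup>+v. (\<integral>\<^sup>+x. ?J n x v \<partial>lborel) \<partial>lborel)"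
      by (rule lborel_pair.Fubini'[symmetric])
  qed
  also have "\<dots> = (\<Sum>n. ennreal (g * t n))" by (simp only: tn)
  also have "\<dots> = ennreal (g * Re (zeta1 (of_real s)))"
    by (intro suminf_ennreal_eq gt0 sums_mult ts)
  finally have I: "(\<integral>\<^sup>+x. ennreal (indicator {0<..} x * (x powr (s - 1) * ((1 + exp (- x)) / (2 * (1 - exp (- x))) - 1 / x))) \<partial>lborel) = ennreal (Gamma s * Re (zeta1 (of_real s)))"
    unfolding g .
  have "0 \<le> g * Re (zeta1 (of_real s))"
    using sums_le[OF _ sums_zero sums_mult[OF ts, of g]] gt0 by auto
  with I z show ?thesis using that unfolding g by blast
qed

lemma nonpos_Ints_Re_le: "z \<in> \<int>\<^sub>\<le>\<^sub>0 \<Longrightarrow> Re z \<le> 0"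
  by (auto elim!: nonpos_Ints_cases)

text \<open>The two evaluations of the Mellin integral are finite and non-negative, hence equal as
  real numbers. One contains Gamma(s), the other Gamma((1 + s)/2) Gamma((1 - s)/2); the duplication
  formula for Gamma(s) makes Gamma((1 + s)/2) cancel and leaves the symmetric form.\<close>

lemma zeta1_functional_real:
  fixes s :: real
  assumes s: "- 1 < s" "s < 0"
  shows "of_real pi powr (- of_real s / 2) * Gamma (of_real s / 2) * zeta1 (of_real s) =
    of_real pi powr (- (1 - of_real s) / 2) * Gamma ((1 - of_real s) / 2) * zeta1 (1 - of_real s)"
proof -
  define S where "S = (\<Sum>n. real (Suc n) powr (- (1 - s)))"
  obtain r where r: "zeta1 (of_real s) = of_real r" "0 \<le> Gamma s * r"
    "(\<integral>\<^sup>+x. ennreal (indicator {0<..} x * (x powr (s - 1) * ((1 + exp (- x)) / (2 * (1 - exp (- x))) - 1 / x))) \<partial>lborel) = ennreal (Gamma s * r)"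
    by (rule zeta1_real_mellin[OF s])
  have S0: "0 \<le> S" unfolding S_def using s by (intro suminf_nonneg summable_zeta_real) auto
  have zS: "zeta1 (1 - of_real s) = of_real S"
  proof -
    have "zeta1 (1 - of_real s) = (\<Sum>n. of_nat (Suc n) powr (- (1 - of_real s)))"
      using s by (intro zeta1_eq_suminf) auto
    also have "\<dots> = (\<Sum>n. of_real (real (Suc n) powr (- (1 - s))))"
    proof (rule suminf_cong)
      fix n
      have "complex_of_real (real (Suc n) powr (- (1 - s))) = of_real (real (Suc n)) powr of_real (- (1 - s))"
        by (rule powr_of_real[symmetric]) auto
      then show "complex_of_nat (Suc n) powr (- (1 - of_real s)) = of_real (real (Suc n) powr (- (1 - s)))" by simp
    qed
    also have "\<dots> = of_real S" unfolding S_def by (rule suminf_of_real[symmetric], rule summable_zeta_real) (use s in auto)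
    finally show ?thesis .
  qed
  have "ennreal (Gamma s * r) = ennreal (Gamma ((1 + s) / 2) * Gamma ((1 - s) / 2) * (2 * pi) powr (s - 1) * S)"
    using nn_integral_bose_kernel[OF s] r(3) unfolding S_def by simp
  then have eq: "Gamma s * r = Gamma ((1 + s) / 2) * Gamma ((1 - s) / 2) * (2 * pi) powr (s - 1) * S"
    using r(2) S0 s by (subst (asm) ennreal_inj) (auto simp: Gamma_real_nonneg)
  have ni: "of_real s / 2 \<notin> (\<int>\<^sub>\<le>\<^sub>0 :: complex set)" "of_real s / 2 + 1 / 2 \<notin> (\<int>\<^sub>\<le>\<^sub>0 :: complex set)"
  proof -
    have "of_real (s / 2) \<notin> (\<int>\<^sub>\<le>\<^sub>0 :: complex set)"
    proof
      assume "of_real (s / 2) \<in> (\<int>\<^sub>\<le>\<^sub>0 :: complex set)"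
      then obtain n :: int where "complex_of_real (s / 2) = of_int n" by (auto elim!: nonpos_Ints_cases)
      then have "Re (complex_of_real (s / 2)) = Re (of_int n)" by (rule arg_cong)
      then have *: "s = 2 * of_int n" by simp
      then have "n < 0" using s by simp
      then have "real_of_int n \<le> - 1" by linarith
      then show False using * s by linarith
    qed
    then show "of_real s / 2 \<notin> (\<int>\<^sub>\<le>\<^sub>0 :: complex set)" by simp
    have "0 < Re (of_real s / 2 + 1 / 2 :: complex)" using s by simp
    then show "of_real s / 2 + 1 / 2 \<notin> (\<int>\<^sub>\<le>\<^sub>0 :: complex set)"
      using nonpos_Ints_Re_le not_less by blast
  qed
  have "Gamma (of_real s / 2 :: complex) * Gamma (of_real s / 2 + 1 / 2) = exp ((1 - 2 * (of_real s / 2)) * of_real (ln 2)) * of_real (sqrt pi) * Gamma (2 * (of_real s / 2))"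
    by (rule Gamma_legendre_duplication[OF ni])
  also have "\<dots> = of_real (exp ((1 - s) * ln 2) * sqrt pi * Gamma s)"
  proof -
    have "exp ((1 - 2 * (of_real s / 2)) * of_real (ln 2)) = complex_of_real (exp ((1 - s) * ln 2))"
      by (simp flip: exp_of_real)
    then show ?thesis by (simp flip: Gamma_complex_of_real)
  qed
  also have "Gamma (of_real s / 2 :: complex) * Gamma (of_real s / 2 + 1 / 2) = of_real (Gamma (s / 2) * Gamma ((1 + s) / 2))"
    by (simp add: add_divide_distrib add.commute flip: Gamma_complex_of_real)
  finally have dup: "Gamma (s / 2) * Gamma ((1 + s) / 2) = exp ((1 - s) * ln 2) * sqrt pi * Gamma s"
    by (simp only: of_real_eq_iff)
  have G1: "0 < Gamma ((1 + s) / 2)" using s by (intro Gamma_real_pos) auto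
  have "Gamma ((1 + s) / 2) * (Gamma (s / 2) * r) = exp ((1 - s) * ln 2) * sqrt pi * (Gamma s * r)"
    using dup by (simp add: mult_ac)
  also have "\<dots> = Gamma ((1 + s) / 2) * (exp ((1 - s) * ln 2) * sqrt pi * (2 * pi) powr (s - 1) * Gamma ((1 - s) / 2) * S)"
    unfolding eq by (simp add: mult_ac)
  also have "exp ((1 - s) * ln 2) * sqrt pi * (2 * pi) powr (s - 1) = pi powr (s - 1 / 2)"
  proof -
    have "exp ((1 - s) * ln 2) = 2 powr (1 - s)" by (simp add: powr_def)
    moreover have "sqrt pi = pi powr (1 / 2)" by (simp add: powr_half_sqrt)
    moreover have "(2 * pi) powr (s - 1) = 2 powr (s - 1) * pi powr (s - 1)" by (simp add: powr_mult)
    ultimately have "exp ((1 - s) * ln 2) * sqrt pi * (2 * pi) powr (s - 1) = (2 powr (1 - s) * 2 powr (s - 1)) * (pi powr (1 / 2) * pi powr (s - 1))"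
      by simp
    also have "\<dots> = pi powr (1 / 2 + (s - 1))" by (simp flip: powr_add)
    also have "1 / 2 + (s - 1) = s - 1 / 2" by simp
    finally show ?thesis .
  qed
  finally have "Gamma (s / 2) * r = pi powr (s - 1 / 2) * Gamma ((1 - s) / 2) * S" using G1 by simp
  then have "pi powr (- s / 2) * Gamma (s / 2) * r = (pi powr (- s / 2) * pi powr (s - 1 / 2)) * Gamma ((1 - s) / 2) * S"
    by (simp add: mult_ac)
  also have "pi powr (- s / 2) * pi powr (s - 1 / 2) = pi powr (- (1 - s) / 2)"
    by (simp add: diff_divide_distrib flip: powr_add)
  finally have fin: "complex_of_real (pi powr (- s / 2) * Gamma (s / 2) * r) = of_real (pi powr (- (1 - s) / 2) * Gamma ((1 - s) / 2) * S)"
    by (rule arg_cong)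
  have "of_real pi powr (- of_real s / 2) = complex_of_real (pi powr (- s / 2))"
    "of_real pi powr (- (1 - of_real s) / 2) = complex_of_real (pi powr (- (1 - s) / 2))"
    using powr_of_real[of pi "- s / 2"] powr_of_real[of pi "- (1 - s) / 2"] by simp_all
  moreover have "Gamma (of_real s / 2) = complex_of_real (Gamma (s / 2))" "Gamma ((1 - of_real s) / 2) = complex_of_real (Gamma ((1 - s) / 2))"
    by (simp_all flip: Gamma_complex_of_real)
  ultimately show ?thesis unfolding r(1) zS using fin by (simp only: of_real_mult)
qed

text \<open>The strip is symmetric under s -> 1 - s and contains no pole of Gamma(s/2) except 0, so
  both sides are holomorphic off {0, 1}. The identity theorem extends the equation from the real
  segment (-1, 0).\<close>

lemma zeta1_functional_strip:
  assumes "- 1 < Re s" "Re s < 2" "s \<noteq> 0" "s \<noteq> 1"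
  shows "of_real pi powr (- s / 2) * Gamma (s / 2) * zeta1 s =
    of_real pi powr (- (1 - s) / 2) * Gamma ((1 - s) / 2) * zeta1 (1 - s)"
proof -
  define S where "S = {s. - 1 < Re s \<and> Re s < 2}"
  define L where "L s = of_real pi powr (- s / 2) * Gamma (s / 2) * zeta1 s" for s
  have opS: "open S" unfolding S_def by (intro open_Collect_conj open_halfspace_Re_gt open_halfspace_Re_lt)
  have "S = {s. - 1 < Re s} \<inter> {s. Re s < 2}" by (auto simp: S_def)
  then have conS: "connected S"
    by (auto intro!: convex_connected convex_Int convex_halfspace_Re_gt convex_halfspace_Re_lt)
  have op: "open (S - {0, 1})" using opS by auto
  have con: "connected (S - {0, 1})"
    by (rule connected_open_diff_countable) (use opS conS in auto)
  have half: "w / 2 \<notin> \<int>\<^sub>\<le>\<^sub>0" if "- 1 < Re w" "w \<noteq> 0" for w :: complex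
  proof
    assume "w / 2 \<in> \<int>\<^sub>\<le>\<^sub>0"
    then obtain n :: int where n: "w / 2 = of_int n" "n \<le> 0" by (auto elim!: nonpos_Ints_cases)
    then have w: "w = of_int (2 * n)" by (simp add: field_simps)
    then have "Re w = 2 * of_int n" by simp
    then have "n = 0" using that n by linarith
    then show False using w that by simp
  qed
  have holL: "L holomorphic_on (S - {0, 1})" unfolding L_def
    by (intro holomorphic_intros holomorphic_on_subset[OF holomorphic_zeta1]) (auto simp: S_def dest: half)
  have holR: "(\<lambda>s. L (1 - s)) holomorphic_on (S - {0, 1})"
  proof -
    have "(L \<circ> (\<lambda>s. 1 - s)) holomorphic_on (S - {0, 1})"
      by (rule holomorphic_on_compose) (auto intro!: holomorphic_intros holomorphic_on_subset[OF holL] simp: S_def)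
    then show ?thesis by (simp add: o_def)
  qed
  have "L s - L (1 - s) = 0"
  proof (rule analytic_continuation[of "\<lambda>s. L s - L (1 - s)" "S - {0, 1}" "complex_of_real ` {-1<..<0}" "- 1 / 2"])
    show "(\<lambda>s. L s - L (1 - s)) holomorphic_on S - {0, 1}" by (intro holomorphic_on_diff holL holR)
    show "complex_of_real ` {- 1<..<0} \<subseteq> S - {0, 1}" by (auto simp: S_def)
    show "- 1 / 2 islimpt complex_of_real ` {- 1<..<0}"
    proof -
      have "of_real (- 1 / 2) islimpt complex_of_real ` {- 1<..<0}"
      proof (rule islimptI)
        fix T assume T: "complex_of_real (- 1 / 2) \<in> T" "open T"
        then obtain e where e: "0 < e" "ball (complex_of_real (- 1 / 2)) e \<subseteq> T" using open_contains_ball by blast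
        define d where "d = min (e / 2) (1 / 4)"
        have "0 < d" "d < e" "d \<le> 1 / 4" using e by (auto simp: d_def)
        then have "complex_of_real (- 1 / 2 + d) \<in> ball (complex_of_real (- 1 / 2)) e"
          by (simp add: dist_norm flip: of_real_diff of_real_add of_real_minus of_real_divide)
        then have "complex_of_real (- 1 / 2 + d) \<in> T" using e by blast
        moreover have "complex_of_real (- 1 / 2 + d) \<noteq> complex_of_real (- 1 / 2)"
          using \<open>0 < d\<close> unfolding of_real_eq_iff by simp
        moreover have "complex_of_real (- 1 / 2 + d) \<in> complex_of_real ` {- 1<..<0}"
          using \<open>0 < d\<close> \<open>d \<le> 1 / 4\<close> by (intro imageI) auto
        ultimately show "\<exists>y\<in>complex_of_real ` {- 1<..<0}. y \<in> T \<and> y \<noteq> complex_of_real (- 1 / 2)" by blast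
      qed
      then show ?thesis by simp
    qed
    show "L z - L (1 - z) = 0" if "z \<in> complex_of_real ` {- 1<..<0}" for z
      using that zeta1_functional_real by (auto simp: L_def)
  next
    have "- 1 / 2 \<noteq> (0::complex)" "- 1 / 2 \<noteq> (1::complex)" by (auto simp: complex_eq_iff)
    then show "- 1 / 2 \<in> S - {0, 1}" by (simp add: S_def)
  qed (use op con assms in \<open>auto simp: S_def\<close>)
  then show ?thesis by (simp add: L_def)
qed

section \<open>Existence of the continuation, and \<open>zeta\<close> identified with the
  construction\<close>

text \<open>\<open>zeta\<close> has its defining properties only once some function is known to have
  them. The witness is \<open>zeta1\<close> for Re s > -1 and, for Re s < 0, the functional equation
  solved for zeta(s), where \<open>rGamma\<close> in place of a quotient stays holomorphic at the
  poles of Gamma(s/2). The two agree on the overlap by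
  \<open>zeta1_functional_strip\<close>.\<close>

lemma zeta_exists:
  "\<exists>f. f holomorphic_on (- {1}) \<and> (\<forall>s. Re s > 1 \<longrightarrow> f s = (\<Sum>n. of_nat (Suc n) powr (- s)))"
proof -
  define f2 where "f2 s = of_real pi powr (s - 1 / 2) * Gamma ((1 - s) / 2) * rGamma (s / 2) * zeta1 (1 - s)" for s
  define A B where "A = {s. - 1 < Re s} - {1::complex}" and "B = {s. Re s < 0}"
  have opA: "open A" "open B" unfolding A_def B_def by (auto intro: open_Diff open_halfspace_Re_gt open_halfspace_Re_lt)
  have hol2: "f2 holomorphic_on B"
  proof -
    have "(zeta1 \<circ> (\<lambda>s. 1 - s)) holomorphic_on B"
      by (rule holomorphic_on_compose) (auto intro!: holomorphic_intros holomorphic_on_subset[OF holomorphic_zeta1] simp: B_def)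
    then have z: "(\<lambda>s. zeta1 (1 - s)) holomorphic_on B" by (simp add: o_def)
    have g: "(1 - s) / 2 \<notin> \<int>\<^sub>\<le>\<^sub>0" if "s \<in> B" for s
    proof
      assume "(1 - s) / 2 \<in> \<int>\<^sub>\<le>\<^sub>0"
      then have "Re ((1 - s) / 2) \<le> 0" by (rule nonpos_Ints_Re_le)
      then show False using that by (simp add: B_def)
    qed
    show ?thesis unfolding f2_def by (intro holomorphic_intros z) (auto simp: g)
  qed
  have agree: "zeta1 s = f2 s" if "s \<in> A" "s \<in> B" for s
  proof -
    have s: "- 1 < Re s" "Re s < 0" using that by (auto simp: A_def B_def)
    then have nz: "s \<noteq> 0" "s \<noteq> 1" by auto
    have ni: "s / 2 \<notin> \<int>\<^sub>\<le>\<^sub>0"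
    proof
      assume "s / 2 \<in> \<int>\<^sub>\<le>\<^sub>0"
      then obtain n :: int where n: "s / 2 = of_int n" by (auto elim!: nonpos_Ints_cases)
      then have "Re (s / 2) = of_int n" by simp
      then have *: "Re s = 2 * of_int n" by simp
      then have "n < 0" using s by simp
      then have "real_of_int n \<le> - 1" by linarith
      then show False using * s by linarith
    qed
    have "of_real pi powr (s / 2) * rGamma (s / 2) * (of_real pi powr (- s / 2) * Gamma (s / 2) * zeta1 s)
      = (of_real pi powr (s / 2) * of_real pi powr (- s / 2)) * (rGamma (s / 2) * Gamma (s / 2)) * zeta1 s" by (simp add: mult_ac)
    also have "of_real pi powr (s / 2) * of_real pi powr (- s / 2) = (1::complex)"
      by (simp flip: powr_add)
    also have "rGamma (s / 2) * Gamma (s / 2) = 1"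
      using ni by (simp add: rGamma_inverse_Gamma Gamma_eq_zero_iff)
    finally have "zeta1 s = of_real pi powr (s / 2) * rGamma (s / 2) * (of_real pi powr (- s / 2) * Gamma (s / 2) * zeta1 s)" by simp
    also have "\<dots> = of_real pi powr (s / 2) * rGamma (s / 2) * (of_real pi powr (- (1 - s) / 2) * Gamma ((1 - s) / 2) * zeta1 (1 - s))"
      using zeta1_functional_strip[of s] s nz by simp
    also have "\<dots> = (of_real pi powr (s / 2) * of_real pi powr (- (1 - s) / 2)) * Gamma ((1 - s) / 2) * rGamma (s / 2) * zeta1 (1 - s)" by (simp add: mult_ac)
    also have "of_real pi powr (s / 2) * of_real pi powr (- (1 - s) / 2) = (of_real pi powr (s - 1 / 2) :: complex)"
    proof -
      have "s / 2 + (- (1 - s) / 2) = s - 1 / 2" by (simp add: field_simps)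
      then show ?thesis by (simp flip: powr_add)
    qed
    finally show ?thesis by (simp add: f2_def)
  qed
  define f where "f s = (if s \<in> A then zeta1 s else f2 s)" for s
  have "f holomorphic_on (A \<union> B)" unfolding f_def
    by (rule holomorphic_on_If_Un) (use opA hol2 agree holomorphic_zeta1 in \<open>auto simp: A_def\<close>)
  moreover have "- {1} \<subseteq> A \<union> B" by (auto simp: A_def B_def)
  ultimately have "f holomorphic_on (- {1})" by (rule holomorphic_on_subset)
  moreover have "f s = (\<Sum>n. of_nat (Suc n) powr (- s))" if "1 < Re s" for s
    using zeta1_eq_suminf[OF that] that by (auto simp: f_def A_def)
  ultimately show ?thesis by blast
qed

lemma holomorphic_zeta: "zeta holomorphic_on (- {1})"
  and zeta_eq_suminf: "1 < Re s \<Longrightarrow> zeta s = (\<Sum>n. of_nat (Suc n) powr (- s))"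
  using someI_ex[OF zeta_exists] unfolding zeta_def by blast+

text \<open>The chosen function might a priori differ from the witness; the identity theorem,
  starting from the half-plane of the Dirichlet series, excludes this wherever \<open>zeta1\<close>
  converges.\<close>

lemma zeta_eq_zeta1:
  assumes "- 1 < Re s" "s \<noteq> 1"
  shows "zeta s = zeta1 s"
proof -
  let ?S = "{s. - 1 < Re s} - {1::complex}"
  have op: "open ?S" by (intro open_Diff open_halfspace_Re_gt) auto
  have con: "connected ?S"
    by (rule connected_open_delete) (auto intro: open_halfspace_Re_gt convex_connected convex_halfspace_Re_gt)
  show ?thesis
  proof (rule analytic_continuation_open[of "{s. 1 < Re s}" ?S zeta zeta1])
    show "{s. 1 < Re s} \<noteq> {}" by (auto intro: exI[of _ 2])
    show "zeta holomorphic_on ?S" by (rule holomorphic_on_subset[OF holomorphic_zeta]) auto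
  qed (use op con assms holomorphic_zeta1 in \<open>auto simp: zeta_eq_suminf zeta1_eq_suminf open_halfspace_Re_gt\<close>)
qed

lemma zeta_functional_strip:
  assumes "- 1 < Re s" "Re s < 2" "s \<noteq> 0" "s \<noteq> 1"
  shows "of_real pi powr (- s / 2) * Gamma (s / 2) * zeta s =
    of_real pi powr (- (1 - s) / 2) * Gamma ((1 - s) / 2) * zeta (1 - s)"
  using zeta1_functional_strip[OF assms] assms by (simp add: zeta_eq_zeta1)

lemma zeta_cnj:
  assumes "- 1 < Re s" "s \<noteq> 1"
  shows "zeta (cnj s) = cnj (zeta s)"
proof -
  have t: "trap a (cnj s) = cnj (trap a s)" if "0 < a" for a s
    using that by (simp add: trap_def cnj_powr)
  have "(\<lambda>n. cnj (trap (Suc n) s / 2)) sums cnj (\<Sum>n. trap (Suc n) s / 2)"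
    using summable_sums[OF summable_trap[of s]] assms by (subst sums_cnj) auto
  then have "(\<Sum>n. trap (Suc n) (cnj s) / 2) = cnj (\<Sum>n. trap (Suc n) s / 2)"
    by (simp add: t sums_iff del: of_nat_Suc)
  then have "zeta1 (cnj s) = cnj (zeta1 s)" by (simp add: zeta1_def del: of_nat_Suc)
  moreover have "cnj s \<noteq> 1" using assms by (metis complex_cnj_cnj complex_cnj_one)
  ultimately show ?thesis using assms by (simp add: zeta_eq_zeta1)
qed

section \<open>Stirling-type estimates for the phase and its derivatives\<close>

lemma inverse_square_tail:
  fixes w :: real
  assumes "1 \<le> w"
  shows "summable (\<lambda>n. 1 / (real n + w)\<^sup>2)" "(\<Sum>n. 1 / (real n + w)\<^sup>2) \<le> 2 / w"
proof -
  have t: "(\<lambda>n. 1 / (real n + w) - 1 / (real (Suc n) + w)) sums (1 / (real 0 + w) - 0)"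
  proof (rule telescope_sums')
    show "(\<lambda>n. 1 / (real n + w)) \<longlonglongrightarrow> 0"
      by real_asymp
  qed
  have le: "1 / (real n + w)\<^sup>2 \<le> 2 * (1 / (real n + w) - 1 / (real (Suc n) + w))" for n
  proof -
    define v where "v = real n + w"
    have v: "1 \<le> v" using assms by (simp add: v_def)
    have "1 / v\<^sup>2 = 2 / (2 * v\<^sup>2)" by simp
    also have "\<dots> \<le> 2 / (v * (v + 1))"
    proof (rule divide_left_mono)
      show "v * (v + 1) \<le> 2 * v\<^sup>2" using v by (simp add: power2_eq_square algebra_simps)
      show "0 < 2 * v\<^sup>2 * (v * (v + 1))" using v by (intro mult_pos_pos) auto
    qed auto
    also have "\<dots> = 2 * (1 / v - 1 / (v + 1))" using v by (simp add: field_simps)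
    finally show ?thesis by (simp add: v_def add_ac)
  qed
  show s: "summable (\<lambda>n. 1 / (real n + w)\<^sup>2)"
    by (rule summable_comparison_test'[OF summable_mult[OF sums_summable[OF t], of 2]]) (use le in auto)
  have "(\<Sum>n. 1 / (real n + w)\<^sup>2) \<le> (\<Sum>n. 2 * (1 / (real n + w) - 1 / (real (Suc n) + w)))"
    by (intro suminf_le le summable_mult sums_summable[OF t] s)
  also have "\<dots> = 2 * (1 / (real 0 + w) - 0)" by (rule sums_unique[OF sums_mult[OF t], symmetric])
  also have "\<dots> = 2 / w" by simp
  finally show "(\<Sum>n. 1 / (real n + w)\<^sup>2) \<le> 2 / w" .
qed

text \<open>With w = Re z + |Im z| one has (k + w)^2 <= 2 |z + k|^2, which reduces the series to a
  tail of inverse squares. For the second bound 1/z is written as a telescoping series; the k-th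
  difference is 1/((z + k)^2 (z + k + 1)), smaller by a factor |Im z|.\<close>

lemma trigamma_bounds:
  fixes z :: complex
  assumes x: "- 1 / 2 \<le> Re z" and y: "2 \<le> \<bar>Im z\<bar>"
  shows "norm (Polygamma 1 z) \<le> 8 / \<bar>Im z\<bar>"
    "norm (Polygamma 1 z - 1 / z) \<le> 8 / (Im z)\<^sup>2"
proof -
  define w where "w = Re z + \<bar>Im z\<bar>"
  have w: "1 \<le> w" "\<bar>Im z\<bar> / 2 \<le> w" using x y by (auto simp: w_def)
  have z0: "z + of_nat n \<noteq> 0" for n using y by (auto simp: complex_eq_iff)
  have P: "(\<lambda>k. inverse ((z + of_nat k)^2)) sums Polygamma 1 z"
    using Polygamma_LIMSEQ[of z 1] z0[of 0] by (simp add: numeral_2_eq_2)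
  have n2: "norm (inverse ((z + of_nat k)^2)) \<le> 2 * (1 / (real k + w)\<^sup>2)" for k
  proof -
    have "(real k + w)\<^sup>2 \<le> 2 * ((Re z + k)\<^sup>2 + \<bar>Im z\<bar>\<^sup>2)"
      using sum_squares_bound[of "Re z + k" "\<bar>Im z\<bar>"] by (simp add: w_def power2_eq_square algebra_simps)
    also have "(Re z + k)\<^sup>2 + \<bar>Im z\<bar>\<^sup>2 = (norm (z + of_nat k))\<^sup>2" by (simp add: cmod_power2)
    finally have "1 / (2 * (norm (z + of_nat k))\<^sup>2) \<le> 1 / (real k + w)\<^sup>2"
      using w z0[of k] by (intro divide_left_mono mult_pos_pos zero_less_power) auto
    moreover have "norm (inverse ((z + of_nat k)^2)) = 2 * (1 / (2 * (norm (z + of_nat k))\<^sup>2))"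
      by (simp add: norm_inverse norm_power inverse_eq_divide norm_divide)
    ultimately show ?thesis by linarith
  qed
  have "norm (\<Sum>k. inverse ((z + of_nat k)^2)) \<le> (\<Sum>k. 2 * (1 / (real k + w)\<^sup>2))"
    by (intro norm_suminf_le n2 summable_mult inverse_square_tail w)
  also have "\<dots> = 2 * (\<Sum>k. 1 / (real k + w)\<^sup>2)" by (intro suminf_mult inverse_square_tail w)
  also have "\<dots> \<le> 2 * (2 / w)" using inverse_square_tail[OF w(1)] by simp
  also have "\<dots> \<le> 2 * (2 / (\<bar>Im z\<bar> / 2))" using w y by (intro mult_left_mono divide_left_mono) auto
  finally show "norm (Polygamma 1 z) \<le> 8 / \<bar>Im z\<bar>" using P by (simp add: sums_iff)
  have T: "(\<lambda>k. 1 / (z + of_nat k) - 1 / (z + of_nat (Suc k))) sums (1 / (z + of_nat 0) - 0)"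
  proof (rule telescope_sums')
    have "filterlim (\<lambda>k. z + of_nat k) at_infinity sequentially"
      by (rule tendsto_add_filterlim_at_infinity[OF tendsto_const tendsto_of_nat])
    then show "(\<lambda>k. 1 / (z + of_nat k)) \<longlonglongrightarrow> 0" by (rule tendsto_divide_0[OF tendsto_const])
  qed
  have D: "(\<lambda>k. inverse ((z + of_nat k)^2) - (1 / (z + of_nat k) - 1 / (z + of_nat (Suc k)))) sums (Polygamma 1 z - 1 / z)"
    using sums_diff[OF P T] by simp
  have b: "norm (inverse ((z + of_nat k)^2) - (1 / (z + of_nat k) - 1 / (z + of_nat (Suc k)))) \<le> 1 / \<bar>Im z\<bar> * (2 * (1 / (real k + w)\<^sup>2))" for k
  proof -
    have e: "inverse (v^2) - (1 / v - 1 / (v + 1)) = 1 / (v + 1) * inverse (v^2)" if "v \<noteq> 0" "v + 1 \<noteq> 0" for v :: complex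
    proof -
      define X where "X = 1 / (v + 1) * inverse (v^2)"
      have "inverse (v^2) = (v + 1) * X" "1 / v - 1 / (v + 1) = v * X"
        using that by (simp_all add: X_def power2_eq_square divide_simps)
      then have "inverse (v^2) - (1 / v - 1 / (v + 1)) = (v + 1) * X - v * X" by (simp only:)
      also have "\<dots> = X" by (simp add: algebra_simps)
      finally show ?thesis unfolding X_def .
    qed
    have "norm (inverse ((z + of_nat k)^2) - (1 / (z + of_nat k) - 1 / (z + of_nat (Suc k)))) = norm (1 / (z + of_nat (Suc k))) * norm (inverse ((z + of_nat k)^2))"
      using e[of "z + of_nat k"] z0[of k] z0[of "Suc k"] by (simp add: add_ac norm_mult norm_divide)
    also have "\<dots> \<le> 1 / \<bar>Im z\<bar> * (2 * (1 / (real k + w)\<^sup>2))"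
    proof (intro mult_mono n2)
      have "\<bar>Im z\<bar> \<le> norm (z + of_nat (Suc k))" using abs_Im_le_cmod[of "z + of_nat (Suc k)"] by simp
      then show "norm (1 / (z + of_nat (Suc k))) \<le> 1 / \<bar>Im z\<bar>"
        using y unfolding norm_divide norm_one by (intro divide_left_mono mult_pos_pos) auto
    qed auto
    finally show ?thesis .
  qed
  have "norm (\<Sum>k. inverse ((z + of_nat k)^2) - (1 / (z + of_nat k) - 1 / (z + of_nat (Suc k)))) \<le> (\<Sum>k. 1 / \<bar>Im z\<bar> * (2 * (1 / (real k + w)\<^sup>2)))"
    by (intro norm_suminf_le b summable_mult inverse_square_tail w)
  also have "\<dots> = 1 / \<bar>Im z\<bar> * (2 * (\<Sum>k. 1 / (real k + w)\<^sup>2))"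
    by (subst suminf_mult[OF summable_mult[OF inverse_square_tail(1)[OF w(1)]]], subst suminf_mult[OF inverse_square_tail(1)[OF w(1)]]) (rule refl)
  also have "\<dots> \<le> 1 / \<bar>Im z\<bar> * (2 * (2 / w))" using inverse_square_tail[OF w(1)] by (intro mult_left_mono) auto
  also have "\<dots> \<le> 1 / \<bar>Im z\<bar> * (2 * (2 / (\<bar>Im z\<bar> / 2)))" using w y by (intro mult_left_mono divide_left_mono) auto
  also have "\<dots> = 8 / (Im z)\<^sup>2" by (simp add: power2_eq_square flip: abs_mult)
  finally show "norm (Polygamma 1 z - 1 / z) \<le> 8 / (Im z)\<^sup>2" using D by (simp add: sums_iff)
qed

text \<open>Exponentiating would give the identity only modulo 2 pi i. It is read off instead from
  the defining limit, whose logarithms are principal and commute with conjugation off the negative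
  axis.\<close>

lemma cnj_ln_Gamma:
  assumes "Im z \<noteq> 0"
  shows "ln_Gamma (cnj z) = cnj (ln_Gamma z)"
proof -
  have im: "Im w \<noteq> 0 \<Longrightarrow> w \<notin> \<int>\<^sub>\<le>\<^sub>0" for w :: complex by (auto elim!: nonpos_Ints_cases)
  have l: "Ln (cnj w) = cnj (Ln w)" if "Im w \<noteq> 0" for w
    using that by (intro cnj_Ln[symmetric]) (auto simp: complex_nonpos_Reals_iff)
  have ser: "ln_Gamma_series (cnj z) (Suc n) = cnj (ln_Gamma_series z (Suc n))" for n
  proof -
    have "Ln (cnj z / of_nat k + 1) = cnj (Ln (z / of_nat k + 1))" if "k \<in> {1..Suc n}" for k
      using l[of "z / of_nat k + 1"] that assms by simp
    moreover have "Ln (of_nat (Suc n)) = cnj (Ln (of_nat (Suc n)))"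
      by (simp add: Ln_of_nat del: of_nat_Suc)
    ultimately show ?thesis by (simp add: ln_Gamma_series_def l[OF assms] del: of_nat_Suc)
  qed
  have "(\<lambda>n. cnj (ln_Gamma_series z (Suc n))) \<longlonglongrightarrow> ln_Gamma (cnj z)"
    using LIMSEQ_Suc[OF ln_Gamma_complex_LIMSEQ[of "cnj z"]] assms im[of "cnj z"] by (simp add: ser)
  moreover have "(\<lambda>n. cnj (ln_Gamma_series z (Suc n))) \<longlonglongrightarrow> cnj (ln_Gamma z)"
    using LIMSEQ_Suc[OF ln_Gamma_complex_LIMSEQ[of z]] assms im[of z] by (intro tendsto_cnj) auto
  ultimately show ?thesis by (rule LIMSEQ_unique)
qed

text \<open>The holomorphic continuation of \<open>\<i> \<vartheta>\<close> from the critical line: \<open>thA (1/2 + \<i> t) = \<i> \<vartheta> t\<close>.\<close>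
definition thA :: "complex \<Rightarrow> complex" where
  "thA s = ((1 / 2 - s) * of_real (ln pi) + ln_Gamma (s / 2) - ln_Gamma ((1 - s) / 2)) / 2"

definition thA1 :: "complex \<Rightarrow> complex" where
  "thA1 s = (- of_real (ln pi) + Digamma (s / 2) / 2 + Digamma ((1 - s) / 2) / 2) / 2"

definition thA2 :: "complex \<Rightarrow> complex" where
  "thA2 s = (Polygamma 1 (s / 2) / 4 - Polygamma 1 ((1 - s) / 2) / 4) / 2"

lemma thA_not_nonpos:
  assumes "0 < Im s"
  shows "s / 2 \<notin> \<real>\<^sub>\<le>\<^sub>0" "(1 - s) / 2 \<notin> \<real>\<^sub>\<le>\<^sub>0" "s / 2 \<notin> \<int>\<^sub>\<le>\<^sub>0" "(1 - s) / 2 \<notin> \<int>\<^sub>\<le>\<^sub>0"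
  using assms nonpos_Ints_subset_nonpos_Reals by (auto simp: complex_nonpos_Reals_iff subset_iff)

lemma thA_deriv:
  assumes "0 < Im s"
  shows "(thA has_field_derivative thA1 s) (at s within S)" "(thA1 has_field_derivative thA2 s) (at s within S)"
proof -
  note n = thA_not_nonpos[OF assms]
  have h: "((\<lambda>s::complex. s / 2) has_field_derivative 1 / 2) (at s within S)"
    "((\<lambda>s::complex. (1 - s) / 2) has_field_derivative - 1 / 2) (at s within S)"
    by (auto intro!: derivative_eq_intros)
  have a: "((\<lambda>s. ln_Gamma (s / 2)) has_field_derivative Digamma (s / 2) * (1 / 2)) (at s within S)"
    "((\<lambda>s. ln_Gamma ((1 - s) / 2)) has_field_derivative Digamma ((1 - s) / 2) * (- 1 / 2)) (at s within S)"
    by (rule DERIV_chain2[OF has_field_derivative_ln_Gamma_complex[OF n(1)] h(1)])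
       (rule DERIV_chain2[OF has_field_derivative_ln_Gamma_complex[OF n(2)] h(2)])
  have b: "((\<lambda>s. Digamma (s / 2)) has_field_derivative Polygamma (Suc 0) (s / 2) * (1 / 2)) (at s within S)"
    "((\<lambda>s. Digamma ((1 - s) / 2)) has_field_derivative Polygamma (Suc 0) ((1 - s) / 2) * (- 1 / 2)) (at s within S)"
    by (rule DERIV_chain2[OF has_field_derivative_Polygamma[OF n(3)] h(1)])
       (rule DERIV_chain2[OF has_field_derivative_Polygamma[OF n(4)] h(2)])
  have l: "((\<lambda>s. (1 / 2 - s) * complex_of_real (ln pi)) has_field_derivative - of_real (ln pi)) (at s within S)"
    by (auto intro!: derivative_eq_intros)
  from DERIV_cdivide[OF DERIV_diff[OF DERIV_add[OF l a(1)] a(2)], of 2]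
  show "(thA has_field_derivative thA1 s) (at s within S)"
    unfolding thA_def [abs_def] thA1_def by simp
  from DERIV_cdivide[OF DERIV_add[OF DERIV_add[OF DERIV_const[of "- complex_of_real (ln pi)"] DERIV_cdivide[OF b(1), of 2]] DERIV_cdivide[OF b(2), of 2]], of 2]
  show "(thA1 has_field_derivative thA2 s) (at s within S)"
    unfolding thA1_def [abs_def] thA2_def by simp
qed

lemma norm_thA2_le:
  assumes "- 1 \<le> Re s" "Re s \<le> 2" "4 \<le> Im s"
  shows "norm (thA2 s) \<le> 4 / Im s"
proof -
  have "norm (thA2 s) \<le> (norm (Polygamma 1 (s / 2)) / 4 + norm (Polygamma 1 ((1 - s) / 2)) / 4) / 2"
    unfolding thA2_def using norm_triangle_ineq4[of "Polygamma 1 (s / 2) / 4" "Polygamma 1 ((1 - s) / 2) / 4"]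
    by (simp add: norm_divide)
  also have "\<dots> \<le> (8 / \<bar>Im (s / 2)\<bar> / 4 + 8 / \<bar>Im ((1 - s) / 2)\<bar> / 4) / 2"
    using assms by (intro divide_right_mono add_mono trigamma_bounds) auto
  also have "\<dots> = 4 / Im s" using assms by simp
  finally show ?thesis .
qed

text \<open>The second derivative is O(1/h) above height h, so over distances of order H the phase
  is linear up to O(H^2/h) and its slope is constant up to O(H/h). The region is an intersection of
  half-planes, hence convex, and Taylor's formula applies.\<close>

lemma thA_taylor:
  assumes s: "- 1 \<le> Re s" "Re s \<le> 2" "h \<le> Im s" and s0: "- 1 \<le> Re s0" "Re s0 \<le> 2" "h \<le> Im s0" and h: "4 \<le> h"
  shows "norm (thA s - (thA s0 + thA1 s0 * (s - s0))) \<le> 4 / h * (norm (s - s0))\<^sup>2"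
    "norm (thA1 s - thA1 s0) \<le> 4 / h * norm (s - s0)"
proof -
  define S where "S = {s. - 1 \<le> Re s} \<inter> {s. Re s \<le> 2} \<inter> {s. h \<le> Im s}"
  have conv: "convex S" unfolding S_def
    by (intro convex_Int convex_halfspace_Re_ge convex_halfspace_Re_le convex_halfspace_Im_ge)
  have B: "norm (thA2 x) \<le> 4 / h" if "x \<in> S" for x
  proof -
    have "norm (thA2 x) \<le> 4 / Im x" using that h by (intro norm_thA2_le) (auto simp: S_def)
    also have "\<dots> \<le> 4 / h" using that h by (intro divide_left_mono) (auto simp: S_def)
    finally show ?thesis .
  qed
  have pos: "0 < Im x" if "x \<in> S" for x using that h by (auto simp: S_def)
  have sS: "s0 \<in> S" "s \<in> S" using s s0 by (auto simp: S_def)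
  define f where "f i = (if i = 0 then thA else if i = 1 then thA1 else thA2)" for i :: nat
  have df: "(f i has_field_derivative f (Suc i) x) (at x within S)" if "x \<in> S" "i \<le> 1" for i x
    using that thA_deriv[OF pos[OF that(1)]] by (cases "i = 0") (auto simp: f_def)
  have "norm (f 0 s - (\<Sum>i\<le>1. f i s0 * (s - s0)^i / fact i)) \<le> 4 / h * norm (s - s0) ^ (Suc 1) / fact 1"
    by (rule complex_Taylor[where f = f and n = 1 and B = "4 / h", OF conv df]) (use B sS in \<open>auto simp: f_def\<close>)
  then show "norm (thA s - (thA s0 + thA1 s0 * (s - s0))) \<le> 4 / h * (norm (s - s0))\<^sup>2" by (simp add: f_def numeral_2_eq_2)
  define g where "g i = (if i = 0 then thA1 else thA2)" for i :: nat
  have dg: "(g i has_field_derivative g (Suc i) x) (at x within S)" if "x \<in> S" "i \<le> 0" for i x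
    using that thA_deriv[OF pos[OF that(1)]] by (auto simp: g_def)
  have "norm (g 0 s - (\<Sum>i\<le>0. g i s0 * (s - s0)^i / fact i)) \<le> 4 / h * norm (s - s0) ^ (Suc 0) / fact 0"
    by (rule complex_Taylor[where f = g and n = 0 and B = "4 / h", OF conv dg]) (use B sS in \<open>auto simp: g_def\<close>)
  then show "norm (thA1 s - thA1 s0) \<le> 4 / h * norm (s - s0)" by (simp add: g_def)
qed

lemma thA_reflect:
  assumes "0 < Im s"
  shows "thA (1 - cnj s) = - cnj (thA s)"
proof -
  have "(1 - (1 - cnj s)) / 2 = cnj (s / 2)" "(1 - cnj s) / 2 = cnj ((1 - s) / 2)" by simp_all
  then have "ln_Gamma ((1 - (1 - cnj s)) / 2) = cnj (ln_Gamma (s / 2))" "ln_Gamma ((1 - cnj s) / 2) = cnj (ln_Gamma ((1 - s) / 2))"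
    using cnj_ln_Gamma[of "s / 2"] cnj_ln_Gamma[of "(1 - s) / 2"] assms by (simp_all only: Im_divide_numeral) auto
  then show ?thesis unfolding thA_def by (simp add: field_simps)
qed

lemma thA_critical:
  assumes "0 < t"
  shows "thA (Complex (1/2) t) = \<i> * of_real (theta t)"
proof -
  let ?s = "Complex (1/2) t"
  have e: "?s / 2 = Complex (1/4) (t/2)" "(1 - ?s) / 2 = cnj (Complex (1/4) (t/2))" by (auto simp: complex_eq_iff)
  have "ln_Gamma ((1 - ?s) / 2) = cnj (ln_Gamma (Complex (1/4) (t/2)))"
    unfolding e using assms by (intro cnj_ln_Gamma) auto
  then show ?thesis unfolding thA_def e(1) theta_def by (simp add: complex_eq_iff)
qed

text \<open>The derivative of \<open>theta\<close>. On the critical line \<open>thA1\<close> is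
  real, as \<open>theta_deriv\<close> shows, so the real part is its full value.\<close>

definition theta1 :: "real \<Rightarrow> real" where "theta1 t = Re (thA1 (Complex (1/2) t))"

lemma theta_deriv:
  assumes "0 < t"
  shows "(theta has_real_derivative theta1 t) (at t)" "thA1 (Complex (1/2) t) = of_real (theta1 t)"
proof -
  have c: "Complex (1/2) u = 1 / 2 + \<i> * of_real u" for u by (simp add: complex_eq_iff)
  have "(thA \<circ> (\<lambda>z. 1 / 2 + \<i> * z) has_field_derivative thA1 (1 / 2 + \<i> * of_real t) * \<i>) (at (of_real t))"
    by (rule DERIV_chain, rule thA_deriv) (use assms in \<open>auto intro!: derivative_eq_intros\<close>)
  from has_vector_derivative_real_field[OF this, of UNIV]
  have V: "((\<lambda>u. thA (Complex (1/2) u)) has_vector_derivative thA1 (Complex (1/2) t) * \<i>) (at t)"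
    by (simp add: o_def c)
  have ev: "eventually (\<lambda>u. 0 < u) (nhds t)" using eventually_nhds_in_open[of "{0<..}" t] assms by simp
  have "((\<lambda>u. Im (thA (Complex (1/2) u))) has_real_derivative Im (thA1 (Complex (1/2) t) * \<i>)) (at t)"
    using bounded_linear.has_vector_derivative[OF bounded_linear_Im V] by (simp add: has_real_derivative_iff_has_vector_derivative)
  moreover have "eventually (\<lambda>u. Im (thA (Complex (1/2) u)) = theta u) (nhds t)"
    using ev by eventually_elim (simp add: thA_critical)
  ultimately show "(theta has_real_derivative theta1 t) (at t)"
    by (subst DERIV_cong_ev[OF refl _ refl, of _ "\<lambda>u. Im (thA (Complex (1/2) u))" t]) (auto simp: theta1_def elim: eventually_mono)
  \<comment> \<open>The real part of \<open>thA\<close> vanishes along the critical line, hence so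
    does its derivative: this is what makes \<open>thA1\<close> real there.\<close>
  have "((\<lambda>u. Re (thA (Complex (1/2) u))) has_real_derivative Re (thA1 (Complex (1/2) t) * \<i>)) (at t)"
    using bounded_linear.has_vector_derivative[OF bounded_linear_Re V] by (simp add: has_real_derivative_iff_has_vector_derivative)
  moreover have "eventually (\<lambda>u. Re (thA (Complex (1/2) u)) = 0) (nhds t)"
    using ev by eventually_elim (simp add: thA_critical)
  ultimately have "((\<lambda>u. 0) has_real_derivative Re (thA1 (Complex (1/2) t) * \<i>)) (at t)"
    by (subst (asm) DERIV_cong_ev[OF refl _ refl, of _ "\<lambda>u. 0" t]) auto
  then have "Re (thA1 (Complex (1/2) t) * \<i>) = 0" using DERIV_unique[OF _ DERIV_const] by blast
  then show "thA1 (Complex (1/2) t) = of_real (theta1 t)" by (simp add: theta1_def complex_eq_iff)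
qed

text \<open>The leading terms 1/z and 1/cnj z of the two trigamma values differ by an imaginary
  number of size about 4/t, which contributes 1/(2 t) after division by 8; the remainders are
  O(1/t^2) by \<open>trigamma_bounds\<close>.\<close>

lemma theta1_deriv:
  assumes "4 \<le> t"
  obtains d where "(theta1 has_real_derivative d) (at t)" "\<bar>d - 1 / (2 * t)\<bar> \<le> 9 / t\<^sup>2"
proof -
  let ?s = "Complex (1/2) t"
  define z where "z = Complex (1/4) (t/2)"
  have e: "?s / 2 = z" "(1 - ?s) / 2 = cnj z" by (auto simp: complex_eq_iff z_def)
  have c: "Complex (1/2) u = 1 / 2 + \<i> * of_real u" for u by (simp add: complex_eq_iff)
  have "(thA1 \<circ> (\<lambda>z. 1 / 2 + \<i> * z) has_field_derivative thA2 (1 / 2 + \<i> * of_real t) * \<i>) (at (of_real t))"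
    by (rule DERIV_chain, rule thA_deriv) (use assms in \<open>auto intro!: derivative_eq_intros\<close>)
  from has_vector_derivative_real_field[OF this, of UNIV]
  have V: "((\<lambda>u. thA1 (Complex (1/2) u)) has_vector_derivative thA2 ?s * \<i>) (at t)"
    by (simp add: o_def c)
  have D: "(theta1 has_real_derivative Re (thA2 ?s * \<i>)) (at t)"
    using bounded_linear.has_vector_derivative[OF bounded_linear_Re V] unfolding theta1_def [abs_def] by (simp add: has_real_derivative_iff_has_vector_derivative)
  have z: "1 / z - 1 / cnj z = - \<i> * of_real (t / (1 / 16 + t\<^sup>2 / 4))"
  proof -
    have zz: "z * cnj z = of_real (1 / 16 + t\<^sup>2 / 4)" "cnj z - z = - \<i> * of_real t"
      by (auto simp: z_def complex_eq_iff power2_eq_square)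
    have "z \<noteq> 0" "cnj z \<noteq> 0" using assms by (auto simp: z_def complex_eq_iff)
    then have "1 / z - 1 / cnj z = (cnj z - z) / (z * cnj z)" by (simp add: diff_divide_eq_iff divide_diff_eq_iff)
    then show ?thesis unfolding zz by simp
  qed
  define E where "E = (Polygamma 1 z - 1 / z) / 8 - (Polygamma 1 (cnj z) - 1 / cnj z) / 8"
  have "norm E \<le> (8 / (Im z)\<^sup>2) / 8 + (8 / (Im (cnj z))\<^sup>2) / 8"
    unfolding E_def by (rule order_trans[OF norm_triangle_ineq4], unfold norm_divide norm_numeral)
      (use assms in \<open>intro add_mono divide_right_mono trigamma_bounds, auto simp: z_def\<close>)
  also have "\<dots> = 8 / t\<^sup>2" by (simp add: z_def power2_eq_square)
  finally have E: "norm E \<le> 8 / t\<^sup>2" .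
  have "thA2 ?s = E + (1 / z - 1 / cnj z) / 8" unfolding thA2_def e E_def by (simp add: field_simps)
  then have "Re (thA2 ?s * \<i>) = - Im E + (t / (1 / 16 + t\<^sup>2 / 4)) / 8" unfolding z by simp
  moreover have "\<bar>(t / (1 / 16 + t\<^sup>2 / 4)) / 8 - 1 / (2 * t)\<bar> \<le> 1 / t\<^sup>2"
  proof -
    have "(t / (1 / 16 + t\<^sup>2 / 4)) / 8 = 2 * t / (1 + 4 * t\<^sup>2)"
    proof -
      define D where "D = 1 + 4 * t\<^sup>2"
      have e: "1 / 16 + t\<^sup>2 / 4 = D / 16" by (simp add: D_def)
      show ?thesis unfolding e D_def[symmetric] by simp
    qed
    also have "2 * t / (1 + 4 * t\<^sup>2) - 1 / (2 * t) = - 1 / (2 * t * (1 + 4 * t\<^sup>2))"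
    proof -
      have "1 + 4 * t\<^sup>2 \<noteq> 0" by (metis add_nonneg_pos not_less_iff_gr_or_eq zero_le_numeral zero_le_power2 zero_less_one add.commute mult_nonneg_nonneg)
      then show ?thesis using assms by (simp add: field_simps power2_eq_square)
    qed
    finally have "\<bar>(t / (1 / 16 + t\<^sup>2 / 4)) / 8 - 1 / (2 * t)\<bar> = 1 / (2 * t * (1 + 4 * t\<^sup>2))"
      using assms by (simp add: abs_divide abs_mult)
    also have "\<dots> \<le> 1 / t\<^sup>2"
    proof (rule divide_left_mono)
      have "1 * t\<^sup>2 \<le> (2 * t) * (1 + 4 * t\<^sup>2)" using assms by (intro mult_mono) auto
      then show "t\<^sup>2 \<le> 2 * t * (1 + 4 * t\<^sup>2)" by simp
      show "0 < 2 * t * (1 + 4 * t\<^sup>2) * t\<^sup>2" using assms by (intro mult_pos_pos add_pos_nonneg) auto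
    qed simp
    finally show ?thesis .
  qed
  moreover have "\<bar>Im E\<bar> \<le> 8 / t\<^sup>2" using E abs_Im_le_cmod[of E] by linarith
  ultimately have "\<bar>Re (thA2 ?s * \<i>) - 1 / (2 * t)\<bar> \<le> 8 / t\<^sup>2 + 1 / t\<^sup>2" by linarith
  then have "\<bar>Re (thA2 ?s * \<i>) - 1 / (2 * t)\<bar> \<le> 9 / t\<^sup>2" by (simp flip: add_divide_distrib)
  with D show ?thesis by (rule that)
qed

text \<open>A bounded error serves the purpose, which is that exp (\<open>theta1 T\<close>) has the
  order of T^(1/2). It results from integrating the derivative: \<open>g t + 9 / t\<close> decreases
  and \<open>g t - 9 / t\<close> increases.\<close>

lemma theta1_asymp:
  obtains C where "0 \<le> C" "\<And>t. 4 \<le> t \<Longrightarrow> \<bar>theta1 t - ln t / 2\<bar> \<le> C"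
proof -
  define g where "g t = theta1 t - ln t / 2" for t
  have g: "\<exists>d. (g has_real_derivative d) (at t) \<and> \<bar>d\<bar> \<le> 9 / t\<^sup>2" if t: "4 \<le> t" for t
  proof -
    obtain d where d: "(theta1 has_real_derivative d) (at t)" "\<bar>d - 1 / (2 * t)\<bar> \<le> 9 / t\<^sup>2" using theta1_deriv[OF t] .
    have "(g has_real_derivative (d - 1 / (2 * t))) (at t)"
      unfolding g_def using d(1) t by (auto intro!: derivative_eq_intros)
    with d(2) show ?thesis by blast
  qed
  have iv: "((\<lambda>t. 9 / t) has_real_derivative - (9 / t\<^sup>2)) (at t)" if "4 \<le> t" for t :: real
    using that by (auto intro!: derivative_eq_intros simp: power2_eq_square)
  have up: "g t + 9 / t \<le> g 4 + 9 / 4" if "4 \<le> t" for t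
  proof (rule DERIV_nonpos_imp_nonincreasing[of 4 t "\<lambda>t. g t + 9 / t"])
    fix x :: real assume "4 \<le> x" "x \<le> t"
    then obtain d where "(g has_real_derivative d) (at x)" "\<bar>d\<bar> \<le> 9 / x\<^sup>2" using g by blast
    then show "\<exists>y. ((\<lambda>t. g t + 9 / t) has_real_derivative y) (at x) \<and> y \<le> 0"
      using DERIV_add[OF _ iv[OF \<open>4 \<le> x\<close>]] by (intro exI[of _ "d + - (9 / x\<^sup>2)"]) auto
  qed (use that in auto)
  have lo: "g 4 - 9 / 4 \<le> g t - 9 / t" if "4 \<le> t" for t
  proof (rule DERIV_nonneg_imp_nondecreasing[of 4 t "\<lambda>t. g t - 9 / t"])
    fix x :: real assume "4 \<le> x" "x \<le> t"
    then obtain d where "(g has_real_derivative d) (at x)" "\<bar>d\<bar> \<le> 9 / x\<^sup>2" using g by blast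
    then show "\<exists>y. ((\<lambda>t. g t - 9 / t) has_real_derivative y) (at x) \<and> 0 \<le> y"
      using DERIV_diff[OF _ iv[OF \<open>4 \<le> x\<close>]] by (intro exI[of _ "d - - (9 / x\<^sup>2)"]) auto
  qed (use that in auto)
  have "\<bar>theta1 t - ln t / 2\<bar> \<le> \<bar>g 4\<bar> + 9 / 4" if "4 \<le> t" for t
  proof -
    have "0 \<le> 9 / t" using that by simp
    then show ?thesis using up[OF that] lo[OF that] unfolding g_def[of t, symmetric] by linarith
  qed
  then show ?thesis by (intro that[of "\<bar>g 4\<bar> + 9 / 4"]) auto
qed

section \<open>Dirichlet polynomials, and the growth of zeta on and to the right of the critical
  line\<close>

lemma abel_interval:
  fixes y :: "nat \<Rightarrow> complex" and w :: "nat \<Rightarrow> real"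
  assumes part: "\<And>k. a \<le> k \<Longrightarrow> k \<le> b \<Longrightarrow> norm (\<Sum>n=a..<k. y n) \<le> B" and B: "0 \<le> B"
    and mono: "(\<forall>n. a \<le> n \<longrightarrow> Suc n < b \<longrightarrow> w n \<le> w (Suc n)) \<or> (\<forall>n. a \<le> n \<longrightarrow> Suc n < b \<longrightarrow> w (Suc n) \<le> w n)"
    and bnd: "\<And>n. a \<le> n \<Longrightarrow> n < b \<Longrightarrow> 0 \<le> w n \<and> w n \<le> C" and C: "0 \<le> C"
  shows "norm (\<Sum>n=a..<b. of_real (w n) * y n) \<le> 2 * C * B"
proof (cases "a \<le> b")
  case True
  have sh: "(\<Sum>n=a..<a+k. f n) = (\<Sum>n<k. f (a + n))" for f :: "nat \<Rightarrow> complex" and k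
    by (rule sum.reindex_bij_witness[of _ "\<lambda>n. a + n" "\<lambda>n. n - a"]) auto
  obtain K where K: "b = a + K" using True le_Suc_ex by blast
  have "norm (\<Sum>n<K. of_real (w (a + n)) * y (a + n)) \<le> 2 * C * B"
  proof (rule abel_summation_bound)
    fix k assume "k \<le> K"
    then show "norm (\<Sum>n<k. y (a + n)) \<le> B" using part[of "a + k"] K by (simp add: sh)
  next
    show "(\<forall>n. Suc n < K \<longrightarrow> w (a + n) \<le> w (a + Suc n)) \<or> (\<forall>n. Suc n < K \<longrightarrow> w (a + Suc n) \<le> w (a + n))"
      using mono K by auto
  qed (use bnd K C in auto)
  then show ?thesis unfolding K sh .
qed (use B C in auto)

lemma cis_log_sum_trivial: "norm (\<Sum>n=a..<b. cis (f n)) \<le> real (b - a)"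
  using sum_norm_le[of "{a..<b}" "\<lambda>n. cis (f n)" "\<lambda>_. 1"] by simp

text \<open>The square should be of order M t^(1/3), so that division by sqrt M later leaves
  t^(1/6). With c = t^(1/3), the trivial bound suffices up to M = c, the third derivative test from
  c to c^2, and the second derivative test from c^2 on; the M/t of the latter takes over beyond
  t^(4/3).\<close>

lemma cis_log_block:
  fixes t M :: real and a b :: nat
  assumes t: "1 \<le> t" and M: "1 \<le> M" "M \<le> a" "b \<le> 2 * M"
  shows "(norm (\<Sum>n=a..<b. cis (- t * ln n)))\<^sup>2 \<le> 4000 * (M * (t powr (1/3) + M / t)) * (1 + ln M)"
proof -
  define c where "c = t powr (1/3)"
  have c: "1 \<le> c" "c^3 = t" using t by (auto simp: c_def ge_one_powr_ge_zero powr_powr powr_realpow[symmetric])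
  have lnM: "0 \<le> ln M" using M by simp
  have base: "M * c * 4000 \<le> 4000 * (M * (c + M / t))" using M t by (simp add: algebra_simps)
  have ba: "real (b - a) \<le> M" using M by (cases "a \<le> b") (auto simp: of_nat_diff)
  consider "M \<le> c" | "c \<le> M" "M \<le> c\<^sup>2" | "c\<^sup>2 \<le> M" by linarith
  then show ?thesis
  proof cases
    case 1
    have "(norm (\<Sum>n=a..<b. cis (- t * ln n)))\<^sup>2 \<le> M\<^sup>2"
      using cis_log_sum_trivial[of "\<lambda>n. - t * ln n" a b] ba by (intro power_mono) auto
    also have "\<dots> \<le> M * c * 4000" using 1 M by (simp add: power2_eq_square mult_left_mono)
    also have "\<dots> \<le> 4000 * (M * (c + M / t)) * 1" using base by simp
    also have "\<dots> \<le> 4000 * (M * (c + M / t)) * (1 + ln M)" using M c t lnM by (intro mult_left_mono) auto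
    finally show ?thesis by (simp add: c_def)
  next
    case 2
    \<comment> \<open>With q about M/c the ratio q t/M^3 is about (c/M)^2, and all four terms of the
      third derivative test become O(M c).\<close>
    define q where "q = nat \<lceil>M / c\<rceil>"
    have y: "1 \<le> M / c" using 2 c by simp
    have q': "M / c \<le> real q" "real q \<le> 2 * (M / c)"
      using y unfolding q_def by linarith+
    have "real 1 \<le> real q" unfolding of_nat_1 using y q'(1) by (rule order_trans)
    then have "1 \<le> q" by (simp only: of_nat_le_iff)
    with q' have q: "M / c \<le> real q" "real q \<le> 2 * (M / c)" "1 \<le> q" by blast+
    have q0: "0 < real q" using q(3) by linarith
    have z0: "0 < q * t / M^3" by (intro divide_pos_pos mult_pos_pos q0) (use t M in auto)
    have "(norm (\<Sum>n=a..<b. cis (- t * ln n)))\<^sup>2 \<le>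
      400 * ((real q)\<^sup>2 + M\<^sup>2 / q + M\<^sup>2 * sqrt (q * t / M^3) + M / sqrt (q * t / M^3)) * (1 + ln M)"
      by (rule cis_log_block_third[OF _ M q(3) ba]) (use t in simp)
    also have "\<dots> \<le> 400 * (10 * (M * c)) * (1 + ln M)"
    proof (intro mult_right_mono mult_left_mono)
      have "(real q)\<^sup>2 \<le> (2 * (M / c))\<^sup>2" using q by (intro power_mono) auto
      also have "\<dots> = 4 * (M * M / c\<^sup>2)" by (simp add: power2_eq_square)
      also have "\<dots> \<le> 4 * (M * 1)"
        using 2 c M by (intro mult_left_mono) (auto simp: pos_divide_le_eq mult_left_mono)
      also have "\<dots> \<le> 4 * (M * c)" using c M by simp
      finally have 1: "(real q)\<^sup>2 \<le> 4 * (M * c)" .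
      have "M\<^sup>2 / q \<le> M\<^sup>2 / (M / c)"
      proof (rule divide_left_mono[OF q'(1)])
        show "0 < real q * (M / c)" using q0 M(1) c(1) by (intro mult_pos_pos divide_pos_pos) auto
      qed simp
      also have "\<dots> = M * c" using M c by (simp add: power2_eq_square)
      finally have 2: "M\<^sup>2 / q \<le> M * c" .
      have lo: "(c / M)\<^sup>2 \<le> q * t / M^3"
      proof -
        have "(c / M)\<^sup>2 = (M / c) * t / M^3" using M c by (simp add: c(2)[symmetric] power2_eq_square power3_eq_cube)
        also have "\<dots> \<le> q * t / M^3" using q t M by (intro divide_right_mono mult_right_mono) auto
        finally show ?thesis .
      qed
      have hi: "q * t / M^3 \<le> (2 * (c / M))\<^sup>2"
      proof -
        have "q * t / M^3 \<le> (2 * (M / c)) * t / M^3" using q t M by (intro divide_right_mono mult_right_mono) auto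
        also have "\<dots> = 2 * (c / M)\<^sup>2" using M c by (simp add: c(2)[symmetric] power2_eq_square power3_eq_cube)
        also have "\<dots> \<le> 4 * (c / M)\<^sup>2" by simp
        also have "\<dots> = (2 * (c / M))\<^sup>2" unfolding power_mult_distrib by simp
        finally show ?thesis .
      qed
      have s1: "c / M \<le> sqrt (q * t / M^3)" using lo M c by (intro real_le_rsqrt) auto
      have s2: "sqrt (q * t / M^3) \<le> 2 * (c / M)" using hi M c by (intro real_le_lsqrt) auto
      have "M\<^sup>2 * sqrt (q * t / M^3) \<le> M\<^sup>2 * (2 * (c / M))" using s2 by (intro mult_left_mono) auto
      also have "\<dots> = 2 * (M * c)" using M by (simp add: power2_eq_square)
      finally have 3: "M\<^sup>2 * sqrt (q * t / M^3) \<le> 2 * (M * c)" .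
      have "M / sqrt (q * t / M^3) \<le> M / (c / M)"
      proof (rule divide_left_mono[OF s1])
        show "0 < sqrt (q * t / M^3) * (c / M)" using z0 M c by (intro mult_pos_pos) auto
      qed (use M in auto)
      also have "\<dots> = M * (M / c)" using M c by simp
      also have "\<dots> \<le> M * c" using \<open>M \<le> c\<^sup>2\<close> M c by (intro mult_left_mono) (auto simp: pos_divide_le_eq power2_eq_square)
      finally have 4: "M / sqrt (q * t / M^3) \<le> M * c" .
      show "(real q)\<^sup>2 + M\<^sup>2 / q + M\<^sup>2 * sqrt (q * t / M^3) + M / sqrt (q * t / M^3) \<le> 10 * (M * c)"
        using 1 2 3 4 mult_nonneg_nonneg[of M c] M c by linarith
    qed (use lnM in auto)
    also have "\<dots> \<le> 4000 * (M * (c + M / t)) * (1 + ln M)" using base lnM by (intro mult_right_mono) auto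
    finally show ?thesis by (simp add: c_def)
  next
    case 3
    have "(norm (\<Sum>n=a..<b. cis (- t * ln n)))\<^sup>2 \<le> 1200 * (t + M\<^sup>2 / t) * (1 + ln M)"
      using t M by (intro cis_log_block_second) auto
    also have "\<dots> \<le> 1200 * (M * (c + M / t)) * (1 + ln M)"
    proof (intro mult_right_mono mult_left_mono)
      have "t = c\<^sup>2 * c" using c by (simp add: power2_eq_square power3_eq_cube mult_ac)
      also have "\<dots> \<le> M * c" using 3 c by (intro mult_right_mono) auto
      finally show "t + M\<^sup>2 / t \<le> M * (c + M / t)" by (simp add: power2_eq_square algebra_simps)
    qed (use lnM in auto)
    also have "\<dots> \<le> 4000 * (M * (c + M / t)) * (1 + ln M)" using lnM M c t by (intro mult_right_mono) auto
    finally show ?thesis by (simp add: c_def)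
  qed
qed

text \<open>The term n^(-1/2 - i t), split into its real weight and its phase for partial
  summation.\<close>

definition dz :: "real \<Rightarrow> nat \<Rightarrow> complex" where
  "dz t n = of_real (1 / sqrt n) * cis (- t * ln n)"

lemma norm_dz_block:
  fixes M t X S :: real and a b :: nat
  assumes M: "0 < M" "M \<le> a" and ab: "a \<le> b"
    and S: "\<And>k. a \<le> k \<Longrightarrow> k \<le> b \<Longrightarrow> norm (\<Sum>n=a..<k. cis (- t * ln n)) \<le> S"
  shows "norm (\<Sum>n=a..<b. dz t n) \<le> 2 * (1 / sqrt M) * S"
  unfolding dz_def
proof (rule abel_interval[OF S])
  have apos: "0 < real a" using M by linarith
  have "1 / sqrt (Suc n) \<le> 1 / sqrt n" if "a \<le> n" for n
    using that apos by (intro divide_left_mono mult_pos_pos) auto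
  then show "(\<forall>n\<ge>a. Suc n < b \<longrightarrow> 1 / sqrt n \<le> 1 / sqrt (Suc n)) \<or> (\<forall>n\<ge>a. Suc n < b \<longrightarrow> 1 / sqrt (Suc n) \<le> 1 / sqrt n)"
    by blast
  show "0 \<le> 1 / sqrt n \<and> 1 / sqrt n \<le> 1 / sqrt M" if "a \<le> n" "n < b" for n
    using that M apos by (auto intro!: divide_left_mono mult_pos_pos)
  show "0 \<le> S" using S[of a] ab by simp
qed (use M in auto)

text \<open>Dyadic decomposition by induction on the number k of blocks. On each block the weight
  1/sqrt M cancels the factor M under the root, so that all blocks share one bound.\<close>

lemma norm_dz_partial:
  fixes t N :: real and K :: nat
  assumes t: "1 \<le> t" and N: "1 \<le> N" and b: "real b \<le> N" "b \<le> 2 ^ k"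
  shows "norm (\<Sum>n=1..<b. dz t n) \<le> real k * (130 * sqrt ((t powr (1/3) + N / t) * (1 + ln N)))"
  using b
proof (induction k arbitrary: b)
  case 0
  then have "{1..<b} = {}" by auto
  then show ?case by simp
next
  case (Suc k)
  define E where "E = 130 * sqrt ((t powr (1/3) + N / t) * (1 + ln N))"
  have E0: "0 \<le> E" using t N by (simp add: E_def)
  show ?case
  proof (cases "b \<le> 2 ^ k")
    case True
    then have "norm (\<Sum>n=1..<b. dz t n) \<le> real k * E" using Suc unfolding E_def by blast
    also have "\<dots> \<le> real (Suc k) * E" using E0 by (intro mult_right_mono) auto
    finally show ?thesis by (simp add: E_def)
  next
    case False
    define M :: real where "M = 2 ^ k"
    have M: "1 \<le> M" "M \<le> N" using False Suc.prems by (auto simp: M_def intro: order_trans[of _ "real b"] simp flip: of_nat_le_iff)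
    have "(\<Sum>n=1..<b. dz t n) = (\<Sum>n=1..<2^k. dz t n) + (\<Sum>n=2^k..<b. dz t n)"
      using False by (subst sum.atLeastLessThan_concat) auto
    also have "norm \<dots> \<le> norm (\<Sum>n=1..<2^k. dz t n) + norm (\<Sum>n=2^k..<b. dz t n)" by (rule norm_triangle_ineq)
    also have "norm (\<Sum>n=1..<2^k. dz t n) \<le> real k * E"
      unfolding E_def using M by (intro Suc.IH) (auto simp: M_def)
    also have "norm (\<Sum>n=2^k..<b. dz t n) \<le> 2 * (1 / sqrt M) * (sqrt (4000 * (M * (t powr (1/3) + N / t)) * (1 + ln N)))"
    proof (rule norm_dz_block)
      fix j assume j: "2 ^ k \<le> j" "j \<le> b"
      have "j \<le> 2 * 2 ^ k" using j Suc.prems by simp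
      then have "real j \<le> real (2 * 2 ^ k)" by (simp only: of_nat_le_iff)
      then have "real j \<le> 2 * M" by (simp add: M_def)
      then have "(norm (\<Sum>n=2^k..<j. cis (- t * ln n)))\<^sup>2 \<le> 4000 * (M * (t powr (1/3) + M / t)) * (1 + ln M)"
        using t M by (intro cis_log_block) (auto simp: M_def)
      also have "\<dots> \<le> 4000 * (M * (t powr (1/3) + N / t)) * (1 + ln N)"
        using t M by (intro mult_mono mult_left_mono add_mono divide_right_mono) auto
      finally show "norm (\<Sum>n=2^k..<j. cis (- t * ln n)) \<le> sqrt (4000 * (M * (t powr (1/3) + N / t)) * (1 + ln N))"
        by (rule real_le_rsqrt)
    qed (use M False in \<open>auto simp: M_def\<close>)
    also have "2 * (1 / sqrt M) * (sqrt (4000 * (M * (t powr (1/3) + N / t)) * (1 + ln N))) = 2 * sqrt 4000 * sqrt ((t powr (1/3) + N / t) * (1 + ln N))"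
      using M by (simp add: real_sqrt_mult)
    also have "\<dots> \<le> E"
    proof -
      have "sqrt 4000 \<le> (65::real)" by (rule real_le_lsqrt) auto
      then show ?thesis unfolding E_def using t N by (intro mult_right_mono) auto
    qed
    finally show ?thesis by (simp add: E_def algebra_simps)
  qed
qed

lemma of_nat_powr_eq_dz:
  assumes "0 < n"
  shows "of_nat n powr (- Complex \<sigma> t) = of_real (n powr (1/2 - \<sigma>)) * dz t n"
proof -
  have "of_nat n powr (- Complex \<sigma> t) = exp (- Complex \<sigma> t * of_real (ln n))"
    using assms by (simp add: powr_def Ln_of_nat)
  also have "- Complex \<sigma> t * of_real (ln n) = of_real (- \<sigma> * ln n) + \<i> * of_real (- t * ln n)"
    by (simp add: complex_eq_iff)
  also have "exp \<dots> = of_real (exp (- \<sigma> * ln n)) * cis (- t * ln n)"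
    by (simp only: exp_add cis_conv_exp exp_of_real)
  also have "exp (- \<sigma> * ln n) = n powr (1/2 - \<sigma>) * (1 / sqrt n)"
    using assms by (simp add: powr_def exp_diff exp_minus field_simps ln_sqrt[symmetric] flip: exp_add)
  finally show ?thesis by (simp add: dz_def)
qed

lemma one_plus_ln_le:
  fixes x \<delta> :: real
  assumes "1 \<le> x" "0 < \<delta>"
  shows "1 + ln x \<le> (1 + 1 / \<delta>) * x powr \<delta>"
proof -
  have "1 \<le> x powr \<delta>" using assms by (simp add: ge_one_powr_ge_zero)
  moreover have "ln x \<le> x powr \<delta> / \<delta>" using ln_powr_bound[OF assms] .
  ultimately show ?thesis by (simp add: algebra_simps)
qed

text \<open>At length T^(4/3 + \<epsilon>) the term N/t matches t^(1/3) up to T^\<epsilon>. Under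
  the root this costs \<epsilon>/2 in the exponent and the logarithm \<epsilon>/32; the number of
  blocks costs \<epsilon>/16. The sum, 19\<epsilon>/32, is below 5\<epsilon>/8.\<close>

lemma norm_dz_partial_le:
  fixes \<epsilon> :: real
  assumes \<epsilon>: "0 < \<epsilon>" "\<epsilon> \<le> 1 / 100"
  obtains C where "0 < C" "\<And>T t b. 4 \<le> T \<Longrightarrow> T / 2 \<le> t \<Longrightarrow> t \<le> 2 * T \<Longrightarrow> real b \<le> 2 * T powr (4/3 + \<epsilon>) \<Longrightarrow>
    norm (\<Sum>n=1..<b. dz t n) \<le> C * T powr (1/6 + 5 * \<epsilon> / 8)"
proof -
  \<comment> \<open>The constant in 1 + ln T <= K T^(\<epsilon>/16), used both for the number of
    blocks and for the logarithm in the block bound.\<close>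
  define K where "K = 1 + 16 / \<epsilon>"
  have K: "1 \<le> K" using \<epsilon> by (simp add: K_def)
  define C where "C = (6 * K) * (130 * sqrt (6 * (3 * K)))"
  have C: "0 < C" using K by (simp add: C_def)
  have main: "norm (\<Sum>n=1..<b. dz t n) \<le> C * T powr (1/6 + 5 * \<epsilon> / 8)"
    if T: "4 \<le> T" and t: "T / 2 \<le> t" "t \<le> 2 * T" and b: "real b \<le> 2 * T powr (4/3 + \<epsilon>)" for T t b
  proof -
    define N where "N = 2 * T powr (4/3 + \<epsilon>)"
    have Tp: "1 \<le> T powr p" if "0 \<le> p" for p using T that by (simp add: ge_one_powr_ge_zero)
    have N1: "1 \<le> N" using Tp[of "4/3 + \<epsilon>"] \<epsilon> by (simp add: N_def)
    \<comment> \<open>A crude power bound, enough to compare ln N with ln T.\<close>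
    have N3: "N \<le> T powr 3"
    proof -
      have "N \<le> T powr 1 * T powr (4/3 + \<epsilon>)" using T unfolding N_def by (intro mult_right_mono) auto
      also have "\<dots> = T powr (1 + (4/3 + \<epsilon>))" by (rule powr_add[symmetric])
      also have "\<dots> \<le> T powr 3" using T \<epsilon> by (intro powr_mono) auto
      finally show ?thesis .
    qed
    have "ln N \<le> ln (T powr 3)" using N1 N3 by (intro ln_mono) auto
    then have lnN: "ln N \<le> 3 * ln T" using T by (subst (asm) ln_powr) auto
    have lT: "0 \<le> ln T" using T by simp
    have L: "1 + ln T \<le> K * T powr (\<epsilon> / 16)"
      unfolding K_def using one_plus_ln_le[of T "\<epsilon> / 16"] T \<epsilon> by simp
    define k where "k = nat \<lceil>log 2 N\<rceil>"
    have lg0: "0 \<le> log 2 N" using N1 by simp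
    have "N = 2 powr (log 2 N)" using N1 by simp
    also have "\<dots> \<le> 2 powr k" using lg0 unfolding k_def by (intro powr_mono) auto
    also have "\<dots> = real (2 ^ k)" by (simp add: powr_realpow)
    finally have "N \<le> real (2 ^ k)" .
    then have "real b \<le> real (2 ^ k)" using b unfolding N_def by (rule order_trans[rotated])
    then have bk: "b \<le> 2 ^ k" by (simp only: of_nat_le_iff)
    have "log 2 N \<le> 2 * ln N"
    proof -
      have "1 / 2 \<le> ln (2::real)" using ln_2_less_1 ln2_ge_two_thirds by linarith
      then have "ln N * 1 \<le> ln N * (2 * ln 2)" using N1 by (intro mult_left_mono) auto
      then show ?thesis by (simp add: log_def divide_simps)
    qed
    then have "real k \<le> 6 * ln T + 1" using lg0 lnN unfolding k_def by linarith
    also have "\<dots> \<le> 6 * (1 + ln T)" by simp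
    also have "\<dots> \<le> 6 * (K * T powr (\<epsilon> / 16))" using L by simp
    finally have k: "real k \<le> 6 * K * T powr (\<epsilon> / 16)" by simp
    have "norm (\<Sum>n=1..<b. dz t n) \<le> real k * (130 * sqrt ((t powr (1/3) + N / t) * (1 + ln N)))"
      using t T N1 b bk by (intro norm_dz_partial) (auto simp: N_def)
    also have "\<dots> \<le> (6 * K * T powr (\<epsilon> / 16)) * (130 * sqrt (6 * T powr (1/3 + \<epsilon>) * (3 * K * T powr (\<epsilon> / 16))))"
    proof (intro mult_mono k mult_left_mono real_sqrt_le_mono)
      have "t powr (1/3) \<le> (2 * T) powr (1/3)" using t T by (intro powr_mono2) auto
      also have "\<dots> = 2 powr (1/3) * T powr (1/3)" using T by (simp add: powr_mult)
      also have "\<dots> \<le> 2 powr 1 * T powr (1/3 + \<epsilon>)" using T \<epsilon> by (intro mult_mono powr_mono) auto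
      finally have 1: "t powr (1/3) \<le> 2 * T powr (1/3 + \<epsilon>)" by simp
      have "N / t \<le> N / (T / 2)" using t T N1 by (intro divide_left_mono mult_pos_pos) auto
      also have "\<dots> = 4 * (T powr (4/3 + \<epsilon>) / T powr 1)" using T by (simp add: N_def)
      also have "T powr (4/3 + \<epsilon>) / T powr 1 = T powr (4/3 + \<epsilon> - 1)" by (rule powr_diff[symmetric])
      also have "4/3 + \<epsilon> - 1 = 1/3 + \<epsilon>" by simp
      finally show "t powr (1/3) + N / t \<le> 6 * T powr (1/3 + \<epsilon>)" using 1 by simp
      show "1 + ln N \<le> 3 * K * T powr (\<epsilon> / 16)" using lnN L by simp
    qed (use N1 t T K in auto)
    also have "sqrt (6 * T powr (1/3 + \<epsilon>) * (3 * K * T powr (\<epsilon> / 16))) = sqrt (6 * (3 * K)) * T powr (1/6 + \<epsilon>/2 + \<epsilon>/32)"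
    proof -
      have "6 * T powr (1/3 + \<epsilon>) * (3 * K * T powr (\<epsilon> / 16)) = (6 * (3 * K)) * (T powr (1/6 + \<epsilon>/2 + \<epsilon>/32))\<^sup>2"
        using T by (simp add: power2_eq_square flip: powr_add)
      then show ?thesis by (simp only: real_sqrt_mult real_sqrt_abs) simp
    qed
    also have "(6 * K * T powr (\<epsilon> / 16)) * (130 * (sqrt (6 * (3 * K)) * T powr (1/6 + \<epsilon>/2 + \<epsilon>/32))) =
        C * T powr (\<epsilon> / 16 + (1/6 + \<epsilon>/2 + \<epsilon>/32))"
      unfolding C_def powr_add by simp
    also have "\<dots> \<le> C * T powr (1/6 + 5 * \<epsilon> / 8)" using C T \<epsilon> by (intro mult_left_mono powr_mono) auto
    finally show ?thesis .
  qed
  show ?thesis by (rule that[OF C main])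
qed

text \<open>For N = T^(4/3 + \<epsilon>) the remainder T^2 N^(-3/2) is T^(-3\<epsilon>/2), and the
  boundary terms N^(-1/2) and N^(1/2)/T are no larger for small \<epsilon>. Multiplied by a length
  T^(1/6 + 2\<epsilon>) this leaves \<epsilon>/2 above 1/6 in the exponent.\<close>

lemma zeta_error_le:
  fixes T \<epsilon> :: real and s :: complex
  assumes \<epsilon>: "0 < \<epsilon>" "\<epsilon> \<le> 1 / 100" and T: "4 \<le> T" and s: "1 / 2 \<le> Re s" "Re s \<le> 2" "T / 2 \<le> Im s" "Im s \<le> 2 * T"
    and N: "N = nat \<lceil>T powr (4/3 + \<epsilon>)\<rceil>"
  shows "norm (zeta s - (\<Sum>n=1..<N. of_nat n powr (- s))) \<le> 20 * T powr (- (3/2) * \<epsilon>)"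
    "real N \<le> 2 * T powr (4/3 + \<epsilon>)"
proof -
  define L where "L = T powr (4/3 + \<epsilon>)"
  have L1: "1 \<le> L" using T \<epsilon> by (simp add: L_def ge_one_powr_ge_zero)
  have NL: "L \<le> real N" "real N \<le> 2 * L" "1 \<le> N" using L1 unfolding N L_def[symmetric] by linarith+
  then show "real N \<le> 2 * T powr (4/3 + \<epsilon>)" by (simp add: L_def)
  have s1: "s \<noteq> 1" using s T by auto
  define A where "A = (\<Sum>n=1..<N. of_nat n powr (- s))"
  define D where "D = of_nat N powr (- s) / 2 + of_nat N powr (1 - s) / (s - 1)"
  have "norm (zeta1 s - (A + of_nat N powr (- s) / 2 + of_nat N powr (1 - s) / (s - 1))) \<le> norm s * norm (s + 1) * real N powr (- Re s - 1)"
    unfolding A_def using zeta1_approx[OF s1 _ NL(3)] s by simp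
  moreover have "zeta s = zeta1 s" using s s1 by (intro zeta_eq_zeta1) auto
  ultimately have "norm (zeta s - A - D) \<le> norm s * norm (s + 1) * real N powr (- Re s - 1)"
    unfolding D_def by (simp add: algebra_simps)
  also have "\<dots> \<le> (3 * T) * (4 * T) * L powr (- (3/2))"
  proof (intro mult_mono)
    have "norm s \<le> \<bar>Re s\<bar> + \<bar>Im s\<bar>" by (rule cmod_le)
    then show "norm s \<le> 3 * T" using s T by linarith
    have "norm (s + 1) \<le> \<bar>Re (s + 1)\<bar> + \<bar>Im (s + 1)\<bar>" by (rule cmod_le)
    then show "norm (s + 1) \<le> 4 * T" using s T by simp
    have "real N powr (- Re s - 1) \<le> real N powr (- (3/2))" using NL s by (intro powr_mono) auto
    also have "\<dots> \<le> L powr (- (3/2))" using NL L1 by (intro powr_mono2') auto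
    finally show "real N powr (- Re s - 1) \<le> L powr (- (3/2))" .
  qed (use T in auto)
  also have "\<dots> = 12 * (T powr 2 * L powr (- (3/2)))" using T by (simp add: powr_numeral power2_eq_square)
  also have "T powr 2 * L powr (- (3/2)) = T powr (- (3/2) * \<epsilon>)"
    unfolding L_def powr_powr powr_add[symmetric] by (simp add: algebra_simps)
  finally have 1: "norm (zeta s - A - D) \<le> 12 * T powr (- (3/2) * \<epsilon>)" .
  have "norm D \<le> norm (of_nat N powr (- s) / 2) + norm (of_nat N powr (1 - s) / (s - 1))"
    unfolding D_def by (rule norm_triangle_ineq)
  also have "norm (of_nat N powr (- s) / 2) = real N powr (- Re s) / 2" using NL
    by (simp add: norm_divide norm_powr_real_powr)
  also have "\<dots> \<le> L powr (- (1/2))"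
  proof -
    have "real N powr (- Re s) \<le> real N powr (- (1/2))" using NL s by (intro powr_mono) auto
    also have "\<dots> \<le> L powr (- (1/2))" using NL L1 by (intro powr_mono2') auto
    finally show ?thesis using powr_ge_zero[of L "- (1/2)"] by linarith
  qed
  also have "\<dots> \<le> T powr (- (3/2) * \<epsilon>)" unfolding L_def powr_powr using T \<epsilon> by (intro powr_mono) auto
  also have "norm (of_nat N powr (1 - s) / (s - 1)) \<le> 4 * T powr (- (3/2) * \<epsilon>)"
  proof -
    have "T / 2 \<le> norm (s - 1)" using abs_Im_le_cmod[of "s - 1"] s by simp
    moreover have "norm (of_nat N powr (1 - s)) \<le> (2 * L) powr (1/2)"
    proof -
      have "norm (of_nat N powr (1 - s)) = real N powr (1 - Re s)" using NL by (simp add: norm_powr_real_powr)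
      also have "\<dots> \<le> real N powr (1/2)" using NL s by (intro powr_mono) auto
      also have "\<dots> \<le> (2 * L) powr (1/2)" using NL by (intro powr_mono2) auto
      finally show ?thesis .
    qed
    ultimately have "norm (of_nat N powr (1 - s) / (s - 1)) \<le> (2 * L) powr (1/2) / (T / 2)"
      unfolding norm_divide using T by (intro frac_le) auto
    also have "(2 * L) powr (1/2) = 2 powr (1/2) * L powr (1/2)" using L1 by (simp add: powr_mult)
    also have "\<dots> \<le> 2 powr 1 * L powr (1/2)" by (intro mult_right_mono powr_mono) auto
    also have "2 powr 1 * L powr (1/2) / (T / 2) = 4 * (T powr ((4/3 + \<epsilon>) * (1/2)) / T powr 1)"
      using T unfolding L_def powr_powr by simp
    also have "\<dots> = 4 * T powr ((4/3 + \<epsilon>) * (1/2) - 1)" by (simp only: powr_diff)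
    also have "\<dots> \<le> 4 * T powr (- (3/2) * \<epsilon>)"
    proof -
      have "(4/3 + \<epsilon>) * (1/2) - 1 \<le> - (3/2) * \<epsilon>" using \<epsilon> by (simp add: field_simps)
      then show ?thesis using T by (intro mult_left_mono powr_mono) auto
    qed
    finally show ?thesis using T by (auto simp: divide_right_mono)
  qed
  finally have 2: "norm D \<le> 5 * T powr (- (3/2) * \<epsilon>)" by simp
  have "norm (zeta s - A) \<le> norm (zeta s - A - D) + norm D" by norm
  then show "norm (zeta s - A) \<le> 20 * T powr (- (3/2) * \<epsilon>)" using 1 2 powr_ge_zero[of T "- (3/2) * \<epsilon>"] by linarith
qed

text \<open>To the right of the critical line the extra factor n^(1/2 - Re s) is decreasing and at
  most 1, so partial summation transfers the critical-line bound.\<close>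

lemma zeta_growth:
  fixes \<epsilon> :: real
  assumes \<epsilon>: "0 < \<epsilon>" "\<epsilon> \<le> 1 / 100"
  obtains C where "0 < C" "\<And>T s. 4 \<le> T \<Longrightarrow> 1 / 2 \<le> Re s \<Longrightarrow> Re s \<le> 2 \<Longrightarrow> T / 2 \<le> Im s \<Longrightarrow> Im s \<le> 2 * T \<Longrightarrow>
    norm (zeta s) \<le> C * T powr (1/6 + 5 * \<epsilon> / 8)"
proof -
  obtain C where C: "0 < C" "\<And>T t b. 4 \<le> T \<Longrightarrow> T / 2 \<le> t \<Longrightarrow> t \<le> 2 * T \<Longrightarrow> real b \<le> 2 * T powr (4/3 + \<epsilon>) \<Longrightarrow>
    norm (\<Sum>n=1..<b. dz t n) \<le> C * T powr (1/6 + 5 * \<epsilon> / 8)" using norm_dz_partial_le[OF \<epsilon>] by blast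
  have "norm (zeta s) \<le> (2 * C + 20) * T powr (1/6 + 5 * \<epsilon> / 8)"
    if T: "4 \<le> T" and s: "1 / 2 \<le> Re s" "Re s \<le> 2" "T / 2 \<le> Im s" "Im s \<le> 2 * T" for T s
  proof -
    define N where "N = nat \<lceil>T powr (4/3 + \<epsilon>)\<rceil>"
    note err = zeta_error_le[OF \<epsilon> T s N_def]
    have "(\<Sum>n=1..<N. of_nat n powr (- s)) = (\<Sum>n=1..<N. of_real (n powr (1/2 - Re s)) * dz (Im s) n)"
      using of_nat_powr_eq_dz[of _ "Re s" "Im s"] by (intro sum.cong) auto
    also have "norm \<dots> \<le> 2 * 1 * (C * T powr (1/6 + 5 * \<epsilon> / 8))"
    proof (rule abel_interval)
      fix k assume "1 \<le> k" "k \<le> N"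
      then show "norm (\<Sum>n=1..<k. dz (Im s) n) \<le> C * T powr (1/6 + 5 * \<epsilon> / 8)"
        using C(2)[OF T s(3,4), of k] err(2) by (meson of_nat_le_iff order_trans)
    next
      have "real (Suc n) powr (1/2 - Re s) \<le> real n powr (1/2 - Re s)" if "1 \<le> n" for n
        using that s by (intro powr_mono2') auto
      then show "(\<forall>n\<ge>1. Suc n < N \<longrightarrow> n powr (1/2 - Re s) \<le> Suc n powr (1/2 - Re s)) \<or> (\<forall>n\<ge>1. Suc n < N \<longrightarrow> Suc n powr (1/2 - Re s) \<le> n powr (1/2 - Re s))"
        by blast
    next
      fix n assume "1 \<le> n" "n < N"
      then show "0 \<le> real n powr (1/2 - Re s) \<and> real n powr (1/2 - Re s) \<le> 1"
        using s powr_mono[of "1/2 - Re s" 0 "real n"] by simp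
    qed (use C in auto)
    finally have 1: "norm (\<Sum>n=1..<N. of_nat n powr (- s)) \<le> 2 * C * T powr (1/6 + 5 * \<epsilon> / 8)" by simp
    have "T powr (- (3/2) * \<epsilon>) \<le> T powr (1/6 + 5 * \<epsilon> / 8)" using T \<epsilon> by (intro powr_mono) auto
    moreover have "norm (zeta s) \<le> norm (zeta s - (\<Sum>n=1..<N. of_nat n powr (- s))) + norm (\<Sum>n=1..<N. of_nat n powr (- s))" by norm
    ultimately show ?thesis using err(1) 1 by (simp add: algebra_simps)
  qed
  then show ?thesis using C(1) by (intro that[of "2 * C + 20"]) auto
qed

text \<open>Near sqrt T a bound proportional to the length X is required, because such a block will
  carry a weight of order T^(1/2)/X. The third derivative test with q about T^(1/6 + 2\<epsilon>)
  makes X^2/q and X^2 sqrt (q t/M^3) at most X^2 T^(-1/6 + \<epsilon>), up to constants; the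
  remaining X / sqrt (q t/M^3) is dominated by this from X = T^(1/3 - 2\<epsilon>) on.\<close>

lemma norm_dz_near:
  fixes \<epsilon> c1 c2 :: real
  assumes \<epsilon>: "0 < \<epsilon>" "\<epsilon> \<le> 1 / 100" and c: "0 < c1" "1 \<le> c2"
  obtains C where "0 < C" "\<And>T t M X a b. 4 \<le> T \<Longrightarrow> T / 2 \<le> t \<Longrightarrow> t \<le> 2 * T \<Longrightarrow>
    c1 * T powr (1/2) \<le> M \<Longrightarrow> M \<le> c2 * T powr (1/2) \<Longrightarrow> 1 \<le> M \<Longrightarrow> M \<le> real a \<Longrightarrow> a \<le> b \<Longrightarrow> real b \<le> 2 * M \<Longrightarrow>
    T powr (1/3 - 2 * \<epsilon>) \<le> X \<Longrightarrow> real (b - a) \<le> 2 * X \<Longrightarrow>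
    norm (\<Sum>n=a..<b. dz t n) \<le> C * X * T powr (- (1/3) + 9 * \<epsilon> / 16)"
proof -
  define K where "K = 1 + ln c2 + 8 / \<epsilon>"
  have K: "1 \<le> K" using \<epsilon> c by (simp add: K_def)
  \<comment> \<open>The four summands are the constants for the four terms of the third derivative
    test, in \<open>t1\<close> to \<open>t4\<close>, measured in units of \<open>Y\<close>.\<close>
  define A where "A = 4 + 4 + 4 * sqrt (4 / c1^3) + 2 * sqrt (2 * c2^3)"
  have A: "0 \<le> A" using c by (simp add: A_def)
  define C where "C = 2 * sqrt (400 * A * K / c1) + 1"
  have C: "0 < C" using A K c by (simp add: C_def add_nonneg_pos)
  have main: "norm (\<Sum>n=a..<b. dz t n) \<le> C * X * T powr (- (1/3) + 9 * \<epsilon> / 16)"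
    if T: "4 \<le> T" and t: "T / 2 \<le> t" "t \<le> 2 * T" and M: "c1 * T powr (1/2) \<le> M" "M \<le> c2 * T powr (1/2)" "1 \<le> M"
      and a: "M \<le> real a" "a \<le> b" and b: "real b \<le> 2 * M"
      and X: "T powr (1/3 - 2 * \<epsilon>) \<le> X" and ba: "real (b - a) \<le> 2 * X" for T t M X :: real and a b :: nat
  proof -
    define y where "y = T powr (1/6 + 2 * \<epsilon>)"
    have Tp: "1 \<le> T powr p" if "0 \<le> p" for p using T that by (simp add: ge_one_powr_ge_zero)
    have y1: "1 \<le> y" unfolding y_def using \<epsilon> by (intro Tp) auto
    define q where "q = nat \<lceil>y\<rceil>"
    have q': "y \<le> real q" "real q \<le> 2 * y" using y1 unfolding q_def by linarith+
    then have q: "1 \<le> q" using y1 by linarith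
    have "0 < T powr (1/3 - 2 * \<epsilon>)" using T by simp
    then have X0: "0 < X" using X by (rule less_le_trans)
    define Y where "Y = X\<^sup>2 * T powr (- (1/6) + \<epsilon>)"
    have Y0: "0 \<le> Y" by (simp add: Y_def)
    have T12: "(T powr (1/2))^3 = T powr (3/2)" using T by (simp add: powr_powr flip: powr_realpow)
    have M3: "c1^3 * T powr (3/2) \<le> M^3" "M^3 \<le> c2^3 * T powr (3/2)"
    proof -
      have "(c1 * T powr (1/2))^3 \<le> M^3" using M c by (intro power_mono) auto
      then show "c1^3 * T powr (3/2) \<le> M^3" by (simp only: power_mult_distrib T12)
      have "M^3 \<le> (c2 * T powr (1/2))^3" using M by (intro power_mono) auto
      then show "M^3 \<le> c2^3 * T powr (3/2)" by (simp only: power_mult_distrib T12)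
    qed
    define z where "z = q * t / M^3"
    have z0: "0 < z" using q t T M unfolding z_def by (intro divide_pos_pos mult_pos_pos) auto
    have zlo: "1 / (2 * c2^3) * (T powr (- (1/6) + \<epsilon>))\<^sup>2 \<le> z"
    proof -
      have "1 / (2 * c2^3) * (T powr (- (1/6) + \<epsilon>))\<^sup>2 = (y * (T powr 1 / 2)) / (c2^3 * T powr (3/2))"
      proof -
        have "y * T powr 1 / T powr (3/2) = T powr (1/6 + 2 * \<epsilon> + 1 - 3/2)" unfolding y_def by (simp only: powr_add powr_diff)
        also have "1/6 + 2 * \<epsilon> + 1 - 3/2 = (- (1/6) + \<epsilon>) + (- (1/6) + \<epsilon>)" by simp
        also have "T powr \<dots> = (T powr (- (1/6) + \<epsilon>))\<^sup>2" by (simp only: powr_add power2_eq_square)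
        finally have "(T powr (- (1/6) + \<epsilon>))\<^sup>2 = y * T powr 1 / T powr (3/2)" ..
        then show ?thesis by simp
      qed
      also have "\<dots> \<le> z" unfolding z_def
      proof (rule frac_le)
        show "y * (T powr 1 / 2) \<le> real q * t" using q' y1 t T by (intro mult_mono) auto
      qed (use M M3 y1 t T q in auto)
      finally show ?thesis .
    qed
    have zhi: "z \<le> 4 / c1^3 * (T powr (- (1/6) + \<epsilon>))\<^sup>2"
    proof -
      have "z \<le> (2 * y * (2 * T powr 1)) / (c1^3 * T powr (3/2))" unfolding z_def
      proof (rule frac_le)
        show "real q * t \<le> 2 * y * (2 * T powr 1)" using q' y1 t T by (intro mult_mono) auto
      qed (use M M3 y1 t T c in auto)
      also have "\<dots> = 4 / c1^3 * (y * T powr 1 / T powr (3/2))" by simp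
      also have "y * T powr 1 / T powr (3/2) = T powr (1/6 + 2 * \<epsilon> + 1 - 3/2)" unfolding y_def by (simp only: powr_add powr_diff)
      also have "1/6 + 2 * \<epsilon> + 1 - 3/2 = (- (1/6) + \<epsilon>) + (- (1/6) + \<epsilon>)" by simp
      also have "T powr \<dots> = (T powr (- (1/6) + \<epsilon>))\<^sup>2" by (simp only: powr_add power2_eq_square)
      finally show ?thesis .
    qed
    have t1: "(real q)\<^sup>2 \<le> 4 * Y"
    proof -
      have "(real q)\<^sup>2 \<le> (2 * y)\<^sup>2" using q' by (intro power_mono) auto
      also have "\<dots> = 4 * T powr ((1/3 - 2 * \<epsilon>) + (1/3 - 2 * \<epsilon>) + (- (1/3) + 8 * \<epsilon>))"
      proof -
        have "(1/6 + 2 * \<epsilon>) + (1/6 + 2 * \<epsilon>) = (1/3 - 2 * \<epsilon>) + (1/3 - 2 * \<epsilon>) + (- (1/3) + 8 * \<epsilon>)" by simp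
        then have "y * y = T powr ((1/3 - 2 * \<epsilon>) + (1/3 - 2 * \<epsilon>) + (- (1/3) + 8 * \<epsilon>))" unfolding y_def powr_add[symmetric] by (rule arg_cong)
        then show ?thesis by (simp add: power2_eq_square)
      qed
      also have "\<dots> \<le> 4 * T powr ((1/3 - 2 * \<epsilon>) + (1/3 - 2 * \<epsilon>) + (- (1/6) + \<epsilon>))" using T \<epsilon> by (intro mult_left_mono powr_mono) auto
      also have "\<dots> = 4 * ((T powr (1/3 - 2 * \<epsilon>))\<^sup>2 * T powr (- (1/6) + \<epsilon>))" by (simp only: powr_add power2_eq_square)
      also have "\<dots> \<le> 4 * Y" unfolding Y_def using X by (intro mult_left_mono mult_right_mono power_mono) auto
      finally show ?thesis .
    qed
    have t2: "(2 * X)\<^sup>2 / q \<le> 4 * Y"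
    proof -
      have "(2 * X)\<^sup>2 / q \<le> (2 * X)\<^sup>2 / y" using q' y1 q by (intro divide_left_mono mult_pos_pos) auto
      also have "\<dots> = 4 * (X\<^sup>2 * (1 / y))" by (simp add: power_mult_distrib)
      also have "1 / y = T powr (- (1/6 + 2 * \<epsilon>))" by (simp only: y_def powr_minus_divide)
      also have "4 * (X\<^sup>2 * T powr (- (1/6 + 2 * \<epsilon>))) \<le> 4 * Y" unfolding Y_def using T \<epsilon> by (intro mult_left_mono powr_mono) auto
      finally show ?thesis .
    qed
    have t3: "(2 * X)\<^sup>2 * sqrt z \<le> 4 * sqrt (4 / c1^3) * Y"
    proof -
      have "sqrt z \<le> sqrt (4 / c1^3 * (T powr (- (1/6) + \<epsilon>))\<^sup>2)" using zhi by simp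
      also have "\<dots> = sqrt (4 / c1^3) * T powr (- (1/6) + \<epsilon>)" by (simp only: real_sqrt_mult real_sqrt_abs) simp
      finally have "(2 * X)\<^sup>2 * sqrt z \<le> (2 * X)\<^sup>2 * (sqrt (4 / c1^3) * T powr (- (1/6) + \<epsilon>))" by (intro mult_left_mono) auto
      then show ?thesis by (simp add: Y_def power_mult_distrib mult_ac)
    qed
    have t4: "(2 * X) / sqrt z \<le> 2 * sqrt (2 * c2^3) * Y"
    proof -
      have "sqrt (1 / (2 * c2^3)) * T powr (- (1/6) + \<epsilon>) = sqrt (1 / (2 * c2^3) * (T powr (- (1/6) + \<epsilon>))\<^sup>2)" by (simp only: real_sqrt_mult real_sqrt_abs) simp
      also have "\<dots> \<le> sqrt z" using zlo by simp
      finally have "(2 * X) / sqrt z \<le> (2 * X) / (sqrt (1 / (2 * c2^3)) * T powr (- (1/6) + \<epsilon>))"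
        using X0 T c z0 by (intro divide_left_mono mult_pos_pos) auto
      also have "\<dots> = 2 * sqrt (2 * c2^3) * (X * T powr (1/6 - \<epsilon>))"
      proof -
        have "T powr (1/6 - \<epsilon>) = 1 / T powr (- (1/6) + \<epsilon>)" by (simp add: powr_minus_divide[symmetric])
        then show ?thesis by (simp add: real_sqrt_divide)
      qed
      \<comment> \<open>Here the lower bound for X enters: one factor T^(1/3 - 2\<epsilon>) is
        replaced by X.\<close>
      also have "T powr (1/6 - \<epsilon>) = T powr (1/3 - 2 * \<epsilon>) * T powr (- (1/6) + \<epsilon>)" by (simp add: powr_add[symmetric])
      also have "2 * sqrt (2 * c2^3) * (X * (T powr (1/3 - 2 * \<epsilon>) * T powr (- (1/6) + \<epsilon>))) \<le> 2 * sqrt (2 * c2^3) * (X * (X * T powr (- (1/6) + \<epsilon>)))"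
        using X X0 c by (intro mult_left_mono mult_right_mono) auto
      finally show ?thesis by (simp add: Y_def power2_eq_square mult_ac)
    qed
    have lM: "1 + ln M \<le> K * T powr (\<epsilon> / 8)"
    proof -
      have "ln M \<le> ln (c2 * T powr (1/2))" using M by (intro ln_mono) auto
      also have "\<dots> = ln c2 + 1/2 * ln T" using c T by (simp add: ln_mult ln_powr)
      also have "\<dots> \<le> ln c2 + ln T" using T by simp
      finally have "1 + ln M \<le> ln c2 + (1 + ln T)" by simp
      also have "\<dots> \<le> ln c2 * T powr (\<epsilon> / 8) + (1 + 1 / (\<epsilon> / 8)) * T powr (\<epsilon> / 8)"
        using one_plus_ln_le[of T "\<epsilon> / 8"] T \<epsilon> c mult_left_mono[OF Tp[of "\<epsilon> / 8"], of "ln c2"] by (intro add_mono) auto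
      finally show ?thesis by (simp add: K_def algebra_simps)
    qed
    \<comment> \<open>The root of T^(-1/6 + \<epsilon>) T^(\<epsilon>/8); divided by T^(1/4), the
      order of sqrt M, it yields the exponent -1/3 + 9\<epsilon>/16.\<close>
    define S where "S = T powr (- (1/12) + \<epsilon>/2 + \<epsilon>/16)"
    have part: "norm (\<Sum>n=a..<k. cis (- t * ln n)) \<le> sqrt (400 * A * K) * (X * S)" if k: "a \<le> k" "k \<le> b" for k
    proof -
      have "real (k - a) \<le> 2 * X" using k ba a by (simp add: of_nat_diff)
      moreover have "real k \<le> 2 * M" using k b by (meson of_nat_le_iff order_trans)
      ultimately have "(norm (\<Sum>n=a..<k. cis (- t * ln n)))\<^sup>2 \<le>
         400 * ((real q)\<^sup>2 + (2 * X)\<^sup>2 / q + (2 * X)\<^sup>2 * sqrt (q * t / M^3) + (2 * X) / sqrt (q * t / M^3)) * (1 + ln M)"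
        using t T M a q by (intro cis_log_block_third) auto
      also have "\<dots> \<le> 400 * (A * Y) * (K * T powr (\<epsilon> / 8))"
      proof (intro mult_mono mult_left_mono lM)
        show "(real q)\<^sup>2 + (2 * X)\<^sup>2 / q + (2 * X)\<^sup>2 * sqrt (q * t / M^3) + (2 * X) / sqrt (q * t / M^3) \<le> A * Y"
          using t1 t2 t3 t4 unfolding A_def z_def by (simp add: distrib_right)
      qed (use A Y0 M X0 z0[unfolded z_def] in auto)
      also have "\<dots> = (400 * A * K) * (X\<^sup>2 * (T powr (- (1/6) + \<epsilon>) * T powr (\<epsilon> / 8)))" by (simp add: Y_def mult_ac)
      also have "T powr (- (1/6) + \<epsilon>) * T powr (\<epsilon> / 8) = S\<^sup>2"
        unfolding S_def power2_eq_square powr_add[symmetric] by simp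
      finally have "norm (\<Sum>n=a..<k. cis (- t * ln n)) \<le> sqrt ((400 * A * K) * (X\<^sup>2 * S\<^sup>2))" by (rule real_le_rsqrt)
      also have "\<dots> = sqrt (400 * A * K) * (X * S)" using X0 by (simp add: real_sqrt_mult S_def)
      finally show ?thesis .
    qed
    have "norm (\<Sum>n=a..<b. dz t n) \<le> 2 * (1 / sqrt M) * (sqrt (400 * A * K) * (X * S))"
      using M a part by (intro norm_dz_block) auto
    also have "\<dots> \<le> 2 * (1 / (sqrt c1 * T powr (1/4))) * (sqrt (400 * A * K) * (X * S))"
    proof (intro mult_right_mono mult_left_mono)
      have "sqrt c1 * T powr (1/4) = sqrt (c1 * T powr (1/2))"
        using T by (simp add: real_sqrt_mult powr_half_sqrt[symmetric] powr_powr)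
      also have "\<dots> \<le> sqrt M" using M by simp
      finally show "1 / sqrt M \<le> 1 / (sqrt c1 * T powr (1/4))" using M c T by (intro divide_left_mono mult_pos_pos) auto
    qed (use A K X0 in \<open>auto simp: S_def\<close>)
    also have "\<dots> = 2 * sqrt (400 * A * K / c1) * X * (S / T powr (1/4))" by (simp add: real_sqrt_divide)
    also have "S / T powr (1/4) = T powr (- (1/3) + 9 * \<epsilon> / 16)" unfolding S_def powr_diff[symmetric] by simp
    also have "2 * sqrt (400 * A * K / c1) * X * T powr (- (1/3) + 9 * \<epsilon> / 16) \<le> C * X * T powr (- (1/3) + 9 * \<epsilon> / 16)"
      unfolding C_def using X0 by (intro mult_right_mono) auto
    finally show ?thesis .
  qed
  show ?thesis by (rule that[OF C main])
qed

section \<open>The exponential integral of zeta, with its terms near the stationary point\<close>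

lemma blocks_bound:
  fixes f :: "nat \<Rightarrow> complex" and p :: "nat \<Rightarrow> nat"
  assumes p: "\<And>j. j < k \<Longrightarrow> p j \<le> p (Suc j)"
    and D: "\<And>j. j < k \<Longrightarrow> norm (\<Sum>n=p j..<p (Suc j). f n) \<le> D"
  shows "p 0 \<le> p k \<and> norm (\<Sum>n=p 0..<p k. f n) \<le> real k * D"
  using assms
proof (induction k)
  case (Suc k)
  have IH: "p 0 \<le> p k" "norm (\<Sum>n=p 0..<p k. f n) \<le> real k * D" using Suc by auto
  have "(\<Sum>n=p 0..<p (Suc k). f n) = (\<Sum>n=p 0..<p k. f n) + (\<Sum>n=p k..<p (Suc k). f n)"
    using IH Suc.prems(1)[of k] by (subst sum.atLeastLessThan_concat) auto
  also have "norm \<dots> \<le> norm (\<Sum>n=p 0..<p k. f n) + norm (\<Sum>n=p k..<p (Suc k). f n)" by (rule norm_triangle_ineq)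
  finally show ?case using IH Suc.prems(1)[of k] Suc.prems(2)[of k] by (auto simp: algebra_simps)
qed simp

text \<open>On either side of P the weight 1/ln (P/n) is monotone, and ln x >= 1 - 1/x bounds it by
  1/l when n keeps the relative distance l from P. Beyond P the weight is negative, and its sign is
  reversed first.\<close>

lemma abel_log_weight:
  fixes P l B :: real and a b :: nat and y :: "nat \<Rightarrow> complex"
  assumes P: "0 < P" and l: "0 < l" and ab: "a \<le> b" "1 \<le> a"
    and part: "\<And>k. a \<le> k \<Longrightarrow> k \<le> b \<Longrightarrow> norm (\<Sum>n=a..<k. y n) \<le> B"
    and far: "(\<forall>n. a \<le> n \<longrightarrow> n < b \<longrightarrow> real n < P \<and> l \<le> 1 - n / P) \<or> (\<forall>n. a \<le> n \<longrightarrow> n < b \<longrightarrow> P < real n \<and> l \<le> 1 - P / n)"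
  shows "norm (\<Sum>n=a..<b. of_real (1 / ln (P / n)) * y n) \<le> 2 * (1 / l) * B"
proof -
  have B: "0 \<le> B" using part[of a] ab by simp
  have lnge: "1 - 1 / x \<le> ln x" if "0 < x" for x :: real
    using ln_le_minus_one[of "1 / x"] that by (simp add: ln_div)
  show ?thesis using far
  proof
    assume A: "\<forall>n. a \<le> n \<longrightarrow> n < b \<longrightarrow> real n < P \<and> l \<le> 1 - n / P"
    have ln: "l \<le> ln (P / n)" if "a \<le> n" "n < b" for n
      using A that lnge[of "P / n"] P ab by fastforce
    show ?thesis
    proof (rule abel_interval[OF part B])
      have "1 / ln (P / n) \<le> 1 / ln (P / Suc n)" if "a \<le> n" "Suc n < b" for n
      proof (rule divide_left_mono)
        have "P / Suc n \<le> P / n" using that ab P by (intro divide_left_mono mult_pos_pos) auto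
        then show "ln (P / Suc n) \<le> ln (P / n)" using P by (intro ln_mono) auto
        show "0 < ln (P / n) * ln (P / Suc n)" using ln[of n] ln[of "Suc n"] l that by (intro mult_pos_pos) auto
      qed auto
      then show "(\<forall>n\<ge>a. Suc n < b \<longrightarrow> 1 / ln (P / n) \<le> 1 / ln (P / Suc n)) \<or> (\<forall>n\<ge>a. Suc n < b \<longrightarrow> 1 / ln (P / Suc n) \<le> 1 / ln (P / n))" by blast
      fix n assume "a \<le> n" "n < b"
      from ln[OF this] show "0 \<le> 1 / ln (P / n) \<and> 1 / ln (P / n) \<le> 1 / l" using l by (auto intro!: divide_left_mono mult_pos_pos)
    qed (use l in auto)
  next
    assume A: "\<forall>n. a \<le> n \<longrightarrow> n < b \<longrightarrow> P < real n \<and> l \<le> 1 - P / n"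
    have ln: "l \<le> ln (n / P)" if "a \<le> n" "n < b" for n
      using A that lnge[of "n / P"] P ab by fastforce
    have "norm (\<Sum>n=a..<b. of_real (1 / ln (n / P)) * y n) \<le> 2 * (1 / l) * B"
    proof (rule abel_interval[OF part B])
      have "1 / ln (Suc n / P) \<le> 1 / ln (n / P)" if "a \<le> n" "Suc n < b" for n
      proof (rule divide_left_mono)
        have "n / P \<le> Suc n / P" using P by (intro divide_right_mono) auto
        then show "ln (n / P) \<le> ln (Suc n / P)" using P ab that by (intro ln_mono) auto
        show "0 < ln (Suc n / P) * ln (n / P)" using ln[of n] ln[of "Suc n"] l that by (intro mult_pos_pos) auto
      qed auto
      then show "(\<forall>n\<ge>a. Suc n < b \<longrightarrow> 1 / ln (n / P) \<le> 1 / ln (Suc n / P)) \<or> (\<forall>n\<ge>a. Suc n < b \<longrightarrow> 1 / ln (Suc n / P) \<le> 1 / ln (n / P))" by blast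
      fix n assume "a \<le> n" "n < b"
      from ln[OF this] show "0 \<le> 1 / ln (n / P) \<and> 1 / ln (n / P) \<le> 1 / l" using l by (auto intro!: divide_left_mono mult_pos_pos)
    qed (use l in auto)
    moreover have "(\<Sum>n=a..<b. of_real (1 / ln (P / n)) * y n) = - (\<Sum>n=a..<b. of_real (1 / ln (n / P)) * y n)"
      unfolding sum_negf[symmetric]
    proof (rule sum.cong[OF refl])
      fix n assume "n \<in> {a..<b}"
      then have "ln (P / n) = - ln (n / P)" using P ab by (simp add: ln_div)
      then show "of_real (1 / ln (P / n)) * y n = - (of_real (1 / ln (n / P)) * y n)" by simp
    qed
    ultimately show ?thesis by simp
  qed
qed

lemma has_integral_cis_linear:
  fixes l A B :: real
  assumes "l \<noteq> 0" "A \<le> B"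
  shows "((\<lambda>u. cis (u * l)) has_integral (cis (B * l) - cis (A * l)) / (\<i> * of_real l)) {A..B}"
proof -
  have "((\<lambda>u. cis (u * l)) has_integral (cis (B * l) / (\<i> * of_real l) - cis (A * l) / (\<i> * of_real l))) {A..B}"
  proof (rule fundamental_theorem_of_calculus[OF assms(2)])
    fix u assume "u \<in> {A..B}"
    have "((\<lambda>z. exp (\<i> * of_real l * z) / (\<i> * of_real l)) has_field_derivative exp (\<i> * of_real l * of_real u)) (at (of_real u))"
      using assms by (auto intro!: derivative_eq_intros)
    from has_vector_derivative_real_field[OF this, of "{A..B}"]
    show "((\<lambda>u. cis (u * l) / (\<i> * of_real l)) has_vector_derivative cis (u * l)) (at u within {A..B})"
      by (simp add: cis_conv_exp mult_ac)
  qed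
  then show ?thesis by (simp add: diff_divide_distrib)
qed

lemma norm_integral_le:
  fixes f :: "real \<Rightarrow> 'a::euclidean_space"
  assumes "f integrable_on {a..b}" "a \<le> b" "\<And>u. u \<in> {a..b} \<Longrightarrow> norm (f u) \<le> B"
  shows "norm (integral {a..b} f) \<le> B * (b - a)"
proof -
  have "0 \<le> B" using assms(2) assms(3)[of a] by (meson atLeastAtMost_iff norm_ge_zero order.trans order_refl)
  have "(f has_integral integral {a..b} f) (cbox a b)" using assms(1) by (simp add: integrable_integral)
  then show ?thesis using has_integral_bound[OF \<open>0 \<le> B\<close>, of f _ a b] assms by simp
qed

text \<open>Integrating the n-th term against P^(iu) will produce the weight 1/ln (P/n), which blows
  up at n = P. The terms p <= n < r, within about T^(1/3 - 2\<epsilon>) of P, are therefore bounded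
  without this weight. Outside, a block at distance Z from P has length Z and weight of order P/Z,
  so by \<open>norm_dz_near\<close> it contributes P T^(-1/3), or T^(1/6) up to small powers, and
  there are O(ln T) such blocks. Beyond distance P/4 the weight is bounded and the bound for partial
  sums suffices.\<close>

lemma stationary_sum_bound:
  fixes \<epsilon> c1 c2 :: real
  assumes \<epsilon>: "0 < \<epsilon>" "\<epsilon> \<le> 1 / 100" and c: "0 < c1" "1 \<le> c2"
  obtains C T0 where "0 < C" "4 \<le> T0" "\<And>T P N. T0 \<le> T \<Longrightarrow> c1 * T powr (1/2) \<le> P \<Longrightarrow> P \<le> c2 * T powr (1/2) \<Longrightarrow>
      T powr (4/3 + \<epsilon>) \<le> real N \<Longrightarrow> real N \<le> 2 * T powr (4/3 + \<epsilon>) \<Longrightarrow>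
      \<exists>p r. 1 \<le> p \<and> p \<le> r \<and> r \<le> N \<and> real p \<le> P \<and> P < real r \<and>
        (\<forall>n. 1 \<le> n \<longrightarrow> n < p \<longrightarrow> real n < P) \<and>
        (\<forall>t. T / 2 \<le> t \<longrightarrow> t \<le> 2 * T \<longrightarrow>
          norm (\<Sum>n=p..<r. dz t n) \<le> C * T powr (9 * \<epsilon> / 16 - 2 * \<epsilon>) \<and>
          norm (\<Sum>n=1..<p. of_real (1 / ln (P / n)) * dz t n) \<le> C * T powr (1/6 + 5 * \<epsilon> / 8) \<and>
          norm (\<Sum>n=r..<N. of_real (1 / ln (P / n)) * dz t n) \<le> C * T powr (1/6 + 5 * \<epsilon> / 8))"
proof -
  obtain CB where CB: "0 < CB" "\<And>T t b. 4 \<le> T \<Longrightarrow> T / 2 \<le> t \<Longrightarrow> t \<le> 2 * T \<Longrightarrow> real b \<le> 2 * T powr (4/3 + \<epsilon>) \<Longrightarrow>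
    norm (\<Sum>n=1..<b. dz t n) \<le> CB * T powr (1/6 + 5 * \<epsilon> / 8)" using norm_dz_partial_le[OF \<epsilon>] by blast
  \<comment> \<open>Two thirds, because all blocks will be placed in one dyadic interval [M, 2 M]
    with M = 2 P/3.\<close>
  define d1 where "d1 = 2 / 3 * c1"
  have d1: "0 < d1" using c by (simp add: d1_def)
  obtain CN where CN: "0 < CN" "\<And>T t M X a b. 4 \<le> T \<Longrightarrow> T / 2 \<le> t \<Longrightarrow> t \<le> 2 * T \<Longrightarrow>
    d1 * T powr (1/2) \<le> M \<Longrightarrow> M \<le> c2 * T powr (1/2) \<Longrightarrow> 1 \<le> M \<Longrightarrow> M \<le> real a \<Longrightarrow> a \<le> b \<Longrightarrow> real b \<le> 2 * M \<Longrightarrow>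
    T powr (1/3 - 2 * \<epsilon>) \<le> X \<Longrightarrow> real (b - a) \<le> 2 * X \<Longrightarrow>
    norm (\<Sum>n=a..<b. dz t n) \<le> CN * X * T powr (- (1/3) + 9 * \<epsilon> / 16)" using norm_dz_near[OF \<epsilon> d1 c(2)] by blast
  define B0 where "B0 = 12 / c1 + 2 * c2 + 4"
  have B0: "4 \<le> B0" "12 / c1 \<le> B0" "2 * c2 \<le> B0" using c by (auto simp: B0_def)
  \<comment> \<open>The twelfth power gives T^(1/12) >= \<open>B0\<close>, hence T^q >=
    \<open>B0\<close> for every exponent q >= 1/12 that occurs below.\<close>
  define T0 where "T0 = B0 powr 12"
  have T04: "4 \<le> T0"
  proof -
    have "4 \<le> B0 powr 1" using B0 by simp
    also have "\<dots> \<le> T0" unfolding T0_def using B0 by (intro powr_mono) auto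
    finally show ?thesis .
  qed
  define KK where "KK = 2 * (1 + ln c2) * (1 + 16 / \<epsilon>)"
  have KK: "0 \<le> KK" using c \<epsilon> by (simp add: KK_def)
  define C where "C = 4 * CN + 8 * CB + 28 * CB + KK * (16 / 3 * CN * c2)"
  have C: "0 < C" using CN(1) CB(1) KK c unfolding C_def by (intro add_pos_nonneg) auto
  show ?thesis
  proof (rule that[OF C T04])
    fix T P :: real and N :: nat
    assume T0: "T0 \<le> T" and P: "c1 * T powr (1/2) \<le> P" "P \<le> c2 * T powr (1/2)" and N: "T powr (4/3 + \<epsilon>) \<le> real N" "real N \<le> 2 * T powr (4/3 + \<epsilon>)"
    have T: "4 \<le> T" using T0 T04 by simp
    have "(B0 powr 12) powr (1/12) \<le> T powr (1/12)" using T0 B0 unfolding T0_def by (intro powr_mono2) auto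
    moreover have "(B0 powr 12) powr (1/12) = B0" using B0 unfolding powr_powr by simp
    ultimately have BT: "B0 \<le> T powr (1/12)" by simp
    have Bp: "B0 \<le> T powr q" if "1/12 \<le> q" for q
      using BT powr_mono[OF that, of T] T by linarith
    have P12: "12 \<le> P"
    proof -
      have "12 = c1 * (12 / c1)" using c by simp
      also have "\<dots> \<le> c1 * T powr (1/2)" using B0 Bp[of "1/2"] c by (intro mult_left_mono) auto
      finally show ?thesis using P by simp
    qed
    define Y where "Y = T powr (1/3 - 2 * \<epsilon>)"
    have Y4: "4 \<le> Y" using B0 Bp[of "1/3 - 2 * \<epsilon>"] \<epsilon> by (simp add: Y_def)
    \<comment> \<open>P is at least 4 Y, which leaves room for dyadic distances between Y and
      P/4.\<close>
    have PY: "1 \<le> P / (4 * Y)"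
    proof -
      have "4 * Y \<le> (c1 * B0) * Y" using B0 c Y4 by (intro mult_right_mono) (auto simp: field_simps)
      also have "\<dots> \<le> (c1 * T powr (1/6)) * T powr (1/3)"
        unfolding Y_def using c Bp[of "1/6"] T \<epsilon> by (intro mult_mono mult_left_mono powr_mono) auto
      also have "\<dots> = c1 * T powr (1/2)" by (simp add: mult.assoc flip: powr_add)
      also have "\<dots> \<le> P" by (rule P)
      finally show ?thesis using Y4 by simp
    qed
    \<comment> \<open>K doublings lead from a first distance \<open>M0\<close>, between Y and 2 Y,
      to exactly P/4.\<close>
    define K where "K = nat \<lfloor>log 2 (P / (4 * Y))\<rfloor>"
    have lg: "0 \<le> log 2 (P / (4 * Y))" using PY by simp
    have Kl: "real K \<le> log 2 (P / (4 * Y))" "log 2 (P / (4 * Y)) < real K + 1" using lg unfolding K_def by linarith+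
    define M0 where "M0 = P / (4 * 2 ^ K)"
    have pw: "2 powr real K \<le> P / (4 * Y)" "P / (4 * Y) \<le> 2 powr (real K + 1)"
    proof -
      have "2 powr real K \<le> 2 powr (log 2 (P / (4 * Y)))" using Kl by (intro powr_mono) auto
      then show "2 powr real K \<le> P / (4 * Y)" using PY by simp
      have "2 powr (log 2 (P / (4 * Y))) \<le> 2 powr (real K + 1)" using Kl by (intro powr_mono) auto
      then show "P / (4 * Y) \<le> 2 powr (real K + 1)" using PY by simp
    qed
    have pw': "2 ^ K * (4 * Y) \<le> P" "P \<le> 2 ^ K * (8 * Y)"
      using pw Y4 by (simp_all add: powr_add powr_realpow field_simps)
    have M0: "Y \<le> M0" "M0 \<le> 2 * Y" using pw' by (simp_all add: M0_def field_simps)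
    define X where "X j = M0 * 2 ^ j" for j
    have X: "M0 \<le> X j" "Y \<le> X j" "4 \<le> X j" "X (Suc j) = 2 * X j" for j
    proof -
      have "M0 * 1 \<le> M0 * 2 ^ j" using M0 Y4 by (intro mult_left_mono) auto
      then show "M0 \<le> X j" by (simp add: X_def)
      then show "Y \<le> X j" "4 \<le> X j" using M0 Y4 by auto
    qed (simp add: X_def)
    have XK: "X K = P / 4" by (simp add: X_def M0_def)
    have Xle: "X j \<le> P / 4" if "j \<le> K" for j
    proof -
      have "X j \<le> X K" unfolding X_def using that M0 Y4 by (intro mult_left_mono power_increasing) auto
      then show ?thesis by (simp add: XK)
    qed
    define f where "f x = nat \<lfloor>x\<rfloor>" for x :: real
    have f: "real (f x) \<le> x" "x - 1 < real (f x)" if "0 \<le> x" for x using that unfolding f_def by linarith+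
    have fmono: "f x \<le> f y" if "x \<le> y" for x y using that unfolding f_def by (intro nat_mono floor_mono)
    \<comment> \<open>Floors of points in [3 P/4, 5 P/4] lie in [2 P/3, 4 P/3] because P >=
      12.\<close>
    define M where "M = 2 / 3 * P"
    have M: "d1 * T powr (1/2) \<le> M" "M \<le> c2 * T powr (1/2)" "1 \<le> M"
      using P P12 by (auto simp: M_def d1_def)
    \<comment> \<open>With growing j the left points approach P and the right points
      \<open>b j\<close> recede from it, so that both families are increasing.\<close>
    define a where "a j = f (P - X (K - j))" for j
    define b where "b j = f (P + X j)" for j
    have loM: "M \<le> real (f x)" if "3/4 * P \<le> x" for x using f[of x] that P12 by (simp add: M_def)
    have nat1: "1 \<le> n" if "M \<le> real n" for n
    proof -
      have "real 1 \<le> real n" using M that by simp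
      then show ?thesis by (simp only: of_nat_le_iff)
    qed
    have hiM: "real (f x) \<le> 2 * M" if "0 \<le> x" "x \<le> 5/4 * P" for x using f[of x] that P12 by (simp add: M_def)
    have near: "norm (\<Sum>n=f x..<k. dz t n) \<le> CN * Z * T powr (- (1/3) + 9 * \<epsilon> / 16)"
      if t: "T / 2 \<le> t" "t \<le> 2 * T" and xy: "3/4 * P \<le> x" "f x \<le> k" "k \<le> f y" "y \<le> 5/4 * P" "x \<le> y" "y - x \<le> Z" "Y \<le> Z" for t x y Z k
    proof (rule CN(2)[OF T t M loM[OF xy(1)] xy(2)])
      have y0: "0 \<le> y" "0 \<le> x" using xy P12 by auto
      have "real k \<le> real (f y)" using xy by simp
      then show "real k \<le> 2 * M" using hiM[of y] y0 xy by simp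
      show "T powr (1/3 - 2 * \<epsilon>) \<le> Z" using xy by (simp add: Y_def)
      have "real (k - f x) = real k - real (f x)" using xy by (simp add: of_nat_diff)
      also have "\<dots> \<le> y - (x - 1)" using \<open>real k \<le> real (f y)\<close> f(1)[OF y0(1)] f(2)[OF y0(2)] by linarith
      finally show "real (k - f x) \<le> 2 * Z" using xy Y4 by linarith
    qed
    define D where "D = 16 / 3 * CN * c2 * T powr (1/6 + 9 * \<epsilon> / 16)"
    have PD: "P * T powr (- (1/3) + 9 * \<epsilon> / 16) \<le> c2 * T powr (1/6 + 9 * \<epsilon> / 16)"
    proof -
      have "P * T powr (- (1/3) + 9 * \<epsilon> / 16) \<le> c2 * T powr (1/2) * T powr (- (1/3) + 9 * \<epsilon> / 16)"
        using P by (intro mult_right_mono) auto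
      also have "\<dots> = c2 * T powr (1/2 + (- (1/3) + 9 * \<epsilon> / 16))" by (simp only: mult.assoc powr_add)
      also have "1/2 + (- (1/3) + 9 * \<epsilon> / 16) = 1/6 + 9 * \<epsilon> / 16" by simp
      finally show ?thesis .
    qed
    \<comment> \<open>The length Z cancels against the weight P/Z, so the bound is the same for
      every block. The constant 3/8 is that of the right side, the worse of the two.\<close>
    have scale: "2 * (1 / l) * (CN * Z * T powr (- (1/3) + 9 * \<epsilon> / 16)) \<le> D" if "0 < Z" "3 * Z / (8 * P) \<le> l" for l Z
    proof -
      have l: "0 < 3 * Z / (8 * P)" using that P12 by simp
      have "1 / l \<le> 1 / (3 * Z / (8 * P))"
      proof (rule divide_left_mono[OF that(2)])
        have "0 < l" using l that(2) by (rule less_le_trans)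
        then show "0 < l * (3 * Z / (8 * P))" using l by (rule mult_pos_pos)
      qed simp
      then have "1 / l \<le> 8 * P / (3 * Z)" by simp
      then have "2 * (1 / l) * (CN * Z * T powr (- (1/3) + 9 * \<epsilon> / 16)) \<le> 2 * (8 * P / (3 * Z)) * (CN * Z * T powr (- (1/3) + 9 * \<epsilon> / 16))"
        using that CN(1) by (intro mult_right_mono) auto
      also have "\<dots> = 16 / 3 * CN * (P * T powr (- (1/3) + 9 * \<epsilon> / 16))" using that by simp
      also have "\<dots> \<le> 16 / 3 * CN * (c2 * T powr (1/6 + 9 * \<epsilon> / 16))" using PD CN(1) by (intro mult_left_mono) auto
      finally show ?thesis by (simp add: D_def)
    qed
    have KD: "real K * D \<le> KK * (16 / 3 * CN * c2) * T powr (1/6 + 5 * \<epsilon> / 8)"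
    proof -
      have "real K * ln 2 \<le> ln (P / (4 * Y))" using Kl by (simp add: log_def field_simps)
      also have "\<dots> \<le> ln P" using PY P12 Y4 by (intro ln_mono) (auto simp: pos_divide_le_eq)
      also have "\<dots> \<le> ln (c2 * T powr (1/2))" using P P12 by (intro ln_mono) auto
      also have "\<dots> = ln c2 + 1/2 * ln T" using c T by (simp add: ln_mult ln_powr)
      finally have "real K * ln 2 \<le> ln c2 + 1/2 * ln T" .
      moreover have "real K * (1/2) \<le> real K * ln 2" using ln2_ge_two_thirds by (intro mult_left_mono) auto
      ultimately have "real K * (1/2) \<le> ln c2 + 1/2 * ln T" by (rule order_trans[rotated])
      then have "real K \<le> 2 * ln c2 + ln T" by simp
      moreover have "0 \<le> ln T" using T by simp
      ultimately have "real K \<le> 2 * (ln c2 + ln T)" by simp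
      also have "\<dots> \<le> 2 * ((1 + ln c2) * (1 + ln T))" using c T by (simp add: algebra_simps)
      also have "\<dots> \<le> 2 * ((1 + ln c2) * ((1 + 1 / (\<epsilon> / 16)) * T powr (\<epsilon> / 16)))"
        using c T \<epsilon> by (intro mult_left_mono one_plus_ln_le) auto
      also have "\<dots> = KK * T powr (\<epsilon> / 16)" by (simp only: KK_def divide_divide_eq_right mult_1 mult.assoc)
      finally have "real K \<le> KK * T powr (\<epsilon> / 16)" .
      then have "real K * D \<le> (KK * T powr (\<epsilon> / 16)) * D" using CN(1) c by (intro mult_right_mono) (auto simp: D_def)
      also have "\<dots> = KK * (16 / 3 * CN * c2) * T powr (\<epsilon> / 16 + (1/6 + 9 * \<epsilon> / 16))" unfolding D_def powr_add by simp
      also have "\<epsilon> / 16 + (1/6 + 9 * \<epsilon> / 16) = 1/6 + 5 * \<epsilon> / 8" by simp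
      finally show ?thesis .
    qed
    have a_pos: "1 \<le> a 0"
    proof -
      have "M \<le> real (a 0)" unfolding a_def diff_zero using XK P12 by (intro loM) auto
      then show ?thesis by (rule nat1)
    qed
    have aK: "a K = f (P - M0)" "b 0 = f (P + M0)" by (simp_all add: a_def b_def X_def)
    have ar: "a K \<le> b 0" unfolding aK using M0 Y4 by (intro fmono) auto
    have bN: "b K \<le> N"
    proof -
      have "real (b K) \<le> P + X K" unfolding b_def using P12 XK by (intro f) auto
      also have "\<dots> \<le> 2 * P" using XK P12 by simp
      also have "\<dots> \<le> 2 * c2 * T powr (1/2)" using P by simp
      also have "\<dots> \<le> T powr (5/6) * T powr (1/2)" using B0 Bp[of "5/6"] by (intro mult_right_mono) auto
      also have "\<dots> = T powr (5/6 + 1/2)" by (rule powr_add[symmetric])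
      also have "\<dots> \<le> T powr (4/3 + \<epsilon>)" using T \<epsilon> by (intro powr_mono) auto
      finally show ?thesis using N by simp
    qed
    have B: "norm (\<Sum>n=1..<k. dz t n) \<le> CB * T powr (1/6 + 5 * \<epsilon> / 8)" if "T / 2 \<le> t" "t \<le> 2 * T" "k \<le> N" for t k
      using CB(2)[OF T that(1,2), of k] N that(3) by (meson of_nat_le_iff order_trans)
    have left: "a 0 \<le> a K \<and> norm (\<Sum>n=a 0..<a K. of_real (1 / ln (P / n)) * dz t n) \<le> real K * D"
      if t: "T / 2 \<le> t" "t \<le> 2 * T" for t
    proof (rule blocks_bound)
      fix j assume j: "j < K"
      define Z where "Z = X (K - Suc j)"
      have Z2: "X (K - j) = 2 * Z" using X(4)[of "K - Suc j"] j by (simp add: Z_def Suc_diff_Suc)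
      have Z: "4 \<le> Z" "Y \<le> Z" "2 * Z \<le> P / 4" using X Xle[of "K - j"] Z2 by (auto simp: Z_def)
      have aj: "a j = f (P - 2 * Z)" "a (Suc j) = f (P - Z)" by (simp_all add: a_def Z2 Z_def)
      show le: "a j \<le> a (Suc j)" unfolding aj using Z by (intro fmono) auto
      have "norm (\<Sum>n=a j..<a (Suc j). of_real (1 / ln (P / n)) * dz t n) \<le> 2 * (1 / (Z / P)) * (CN * Z * T powr (- (1/3) + 9 * \<epsilon> / 16))"
      proof (rule abel_log_weight[OF _ _ le])
        show "1 \<le> a j" unfolding aj by (intro nat1 loM) (use Z in auto)
        show "norm (\<Sum>n=a j..<k. dz t n) \<le> CN * Z * T powr (- (1/3) + 9 * \<epsilon> / 16)" if "a j \<le> k" "k \<le> a (Suc j)" for k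
          using that unfolding aj by (intro near[OF t, where y = "P - Z"]) (use Z P12 in auto)
        have "real n < P \<and> Z / P \<le> 1 - n / P" if "a j \<le> n" "n < a (Suc j)" for n
        proof -
          have "real n \<le> P - Z" using that f(1)[of "P - Z"] Z P12 unfolding aj by linarith
          then show ?thesis using Z P12 by (simp add: field_simps)
        qed
        then show "(\<forall>n\<ge>a j. n < a (Suc j) \<longrightarrow> real n < P \<and> Z / P \<le> 1 - n / P) \<or> (\<forall>n\<ge>a j. n < a (Suc j) \<longrightarrow> P < real n \<and> Z / P \<le> 1 - P / n)" by blast
      qed (use Z P12 in auto)
      also have "\<dots> \<le> D" using Z P12 by (intro scale) (auto simp: field_simps)
      finally show "norm (\<Sum>n=a j..<a (Suc j). of_real (1 / ln (P / n)) * dz t n) \<le> D" .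
    qed
    have right: "b 0 \<le> b K \<and> norm (\<Sum>n=b 0..<b K. of_real (1 / ln (P / n)) * dz t n) \<le> real K * D"
      if t: "T / 2 \<le> t" "t \<le> 2 * T" for t
    proof (rule blocks_bound)
      fix j assume j: "j < K"
      define Z where "Z = X j"
      have Z: "4 \<le> Z" "Y \<le> Z" "2 * Z \<le> P / 4" using X[of j] Xle[of "Suc j"] j by (auto simp: Z_def)
      have bj: "b j = f (P + Z)" "b (Suc j) = f (P + 2 * Z)" by (simp_all add: b_def X(4) Z_def)
      show le: "b j \<le> b (Suc j)" unfolding bj using Z by (intro fmono) auto
      have "norm (\<Sum>n=b j..<b (Suc j). of_real (1 / ln (P / n)) * dz t n) \<le> 2 * (1 / (3 * Z / (8 * P))) * (CN * Z * T powr (- (1/3) + 9 * \<epsilon> / 16))"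
      proof (rule abel_log_weight[OF _ _ le])
        show "1 \<le> b j" unfolding bj by (intro nat1 loM) (use Z P12 in auto)
        show "norm (\<Sum>n=b j..<k. dz t n) \<le> CN * Z * T powr (- (1/3) + 9 * \<epsilon> / 16)" if "b j \<le> k" "k \<le> b (Suc j)" for k
          using that unfolding bj by (intro near[OF t, where y = "P + 2 * Z"]) (use Z P12 in auto)
        \<comment> \<open>Rounding loses at most Z/2 of the distance, as Z >= 4, and n <= 4 P/3; the
          quotient gives 3/8.\<close>
        have "P < real n \<and> 3 * Z / (8 * P) \<le> 1 - P / n" if "b j \<le> n" "n < b (Suc j)" for n
        proof -
          have n: "P + Z / 2 \<le> real n" "real n \<le> 4/3 * P"
            using that f(2)[of "P + Z"] f(1)[of "P + 2 * Z"] Z P12 unfolding bj by linarith+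
          have "3 * Z / (8 * P) = (Z / 2) / (4/3 * P)" by simp
          also have "\<dots> \<le> (real n - P) / real n" using n Z P12 by (intro frac_le) auto
          also have "\<dots> = 1 - P / n" using n Z P12 by (simp add: diff_divide_distrib)
          finally show ?thesis using n Z by simp
        qed
        then show "(\<forall>n\<ge>b j. n < b (Suc j) \<longrightarrow> real n < P \<and> 3 * Z / (8 * P) \<le> 1 - n / P) \<or> (\<forall>n\<ge>b j. n < b (Suc j) \<longrightarrow> P < real n \<and> 3 * Z / (8 * P) \<le> 1 - P / n)" by blast
      qed (use Z P12 in auto)
      also have "\<dots> \<le> D" using Z P12 by (intro scale) auto
      finally show "norm (\<Sum>n=b j..<b (Suc j). of_real (1 / ln (P / n)) * dz t n) \<le> D" .
    qed
    define R where "R = T powr (1/6 + 5 * \<epsilon> / 8)"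
    have R0: "0 \<le> R" by (simp add: R_def)
    have ab0: "a 0 \<le> a K" "b 0 \<le> b K" using left[of T] right[of T] T by auto
    have nP: "real n < P" if "n < a K" for n
    proof -
      have "real n < real (a K)" using that by simp
      also have "\<dots> \<le> P - M0" unfolding aK using Xle[of 0] P12 by (intro f) (simp add: X_def)
      finally show ?thesis using M0 Y4 by simp
    qed
    show "\<exists>p r. 1 \<le> p \<and> p \<le> r \<and> r \<le> N \<and> real p \<le> P \<and> P < real r \<and>
        (\<forall>n. 1 \<le> n \<longrightarrow> n < p \<longrightarrow> real n < P) \<and>
        (\<forall>t. T / 2 \<le> t \<longrightarrow> t \<le> 2 * T \<longrightarrow>
          norm (\<Sum>n=p..<r. dz t n) \<le> C * T powr (9 * \<epsilon> / 16 - 2 * \<epsilon>) \<and>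
          norm (\<Sum>n=1..<p. of_real (1 / ln (P / n)) * dz t n) \<le> C * T powr (1/6 + 5 * \<epsilon> / 8) \<and>
          norm (\<Sum>n=r..<N. of_real (1 / ln (P / n)) * dz t n) \<le> C * T powr (1/6 + 5 * \<epsilon> / 8))"
    proof (rule exI[of _ "a K"], rule exI[of _ "b 0"], intro conjI allI impI)
      show "1 \<le> a K" using a_pos ab0 by simp
      show "a K \<le> b 0" by (rule ar)
      show "b 0 \<le> N" using ab0 bN by simp
      have "real (a K) \<le> P - M0" unfolding aK using Xle[of 0] P12 by (intro f) (simp add: X_def)
      then show "real (a K) \<le> P" using M0 Y4 by simp
      have "P + M0 - 1 < real (b 0)" unfolding aK using M0 Y4 P12 by (intro f) auto
      then show "P < real (b 0)" using M0 Y4 by simp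
      show "real n < P" if "n < a K" for n using nP[OF that] .
    next
      fix t assume t: "T / 2 \<le> t" "t \<le> 2 * T"
      have "norm (\<Sum>n=f (P - M0)..<f (P + M0). dz t n) \<le> CN * (2 * M0) * T powr (- (1/3) + 9 * \<epsilon> / 16)"
        using Xle[of 0] M0 Y4 ar[unfolded aK] by (intro near[OF t, where y = "P + M0"]) (auto simp: X_def)
      also have "\<dots> \<le> CN * (4 * Y) * T powr (- (1/3) + 9 * \<epsilon> / 16)" using M0 CN(1) by (intro mult_right_mono mult_left_mono) auto
      also have "\<dots> = 4 * CN * (Y * T powr (- (1/3) + 9 * \<epsilon> / 16))" by simp
      also have "Y * T powr (- (1/3) + 9 * \<epsilon> / 16) = T powr (9 * \<epsilon> / 16 - 2 * \<epsilon>)" unfolding Y_def powr_add[symmetric] by simp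
      also have "4 * CN * T powr (9 * \<epsilon> / 16 - 2 * \<epsilon>) \<le> C * T powr (9 * \<epsilon> / 16 - 2 * \<epsilon>)"
        unfolding C_def using CB(1) CN(1) KK c by (intro mult_right_mono) auto
      finally show "norm (\<Sum>n=a K..<b 0. dz t n) \<le> C * T powr (9 * \<epsilon> / 16 - 2 * \<epsilon>)" unfolding aK .
    next
      fix t assume t: "T / 2 \<le> t" "t \<le> 2 * T"
      have far: "norm (\<Sum>n=1..<a 0. of_real (1 / ln (P / n)) * dz t n) \<le> 2 * (1 / (1/4)) * (CB * R)"
      proof (rule abel_log_weight[OF _ _ a_pos])
        show "norm (\<Sum>n=1..<k. dz t n) \<le> CB * R" if "1 \<le> k" "k \<le> a 0" for k
          unfolding R_def using that ab0 ar bN by (intro B t) auto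
        have "real n < P \<and> 1/4 \<le> 1 - n / P" if "n < a 0" for n
        proof -
          have "real n < real (a 0)" using that by simp
          also have "\<dots> \<le> 3/4 * P"
          proof -
            have e: "P - X K = 3/4 * P" using XK by simp
            show ?thesis unfolding a_def diff_zero e by (rule f) (use P12 in simp)
          qed
          finally show ?thesis using P12 by (simp add: field_simps)
        qed
        then show "(\<forall>n\<ge>1. n < a 0 \<longrightarrow> real n < P \<and> 1/4 \<le> 1 - n / P) \<or> (\<forall>n\<ge>1. n < a 0 \<longrightarrow> P < real n \<and> 1/4 \<le> 1 - P / n)" by blast
      qed (use P12 in auto)
      have "(\<Sum>n=1..<a K. of_real (1 / ln (P / n)) * dz t n) = (\<Sum>n=1..<a 0. of_real (1 / ln (P / n)) * dz t n) + (\<Sum>n=a 0..<a K. of_real (1 / ln (P / n)) * dz t n)"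
        using a_pos ab0 by (subst sum.atLeastLessThan_concat) auto
      also have "norm \<dots> \<le> norm (\<Sum>n=1..<a 0. of_real (1 / ln (P / n)) * dz t n) + norm (\<Sum>n=a 0..<a K. of_real (1 / ln (P / n)) * dz t n)" by (rule norm_triangle_ineq)
      also have "\<dots> \<le> 8 * (CB * R) + KK * (16 / 3 * CN * c2) * R"
      proof (rule add_mono)
        show "norm (\<Sum>n=1..<a 0. of_real (1 / ln (P / n)) * dz t n) \<le> 8 * (CB * R)" using far by simp
        show "norm (\<Sum>n=a 0..<a K. of_real (1 / ln (P / n)) * dz t n) \<le> KK * (16 / 3 * CN * c2) * R"
          unfolding R_def by (rule order_trans[OF conjunct2[OF left[OF t]] KD])
      qed
      also have "\<dots> \<le> C * R" unfolding C_def using CB(1) CN(1) R0 by (simp add: algebra_simps)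
      finally show "norm (\<Sum>n=1..<a K. of_real (1 / ln (P / n)) * dz t n) \<le> C * T powr (1/6 + 5 * \<epsilon> / 8)" by (simp add: R_def)
    next
      fix t assume t: "T / 2 \<le> t" "t \<le> 2 * T"
      have bP: "7/6 * P \<le> real (b K)"
      proof -
        have e: "P + X K = 5/4 * P" using XK by simp
        have "5/4 * P - 1 < real (b K)" unfolding b_def e by (rule f) (use P12 in simp)
        then show ?thesis using P12 by simp
      qed
      have far: "norm (\<Sum>n=b K..<N. of_real (1 / ln (P / n)) * dz t n) \<le> 2 * (1 / (1/7)) * (2 * (CB * R))"
      proof (rule abel_log_weight[OF _ _ bN])
        show "1 \<le> b K" using bP P12 by simp
        \<comment> \<open>A sum starting at \<open>b K\<close> is a difference of two initial sums,
          hence the factor 2.\<close>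
        then show "norm (\<Sum>n=b K..<k. dz t n) \<le> 2 * (CB * R)" if "b K \<le> k" "k \<le> N" for k
        proof -
          have "(\<Sum>n=1..<k. dz t n) = (\<Sum>n=1..<b K. dz t n) + (\<Sum>n=b K..<k. dz t n)"
            using \<open>1 \<le> b K\<close> that by (subst sum.atLeastLessThan_concat) auto
          then have "(\<Sum>n=b K..<k. dz t n) = (\<Sum>n=1..<k. dz t n) - (\<Sum>n=1..<b K. dz t n)" by simp
          also have "norm \<dots> \<le> norm (\<Sum>n=1..<k. dz t n) + norm (\<Sum>n=1..<b K. dz t n)" by (rule norm_triangle_ineq4)
          also have "\<dots> \<le> CB * R + CB * R" unfolding R_def using that bN by (intro add_mono B t) auto
          finally show ?thesis by simp
        qed
        have "P < real n \<and> 1/7 \<le> 1 - P / n" if "b K \<le> n" for n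
        proof -
          have "7/6 * P \<le> real n" using bP that by (meson of_nat_le_iff order_trans)
          then show ?thesis using P12 by (simp add: field_simps)
        qed
        then show "(\<forall>n\<ge>b K. n < N \<longrightarrow> real n < P \<and> 1/7 \<le> 1 - n / P) \<or> (\<forall>n\<ge>b K. n < N \<longrightarrow> P < real n \<and> 1/7 \<le> 1 - P / n)" by blast
      qed (use P12 in auto)
      have "(\<Sum>n=b 0..<N. of_real (1 / ln (P / n)) * dz t n) = (\<Sum>n=b 0..<b K. of_real (1 / ln (P / n)) * dz t n) + (\<Sum>n=b K..<N. of_real (1 / ln (P / n)) * dz t n)"
        using bN ab0 by (subst sum.atLeastLessThan_concat) auto
      also have "norm \<dots> \<le> norm (\<Sum>n=b 0..<b K. of_real (1 / ln (P / n)) * dz t n) + norm (\<Sum>n=b K..<N. of_real (1 / ln (P / n)) * dz t n)" by (rule norm_triangle_ineq)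
      also have "\<dots> \<le> KK * (16 / 3 * CN * c2) * R + 28 * (CB * R)"
      proof (rule add_mono)
        show "norm (\<Sum>n=b K..<N. of_real (1 / ln (P / n)) * dz t n) \<le> 28 * (CB * R)" using far by simp
        show "norm (\<Sum>n=b 0..<b K. of_real (1 / ln (P / n)) * dz t n) \<le> KK * (16 / 3 * CN * c2) * R"
          unfolding R_def by (rule order_trans[OF conjunct2[OF right[OF t]] KD])
      qed
      also have "\<dots> \<le> C * R" unfolding C_def using CB(1) CN(1) R0 by (simp add: algebra_simps)
      finally show "norm (\<Sum>n=b 0..<N. of_real (1 / ln (P / n)) * dz t n) \<le> C * T powr (1/6 + 5 * \<epsilon> / 8)" by (simp add: R_def)
    qed
  qed
qed

lemma continuous_on_zeta_critical: "0 < A \<Longrightarrow> continuous_on {A..B} (\<lambda>u. zeta (Complex (1/2) u))"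
proof -
  assume "0 < A"
  have "continuous_on {A..B} (zeta \<circ> Complex (1/2))"
  proof (rule continuous_on_compose)
    show "continuous_on {A..B} (Complex (1/2))" by (intro continuous_on_Complex continuous_intros)
    show "continuous_on (Complex (1/2) ` {A..B}) zeta"
      by (rule holomorphic_on_imp_continuous_on, rule holomorphic_on_subset[OF holomorphic_zeta]) (auto simp: complex_eq_iff)
  qed
  then show ?thesis by (simp add: o_def)
qed

text \<open>The twist P^(iu) imitates e^(i\<vartheta>) with P = e^L. Outside p <= n < r the terms
  are integrated exactly, and the result collapses to the weighted sums at the two endpoints A and
  B. Inside, the pointwise bound T^(9\<epsilon>/16 - 2\<epsilon>) is multiplied by a length of order
  T^(1/6 + 2\<epsilon>), and the two 2\<epsilon> cancel.\<close>

lemma integral_zeta_twisted: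
  fixes \<epsilon> c1 c2 :: real
  assumes \<epsilon>: "0 < \<epsilon>" "\<epsilon> \<le> 1 / 100" and c: "0 < c1" "1 \<le> c2"
  obtains C T0 where "0 < C" "4 \<le> T0" "\<And>T P A B. T0 \<le> T \<Longrightarrow> c1 * T powr (1/2) \<le> P \<Longrightarrow> P \<le> c2 * T powr (1/2) \<Longrightarrow>
      T / 2 \<le> A \<Longrightarrow> A \<le> B \<Longrightarrow> B \<le> 2 * T \<Longrightarrow> B - A \<le> 3 * T powr (1/6 + 2 * \<epsilon>) \<Longrightarrow>
      norm (integral {A..B} (\<lambda>u. zeta (Complex (1/2) u) * cis (u * ln P))) \<le> C * T powr (1/6 + 5 * \<epsilon> / 8)"
proof -
  obtain C T0 where C: "0 < C" "4 \<le> T0" and main: "\<And>T P N. T0 \<le> T \<Longrightarrow> c1 * T powr (1/2) \<le> P \<Longrightarrow> P \<le> c2 * T powr (1/2) \<Longrightarrow>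
      T powr (4/3 + \<epsilon>) \<le> real N \<Longrightarrow> real N \<le> 2 * T powr (4/3 + \<epsilon>) \<Longrightarrow>
      \<exists>p r. 1 \<le> p \<and> p \<le> r \<and> r \<le> N \<and> real p \<le> P \<and> P < real r \<and>
        (\<forall>n. 1 \<le> n \<longrightarrow> n < p \<longrightarrow> real n < P) \<and>
        (\<forall>t. T / 2 \<le> t \<longrightarrow> t \<le> 2 * T \<longrightarrow>
          norm (\<Sum>n=p..<r. dz t n) \<le> C * T powr (9 * \<epsilon> / 16 - 2 * \<epsilon>) \<and>
          norm (\<Sum>n=1..<p. of_real (1 / ln (P / n)) * dz t n) \<le> C * T powr (1/6 + 5 * \<epsilon> / 8) \<and>
          norm (\<Sum>n=r..<N. of_real (1 / ln (P / n)) * dz t n) \<le> C * T powr (1/6 + 5 * \<epsilon> / 8))"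
    using stationary_sum_bound[OF \<epsilon> c] by blast
  have C': "0 < 7 * C + 60" using C by simp
  show ?thesis
  proof (rule that[OF C' C(2)])
    fix T P A B :: real
    assume T0: "T0 \<le> T" and P: "c1 * T powr (1/2) \<le> P" "P \<le> c2 * T powr (1/2)" and AB: "T / 2 \<le> A" "A \<le> B" "B \<le> 2 * T" "B - A \<le> 3 * T powr (1/6 + 2 * \<epsilon>)"
    have T: "4 \<le> T" using T0 C by simp
    define N where "N = nat \<lceil>T powr (4/3 + \<epsilon>)\<rceil>"
    have N: "T powr (4/3 + \<epsilon>) \<le> real N" unfolding N_def by linarith
    have err: "norm (zeta (Complex (1/2) u) - (\<Sum>n=1..<N. dz u n)) \<le> 20 * T powr (- (3/2) * \<epsilon>)" "real N \<le> 2 * T powr (4/3 + \<epsilon>)"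
      if u: "T / 2 \<le> u" "u \<le> 2 * T" for u
    proof -
      have "(\<Sum>n=1..<N. of_nat n powr (- Complex (1/2) u)) = (\<Sum>n=1..<N. dz u n)"
      proof (rule sum.cong[OF refl])
        fix n assume "n \<in> {1..<N}"
        then show "of_nat n powr (- Complex (1/2) u) = dz u n" using of_nat_powr_eq_dz[of n "1/2" u] by simp
      qed
      then show "norm (zeta (Complex (1/2) u) - (\<Sum>n=1..<N. dz u n)) \<le> 20 * T powr (- (3/2) * \<epsilon>)" "real N \<le> 2 * T powr (4/3 + \<epsilon>)"
        using zeta_error_le[OF \<epsilon> T _ _ _ _ N_def, of "Complex (1/2) u"] u by auto
    qed
    obtain p r where pr: "1 \<le> p" "p \<le> r" "r \<le> N" "real p \<le> P" "P < real r" "\<And>n. 1 \<le> n \<Longrightarrow> n < p \<Longrightarrow> real n < P"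
      and bd: "\<And>t. T / 2 \<le> t \<Longrightarrow> t \<le> 2 * T \<Longrightarrow> norm (\<Sum>n=p..<r. dz t n) \<le> C * T powr (9 * \<epsilon> / 16 - 2 * \<epsilon>) \<and>
          norm (\<Sum>n=1..<p. of_real (1 / ln (P / n)) * dz t n) \<le> C * T powr (1/6 + 5 * \<epsilon> / 8) \<and>
          norm (\<Sum>n=r..<N. of_real (1 / ln (P / n)) * dz t n) \<le> C * T powr (1/6 + 5 * \<epsilon> / 8)"
      using main[OF T0 P N err(2)[of T]] T by auto
    have Ppos: "0 < P" using pr by linarith
    define R where "R = T powr (1/6 + 5 * \<epsilon> / 8)"
    define Out where "Out = {1..<p} \<union> {r..<N}"
    \<comment> \<open>No n outside [p, r) equals P, so each of these phases is non-constant and has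
      the usual antiderivative.\<close>
    have Oz: "ln (P / n) \<noteq> 0 \<and> 0 < n" if "n \<in> Out" for n
    proof -
      have "n < p \<or> r \<le> n" "0 < n" using that pr(1,2) by (auto simp: Out_def)
      then have "real n < P \<or> P < real n" using pr(6)[of n] pr(5) by (smt (verit) One_nat_def Suc_leI of_nat_le_iff)
      then have "P / n \<noteq> 1" using \<open>0 < n\<close> by auto
      then show ?thesis using Ppos \<open>0 < n\<close> by simp
    qed
    have sumOut: "(\<Sum>n\<in>Out. h n) = (\<Sum>n=1..<p. h n) + (\<Sum>n=r..<N. h n)" for h :: "nat \<Rightarrow> complex"
      unfolding Out_def using pr(2) by (intro sum.union_disjoint) auto
    have sumAll: "(\<Sum>n=1..<N. h n) = (\<Sum>n\<in>Out. h n) + (\<Sum>n=p..<r. h n)" for h :: "nat \<Rightarrow> complex"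
    proof -
      have "(\<Sum>n=1..<N. h n) = (\<Sum>n=1..<p. h n) + ((\<Sum>n=p..<r. h n) + (\<Sum>n=r..<N. h n))"
        using pr(1-3) by (simp add: sum.atLeastLessThan_concat)
      then show ?thesis unfolding sumOut by simp
    qed
    \<comment> \<open>\<open>h\<close> is the part that is integrated exactly; \<open>r'\<close>
      collects the truncation error and the terms next to P.\<close>
    define h where "h u = (\<Sum>n\<in>Out. dz u n * cis (u * ln P))" for u
    define r' where "r' u = zeta (Complex (1/2) u) * cis (u * ln P) - h u" for u
    have dzc: "dz u n * cis (u * ln P) = of_real (1 / sqrt n) * cis (u * ln (P / n))" if "0 < n" for u n
      using that Ppos by (simp add: dz_def cis_mult ln_div algebra_simps)
    define EO where "EO t = (\<Sum>n\<in>Out. of_real (1 / ln (P / n)) * dz t n)" for t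
    have EO: "norm (EO t) \<le> 2 * C * R" if "T / 2 \<le> t" "t \<le> 2 * T" for t
      unfolding EO_def sumOut R_def using bd[OF that] by (intro order_trans[OF norm_triangle_ineq]) simp
    have hI: "(h has_integral (\<Sum>n\<in>Out. of_real (1 / sqrt n) * ((cis (B * ln (P / n)) - cis (A * ln (P / n))) / (\<i> * of_real (ln (P / n)))))) {A..B}"
      unfolding h_def
    proof (intro has_integral_sum)
      fix n assume n: "n \<in> Out"
      have "((\<lambda>u. of_real (1 / sqrt n) * cis (u * ln (P / n))) has_integral of_real (1 / sqrt n) * ((cis (B * ln (P / n)) - cis (A * ln (P / n))) / (\<i> * of_real (ln (P / n))))) {A..B}"
        using Oz[OF n] AB by (intro has_integral_mult_right has_integral_cis_linear) auto
      then show "((\<lambda>u. dz u n * cis (u * ln P)) has_integral of_real (1 / sqrt n) * ((cis (B * ln (P / n)) - cis (A * ln (P / n))) / (\<i> * of_real (ln (P / n))))) {A..B}"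
        using Oz[OF n] by (simp add: dzc)
    qed (simp add: Out_def)
    also have "(\<Sum>n\<in>Out. of_real (1 / sqrt n) * ((cis (B * ln (P / n)) - cis (A * ln (P / n))) / (\<i> * of_real (ln (P / n)))))
       = (cis (B * ln P) * EO B - cis (A * ln P) * EO A) / \<i>"
      unfolding EO_def sum_distrib_left sum_subtractf[symmetric] sum_divide_distrib
    proof (rule sum.cong[OF refl])
      fix n assume n: "n \<in> Out"
      have e: "cis (t * ln P) * (of_real (1 / ln (P / n)) * dz t n) = of_real (1 / ln (P / n)) * (of_real (1 / sqrt n) * cis (t * ln (P / n)))" for t
        using dzc[of n t] Oz[OF n] by (metis mult.assoc mult.commute)
      show "of_real (1 / sqrt n) * ((cis (B * ln (P / n)) - cis (A * ln (P / n))) / (\<i> * of_real (ln (P / n)))) =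
         (cis (B * ln P) * (of_real (1 / ln (P / n)) * dz B n) - cis (A * ln P) * (of_real (1 / ln (P / n)) * dz A n)) / \<i>"
      proof -
        have alg: "q * ((x - y) / (i * l)) = (1 / l * (q * x) - 1 / l * (q * y)) / i" for q x y i l :: complex
          by (cases "l = 0"; cases "i = 0") (simp_all add: field_simps)
        show ?thesis unfolding e unfolding of_real_divide[of 1 "ln (P / n)"] of_real_1 by (rule alg)
      qed
    qed
    finally have hI: "(h has_integral (cis (B * ln P) * EO B - cis (A * ln P) * EO A) / \<i>) {A..B}" .
    have hb: "norm (integral {A..B} h) \<le> 4 * C * R"
    proof -
      have "norm (integral {A..B} h) = norm (cis (B * ln P) * EO B - cis (A * ln P) * EO A)"
        unfolding integral_unique[OF hI] by (simp only: norm_divide norm_ii div_by_1)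
      also have "\<dots> \<le> norm (cis (B * ln P) * EO B) + norm (cis (A * ln P) * EO A)" by (rule norm_triangle_ineq4)
      also have "\<dots> = norm (EO B) + norm (EO A)" by (simp add: norm_mult)
      also have "\<dots> \<le> 2 * C * R + 2 * C * R" using AB by (intro add_mono EO) auto
      finally show ?thesis by simp
    qed
    have zi: "(\<lambda>u. zeta (Complex (1/2) u) * cis (u * ln P)) integrable_on {A..B}"
      using AB T by (intro integrable_continuous_real continuous_intros continuous_on_zeta_critical) auto
    have ri: "r' integrable_on {A..B}" unfolding r'_def using zi hI by (intro integrable_diff) auto
    have rb: "norm (r' u) \<le> C * T powr (9 * \<epsilon> / 16 - 2 * \<epsilon>) + 20 * T powr (- (3/2) * \<epsilon>)" if "u \<in> {A..B}" for u
    proof -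
      have u: "T / 2 \<le> u" "u \<le> 2 * T" using that AB by auto
      have "r' u = ((zeta (Complex (1/2) u) - (\<Sum>n=1..<N. dz u n)) + (\<Sum>n=p..<r. dz u n)) * cis (u * ln P)"
        unfolding r'_def h_def sumAll by (simp add: algebra_simps sum_distrib_right)
      then have "norm (r' u) = norm ((zeta (Complex (1/2) u) - (\<Sum>n=1..<N. dz u n)) + (\<Sum>n=p..<r. dz u n))" by (simp add: norm_mult)
      also have "\<dots> \<le> norm (zeta (Complex (1/2) u) - (\<Sum>n=1..<N. dz u n)) + norm (\<Sum>n=p..<r. dz u n)" by (rule norm_triangle_ineq)
      also have "\<dots> \<le> 20 * T powr (- (3/2) * \<epsilon>) + C * T powr (9 * \<epsilon> / 16 - 2 * \<epsilon>)"
        using err(1)[OF u] bd[OF u] by (intro add_mono) auto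
      finally show ?thesis by simp
    qed
    have "norm (integral {A..B} r') \<le> (C * T powr (9 * \<epsilon> / 16 - 2 * \<epsilon>) + 20 * T powr (- (3/2) * \<epsilon>)) * (B - A)"
      by (rule norm_integral_le[OF ri _ rb]) (use AB in auto)
    also have "\<dots> \<le> (C * T powr (9 * \<epsilon> / 16 - 2 * \<epsilon>) + 20 * T powr (- (3/2) * \<epsilon>)) * (3 * T powr (1/6 + 2 * \<epsilon>))"
      using AB C by (intro mult_left_mono) auto
    also have "\<dots> = 3 * C * T powr (9 * \<epsilon> / 16 - 2 * \<epsilon> + (1/6 + 2 * \<epsilon>)) + 60 * T powr (- (3/2) * \<epsilon> + (1/6 + 2 * \<epsilon>))"
      unfolding powr_add by (simp add: algebra_simps)
    also have "\<dots> \<le> 3 * C * R + 60 * R"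
    proof (intro add_mono mult_left_mono)
      show "T powr (9 * \<epsilon> / 16 - 2 * \<epsilon> + (1/6 + 2 * \<epsilon>)) \<le> R" unfolding R_def by (rule powr_mono) (use T \<epsilon> in auto)
      show "T powr (- (3/2) * \<epsilon> + (1/6 + 2 * \<epsilon>)) \<le> R" unfolding R_def by (rule powr_mono) (use T \<epsilon> in auto)
    qed (use C in auto)
    finally have "norm (integral {A..B} r') \<le> 3 * C * R + 60 * R" .
    moreover have "integral {A..B} (\<lambda>u. zeta (Complex (1/2) u) * cis (u * ln P)) = integral {A..B} h + integral {A..B} r'"
    proof -
      have "integral {A..B} (\<lambda>u. h u + r' u) = integral {A..B} h + integral {A..B} r'" using hI ri by (intro integral_add) auto
      then show ?thesis by (simp add: r'_def)
    qed
    ultimately show "norm (integral {A..B} (\<lambda>u. zeta (Complex (1/2) u) * cis (u * ln P))) \<le> (7 * C + 60) * T powr (1/6 + 5 * \<epsilon> / 8)"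
      using hb norm_triangle_ineq[of "integral {A..B} h" "integral {A..B} r'"] unfolding R_def[symmetric] by (simp add: algebra_simps)
  qed
qed

section \<open>The residue formula for sums over equally spaced points of the critical line\<close>

text \<open>The reflection z -> 1 - cnj z turns dz into - cnj dz, and the antisymmetry of G supplies
  a second sign, so the reflected integral is the conjugate.\<close>

lemma contour_integral_linepath_reflect:
  assumes "\<And>z. z \<in> closed_segment p q \<Longrightarrow> G (1 - cnj z) = - cnj (G z)"
  shows "contour_integral (linepath (1 - cnj p) (1 - cnj q)) G = cnj (contour_integral (linepath p q) G)"
proof -
  have lp: "linepath (1 - cnj p) (1 - cnj q) x = 1 - cnj (linepath p q x)" for x
    by (simp add: linepath_def scaleR_conv_of_real algebra_simps)
  have "contour_integral (linepath (1 - cnj p) (1 - cnj q)) G = integral {0..1} (\<lambda>x. G (linepath (1 - cnj p) (1 - cnj q) x) * (1 - cnj q - (1 - cnj p)))"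
    by (simp add: contour_integral_integral)
  also have "\<dots> = integral {0..1} (\<lambda>x. cnj (G (linepath p q x) * (q - p)))"
  proof (rule integral_cong)
    fix x :: real assume "x \<in> {0..1}"
    then have "linepath p q x \<in> closed_segment p q" by (auto simp: linepath_in_path)
    from assms[OF this] show "G (linepath (1 - cnj p) (1 - cnj q) x) * (1 - cnj q - (1 - cnj p)) = cnj (G (linepath p q x) * (q - p))"
      unfolding lp by (simp add: algebra_simps)
  qed
  also have "\<dots> = cnj (integral {0..1} (\<lambda>x. G (linepath p q x) * (q - p)))" by (rule integral_cnj[symmetric])
  also have "integral {0..1} (\<lambda>x. G (linepath p q x) * (q - p)) = contour_integral (linepath p q) G"
    by (simp add: contour_integral_integral)
  finally show ?thesis .
qed

lemma contour_integral_rectpath: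
  assumes "continuous_on (path_image (rectpath a1 a3)) f"
  defines "a2 \<equiv> Complex (Re a3) (Im a1)" and "a4 \<equiv> Complex (Re a1) (Im a3)"
  shows "contour_integral (rectpath a1 a3) f = contour_integral (linepath a1 a2) f + contour_integral (linepath a2 a3) f
    + contour_integral (linepath a3 a4) f + contour_integral (linepath a4 a1) f"
proof -
  have "path_image (rectpath a1 a3) = closed_segment a1 a2 \<union> closed_segment a2 a3 \<union> closed_segment a3 a4 \<union> closed_segment a4 a1"
    unfolding rectpath_def Let_def a2_def[symmetric] a4_def[symmetric] by (simp add: path_image_join Un_assoc)
  then have c: "f contour_integrable_on linepath a1 a2" "f contour_integrable_on linepath a2 a3"
    "f contour_integrable_on linepath a3 a4" "f contour_integrable_on linepath a4 a1"
    using assms(1) by (auto intro!: contour_integrable_continuous_linepath elim: continuous_on_subset)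
  show ?thesis unfolding rectpath_def Let_def a2_def[symmetric] a4_def[symmetric]
    using c by (simp add: contour_integral_join contour_integrable_joinI valid_path_join)
qed

text \<open>The points are zeros of 1 - w, and G = F/2 + F w/(1 - w) has simple poles there with
  residue F/L. Reflection replaces w by 1/cnj w, which makes G = (F/2)(1 + w)/(1 - w) antisymmetric;
  hence the rectangle integral is X - cnj X = 2 i Im X, with X the integral over the right half. The
  F/2 part of X is deformed to the critical line. The heights y1 and y2 lie halfway between
  consecutive points, where w is real and negative and 1 - w stays away from 0.\<close>

lemma reflected_sum_formula:
  fixes F :: "complex \<Rightarrow> complex" and L \<beta> :: real and a b :: int
  assumes F: "F holomorphic_on {s. 0 < Im s}"
    and Frefl: "\<And>s. 0 < Im s \<Longrightarrow> - 1 / 2 \<le> Re s \<Longrightarrow> Re s \<le> 3/2 \<Longrightarrow> F (1 - cnj s) = cnj (F s)"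
    and L: "0 < L" and ab: "a < b" and pos: "0 < 2 * pi * a - \<beta>"
  defines "w \<equiv> \<lambda>s. exp (- \<i> * of_real \<beta> - of_real L * (s - 1 / 2))"
    and "y1 \<equiv> (2 * pi * a + pi - \<beta>) / L" and "y2 \<equiv> (2 * pi * b + pi - \<beta>) / L"
  defines "g \<equiv> \<lambda>s. F s * w s / (1 - w s)"
  shows "(\<Sum>\<nu>\<in>{a<..b}. F (Complex (1/2) ((2 * pi * \<nu> - \<beta>) / L))) =
    of_real (L / (2 * pi) * Re (integral {y1..y2} (\<lambda>u. F (Complex (1/2) u)))
      + L / pi * Im (contour_integral (linepath (Complex (1/2) y1) (Complex (3/2) y1)) g
         + contour_integral (linepath (Complex (3/2) y1) (Complex (3/2) y2)) g
         + contour_integral (linepath (Complex (3/2) y2) (Complex (1/2) y2)) g))"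
proof -
  define c where "c \<nu> = Complex (1/2) ((2 * pi * \<nu> - \<beta>) / L)" for \<nu> :: int
  define P where "P = c ` {a<..b}"
  \<comment> \<open>The strip is bounded by the heights of the points with numbers a and b + 1;
    being open, it contains exactly those with a < \<nu> <= b.\<close>
  define S where "S = {s. 0 < Im s} \<inter> {s. y1 - pi / L < Im s} \<inter> {s. Im s < y2 + pi / L}"
  define G where "G s = F s / 2 + g s" for s
  have y1e: "y1 - pi / L = (2 * pi * a - \<beta>) / L" and y2e: "y2 + pi / L = (2 * pi * (b + 1) - \<beta>) / L"
    by (auto simp: y1_def y2_def diff_divide_distrib add_divide_distrib algebra_simps)
  have y1pos: "0 < y1 - pi / L" unfolding y1e using pos L by simp
  have y12: "y1 < y2" unfolding y1_def y2_def using L ab by (intro divide_strict_right_mono) auto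
  have piL: "0 < pi / L" using L by simp
  have opS: "open S" unfolding S_def by (intro open_Int open_halfspace_Im_gt open_halfspace_Im_lt)
  have cvS: "convex S" unfolding S_def by (intro convex_Int convex_halfspace_Im_gt convex_halfspace_Im_lt)
  have w1: "w s = 1 \<longleftrightarrow> (\<exists>\<nu>. s = c \<nu>)" for s
  proof -
    have "w s = 1 \<longleftrightarrow> L * (Re s - 1/2) = 0 \<and> (\<exists>n::int. - \<beta> - L * Im s = of_int (2 * n) * pi)"
      unfolding w_def exp_eq_1 by simp
    also have "\<dots> \<longleftrightarrow> (\<exists>\<nu>. s = c \<nu>)"
    proof
      assume "L * (Re s - 1/2) = 0 \<and> (\<exists>n::int. - \<beta> - L * Im s = of_int (2 * n) * pi)"
      then obtain n :: int where "Re s = 1/2" "- \<beta> - L * Im s = of_int (2 * n) * pi" using L by auto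
      then have "s = c (- n)" using L by (auto simp: c_def complex_eq_iff field_simps)
      then show "\<exists>\<nu>. s = c \<nu>" ..
    next
      assume "\<exists>\<nu>. s = c \<nu>"
      then obtain \<nu> where s: "s = c \<nu>" ..
      have "- \<beta> - L * Im s = of_int (2 * (- \<nu>)) * pi" using L by (simp add: s c_def)
      then show "L * (Re s - 1/2) = 0 \<and> (\<exists>n::int. - \<beta> - L * Im s = of_int (2 * n) * pi)"
        using s by (auto simp: c_def intro!: exI[of _ "- \<nu>"])
    qed
    finally show ?thesis .
  qed
  have cS: "c \<nu> \<in> S \<longleftrightarrow> \<nu> \<in> {a<..b}" for \<nu>
  proof -
    have 1: "y1 - pi / L < Im (c \<nu>) \<longleftrightarrow> a < \<nu>"
      unfolding y1e c_def using L by (simp add: divide_less_cancel)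
    have "Im (c \<nu>) < y2 + pi / L \<longleftrightarrow> real_of_int \<nu> < real_of_int (b + 1)"
      unfolding y2e c_def using L by (simp add: divide_less_cancel del: of_int_add)
    then have 2: "Im (c \<nu>) < y2 + pi / L \<longleftrightarrow> \<nu> \<le> b" by (simp only: of_int_less_iff) auto
    show ?thesis using 1 2 y1pos by (auto simp: S_def)
  qed
  have wP: "w s \<noteq> 1" if "s \<in> S - P" for s using that w1 cS by (auto simp: P_def)
  have Fh: "F holomorphic_on S" by (rule holomorphic_on_subset[OF F]) (auto simp: S_def)
  have wh: "w holomorphic_on A" for A unfolding w_def by (intro holomorphic_intros)
  have gh: "g holomorphic_on S - P" unfolding g_def
    by (intro holomorphic_intros wh holomorphic_on_subset[OF Fh]) (use wP in auto)
  have Gh: "G holomorphic_on S - P" unfolding G_def by (intro holomorphic_intros gh holomorphic_on_subset[OF Fh]) auto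
  \<comment> \<open>1 - w vanishes to first order with derivative L, because w' = - L w and w = 1 at
    the point; the summand F/2 is regular.\<close>
  have res: "residue G (c \<nu>) = F (c \<nu>) / of_real L" if \<nu>: "\<nu> \<in> {a<..b}" for \<nu>
  proof (rule residue_simple')
    define U where "U = S - (P - {c \<nu>})"
    show "open U" unfolding U_def using opS by (intro open_Diff finite_imp_closed) (auto simp: P_def)
    show "c \<nu> \<in> U" using cS \<nu> by (auto simp: U_def)
    show "G holomorphic_on U - {c \<nu>}" by (rule holomorphic_on_subset[OF Gh]) (auto simp: U_def)
    have w1': "w (c \<nu>) = 1" using w1 by blast
    have Fc: "isCont F (c \<nu>)" using holomorphic_on_imp_continuous_on[OF Fh] cS \<nu> opS by (simp add: continuous_on_eq_continuous_at)
    have "(w has_field_derivative w (c \<nu>) * (- of_real L)) (at (c \<nu>))"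
      unfolding w_def by (auto intro!: derivative_eq_intros)
    then have "((\<lambda>s. (w s - w (c \<nu>)) / (s - c \<nu>)) \<longlongrightarrow> - of_real L) (at (c \<nu>))"
      by (simp add: has_field_derivative_iff w1')
    then have "((\<lambda>s. inverse (- ((w s - w (c \<nu>)) / (s - c \<nu>)))) \<longlongrightarrow> inverse (- (- of_real L))) (at (c \<nu>))"
      using L by (intro tendsto_inverse tendsto_minus) auto
    moreover have "inverse (- ((w s - w (c \<nu>)) / (s - c \<nu>))) = (s - c \<nu>) / (1 - w s)" for s
      unfolding w1' by (simp add: inverse_eq_divide) (metis minus_diff_eq minus_divide_right divide_minus_left)
    ultimately have lim: "((\<lambda>s. (s - c \<nu>) / (1 - w s)) \<longlongrightarrow> inverse (of_real L)) (at (c \<nu>))" by simp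
    have wc: "(w \<longlongrightarrow> 1) (at (c \<nu>))"
    proof -
      have "isCont w (c \<nu>)" unfolding w_def by (intro continuous_intros)
      then show ?thesis unfolding isCont_def w1' .
    qed
    have lim2: "((\<lambda>s. F s / 2 * (s - c \<nu>) + F s * w s * ((s - c \<nu>) / (1 - w s))) \<longlongrightarrow> F (c \<nu>) / 2 * (c \<nu> - c \<nu>) + F (c \<nu>) * 1 * inverse (of_real L)) (at (c \<nu>))"
      using Fc by (intro tendsto_intros lim wc) (auto simp: isCont_def)
    have alg: "x / 2 * d + x * v * (d / e) = (x / 2 + x * v / e) * d" for x d v e :: complex
      by (simp add: distrib_right)
    have e2: "F (c \<nu>) / 2 * (c \<nu> - c \<nu>) + F (c \<nu>) * 1 * inverse (of_real L) = F (c \<nu>) / of_real L"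
      by (simp only: diff_self mult_zero_right add_0 mult_1_right divide_inverse)
    show "((\<lambda>s. G s * (s - c \<nu>)) \<longlongrightarrow> F (c \<nu>) / of_real L) (at (c \<nu>))"
      using lim2 unfolding alg e2 G_def g_def .
  qed
  \<comment> \<open>The corners of the rectangle, symmetric about Re s = 1/2, and the midpoints of
    its horizontal sides on the critical line.\<close>
  define a1 a2 a3 a4 mA mB where "a1 = Complex (- 1 / 2) y1" "a2 = Complex (3/2) y1" "a3 = Complex (3/2) y2" "a4 = Complex (- 1 / 2) y2"
    "mA = Complex (1/2) y1" "mB = Complex (1/2) y2"
  note ad = this
  have Pim: "Im p \<noteq> y1 \<and> Im p \<noteq> y2 \<and> y1 < Im p \<and> Im p < y2 \<and> Re p = 1/2" if p: "p \<in> P" for p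
  proof -
    obtain \<nu> where \<nu>: "a < \<nu>" "\<nu> \<le> b" "p = c \<nu>" using p unfolding P_def by auto
    have "real_of_int a + 1 \<le> \<nu>" "real_of_int \<nu> \<le> b" using \<nu> by linarith+
    then have "pi * (real_of_int a + 1) \<le> pi * \<nu>" "pi * \<nu> \<le> pi * b" by (intro mult_left_mono; simp)+
    then have "pi * a + pi \<le> pi * \<nu>" "pi * \<nu> \<le> pi * b" by (simp_all only: distrib_left mult_1_right)
    then have "2 * pi * a + pi - \<beta> < 2 * pi * \<nu> - \<beta>" "2 * pi * \<nu> - \<beta> < 2 * pi * b + pi - \<beta>"
      using pi_gt_zero by linarith+
    then have "y1 < Im p" "Im p < y2" unfolding y1_def y2_def \<nu> c_def using L by (auto intro!: divide_strict_right_mono)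
    then show ?thesis by (simp add: \<nu> c_def)
  qed
  have inS: "Complex x y \<in> S" if "y1 \<le> y" "y \<le> y2" for x y using that y1pos piL by (auto simp: S_def)
  have segP: "closed_segment (Complex x1 z1) (Complex x2 z2) \<subseteq> S - P"
    if "(z1 = z2 \<and> (z1 = y1 \<or> z1 = y2)) \<or> (x1 = x2 \<and> x1 \<noteq> 1/2 \<and> z1 \<in> {y1..y2} \<and> z2 \<in> {y1..y2})" for x1 z1 x2 z2
  proof
    fix z assume "z \<in> closed_segment (Complex x1 z1) (Complex x2 z2)"
    then obtain r where r: "0 \<le> r" "r \<le> 1" "z = (1 - r) *\<^sub>R Complex x1 z1 + r *\<^sub>R Complex x2 z2" by (auto simp: closed_segment_def)
    have Imz: "Im z = (1 - r) * z1 + r * z2" "Re z = (1 - r) * x1 + r * x2" using r by auto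
    have "Im z \<in> {y1..y2}"
    proof -
      have "z1 \<in> {y1..y2}" "z2 \<in> {y1..y2}" using that y12 by auto
      then show ?thesis using r convexD_alt[of "{y1..y2}" z1 z2 r] unfolding Imz by simp
    qed
    then have "z \<in> S" using inS[of "Im z" "Re z"] by simp
    moreover have "z \<notin> P"
    proof
      assume "z \<in> P"
      from Pim[OF this] have p: "Im z \<noteq> y1" "Im z \<noteq> y2" "Re z = 1/2" by auto
      show False using that
      proof
        assume "z1 = z2 \<and> (z1 = y1 \<or> z1 = y2)"
        then show False using p unfolding Imz by (auto simp: algebra_simps)
      next
        assume "x1 = x2 \<and> x1 \<noteq> 1/2 \<and> z1 \<in> {y1..y2} \<and> z2 \<in> {y1..y2}"
        then show False using p(3) unfolding Imz by (auto simp: algebra_simps)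
      qed
    qed
    ultimately show "z \<in> S - P" by simp
  qed
  have segs: "closed_segment a1 a2 \<subseteq> S - P" "closed_segment a2 a3 \<subseteq> S - P" "closed_segment a3 a4 \<subseteq> S - P" "closed_segment a4 a1 \<subseteq> S - P"
    "closed_segment mA a2 \<subseteq> S - P" "closed_segment a3 mB \<subseteq> S - P" "closed_segment mB a3 \<subseteq> S - P" "closed_segment a2 mA \<subseteq> S - P"
    "closed_segment a3 a2 \<subseteq> S - P" "closed_segment a1 mA \<subseteq> S - P" "closed_segment mB a4 \<subseteq> S - P"
    unfolding ad by (rule segP; use y12 in simp)+
  have rp: "rectpath a1 a3 = linepath a1 a2 +++ linepath a2 a3 +++ linepath a3 a4 +++ linepath a4 a1"
    by (simp add: rectpath_def Let_def ad)
  have imgP: "path_image (rectpath a1 a3) \<subseteq> S - P"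
    unfolding rp using segs by (simp add: path_image_join)
  have contG: "continuous_on A G" if "A \<subseteq> S - P" for A
    using holomorphic_on_imp_continuous_on[OF Gh] that by (rule continuous_on_subset)
  have RT: "contour_integral (rectpath a1 a3) G = 2 * pi * \<i> * (\<Sum>p\<in>P. winding_number (rectpath a1 a3) p * residue G p)"
  proof (rule Residue_theorem[OF opS convex_connected[OF cvS] _ Gh])
    show "\<forall>z. z \<notin> S \<longrightarrow> winding_number (rectpath a1 a3) z = 0"
      using imgP by (auto intro!: winding_number_zero_outside[OF _ cvS])
  qed (use imgP in \<open>auto simp: P_def\<close>)
  also have "(\<Sum>p\<in>P. winding_number (rectpath a1 a3) p * residue G p) = (\<Sum>p\<in>P. F p / of_real L)"
  proof (rule sum.cong[OF refl])
    fix p assume p: "p \<in> P"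
    have "p \<in> box a1 a3" using Pim[OF p] by (auto simp: ad in_box_complex_iff)
    then have "winding_number (rectpath a1 a3) p = 1" by (rule winding_number_rectpath)
    then show "winding_number (rectpath a1 a3) p * residue G p = F p / of_real L" using p res by (auto simp: P_def)
  qed
  also have "\<dots> = (\<Sum>\<nu>\<in>{a<..b}. F (c \<nu>)) / of_real L"
  proof -
    have "inj_on c {a<..b}" using L by (auto simp: inj_on_def c_def)
    then show ?thesis unfolding P_def by (simp add: sum.reindex sum_divide_distrib)
  qed
  finally have RT: "contour_integral (rectpath a1 a3) G = 2 * pi * \<i> * ((\<Sum>\<nu>\<in>{a<..b}. F (c \<nu>)) / of_real L)" .
  \<comment> \<open>Reflection inverts the modulus exp (-L (Re s - 1/2)) of w and keeps its
    argument.\<close>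
  have wr: "w (1 - cnj s) * cnj (w s) = 1" for s
  proof -
    have "w (1 - cnj s) * cnj (w s) = exp ((- \<i> * of_real \<beta> - of_real L * (1 - cnj s - 1 / 2)) + cnj (- \<i> * of_real \<beta> - of_real L * (s - 1 / 2)))"
      unfolding w_def exp_cnj[symmetric] exp_add ..
    also have "(- \<i> * of_real \<beta> - of_real L * (1 - cnj s - 1 / 2)) + cnj (- \<i> * of_real \<beta> - of_real L * (s - 1 / 2)) = 0"
      by (simp add: algebra_simps)
    finally show ?thesis by simp
  qed
  \<comment> \<open>With v = cnj w the reflected quotient is (1/v)/(1 - 1/v) = -1/(1 - v) = -(1 +
    v/(1 - v)); the stray 1 is what the summand F/2 balances.\<close>
  have Gr: "G (1 - cnj s) = - cnj (G s)" if "s \<in> S - P" "- 1 / 2 \<le> Re s" "Re s \<le> 3/2" for s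
  proof -
    have Fr: "F (1 - cnj s) = cnj (F s)" using that by (intro Frefl) (auto simp: S_def)
    define v where "v = cnj (w s)"
    have v: "v \<noteq> 0" "v \<noteq> 1" using wP[OF that(1)] unfolding v_def by (auto simp: w_def)
    have wv: "w (1 - cnj s) = 1 / v" using wr[of s] v by (simp add: v_def field_simps)
    have "1 - 1 / v \<noteq> 0" "1 - v \<noteq> 0" using v by (auto simp: field_simps)
    then have "(1 / v) / (1 - 1 / v) = - 1 / (1 - v)" using v by (simp add: divide_simps)
    then have "G (1 - cnj s) = cnj (F s) / 2 + cnj (F s) * (- 1 / (1 - v))"
      unfolding G_def g_def Fr wv by (metis times_divide_eq_right)
    also have "\<dots> = - (cnj (F s) / 2 + cnj (F s) * v / (1 - v))"
      using \<open>1 - v \<noteq> 0\<close> by (simp add: field_simps)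
    also have "\<dots> = - cnj (G s)" by (simp add: G_def g_def v_def)
    finally show ?thesis .
  qed
  have rng: "- 1 / 2 \<le> Re z \<and> Re z \<le> 3/2" if z: "z \<in> closed_segment p q" and pq: "Re p \<in> {- 1 / 2..3/2}" "Re q \<in> {- 1 / 2..3/2}" for z p q
  proof -
    obtain r where r: "0 \<le> r" "r \<le> 1" "z = (1 - r) *\<^sub>R p + r *\<^sub>R q" using z by (auto simp: closed_segment_def)
    then have "Re z = (1 - r) * Re p + r * Re q" by simp
    then show ?thesis using convexD_alt[of "{- 1 / 2..3/2::real}" "Re p" "Re q" r] r pq by simp
  qed
  define I where "I f p q = contour_integral (linepath p q) f" for f p q
  have rf: "I G (1 - cnj p) (1 - cnj q) = - cnj (I G q p)" if "closed_segment p q \<subseteq> S - P" "Re p \<in> {- 1 / 2..3/2}" "Re q \<in> {- 1 / 2..3/2}" for p q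
  proof -
    have "I G (1 - cnj p) (1 - cnj q) = cnj (I G p q)"
      unfolding I_def by (rule contour_integral_linepath_reflect) (use Gr rng that in auto)
    also have "I G p q = - I G q p" unfolding I_def
      by (rule contour_integral_reverse_linepath) (rule contG[OF that(1)])
    finally show ?thesis by simp
  qed
  define X where "X f = I f mA a2 + I f a2 a3 + I f a3 mB" for f
  have mids: "mA \<in> closed_segment a1 a2" "mB \<in> closed_segment a3 a4"
    unfolding ad closed_segment_def
    by (auto simp: complex_eq_iff intro!: exI[of _ "1/2"])
  have "contour_integral (rectpath a1 a3) G = I G a1 a2 + I G a2 a3 + I G a3 a4 + I G a4 a1"
    unfolding I_def using contour_integral_rectpath[OF contG[OF imgP]] by (simp add: ad)
  also have "I G a1 a2 = I G a1 mA + I G mA a2" unfolding I_def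
    by (rule contour_integral_split_linepath[OF contG[OF segs(1)] mids(1)])
  also have "I G a3 a4 = I G a3 mB + I G mB a4" unfolding I_def
    by (rule contour_integral_split_linepath[OF contG[OF segs(3)] mids(2)])
  also have "I G a1 mA = - cnj (I G mA a2)" using rf[OF segs(8)] by (simp add: ad complex_eq_iff[of "1 - _"] Complex_eq)
  also have "I G mB a4 = - cnj (I G a3 mB)" using rf[OF segs(7)] by (simp add: ad Complex_eq)
  also have "I G a4 a1 = - cnj (I G a2 a3)" using rf[OF segs(9)] by (simp add: ad Complex_eq)
  finally have "contour_integral (rectpath a1 a3) G = X G - cnj (X G)" by (simp add: X_def)
  also have "\<dots> = 2 * \<i> * of_real (Im (X G))" by (simp add: complex_eq_iff)
  finally have sum: "(\<Sum>\<nu>\<in>{a<..b}. F (c \<nu>)) = of_real (L / pi * Im (X G))"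
    unfolding RT using L by (simp add: field_simps)
  have ci: "f contour_integrable_on linepath p q" if "closed_segment p q \<subseteq> S - P" "continuous_on (S - P) f" for f p q
    using that by (intro contour_integrable_continuous_linepath) (rule continuous_on_subset)
  have contF: "continuous_on (S - P) F" "continuous_on (S - P) g" "continuous_on S F"
    using Fh gh by (auto intro: holomorphic_on_imp_continuous_on continuous_on_subset)
  have Isplit: "I G p q = I F p q / 2 + I g p q" if "closed_segment p q \<subseteq> S - P" for p q
    unfolding I_def G_def using ci[OF that contF(1)] ci[OF that contF(2)]
    by (subst contour_integral_add) (auto intro: contour_integrable_div simp: contour_integral_div)
  have XG: "X G = X F / 2 + X g" unfolding X_def using Isplit segs by (simp add: add_divide_distrib)
  have rp2: "rectpath mA a3 = linepath mA a2 +++ linepath a2 a3 +++ linepath a3 mB +++ linepath mB mA"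
    by (simp add: rectpath_def Let_def ad)
  have segAB: "closed_segment mB mA \<subseteq> S"
    using closed_segment_subset[OF _ _ cvS, of mB mA] inS y12 by (simp add: ad)
  have img2: "path_image (rectpath mA a3) \<subseteq> S"
    unfolding rp2 using segs segAB by (auto simp: path_image_join)
  \<comment> \<open>F is holomorphic in the strip, so its integral over the three outer sides of the
    right half equals the one along the critical line.\<close>
  have "(F has_contour_integral 0) (rectpath mA a3)"
    by (rule Cauchy_theorem_convex_simple[OF Fh cvS]) (use img2 in auto)
  then have "0 = contour_integral (rectpath mA a3) F" by (simp add: contour_integral_unique)
  also have "\<dots> = I F mA a2 + I F a2 a3 + I F a3 mB + I F mB mA"
    unfolding I_def using contour_integral_rectpath[OF continuous_on_subset[OF contF(3) img2]] by (simp add: ad)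
  also have "I F mB mA = - I F mA mB" unfolding I_def
    by (rule contour_integral_reverse_linepath) (rule continuous_on_subset[OF contF(3) segAB])
  finally have "X F = I F mA mB" by (simp add: X_def)
  also have "\<dots> = \<i> * integral {y1..y2} (\<lambda>u. F (Complex (1/2) u))"
    unfolding I_def ad using y12 by (simp add: contour_integral_linepath_same_Re)
  finally have "Im (X F) = Re (integral {y1..y2} (\<lambda>u. F (Complex (1/2) u)))" by simp
  then have "Im (X G) = Re (integral {y1..y2} (\<lambda>u. F (Complex (1/2) u))) / 2 + Im (X g)" unfolding XG by simp
  then show ?thesis using sum unfolding c_def X_def I_def ad by (simp add: algebra_simps)
qed

section \<open>The sum of Z over the points of the linearised phase\<close>

definition FZ :: "complex \<Rightarrow> complex" where "FZ s = zeta s * exp (thA s)"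

lemma FZ_holomorphic: "FZ holomorphic_on {s. 0 < Im s}"
proof -
  have "thA holomorphic_on {s. 0 < Im s}"
    unfolding holomorphic_on_def field_differentiable_def using thA_deriv(1) by blast
  moreover have "zeta holomorphic_on {s. 0 < Im s}"
    by (rule holomorphic_on_subset[OF holomorphic_zeta]) auto
  ultimately show ?thesis unfolding FZ_def by (intro holomorphic_intros)
qed

lemma FZ_critical: "0 < t \<Longrightarrow> FZ (Complex (1/2) t) = Z t"
  by (simp add: FZ_def Z_def thA_critical mult.commute)

text \<open>By the functional equation exp (2 \<open>thA s\<close>), a quotient of Gamma factors and
  powers of pi, equals zeta (1 - s) / zeta s. Multiplying zeta by exp (\<open>thA s\<close>), its
  square root, distributes the factor evenly over both sides.\<close>

lemma FZ_reflect:
  assumes s: "0 < Im s" "- 1 < Re s" "Re s < 2"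
  shows "FZ (1 - cnj s) = cnj (FZ s)"
proof -
  have s01: "s \<noteq> 0" "s \<noteq> 1" using s by auto
  note n = thA_not_nonpos[OF s(1)]
  have G: "exp (ln_Gamma (s / 2)) = Gamma (s / 2)" "exp (ln_Gamma ((1 - s) / 2)) = Gamma ((1 - s) / 2)"
    using n(3,4) by (simp_all add: Gamma_complex_altdef)
  have G0: "Gamma ((1 - s) / 2) \<noteq> 0" using n(4) by (simp add: Gamma_eq_zero_iff)
  have "exp (2 * thA s) = exp ((1 / 2 - s) * of_real (ln pi)) * Gamma (s / 2) / Gamma ((1 - s) / 2)"
  proof -
    have "2 * thA s = (1 / 2 - s) * of_real (ln pi) + ln_Gamma (s / 2) - ln_Gamma ((1 - s) / 2)"
      by (simp add: thA_def field_simps)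
    then show ?thesis unfolding G[symmetric] by (simp only: exp_add exp_diff)
  qed
  also have "exp ((1 / 2 - s) * of_real (ln pi)) = of_real pi powr (- s / 2) / of_real pi powr (- (1 - s) / 2)"
    by (simp add: powr_def Ln_of_real field_simps flip: exp_diff)
  finally have e: "exp (2 * thA s) = of_real pi powr (- s / 2) / of_real pi powr (- (1 - s) / 2) * Gamma (s / 2) / Gamma ((1 - s) / 2)" .
  have "exp (2 * thA s) * zeta s = (of_real pi powr (- s / 2) * Gamma (s / 2) * zeta s) / (of_real pi powr (- (1 - s) / 2) * Gamma ((1 - s) / 2))"
    unfolding e by simp
  also have "\<dots> = zeta (1 - s)" unfolding zeta_functional_strip[OF s(2,3) s01] using G0 by simp
  finally have fe: "zeta (1 - s) = exp (2 * thA s) * zeta s" ..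
  have "1 - s \<noteq> 1" using s01 by simp
  then have "zeta (1 - cnj s) = cnj (zeta (1 - s))" using zeta_cnj[of "1 - s"] s by simp
  then have "FZ (1 - cnj s) = cnj (exp (2 * thA s) * zeta s) * exp (- cnj (thA s))"
    by (simp add: FZ_def thA_reflect[OF s(1)] fe)
  also have "\<dots> = cnj (zeta s * (exp (2 * thA s) * exp (- thA s)))" by (simp add: exp_cnj)
  also have "exp (2 * thA s) * exp (- thA s) = exp (thA s)" by (simp flip: exp_add)
  finally show ?thesis by (simp add: FZ_def)
qed

text \<open>\<alpha> is the value at 0 of the tangent to \<open>theta\<close> at T, so the exponent
  is this tangent continued off the critical line. The points considered are within 3 H of 1/2 + i
  T; the Taylor error (8/T)(3 H)^2 = 72 H^2/T doubles on passing to the exponential.\<close>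

lemma FZ_linearised:
  fixes T H :: real and s :: complex
  assumes T: "8 \<le> T" and H: "1 \<le> H" "144 * H\<^sup>2 / T \<le> 1" "2 * H \<le> T / 2" and s: "1 / 4 \<le> Re s" "Re s \<le> 3 / 2" "\<bar>Im s - T\<bar> \<le> 2 * H"
  defines "L \<equiv> theta1 T" and "\<alpha> \<equiv> theta T - theta1 T * T"
  shows "\<exists>R. FZ s = zeta s * exp (\<i> * of_real \<alpha> + of_real L * (s - 1 / 2)) * exp R \<and> norm (exp R - 1) \<le> 144 * H\<^sup>2 / T \<and> norm (exp R) \<le> 3"
proof -
  define R where "R = thA s - (thA (Complex (1/2) T) + thA1 (Complex (1/2) T) * (s - Complex (1/2) T))"
  have n: "norm (s - Complex (1/2) T) \<le> 3 * H"
  proof -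
    have "norm (s - Complex (1/2) T) \<le> \<bar>Re (s - Complex (1/2) T)\<bar> + \<bar>Im (s - Complex (1/2) T)\<bar>" by (rule cmod_le)
    also have "\<dots> \<le> 1 + 2 * H" using s by simp
    finally show ?thesis using H by simp
  qed
  have "norm R \<le> 4 / (T / 2) * (norm (s - Complex (1/2) T))\<^sup>2"
    unfolding R_def by (rule thA_taylor) (use T H s in auto)
  also have "\<dots> \<le> 4 / (T / 2) * (3 * H)\<^sup>2" using n T by (intro mult_left_mono power_mono) auto
  also have "\<dots> = 72 * H\<^sup>2 / T" by (simp add: power_mult_distrib)
  finally have R: "norm R \<le> 72 * H\<^sup>2 / T" .
  have R1: "norm R \<le> 1 / 2" using R H(2) by linarith
  have e: "norm (exp R - 1) \<le> 2 * norm R"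
  proof -
    have "norm (exp R - 1) \<le> 3 / 2 * norm R" by (rule norm_exp_bounds(2)[OF R1])
    then show ?thesis using norm_ge_zero[of R] by linarith
  qed
  show ?thesis
  proof (rule exI[of _ R], intro conjI)
    have "thA s = \<i> * of_real \<alpha> + of_real L * (s - 1 / 2) + R"
    proof -
      have "Complex (1/2) T = 1/2 + \<i> * of_real T" by (simp add: complex_eq_iff)
      then show ?thesis
        unfolding R_def theta_deriv(2)[of T, OF order.strict_trans2[OF _ T], simplified] thA_critical[of T, OF order.strict_trans2[OF _ T], simplified] \<alpha>_def L_def
        by (simp add: algebra_simps)
    qed
    then show "FZ s = zeta s * exp (\<i> * of_real \<alpha> + of_real L * (s - 1 / 2)) * exp R"
      by (simp add: FZ_def exp_add)
    show "norm (exp R - 1) \<le> 144 * H\<^sup>2 / T" using e R by simp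
    have "norm (exp R) \<le> norm (exp R - 1) + norm (1::complex)" by (metis norm_triangle_ineq diff_add_cancel)
    then show "norm (exp R) \<le> 3" using e R1 by simp
  qed
qed

text \<open>On Re s = 3/2 the term n = 1 integrates to the length of the interval, and every other
  term to at most 4 n^(-3/2) by oscillation. Working with the finite sum of
  \<open>zeta_error_le\<close> avoids exchanging an infinite series with the integral.\<close>

lemma zeta_line_integral:
  fixes \<epsilon> :: real
  assumes \<epsilon>: "0 < \<epsilon>" "\<epsilon> \<le> 1 / 100"
  obtains C where "0 < C" "\<And>T A B. 4 \<le> T \<Longrightarrow> T / 2 \<le> A \<Longrightarrow> A \<le> B \<Longrightarrow> B \<le> 2 * T \<Longrightarrow> B - A \<le> 3 * T powr (1/6 + 2 * \<epsilon>) \<Longrightarrow>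
    norm (integral {A..B} (\<lambda>u. zeta (Complex (3/2) u)) - of_real (B - A)) \<le> C * T powr (1/6 + 5 * \<epsilon> / 8)"
proof -
  have sm: "summable (\<lambda>n. real n powr (- (3/2)))" by (simp add: summable_real_powr_iff)
  define K where "K = (\<Sum>n. real n powr (- (3/2)))"
  have K0: "0 \<le> K" unfolding K_def by (intro suminf_nonneg sm) auto
  have C0: "0 < 60 + 4 * K" using K0 by simp
  have main: "norm (integral {A..B} (\<lambda>u. zeta (Complex (3/2) u)) - of_real (B - A)) \<le> (60 + 4 * K) * T powr (1/6 + 5 * \<epsilon> / 8)"
    if T: "4 \<le> T" and AB: "T / 2 \<le> A" "A \<le> B" "B \<le> 2 * T" "B - A \<le> 3 * T powr (1/6 + 2 * \<epsilon>)" for T A B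
  proof -
    define N where "N = nat \<lceil>T powr (4/3 + \<epsilon>)\<rceil>"
    have N2: "2 \<le> N"
    proof -
      have "T powr 1 \<le> T powr (4/3 + \<epsilon>)" using T \<epsilon> by (intro powr_mono) auto
      then have "4 \<le> T powr (4/3 + \<epsilon>)" using T by simp
      then show ?thesis unfolding N_def by linarith
    qed
    define h where "h n u = complex_of_real (n powr (- (3/2))) * cis (u * (- ln n))" for n :: nat and u :: real
    have hn: "of_nat n powr (- Complex (3/2) u) = h n u" if "0 < n" for n u
    proof -
      have e1: "1 / sqrt n = n powr (- (1/2))" by (simp add: powr_half_sqrt powr_minus_divide)
      have "n powr (1/2 - 3/2) * (1 / sqrt n) = n powr (- (3/2))"
        unfolding e1 powr_add[symmetric] by simp
      then have "complex_of_real (n powr (1/2 - 3/2)) * (of_real (1 / sqrt n) * cis (- u * ln n)) = of_real (n powr (- (3/2))) * cis (- u * ln n)"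
        by (simp only: mult.assoc[symmetric] of_real_mult[symmetric])
      then show ?thesis unfolding of_nat_powr_eq_dz[OF that] dz_def h_def by simp
    qed
    have hI: "((\<lambda>u. h n u) has_integral of_real (n powr (- (3/2))) * ((cis (B * (- ln n)) - cis (A * (- ln n))) / (\<i> * of_real (- ln n)))) {A..B}" if "2 \<le> n" for n
      unfolding h_def using that AB by (intro has_integral_mult_right has_integral_cis_linear) auto
    have hb: "norm (integral {A..B} (h n)) \<le> 4 * n powr (- (3/2))" if n: "2 \<le> n" for n
    proof -
      have "ln 2 \<le> ln (real n)" using n by (intro ln_mono) auto
      then have l: "1 / 2 \<le> ln n" using ln2_ge_two_thirds by linarith
      have "norm (integral {A..B} (h n)) = n powr (- (3/2)) * (norm (cis (B * (- ln n)) - cis (A * (- ln n))) / ln n)"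
        using hI[OF n] l by (simp add: integral_unique norm_mult norm_divide)
      also have "\<dots> \<le> n powr (- (3/2)) * (2 / (1/2))"
      proof (intro mult_left_mono frac_le l)
        show "norm (cis (B * (- ln n)) - cis (A * (- ln n))) \<le> 2"
          using norm_triangle_ineq4[of "cis (B * (- ln n))" "cis (A * (- ln n))"] by simp
      qed auto
      finally show ?thesis by simp
    qed
    define r where "r u = zeta (Complex (3/2) u) - (\<Sum>n=1..<N. h n u)" for u
    have rb: "norm (r u) \<le> 20 * T powr (- (3/2) * \<epsilon>)" if "u \<in> {A..B}" for u
    proof -
      have "(\<Sum>n=1..<N. of_nat n powr (- Complex (3/2) u)) = (\<Sum>n=1..<N. h n u)"
        by (intro sum.cong) (auto simp: hn)
      then show ?thesis unfolding r_def using zeta_error_le(1)[OF \<epsilon> T _ _ _ _ N_def, of "Complex (3/2) u"] that AB by auto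
    qed
    have zc: "continuous_on {A..B} (\<lambda>u. zeta (Complex (3/2) u))"
    proof -
      have "continuous_on {A..B} (zeta \<circ> Complex (3/2))"
      proof (rule continuous_on_compose)
        show "continuous_on {A..B} (Complex (3/2))" by (intro continuous_on_Complex continuous_intros)
        show "continuous_on (Complex (3/2) ` {A..B}) zeta"
          by (rule holomorphic_on_imp_continuous_on, rule holomorphic_on_subset[OF holomorphic_zeta]) (auto simp: complex_eq_iff)
      qed
      then show ?thesis by (simp add: o_def)
    qed
    have hc: "continuous_on {A..B} (h n)" for n unfolding h_def by (intro continuous_intros)
    have ri: "r integrable_on {A..B}" unfolding r_def
      by (intro integrable_continuous_real continuous_intros zc hc[unfolded h_def] continuous_on_sum hc)
    have int_h1: "integral {A..B} (h 1) = of_real (B - A)" unfolding h_def using AB by (simp add: scaleR_conv_of_real)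
    have spl: "(\<Sum>n=1..<N. h n u) = h 1 u + (\<Sum>n=2..<N. h n u)" for u
      using N2 by (subst sum.atLeast_Suc_lessThan) (auto simp: numeral_2_eq_2)
    have I2: "((\<lambda>u. \<Sum>n=2..<N. h n u) has_integral (\<Sum>n=2..<N. integral {A..B} (h n))) {A..B}"
      by (intro has_integral_sum integrable_integral integrable_continuous_real hc) auto
    have I1: "(h 1 has_integral of_real (B - A)) {A..B}"
      unfolding int_h1[symmetric] by (intro integrable_integral integrable_continuous_real hc)
    have "((\<lambda>u. r u + (h 1 u + (\<Sum>n=2..<N. h n u))) has_integral integral {A..B} r + (of_real (B - A) + (\<Sum>n=2..<N. integral {A..B} (h n)))) {A..B}"
      by (intro has_integral_add I1 I2 integrable_integral ri)
    moreover have "(\<lambda>u. r u + (h 1 u + (\<Sum>n=2..<N. h n u))) = (\<lambda>u. zeta (Complex (3/2) u))"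
      by (rule ext) (simp only: r_def spl diff_add_cancel)
    ultimately have "integral {A..B} (\<lambda>u. zeta (Complex (3/2) u)) = integral {A..B} r + (of_real (B - A) + (\<Sum>n=2..<N. integral {A..B} (h n)))"
      by (simp add: integral_unique)
    then have "norm (integral {A..B} (\<lambda>u. zeta (Complex (3/2) u)) - of_real (B - A)) = norm (integral {A..B} r + (\<Sum>n=2..<N. integral {A..B} (h n)))"
      by simp
    also have "\<dots> \<le> norm (integral {A..B} r) + norm (\<Sum>n=2..<N. integral {A..B} (h n))" by (rule norm_triangle_ineq)
    finally have n1: "norm (integral {A..B} (\<lambda>u. zeta (Complex (3/2) u)) - of_real (B - A)) \<le> norm (integral {A..B} r) + norm (\<Sum>n=2..<N. integral {A..B} (h n))" .
    have "norm (\<Sum>n=2..<N. integral {A..B} (h n)) \<le> (\<Sum>n=2..<N. 4 * n powr (- (3/2)))"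
      by (intro sum_norm_le hb) auto
    also have "\<dots> = 4 * (\<Sum>n=2..<N. n powr (- (3/2)))" by (simp only: sum_distrib_left)
    also have "\<dots> \<le> 4 * K" unfolding K_def by (intro mult_left_mono sum_le_suminf sm) auto
    finally have n2: "norm (\<Sum>n=2..<N. integral {A..B} (h n)) \<le> 4 * K" .
    have "norm (integral {A..B} r) \<le> 20 * T powr (- (3/2) * \<epsilon>) * (B - A)"
      by (rule norm_integral_le[OF ri _ rb]) (use AB in auto)
    also have "\<dots> \<le> 20 * T powr (- (3/2) * \<epsilon>) * (3 * T powr (1/6 + 2 * \<epsilon>))" using AB by (intro mult_left_mono) auto
    also have "\<dots> = 60 * T powr (- (3/2) * \<epsilon> + (1/6 + 2 * \<epsilon>))" unfolding powr_add by simp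
    also have "\<dots> \<le> 60 * T powr (1/6 + 5 * \<epsilon> / 8)" using T \<epsilon> by (intro mult_left_mono powr_mono) auto
    finally have n3: "norm (integral {A..B} r) \<le> 60 * T powr (1/6 + 5 * \<epsilon> / 8)" .
    have n4: "4 * K \<le> 4 * K * T powr (1/6 + 5 * \<epsilon> / 8)"
      using mult_left_mono[of 1 "T powr (1/6 + 5 * \<epsilon> / 8)" "4 * K"] K0 T \<epsilon> by (simp add: ge_one_powr_ge_zero)
    show ?thesis using n1 n2 n3 n4 by (simp add: algebra_simps)
  qed
  show ?thesis by (rule that[OF C0 main])
qed

text \<open>21000 exceeds 144^2, so that 144 T^(-1/2) <= 1. The quantity H^2/T, at most T^(-1/2), is
  the size of the error of linearising the phase.\<close>

lemma window_length_bounds: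
  fixes T \<epsilon> :: real
  assumes \<epsilon>: "0 < \<epsilon>" "\<epsilon> \<le> 1 / 100" and T: "21000 \<le> T"
  defines "H \<equiv> T powr (1/6 + 2 * \<epsilon>)"
  shows "1 \<le> H" "H \<le> T powr (1/2)" "2 * H \<le> T / 2" "H\<^sup>2 / T \<le> T powr (- (1/2))" "144 * H\<^sup>2 / T \<le> 1" "T powr (- (1/2)) * H \<le> 1"
proof -
  show "1 \<le> H" unfolding H_def using T \<epsilon> by (intro ge_one_powr_ge_zero) auto
  show H: "H \<le> T powr (1/2)" unfolding H_def using T \<epsilon> by (intro powr_mono) auto
  have s72: "144 \<le> T powr (1/2)" using T by (simp add: powr_half_sqrt real_le_rsqrt)
  have sq: "T powr (1/2) * T powr (1/2) = T" using T by (simp add: powr_half_sqrt)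
  have "144 * T powr (1/2) \<le> T powr (1/2) * T powr (1/2)" using s72 by (intro mult_right_mono) auto
  then show "2 * H \<le> T / 2" using H sq T by linarith
  have "H\<^sup>2 = T powr ((1/6 + 2 * \<epsilon>) + (1/6 + 2 * \<epsilon>))" by (simp only: H_def power2_eq_square powr_add)
  also have "\<dots> \<le> T powr (1/2)" using T \<epsilon> by (intro powr_mono) auto
  finally have "H\<^sup>2 / T \<le> T powr (1/2) / T" using T by (intro divide_right_mono) auto
  also have "T powr (1/2) / T = T powr (- (1/2))" using sq T by (simp add: powr_minus field_simps)
  finally show h2: "H\<^sup>2 / T \<le> T powr (- (1/2))" .
  have inv: "T powr (- (1/2)) * T powr (1/2) = 1" using T by (simp flip: powr_add)
  have "T powr (- (1/2)) * 144 \<le> T powr (- (1/2)) * T powr (1/2)" using s72 by (intro mult_left_mono) auto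
  then show "144 * H\<^sup>2 / T \<le> 1" using h2 inv by linarith
  have "T powr (- (1/2)) * H \<le> T powr (- (1/2)) * T powr (1/2)" using H by (intro mult_left_mono) auto
  then show "T powr (- (1/2)) * H \<le> 1" using inv by simp
qed

text \<open>The order T^(1/2) of e^L is used twice: it places the point P = e^L of the twisted
  integral, and it makes |w| = e^(-L) small on Re s = 3/2.\<close>

lemma theta1_scale:
  obtains c T0 where "1 \<le> c" "21000 \<le> T0" "\<forall>T\<ge>T0. 1 \<le> theta1 T \<and>
    1 / c * T powr (1/2) \<le> exp (theta1 T) \<and> exp (theta1 T) \<le> c * T powr (1/2) \<and>
    exp (- theta1 T) \<le> c * T powr (- (1/2)) \<and> exp (- theta1 T) \<le> 1 / 2"
proof -
  obtain C where C: "0 \<le> C" "\<And>t. 4 \<le> t \<Longrightarrow> \<bar>theta1 t - ln t / 2\<bar> \<le> C" using theta1_asymp by blast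
  define T0 where "T0 = max 21000 (exp (2 * C + 2))"
  have l: "C + 1 \<le> ln T / 2" "4 \<le> T" if "T0 \<le> T" for T
  proof -
    have "exp (2 * C + 2) \<le> T" "0 < T" using that by (auto simp: T0_def)
    then have "2 * C + 2 \<le> ln T" by (simp add: ln_ge_iff)
    then show "C + 1 \<le> ln T / 2" by simp
  qed (use that in \<open>auto simp: T0_def\<close>)
  have e: "exp (ln T / 2) = T powr (1/2)" "exp (- (ln T / 2)) = T powr (- (1/2))" if "T0 \<le> T" for T
    using l(2)[OF that] by (auto simp: powr_def)
  have b: "theta1 T \<le> C + ln T / 2" "ln T / 2 - C \<le> theta1 T" if "T0 \<le> T" for T
    using C(2)[OF l(2)[OF that]] by auto
  show ?thesis
  proof (rule that[of "exp C" T0], goal_cases)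
    case 3
    show ?case
    proof (intro allI impI conjI)
      fix T assume T: "T0 \<le> T"
    show "1 \<le> theta1 T" using l[OF T] b[OF T] by simp
    show "exp (theta1 T) \<le> exp C * T powr (1/2)"
      unfolding e[OF T, symmetric] exp_add[symmetric] using b[OF T] by simp
    show "exp (- theta1 T) \<le> exp C * T powr (- (1/2))"
      unfolding e[OF T, symmetric] exp_add[symmetric] using b[OF T] by simp
    show "1 / exp C * T powr (1/2) \<le> exp (theta1 T)"
    proof -
      have "1 / exp C * T powr (1/2) = exp (ln T / 2 - C)" unfolding e[OF T, symmetric] by (simp add: exp_diff)
      then show ?thesis using b[OF T] by simp
    qed
    show "exp (- theta1 T) \<le> 1 / 2"
    proof -
      have "2 \<le> exp (theta1 T)" using l[OF T] b[OF T] exp_ge_add_one_self[of "theta1 T"] C(1) by linarith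
      then have "inverse (exp (theta1 T)) \<le> inverse 2" by (rule le_imp_inverse_le) simp
      then show ?thesis by (simp add: exp_minus)
    qed
    qed
  qed (use C in \<open>auto simp: T0_def\<close>)
qed

lemma norm_contour_integral_linepath_le:
  assumes "\<And>z. z \<in> closed_segment a b \<Longrightarrow> norm (f z) \<le> B"
  shows "norm (contour_integral (linepath a b) f) \<le> B * norm (b - a)"
proof -
  have B: "0 \<le> B" using assms[of a] by (meson ends_in_segment(1) norm_ge_zero order_trans)
  show ?thesis
  proof (cases "f contour_integrable_on linepath a b")
    case True
    then show ?thesis using B assms by (intro contour_integral_bound_linepath) auto
  qed (use B in \<open>simp add: not_integrable_contour_integral\<close>)
qed

text \<open>F w is zeta times cis \<tau> up to the factor exp R. On Re s = 3/2, where w =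
  O(T^(-1/2)), the integrand F w/(1 - w) is therefore nearly cis \<tau> times zeta and integrates to
  about cis \<tau> (y2 - y1); as L (y2 - y1) = 2 pi (b - a), this is the main term. The horizontal
  sides have length 1 and are controlled by the growth of zeta. On the critical line F is zeta times
  P^(iu) with P = e^L, up to a constant phase and a small error. The factor L in the bound
  disappears later, since the points are spaced at 2 pi/L.\<close>

lemma linearised_gram_sum:
  fixes \<epsilon> :: real
  assumes \<epsilon>: "0 < \<epsilon>" "\<epsilon> \<le> 1 / 100"
  obtains C T0 where "0 < C" "21000 \<le> T0"
    "\<And>T \<tau> a b H L \<beta>. T0 \<le> T \<Longrightarrow> H = T powr (1/6 + 2 * \<epsilon>) \<Longrightarrow> L = theta1 T \<Longrightarrow> \<beta> = theta T - theta1 T * T - \<tau> \<Longrightarrow> a < b \<Longrightarrow>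
      T - H \<le> (2 * pi * of_int a + pi - \<beta>) / L \<Longrightarrow> (2 * pi * of_int b + pi - \<beta>) / L \<le> T + 2 * H \<Longrightarrow>
      norm ((\<Sum>\<nu>\<in>{a<..b}. Z ((2 * pi * of_int \<nu> - \<beta>) / L)) - of_real (2 * of_int (b - a) * cos \<tau>)) \<le> C * (L * T powr (1/6 + 5 * \<epsilon> / 8))"
proof -
  obtain c T1 where c: "1 \<le> c" and T1: "21000 \<le> T1" and th0: "\<forall>T\<ge>T1. 1 \<le> theta1 T \<and>
    1 / c * T powr (1/2) \<le> exp (theta1 T) \<and> exp (theta1 T) \<le> c * T powr (1/2) \<and>
    exp (- theta1 T) \<le> c * T powr (- (1/2)) \<and> exp (- theta1 T) \<le> 1 / 2"
    by (rule theta1_scale)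
  have th: "1 \<le> theta1 T" "1 / c * T powr (1/2) \<le> exp (theta1 T)" "exp (theta1 T) \<le> c * T powr (1/2)"
    "exp (- theta1 T) \<le> c * T powr (- (1/2))" "exp (- theta1 T) \<le> 1 / 2" if "T1 \<le> T" for T
    using th0 that by auto
  have ci: "0 < 1 / c" using c by simp
  have "\<exists>CA T2. 0 < CA \<and> (\<forall>T P A B. T2 \<le> T \<longrightarrow> 1 / c * T powr (1/2) \<le> P \<longrightarrow> P \<le> c * T powr (1/2) \<longrightarrow>
      T / 2 \<le> A \<longrightarrow> A \<le> B \<longrightarrow> B \<le> 2 * T \<longrightarrow> B - A \<le> 3 * T powr (1/6 + 2 * \<epsilon>) \<longrightarrow>
      norm (integral {A..B} (\<lambda>u. zeta (Complex (1/2) u) * cis (u * ln P))) \<le> CA * T powr (1/6 + 5 * \<epsilon> / 8))"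
  proof (rule integral_zeta_twisted[OF \<epsilon> ci c])
    fix CA T2 :: real
    assume CA: "0 < CA" and h: "\<And>T P A B. T2 \<le> T \<Longrightarrow> 1 / c * T powr (1/2) \<le> P \<Longrightarrow> P \<le> c * T powr (1/2) \<Longrightarrow>
      T / 2 \<le> A \<Longrightarrow> A \<le> B \<Longrightarrow> B \<le> 2 * T \<Longrightarrow> B - A \<le> 3 * T powr (1/6 + 2 * \<epsilon>) \<Longrightarrow>
      norm (integral {A..B} (\<lambda>u. zeta (Complex (1/2) u) * cis (u * ln P))) \<le> CA * T powr (1/6 + 5 * \<epsilon> / 8)"
    show ?thesis
    proof (rule exI[of _ CA], rule exI[of _ T2], intro conjI allI impI)
      show "0 < CA" by (rule CA)
    qed (rule h)
  qed
  then obtain CA T2 where CA0: "0 < CA" and CA1: "\<forall>T P A B. T2 \<le> T \<longrightarrow> 1 / c * T powr (1/2) \<le> P \<longrightarrow> P \<le> c * T powr (1/2) \<longrightarrow>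
      T / 2 \<le> A \<longrightarrow> A \<le> B \<longrightarrow> B \<le> 2 * T \<longrightarrow> B - A \<le> 3 * T powr (1/6 + 2 * \<epsilon>) \<longrightarrow>
      norm (integral {A..B} (\<lambda>u. zeta (Complex (1/2) u) * cis (u * ln P))) \<le> CA * T powr (1/6 + 5 * \<epsilon> / 8)"
    by blast
  note CA = CA1[rule_format]
  obtain CV where CV: "0 < CV" "\<And>T A B. 4 \<le> T \<Longrightarrow> T / 2 \<le> A \<Longrightarrow> A \<le> B \<Longrightarrow> B \<le> 2 * T \<Longrightarrow> B - A \<le> 3 * T powr (1/6 + 2 * \<epsilon>) \<Longrightarrow>
    norm (integral {A..B} (\<lambda>u. zeta (Complex (3/2) u)) - of_real (B - A)) \<le> CV * T powr (1/6 + 5 * \<epsilon> / 8)"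
    using zeta_line_integral[OF \<epsilon>] by blast
  obtain CZ where CZ: "0 < CZ" "\<And>T s. 4 \<le> T \<Longrightarrow> 1 / 2 \<le> Re s \<Longrightarrow> Re s \<le> 2 \<Longrightarrow> T / 2 \<le> Im s \<Longrightarrow> Im s \<le> 2 * T \<Longrightarrow>
    norm (zeta s) \<le> CZ * T powr (1/6 + 5 * \<epsilon> / 8)" using zeta_growth[OF \<epsilon>] by blast
  define C where "C = (CA + 432 * CZ) + (6 * CZ + (CV + 6 * (144 + c) * CZ))"
  have C0: "0 < C" using CA0 CV CZ c by (simp add: C_def add_pos_pos)
  have main: "norm ((\<Sum>\<nu>\<in>{a<..b}. Z ((2 * pi * of_int \<nu> - \<beta>) / L)) - of_real (2 * of_int (b - a) * cos \<tau>)) \<le> C * (L * T powr (1/6 + 5 * \<epsilon> / 8))"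
    if T: "max T1 T2 \<le> T" and HL: "H = T powr (1/6 + 2 * \<epsilon>)" "L = theta1 T" "\<beta> = theta T - theta1 T * T - \<tau>" and ab: "a < b"
      and y: "T - H \<le> (2 * pi * of_int a + pi - \<beta>) / L" "(2 * pi * of_int b + pi - \<beta>) / L \<le> T + 2 * H"
    for T \<tau> H L \<beta> :: real and a b :: int
  proof -
    have T': "21000 \<le> T" "T1 \<le> T" "T2 \<le> T" using T T1 by auto
    note W = window_length_bounds[OF \<epsilon> T'(1), folded HL(1)]
    note tl = th[OF T'(2), folded HL(2)]
    have L: "0 < L" using tl by simp
    define S where "S = T powr (1/6 + 5 * \<epsilon> / 8)"
    have S0: "0 \<le> S" by (simp add: S_def)
    define y1 where "y1 = (2 * pi * of_int a + pi - \<beta>) / L"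
    define y2 where "y2 = (2 * pi * of_int b + pi - \<beta>) / L"
    have yL: "L * y1 = 2 * pi * of_int a + pi - \<beta>" "L * y2 = 2 * pi * of_int b + pi - \<beta>" using L by (simp_all add: y1_def y2_def)
    have ydiff: "L * (y2 - y1) = 2 * pi * of_int (b - a)" by (simp add: right_diff_distrib yL)
    have y12: "y1 < y2"
    proof -
      have "0 < L * (y2 - y1)" unfolding ydiff using ab by simp
      then show ?thesis using L by (simp add: zero_less_mult_iff)
    qed
    have yb: "T - H \<le> y1" "y2 \<le> T + 2 * H" using y by (auto simp: y1_def y2_def)
    have u: "\<bar>t - T\<bar> \<le> 2 * H" "T / 2 \<le> t" "t \<le> 2 * T" "0 < t" if "y1 \<le> t" "t \<le> y2" for t
      using that yb W T' by (auto simp: abs_le_iff)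
    have yl: "y2 - y1 \<le> 3 * H" "T / 2 \<le> y1" "y2 \<le> 2 * T" using yb u[of y1] u[of y2] y12 by auto
    define w where "w s = exp (- \<i> * of_real \<beta> - of_real L * (s - 1 / 2))" for s
    define g where "g s = FZ s * w s / (1 - w s)" for s
    have zb: "norm (zeta s) \<le> CZ * S" if "1/2 \<le> Re s" "Re s \<le> 3/2" "y1 \<le> Im s" "Im s \<le> y2" for s
      unfolding S_def using that u[of "Im s"] T' by (intro CZ) auto
    have lin: "\<exists>R. FZ s = zeta s * exp (\<i> * of_real (\<beta> + \<tau>) + of_real L * (s - 1 / 2)) * exp R \<and> FZ s * w s = zeta s * cis \<tau> * exp R \<and> norm (exp R - 1) \<le> 144 * (H\<^sup>2 / T) \<and> norm (exp R) \<le> 3"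
      if "1/2 \<le> Re s" "Re s \<le> 3/2" "y1 \<le> Im s" "Im s \<le> y2" for s
    proof -
      have "\<exists>R. FZ s = zeta s * exp (\<i> * of_real (theta T - theta1 T * T) + of_real (theta1 T) * (s - 1 / 2)) * exp R \<and> norm (exp R - 1) \<le> 144 * H\<^sup>2 / T \<and> norm (exp R) \<le> 3"
        by (rule FZ_linearised) (use W T' that u[of "Im s"] in auto)
      then obtain R where R: "FZ s = zeta s * exp (\<i> * of_real (theta T - theta1 T * T) + of_real (theta1 T) * (s - 1 / 2)) * exp R" "norm (exp R - 1) \<le> 144 * H\<^sup>2 / T" "norm (exp R) \<le> 3"
        by blast
      have f: "FZ s = zeta s * exp (\<i> * of_real (\<beta> + \<tau>) + of_real L * (s - 1 / 2)) * exp R" using R(1) HL by simp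
      have "exp (\<i> * of_real (\<beta> + \<tau>) + of_real L * (s - 1 / 2)) * w s = cis \<tau>"
        unfolding w_def exp_add[symmetric] cis_conv_exp by (rule arg_cong[where f = exp]) (simp add: algebra_simps)
      then have "FZ s * w s = zeta s * cis \<tau> * exp R" unfolding f by (simp add: mult_ac)
      then show ?thesis using f R by auto
    qed
    \<comment> \<open>A pointwise error of relative size T^(-1/2) on an interval of length at most 3
      H costs no more than a constant times the bound for zeta, as T^(-1/2) H <= 1.\<close>
    have SH: "CZ * S * (q * T powr (- (1/2))) * (y2 - y1) \<le> 3 * q * CZ * S" if "0 \<le> q" for q
    proof -
      have "CZ * S * (q * T powr (- (1/2))) * (y2 - y1) \<le> CZ * S * (q * T powr (- (1/2))) * (3 * H)"
        using that S0 CZ yl by (intro mult_left_mono) auto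
      also have "\<dots> = 3 * q * CZ * S * (T powr (- (1/2)) * H)" by simp
      also have "\<dots> \<le> 3 * q * CZ * S * 1" using that S0 CZ W by (intro mult_left_mono) auto
      finally show ?thesis by simp
    qed
    have Fc: "continuous_on {y1..y2} (\<lambda>u. FZ (Complex \<sigma> u))" for \<sigma>
    proof (rule continuous_on_compose2[OF holomorphic_on_imp_continuous_on[OF FZ_holomorphic]])
      show "continuous_on {y1..y2} (Complex \<sigma>)" by (intro continuous_on_Complex continuous_intros)
      show "Complex \<sigma> ` {y1..y2} \<subseteq> {s. 0 < Im s}" using u by auto
    qed
    have zc: "continuous_on {y1..y2} (\<lambda>u. zeta (Complex \<sigma> u))" for \<sigma>
    proof (rule continuous_on_compose2[OF holomorphic_on_imp_continuous_on[OF holomorphic_zeta]])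
      show "continuous_on {y1..y2} (Complex \<sigma>)" by (intro continuous_on_Complex continuous_intros)
      show "Complex \<sigma> ` {y1..y2} \<subseteq> - {1}"
      proof
        fix z assume "z \<in> Complex \<sigma> ` {y1..y2}"
        then obtain x where x: "z = Complex \<sigma> x" "y1 \<le> x" "x \<le> y2" by auto
        then show "z \<in> - {1}" using u(4)[OF x(2,3)] by (auto simp: complex_eq_iff)
      qed
    qed
    define I0 where "I0 = integral {y1..y2} (\<lambda>u. FZ (Complex (1/2) u))"
    have I0: "norm I0 \<le> (CA + 432 * CZ) * S"
    proof -
      \<comment> \<open>The linear phase e^(iuL) is P^(iu) with P = \<open>exp L\<close>; its
        logarithm is left as \<open>ln (exp L)\<close> to match the twisted integral.\<close>
      define h where "h u = cis (\<beta> + \<tau>) * (zeta (Complex (1/2) u) * cis (u * ln (exp L)))" for u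
      have hc: "continuous_on {y1..y2} h" unfolding h_def by (intro continuous_intros zc)
      have e: "norm (FZ (Complex (1/2) u) - h u) \<le> CZ * S * (144 * T powr (- (1/2)))" if "u \<in> {y1..y2}" for u
      proof -
        have pr: "1/2 \<le> Re (Complex (1/2) u)" "Re (Complex (1/2) u) \<le> 3/2" "y1 \<le> Im (Complex (1/2) u)" "Im (Complex (1/2) u) \<le> y2" using that by simp_all
        obtain R where R: "FZ (Complex (1/2) u) = zeta (Complex (1/2) u) * exp (\<i> * of_real (\<beta> + \<tau>) + of_real L * (Complex (1/2) u - 1 / 2)) * exp R" "norm (exp R - 1) \<le> 144 * (H\<^sup>2 / T)"
          using lin[OF pr] by blast
        have "exp (\<i> * of_real (\<beta> + \<tau>) + of_real L * (Complex (1/2) u - 1 / 2)) = cis (\<beta> + \<tau>) * cis (u * L)"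
        proof -
          have "Complex (1/2) u - 1/2 = \<i> * of_real u" by (simp add: complex_eq_iff)
          then show ?thesis unfolding cis_conv_exp exp_add[symmetric] by (simp add: mult_ac)
        qed
        then have "FZ (Complex (1/2) u) - h u = h u * (exp R - 1)" unfolding R(1) h_def by (simp add: algebra_simps)
        then have "norm (FZ (Complex (1/2) u) - h u) = norm (zeta (Complex (1/2) u)) * norm (exp R - 1)" by (simp add: h_def norm_mult)
        also have "\<dots> \<le> (CZ * S) * (144 * T powr (- (1/2)))"
          using R(2) W(4) that S0 CZ by (intro mult_mono zb) auto
        finally show ?thesis .
      qed
      have "norm (integral {y1..y2} (\<lambda>u. FZ (Complex (1/2) u) - h u)) \<le> CZ * S * (144 * T powr (- (1/2))) * (y2 - y1)"
        by (rule norm_integral_le[OF _ _ e]) (use y12 in \<open>auto intro!: integrable_continuous_real continuous_intros Fc hc\<close>)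
      also have "\<dots> \<le> 3 * 144 * CZ * S" by (rule SH) simp
      finally have d: "norm (integral {y1..y2} (\<lambda>u. FZ (Complex (1/2) u) - h u)) \<le> 432 * CZ * S" by simp
      have hi: "norm (integral {y1..y2} h) \<le> CA * S"
      proof -
        have "integral {y1..y2} h = cis (\<beta> + \<tau>) * integral {y1..y2} (\<lambda>u. zeta (Complex (1/2) u) * cis (u * ln (exp L)))"
          unfolding h_def by (rule integral_mult_right)
        then have "norm (integral {y1..y2} h) = norm (integral {y1..y2} (\<lambda>u. zeta (Complex (1/2) u) * cis (u * ln (exp L))))" by (simp add: norm_mult)
        also have "\<dots> \<le> CA * S" unfolding S_def using tl yl y12 T' HL by (intro CA) auto
        finally show ?thesis .
      qed
      have "I0 = integral {y1..y2} (\<lambda>u. FZ (Complex (1/2) u) - h u) + integral {y1..y2} h"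
        unfolding I0_def by (subst integral_add[symmetric]) (auto intro!: integrable_continuous_real continuous_intros Fc hc)
      then have "norm I0 \<le> norm (integral {y1..y2} (\<lambda>u. FZ (Complex (1/2) u) - h u)) + norm (integral {y1..y2} h)" by (simp add: norm_triangle_ineq)
      then show ?thesis using d hi by (simp add: algebra_simps)
    qed
    \<comment> \<open>At these two heights w is -exp (-L (Re z - 1/2)), so that |1 - w| >=
      1.\<close>
    have gh: "norm (g z) \<le> 3 * CZ * S" if z: "1/2 \<le> Re z" "Re z \<le> 3/2" "Im z = y1 \<or> Im z = y2" for z
    proof -
      obtain k :: int where k: "L * Im z = 2 * pi * of_int k + pi - \<beta>" using z(3) yL by metis
      have "- \<i> * of_real \<beta> - of_real L * (z - 1 / 2) = of_real (- L * (Re z - 1/2)) + \<i> * of_real (- (2 * pi * of_int k + pi))"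
        using k by (simp add: complex_eq_iff)
      then have "w z = of_real (exp (- L * (Re z - 1/2))) * cis (- (2 * pi * of_int k + pi))"
        unfolding w_def by (simp only: exp_add cis_conv_exp exp_of_real)
      also have "cis (- (2 * pi * of_int k + pi)) = -1"
      proof -
        have "cis (- (2 * pi * of_int k + pi)) = cis (2 * pi * of_int (- k)) * cis (- pi)" by (simp add: cis_mult)
        also have "cis (2 * pi * of_int (- k)) = 1" by (rule cis_multiple_2pi) simp
        finally show ?thesis by (simp add: complex_eq_iff)
      qed
      finally have w: "1 - w z = of_real (1 + exp (- L * (Re z - 1/2)))" by simp
      have w1: "1 \<le> norm (1 - w z)" unfolding w norm_of_real by (smt (verit) exp_gt_zero)
      have pr: "1/2 \<le> Re z" "Re z \<le> 3/2" "y1 \<le> Im z" "Im z \<le> y2" using z y12 by auto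
      obtain R where R: "FZ z * w z = zeta z * cis \<tau> * exp R" "norm (exp R) \<le> 3" using lin[OF pr] by blast
      have "norm (g z) = norm (zeta z) * norm (exp R) / norm (1 - w z)" by (simp add: g_def R norm_divide norm_mult)
      also have "\<dots> \<le> norm (zeta z) * norm (exp R) / 1" using w1 by (intro divide_left_mono) auto
      also have "\<dots> \<le> (CZ * S) * 3" unfolding div_by_1 using R(2) z y12 S0 CZ by (intro mult_mono zb) auto
      finally show ?thesis by simp
    qed
    have hor: "norm (contour_integral (linepath (Complex \<sigma> y) (Complex \<sigma>' y)) g) \<le> 3 * CZ * S"
      if \<sigma>: "1/2 \<le> \<sigma>" "\<sigma> \<le> 3/2" "1/2 \<le> \<sigma>'" "\<sigma>' \<le> 3/2" "\<bar>\<sigma>' - \<sigma>\<bar> = 1" "y = y1 \<or> y = y2" for \<sigma> \<sigma>' y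
    proof -
      have "norm (contour_integral (linepath (Complex \<sigma> y) (Complex \<sigma>' y)) g) \<le> 3 * CZ * S * norm (Complex \<sigma>' y - Complex \<sigma> y)"
      proof (rule norm_contour_integral_linepath_le[OF gh])
        fix z assume "z \<in> closed_segment (Complex \<sigma> y) (Complex \<sigma>' y)"
        then have "Re z \<in> closed_segment \<sigma> \<sigma>'" "Im z = y" by (auto simp: closed_segment_same_Im)
        then show "1/2 \<le> Re z" "Re z \<le> 3/2" "Im z = y1 \<or> Im z = y2" using \<sigma> by (auto simp: closed_segment_eq_real_ivl split: if_splits)
      qed
      moreover have "Complex \<sigma>' y - Complex \<sigma> y = of_real (\<sigma>' - \<sigma>)" by (simp add: complex_eq_iff)
      ultimately show ?thesis using \<sigma>(5) by (simp only: norm_of_real mult_1_right)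
    qed
    define V where "V = integral {y1..y2} (\<lambda>u. g (Complex (3/2) u))"
    have nw: "norm (w (Complex (3/2) u)) = exp (- L)" for u by (simp add: w_def norm_exp_eq_Re)
    have w1: "1 / 2 \<le> norm (1 - w (Complex (3/2) u))" for u
      using norm_triangle_ineq2[of 1 "w (Complex (3/2) u)"] nw[of u] tl(5) by simp
    have V: "norm (V - cis \<tau> * of_real (y2 - y1)) \<le> (CV + 6 * (144 + c) * CZ) * S"
    proof -
      define h where "h u = cis \<tau> * zeta (Complex (3/2) u)" for u
      have hc: "continuous_on {y1..y2} h" unfolding h_def by (intro continuous_intros zc)
      have gc: "continuous_on {y1..y2} (\<lambda>u. g (Complex (3/2) u))"
      proof -
        have "1 - w (Complex (3/2) u) \<noteq> 0" for u using w1[of u] by auto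
        then show ?thesis unfolding g_def w_def by (intro continuous_intros Fc continuous_on_Complex) auto
      qed
      have e: "norm (g (Complex (3/2) u) - h u) \<le> CZ * S * ((2 * (144 + c)) * T powr (- (1/2)))" if "u \<in> {y1..y2}" for u
      proof -
        let ?s = "Complex (3/2) u"
        have pr: "1/2 \<le> Re (?s)" "Re (?s) \<le> 3/2" "y1 \<le> Im (?s)" "Im (?s) \<le> y2" using that by simp_all
        obtain R where R: "FZ ?s * w ?s = zeta ?s * cis \<tau> * exp R" "norm (exp R - 1) \<le> 144 * (H\<^sup>2 / T)"
          using lin[OF pr] by blast
        have w0: "1 - w ?s \<noteq> 0" using w1[of u] by auto
        \<comment> \<open>The relative error combines the error of linearisation, exp R - 1, with
          the size of w; both are O(T^(-1/2)).\<close>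
        have "g ?s - h u = h u * ((exp R - 1 + w ?s) / (1 - w ?s))"
          unfolding g_def R(1) h_def using w0 by (simp add: field_simps)
        then have "norm (g ?s - h u) = norm (zeta ?s) * (norm (exp R - 1 + w ?s) / norm (1 - w ?s))" by (simp add: h_def norm_mult norm_divide)
        also have "\<dots> \<le> (CZ * S) * ((144 * T powr (- (1/2)) + c * T powr (- (1/2))) / (1/2))"
        proof (intro mult_mono frac_le zb w1)
          have "norm (exp R - 1 + w ?s) \<le> norm (exp R - 1) + norm (w ?s)" by (rule norm_triangle_ineq)
          also have "\<dots> \<le> 144 * T powr (- (1/2)) + c * T powr (- (1/2))" using R(2) W(4) nw[of u] tl(4) by (intro add_mono) auto
          finally show "norm (exp R - 1 + w ?s) \<le> 144 * T powr (- (1/2)) + c * T powr (- (1/2))" .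
        qed (use that S0 CZ c in auto)
        also have "\<dots> = CZ * S * ((2 * (144 + c)) * T powr (- (1/2)))" by (simp add: algebra_simps)
        finally show ?thesis .
      qed
      have "norm (integral {y1..y2} (\<lambda>u. g (Complex (3/2) u) - h u)) \<le> CZ * S * ((2 * (144 + c)) * T powr (- (1/2))) * (y2 - y1)"
        by (rule norm_integral_le[OF _ _ e]) (use y12 in \<open>auto intro!: integrable_continuous_real continuous_intros gc hc\<close>)
      also have "\<dots> \<le> 3 * (2 * (144 + c)) * CZ * S" by (rule SH) (use c in simp)
      finally have d: "norm (integral {y1..y2} (\<lambda>u. g (Complex (3/2) u) - h u)) \<le> 6 * (144 + c) * CZ * S" by simp
      have hi: "norm (integral {y1..y2} h - cis \<tau> * of_real (y2 - y1)) \<le> CV * S"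
      proof -
        have "integral {y1..y2} h = cis \<tau> * integral {y1..y2} (\<lambda>u. zeta (Complex (3/2) u))"
          unfolding h_def by (rule integral_mult_right)
        then have "norm (integral {y1..y2} h - cis \<tau> * of_real (y2 - y1)) = norm (integral {y1..y2} (\<lambda>u. zeta (Complex (3/2) u)) - of_real (y2 - y1))"
          by (simp add: norm_mult flip: right_diff_distrib)
        also have "\<dots> \<le> CV * S" unfolding S_def using yl y12 T' HL by (intro CV) auto
        finally show ?thesis .
      qed
      have "V = integral {y1..y2} (\<lambda>u. g (Complex (3/2) u) - h u) + integral {y1..y2} h"
        unfolding V_def by (subst integral_add[symmetric]) (auto intro!: integrable_continuous_real continuous_intros gc hc)
      then have "V - cis \<tau> * of_real (y2 - y1) = integral {y1..y2} (\<lambda>u. g (Complex (3/2) u) - h u) + (integral {y1..y2} h - cis \<tau> * of_real (y2 - y1))" by simp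
      then have "norm (V - cis \<tau> * of_real (y2 - y1)) \<le> norm (integral {y1..y2} (\<lambda>u. g (Complex (3/2) u) - h u)) + norm (integral {y1..y2} h - cis \<tau> * of_real (y2 - y1))" by (simp only: norm_triangle_ineq)
      then show ?thesis using d hi by (simp add: algebra_simps)
    qed
    define E1 where "E1 = contour_integral (linepath (Complex (1/2) y1) (Complex (3/2) y1)) g"
    define E2 where "E2 = contour_integral (linepath (Complex (3/2) y2) (Complex (1/2) y2)) g"
    have E: "norm E1 \<le> 3 * CZ * S" "norm E2 \<le> 3 * CZ * S" unfolding E1_def E2_def by (intro hor; simp)+
    have vert: "contour_integral (linepath (Complex (3/2) y1) (Complex (3/2) y2)) g = \<i> * V"
      unfolding V_def by (rule contour_integral_linepath_same_Re) (use y12 in auto)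
    have ge: "g = (\<lambda>s. FZ s * w s / (1 - w s))" by (rule ext) (rule g_def)
    have "(\<Sum>\<nu>\<in>{a<..b}. FZ (Complex (1/2) ((2 * pi * of_int \<nu> - \<beta>) / L))) =
      of_real (L / (2 * pi) * Re I0 + L / pi * Im (E1 + \<i> * V + E2))"
    proof -
      have "0 < 2 * pi * a - \<beta>"
      proof -
        have "pi < 4" by (rule pi_less_4)
        moreover have "4 \<le> T / 2" using T' by simp
        moreover have "T / 2 \<le> L * y1" using mult_mono[of 1 L "T / 2" y1] tl yl T' by simp
        ultimately show ?thesis using yL by linarith
      qed
      moreover have "FZ (1 - cnj s) = cnj (FZ s)" if "0 < Im s" "- 1 / 2 \<le> Re s" "Re s \<le> 3/2" for s
        using that by (intro FZ_reflect) auto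
      ultimately show ?thesis
        unfolding I0_def E1_def E2_def vert[symmetric] ge w_def y1_def y2_def
        using reflected_sum_formula[OF FZ_holomorphic _ L ab] by blast
    qed
    also have "(\<Sum>\<nu>\<in>{a<..b}. FZ (Complex (1/2) ((2 * pi * of_int \<nu> - \<beta>) / L))) = (\<Sum>\<nu>\<in>{a<..b}. Z ((2 * pi * of_int \<nu> - \<beta>) / L))"
    proof (intro sum.cong FZ_critical)
      fix \<nu> assume "\<nu> \<in> {a<..b}"
      then have "of_int a + 1 \<le> (of_int \<nu> :: real)" by auto
      then have "2 * pi * (of_int a + 1) \<le> 2 * pi * of_int \<nu>" by (intro mult_left_mono) auto
      then have "L * y1 \<le> 2 * pi * of_int \<nu> - \<beta>" unfolding yL by (simp add: distrib_left) (use pi_gt_zero in linarith)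
      moreover have "0 < L * y1" using L yl T' by simp
      ultimately have "0 < 2 * pi * of_int \<nu> - \<beta>" by linarith
      then show "0 < (2 * pi * of_int \<nu> - \<beta>) / L" using L by simp
    qed simp
    finally have "(\<Sum>\<nu>\<in>{a<..b}. Z ((2 * pi * of_int \<nu> - \<beta>) / L)) - of_real (2 * of_int (b - a) * cos \<tau>)
       = of_real (L / (2 * pi) * Re I0 + L / pi * Im (E1 + \<i> * V + E2) - 2 * of_int (b - a) * cos \<tau>)" by simp
    also have "L / (2 * pi) * Re I0 + L / pi * Im (E1 + \<i> * V + E2) - 2 * of_int (b - a) * cos \<tau>
       = L * (Re I0 / (2 * pi) + (Im E1 + Im E2 + Re (V - cis \<tau> * of_real (y2 - y1))) / pi)"
    proof -
      \<comment> \<open>As y1 and y2 are exactly b - a spacings apart, the main terms cancel without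
        a remainder.\<close>
      have "2 * of_int (b - a) * cos \<tau> = L * (y2 - y1) * cos \<tau> / pi" unfolding ydiff by simp
      then show ?thesis by (simp only: plus_complex.simps minus_complex.simps Re_i_times Im_i_times) (simp add: field_simps)
    qed
    finally have "norm ((\<Sum>\<nu>\<in>{a<..b}. Z ((2 * pi * of_int \<nu> - \<beta>) / L)) - of_real (2 * of_int (b - a) * cos \<tau>))
      = L * \<bar>Re I0 / (2 * pi) + (Im E1 + Im E2 + Re (V - cis \<tau> * of_real (y2 - y1))) / pi\<bar>"
      using L by (simp only: norm_of_real abs_mult abs_of_pos)
    also have "\<dots> \<le> L * (C * S)"
    proof (rule mult_left_mono)
      let ?A = "Re I0" and ?B = "Im E1 + Im E2 + Re (V - cis \<tau> * of_real (y2 - y1))"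
      have "\<bar>?A\<bar> \<le> (CA + 432 * CZ) * S" using abs_Re_le_cmod I0 by (rule order_trans)
      moreover have "\<bar>?A / (2 * pi)\<bar> \<le> \<bar>?A\<bar>" using pi_gt3 mult_left_mono[of 1 "2 * pi" "\<bar>?A\<bar>"] by (simp add: abs_divide pos_divide_le_eq)
      moreover have "\<bar>?B\<bar> \<le> 6 * CZ * S + (CV + 6 * (144 + c) * CZ) * S"
        using abs_Im_le_cmod[of E1] abs_Im_le_cmod[of E2] abs_Re_le_cmod[of "V - cis \<tau> * of_real (y2 - y1)"] E V by linarith
      moreover have "\<bar>?B / pi\<bar> \<le> \<bar>?B\<bar>" using pi_gt3 mult_left_mono[of 1 pi "\<bar>?B\<bar>"] by (simp add: abs_divide pos_divide_le_eq)
      moreover have "\<bar>?A / (2 * pi) + ?B / pi\<bar> \<le> \<bar>?A / (2 * pi)\<bar> + \<bar>?B / pi\<bar>" by (rule abs_triangle_ineq)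
      moreover have "C * S = (CA + 432 * CZ) * S + (6 * CZ * S + (CV + 6 * (144 + c) * CZ) * S)" by (simp add: C_def algebra_simps)
      ultimately show "\<bar>?A / (2 * pi) + ?B / pi\<bar> \<le> C * S" by linarith
    qed (use L in simp)
    finally show ?thesis by (simp add: S_def mult_ac)
  qed
  show ?thesis
  proof (rule that[of C "max T1 T2"])
    show "0 < C" by (rule C0)
    show "21000 \<le> max T1 T2" using T1 by simp
  qed (rule main)
qed

section \<open>From the linearised points to the windows around the Gram points\<close>

lemma exp_quarter_le:
  fixes L c T :: real
  assumes "1 \<le> c" "0 < T" "exp L \<le> c * T powr (1/2)"
  shows "exp (L / 4) \<le> c * T powr (1/8)"
proof -
  have "exp (L / 4) = exp L powr (1/4)" by (simp add: powr_def)
  also have "\<dots> \<le> (c * T powr (1/2)) powr (1/4)" using assms by (intro powr_mono2) auto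
  also have "\<dots> = c powr (1/4) * T powr (1/8)" using assms by (simp add: powr_mult powr_powr)
  also have "\<dots> \<le> c powr 1 * T powr (1/8)" using assms by (intro mult_right_mono powr_mono) auto
  finally show ?thesis using assms by simp
qed

text \<open>The Lipschitz bound is Cauchy's inequality on discs of radius 1/4 about the critical
  line, where the exponential factor is at most e^(L/4) = O(T^(1/8)). This is crude, but the
  displacements to be controlled are only O(H^2/T). To the left of the line the reflection is used.
  The 1 subtracted from 2 H leaves room for the discs.\<close>

lemma Z_bounds:
  fixes \<epsilon> :: real
  assumes \<epsilon>: "0 < \<epsilon>" "\<epsilon> \<le> 1 / 100"
  obtains C T0 where "0 < C" "21000 \<le> T0"
    "\<And>T t. T0 \<le> T \<Longrightarrow> T / 2 \<le> t \<Longrightarrow> t \<le> 2 * T \<Longrightarrow> norm (Z t) \<le> C * T powr (1/6 + 5 * \<epsilon> / 8)"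
    "\<And>T H s t. T0 \<le> T \<Longrightarrow> H = T powr (1/6 + 2 * \<epsilon>) \<Longrightarrow> \<bar>s - T\<bar> \<le> 2 * H - 1 \<Longrightarrow> \<bar>t - T\<bar> \<le> 2 * H - 1 \<Longrightarrow>
      norm (Z s - Z t) \<le> C * T powr (1/6 + 5 * \<epsilon> / 8) * T powr (1/8) * \<bar>s - t\<bar>"
proof -
  obtain c T1 where c: "1 \<le> c" and T1: "21000 \<le> T1" and th0: "\<forall>T\<ge>T1. 1 \<le> theta1 T \<and>
    1 / c * T powr (1/2) \<le> exp (theta1 T) \<and> exp (theta1 T) \<le> c * T powr (1/2) \<and>
    exp (- theta1 T) \<le> c * T powr (- (1/2)) \<and> exp (- theta1 T) \<le> 1 / 2"
    by (rule theta1_scale)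
  obtain CZ where CZ: "0 < CZ" "\<And>T s. 4 \<le> T \<Longrightarrow> 1 / 2 \<le> Re s \<Longrightarrow> Re s \<le> 2 \<Longrightarrow> T / 2 \<le> Im s \<Longrightarrow> Im s \<le> 2 * T \<Longrightarrow>
    norm (zeta s) \<le> CZ * T powr (1/6 + 5 * \<epsilon> / 8)" using zeta_growth[OF \<epsilon>] by blast
  define C where "C = 12 * CZ * c"
  have C: "0 < C" "CZ \<le> C" using CZ(1) c mult_left_mono[of 1 c "12 * CZ"] by (auto simp: C_def)
  show ?thesis
  proof (rule that[OF C(1) T1])
    fix T t :: real assume T: "T1 \<le> T" and t: "T / 2 \<le> t" "t \<le> 2 * T"
    have "norm (Z t) = norm (zeta (Complex (1/2) t))" by (simp add: Z_def norm_mult)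
    also have "\<dots> \<le> CZ * T powr (1/6 + 5 * \<epsilon> / 8)" using T T1 t by (intro CZ) auto
    also have "\<dots> \<le> C * T powr (1/6 + 5 * \<epsilon> / 8)" using C by (intro mult_right_mono) auto
    finally show "norm (Z t) \<le> C * T powr (1/6 + 5 * \<epsilon> / 8)" .
  next
    fix T H s t :: real
    assume T: "T1 \<le> T" and H: "H = T powr (1/6 + 2 * \<epsilon>)" and st: "\<bar>s - T\<bar> \<le> 2 * H - 1" "\<bar>t - T\<bar> \<le> 2 * H - 1"
    have T': "21000 \<le> T" using T T1 by simp
    note W = window_length_bounds[OF \<epsilon> T', folded H]
    define L where "L = theta1 T"
    have L: "1 \<le> L" "exp L \<le> c * T powr (1/2)" using th0 T by (auto simp: L_def)
    define S where "S = T powr (1/6 + 5 * \<epsilon> / 8)"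
    have S0: "0 \<le> S" by (simp add: S_def)
    \<comment> \<open>The 3 bounds |exp R|; division by the radius 1/4 turns it into the 12 in
      \<open>C\<close>.\<close>
    define D where "D = CZ * S * (c * T powr (1/8)) * 3"
    have right: "norm (FZ z) \<le> D" if z: "1/2 \<le> Re z" "Re z \<le> 3/4" "\<bar>Im z - T\<bar> \<le> 2 * H" for z
    proof -
      have "\<exists>R. FZ z = zeta z * exp (\<i> * of_real (theta T - theta1 T * T) + of_real (theta1 T) * (z - 1 / 2)) * exp R \<and> norm (exp R - 1) \<le> 144 * H\<^sup>2 / T \<and> norm (exp R) \<le> 3"
        by (rule FZ_linearised) (use W T' z in auto)
      then obtain R where R: "FZ z = zeta z * exp (\<i> * of_real (theta T - theta1 T * T) + of_real (theta1 T) * (z - 1 / 2)) * exp R" "norm (exp R) \<le> 3"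
        by blast
      have "norm (FZ z) = norm (zeta z) * exp (L * (Re z - 1/2)) * norm (exp R)"
        unfolding R(1) by (simp add: norm_mult norm_exp_eq_Re L_def)
      also have "\<dots> \<le> (CZ * S) * (c * T powr (1/8)) * 3"
      proof (intro mult_mono)
        show "norm (zeta z) \<le> CZ * S" unfolding S_def using z W T' by (intro CZ) (auto simp: abs_le_iff)
        have "L * (Re z - 1/2) \<le> L * (1/4)" using z L by (intro mult_left_mono) auto
        then have "exp (L * (Re z - 1/2)) \<le> exp (L / 4)" by simp
        also have "\<dots> \<le> c * T powr (1/8)" using L c T' by (intro exp_quarter_le) auto
        finally show "exp (L * (Re z - 1/2)) \<le> c * T powr (1/8)" .
      qed (use R CZ c S0 in auto)
      finally show ?thesis by (simp add: D_def)
    qed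
    have box: "norm (FZ z) \<le> D" if z: "1/4 \<le> Re z" "Re z \<le> 3/4" "\<bar>Im z - T\<bar> \<le> 2 * H" for z
    proof (cases "1/2 \<le> Re z")
      case True
      then show ?thesis using right z by simp
    next
      case False
      have "0 < Im z" using z W T' by (auto simp: abs_le_iff)
      then have "norm (FZ z) = norm (FZ (1 - cnj z))" using z by (subst FZ_reflect) auto
      also have "\<dots> \<le> D" using False z by (intro right) auto
      finally show ?thesis .
    qed
    let ?p = "\<lambda>u. Complex (1/2) u"
    have d: "norm (deriv FZ z) \<le> D / (1/4)" if z: "Re z = 1/2" "\<bar>Im z - T\<bar> \<le> 2 * H - 1" for z
    proof -
      have bx: "\<bar>Re w - Re z\<bar> \<le> 1/4 \<and> \<bar>Im w - Im z\<bar> \<le> 1/4" if "dist z w \<le> 1/4" for w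
        using abs_Re_le_cmod[of "w - z"] abs_Im_le_cmod[of "w - z"] that by (auto simp: dist_norm norm_minus_commute)
      have sub: "cball z (1/4) \<subseteq> {s. 0 < Im s}"
      proof
        fix w assume "w \<in> cball z (1/4)"
        then have "\<bar>Im w - Im z\<bar> \<le> 1/4" using bx by simp
        then show "w \<in> {s. 0 < Im s}" unfolding mem_Collect_eq using z W T' by linarith
      qed
      have hol: "FZ holomorphic_on cball z (1/4)" by (rule holomorphic_on_subset[OF FZ_holomorphic sub])
      have "norm ((deriv ^^ 1) FZ z) \<le> fact 1 * D / (1/4) ^ 1"
      proof (rule Cauchy_inequality)
        show "FZ holomorphic_on ball z (1/4)" using hol by (rule holomorphic_on_subset) auto
        show "continuous_on (cball z (1/4)) FZ" using hol by (rule holomorphic_on_imp_continuous_on)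
        fix w assume "norm (z - w) = 1/4"
        then have bw: "\<bar>Re w - Re z\<bar> \<le> 1/4" "\<bar>Im w - Im z\<bar> \<le> 1/4" using bx[of w] by (auto simp: dist_norm)
        show "norm (FZ w) \<le> D" by (rule box) (use bw z in linarith)+
      qed simp
      then show ?thesis by simp
    qed
    have seg: "Re z = 1/2" "\<bar>Im z - T\<bar> \<le> 2 * H - 1" if "z \<in> closed_segment (?p s) (?p t)" for z
    proof -
      have "Re z = 1/2" "Im z \<in> closed_segment s t" using that by (auto simp: closed_segment_same_Re)
      then show "Re z = 1/2" "\<bar>Im z - T\<bar> \<le> 2 * H - 1" using st by (auto simp: closed_segment_eq_real_ivl abs_le_iff split: if_splits)
    qed
    have "norm (FZ (?p s) - FZ (?p t)) \<le> D / (1/4) * norm (?p s - ?p t)"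
    proof (rule field_differentiable_bound[where S = "closed_segment (?p s) (?p t)" and f' = "deriv FZ"])
      fix z assume z: "z \<in> closed_segment (?p s) (?p t)"
      have "0 < Im z" using seg[OF z] W T' by (auto simp: abs_le_iff)
      then show "(FZ has_field_derivative deriv FZ z) (at z within closed_segment (?p s) (?p t))"
        using holomorphic_derivI[OF FZ_holomorphic open_halfspace_Im_gt] by (auto intro: has_field_derivative_at_within)
      show "norm (deriv FZ z) \<le> D / (1/4)" using seg[OF z] by (rule d)
    qed auto
    moreover have "?p s - ?p t = \<i> * of_real (s - t)" by (simp add: complex_eq_iff)
    moreover have "0 < s" "0 < t" using st W T' by (auto simp: abs_le_iff)
    ultimately have "norm (Z s - Z t) \<le> D / (1/4) * \<bar>s - t\<bar>" by (simp add: FZ_critical norm_mult del: of_real_diff)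
    also have "D / (1/4) = C * S * T powr (1/8)" by (simp add: D_def C_def)
    finally show "norm (Z s - Z t) \<le> C * T powr (1/6 + 5 * \<epsilon> / 8) * T powr (1/8) * \<bar>s - t\<bar>" by (simp add: S_def)
  qed
qed

lemma theta_linear:
  assumes T: "8 \<le> T" "T / 2 \<le> t"
  shows "\<bar>theta t - theta T - theta1 T * (t - T)\<bar> \<le> 8 / T * (t - T)\<^sup>2" "\<bar>theta1 t - theta1 T\<bar> \<le> 8 / T * \<bar>t - T\<bar>"
proof -
  have p: "0 < t" "0 < T" using T by auto
  have e: "Complex (1/2) t - Complex (1/2) T = \<i> * of_real (t - T)" by (simp add: complex_eq_iff)
  have n: "norm (Complex (1/2) t - Complex (1/2) T) = \<bar>t - T\<bar>" unfolding e by (simp add: norm_mult del: of_real_diff)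
  note b = thA_taylor[of "Complex (1/2) t" "T / 2" "Complex (1/2) T", unfolded n theta_deriv(2)[OF p(1)] theta_deriv(2)[OF p(2)] thA_critical[OF p(1)] thA_critical[OF p(2)]]
  have "norm (\<i> * of_real (theta t) - (\<i> * of_real (theta T) + of_real (theta1 T) * (Complex (1/2) t - Complex (1/2) T)))  \<le> 4 / (T / 2) * \<bar>t - T\<bar>\<^sup>2"
    using T by (intro b) auto
  also have "\<i> * of_real (theta t) - (\<i> * of_real (theta T) + of_real (theta1 T) * (Complex (1/2) t - Complex (1/2) T)) = \<i> * of_real (theta t - theta T - theta1 T * (t - T))"
    unfolding e by (simp add: algebra_simps)
  finally show "\<bar>theta t - theta T - theta1 T * (t - T)\<bar> \<le> 8 / T * (t - T)\<^sup>2" by (simp only: norm_mult norm_ii norm_of_real power2_abs) simp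
  have "norm (complex_of_real (theta1 t) - of_real (theta1 T)) \<le> 4 / (T / 2) * \<bar>t - T\<bar>"
    using T by (intro b) auto
  then show "\<bar>theta1 t - theta1 T\<bar> \<le> 8 / T * \<bar>t - T\<bar>" by (simp only: of_real_diff[symmetric] norm_of_real) simp
qed

text \<open>With slope at least 1, a change of phase bounds the change of t: this converts widths
  and positions of windows from phases to points.\<close>

lemma theta_expanding:
  assumes t0: "0 < t0" "\<And>t. t0 \<le> t \<Longrightarrow> 1 \<le> theta1 t" and st: "t0 \<le> s" "s \<le> t"
  shows "t - s \<le> theta t - theta s"
proof (cases "s = t")
  case False
  then have "s < t" using st by simp
  moreover have "(theta has_real_derivative theta1 x) (at x)" if "s \<le> x" "x \<le> t" for x
    by (rule theta_deriv) (use that t0 st in simp)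
  ultimately obtain z where z: "s < z" "theta t - theta s = (t - s) * theta1 z" using MVT2[of s t theta theta1] by blast
  have "(t - s) * 1 \<le> (t - s) * theta1 z" using z t0(2)[of z] st by (intro mult_left_mono) auto
  then show ?thesis using z by simp
qed simp

text \<open>A solution exists by the intermediate value theorem. It is the only one described by
  \<open>gram\<close>: of two admissible solutions the smaller would have a strictly increasing tail
  containing the larger, with the same value at both.\<close>

lemma gram_between:
  assumes t0: "0 < t0" "\<And>t. t0 \<le> t \<Longrightarrow> 1 \<le> theta1 t" and AB: "t0 \<le> A" "A \<le> B"
    and v: "theta A \<le> pi * real \<kappa> + \<tau>" "pi * real \<kappa> + \<tau> \<le> theta B"
  shows "A \<le> gram \<kappa> \<tau>" "gram \<kappa> \<tau> \<le> B" "theta (gram \<kappa> \<tau>) = pi * real \<kappa> + \<tau>"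
proof -
  note ex = theta_expanding[OF t0]
  have "isCont theta x" if "A \<le> x" "x \<le> B" for x
    using theta_deriv(1)[of x] that t0 AB by (intro DERIV_isCont) auto
  then obtain t where t: "A \<le> t" "t \<le> B" "theta t = pi * real \<kappa> + \<tau>"
    using IVT[of theta A "pi * real \<kappa> + \<tau>" B] v AB by blast
  have m: "strict_mono_on {t..} theta"
  proof (rule strict_mono_onI)
    fix r s assume "r \<in> {t..}" "s \<in> {t..}" "r < s"
    then show "theta r < theta s" using ex[of r s] t AB by simp
  qed
  have "gram \<kappa> \<tau> = t" unfolding gram_def
  proof (rule the_equality)
    fix u assume u: "strict_mono_on {u..} theta \<and> theta u = pi * real \<kappa> + \<tau>"
    consider "u < t" | "t < u" | "u = t" by linarith
    then show "u = t"
    proof cases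
      case 1
      then have "theta u < theta t" using u by (intro strict_mono_onD[of "{u..}" theta]) auto
      then show ?thesis using u t by simp
    next
      case 2
      then have "theta t < theta u" using m by (intro strict_mono_onD[of "{t..}" theta]) auto
      then show ?thesis using u t by simp
    qed
  qed (use m t in simp)
  then show "A \<le> gram \<kappa> \<tau>" "gram \<kappa> \<tau> \<le> B" "theta (gram \<kappa> \<tau>) = pi * real \<kappa> + \<tau>" using t by auto
qed

lemma has_integral_open_inter:
  fixes f :: "real \<Rightarrow> complex"
  assumes "f integrable_on {max p A..min q B}"
  shows "(f has_integral integral {max p A..min q B} f) ({t. p < t \<and> t < q} \<inter> {A..B})"
proof -
  have n: "negligible {p, q}" "negligible ({} :: real set)" by (auto intro: negligible_finite)
  have "(f has_integral integral {max p A..min q B} f) {max p A..min q B}" using assms by (rule integrable_integral)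
  moreover have "negligible {x \<in> {max p A..min q B} - {t. p < t \<and> t < q} \<inter> {A..B}. f x \<noteq> 0}"
    using n(1) by (rule negligible_subset) auto
  moreover have "negligible {x \<in> {t. p < t \<and> t < q} \<inter> {A..B} - {max p A..min q B}. f x \<noteq> 0}"
    using n(2) by (rule negligible_subset) auto
  ultimately show ?thesis using has_integral_spike_set_eq by blast
qed

text \<open>Even and odd indices differ by the phase pi e, and cos (pi e + \<tau>) = (-1)^e cos
  \<tau> accounts for the two signs. The integral passes from the clipped windows \<open>v\<close>
  to full windows \<open>w\<close>, to the windows \<open>w'\<close> of the linear phase, and then
  to an integral over \<tau> of the sums in \<open>linearised_gram_sum\<close>. Every error is
  proportional to x: it is integrated over windows of length at most 2 x or over \<tau> in [-x, x],
  or it carries the factor sin x.\<close>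

lemma gram_windows_integral:
  fixes \<epsilon> :: real and e :: nat
  assumes \<epsilon>: "0 < \<epsilon>" "\<epsilon> \<le> 1 / 100" and e: "e \<le> 1"
  shows "\<exists>C T0. 0 < C \<and> 0 < T0 \<and> (\<forall>T H x. T0 \<le> T \<longrightarrow> H = T powr (1/6 + 2 * \<epsilon>) \<longrightarrow> 0 < x \<longrightarrow> x \<le> pi / 2 \<longrightarrow>
     norm (integral ((\<Union>\<nu>\<in>{\<nu>. 1 \<le> \<nu> \<and> T \<le> gram (2 * \<nu> + e) 0 \<and> gram (2 * \<nu> + e) 0 \<le> T + H}.
        {t. gram (2 * \<nu> + e) (- x) < t \<and> t < gram (2 * \<nu> + e) x}) \<inter> {T..T + H}) Z - of_real ((- 1) ^ e * (2 / pi * H * sin x)))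
     \<le> C * (x * T powr (1/6 + 5 * \<epsilon> / 8)))"
proof -
  obtain c t0 where c: "1 \<le> c" and t0: "21000 \<le> t0" and th0: "\<forall>T\<ge>t0. 1 \<le> theta1 T \<and>
    1 / c * T powr (1/2) \<le> exp (theta1 T) \<and> exp (theta1 T) \<le> c * T powr (1/2) \<and>
    exp (- theta1 T) \<le> c * T powr (- (1/2)) \<and> exp (- theta1 T) \<le> 1 / 2"
    by (rule theta1_scale)
  have g0: "0 < t0" "\<And>t. t0 \<le> t \<Longrightarrow> 1 \<le> theta1 t" using t0 th0 by auto
  note ex = theta_expanding[OF g0] and gb = gram_between[OF g0]
  show ?thesis
  proof (rule linearised_gram_sum[OF \<epsilon>], rule Z_bounds[OF \<epsilon>])
    fix CL T2 CZ T3 :: real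
    assume CL: "0 < CL" and T2: "21000 \<le> T2" and
      lgs: "\<And>T \<tau> a b H L \<beta>. T2 \<le> T \<Longrightarrow> H = T powr (1/6 + 2 * \<epsilon>) \<Longrightarrow> L = theta1 T \<Longrightarrow> \<beta> = theta T - theta1 T * T - \<tau> \<Longrightarrow> a < b \<Longrightarrow>
      T - H \<le> (2 * pi * of_int a + pi - \<beta>) / L \<Longrightarrow> (2 * pi * of_int b + pi - \<beta>) / L \<le> T + 2 * H \<Longrightarrow>
      norm ((\<Sum>\<nu>\<in>{a<..b}. Z ((2 * pi * of_int \<nu> - \<beta>) / L)) - of_real (2 * of_int (b - a) * cos \<tau>)) \<le> CL * (L * T powr (1/6 + 5 * \<epsilon> / 8))"
    assume CZ: "0 < CZ" and T3: "21000 \<le> T3" and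
      Zb: "\<And>T t. T3 \<le> T \<Longrightarrow> T / 2 \<le> t \<Longrightarrow> t \<le> 2 * T \<Longrightarrow> norm (Z t) \<le> CZ * T powr (1/6 + 5 * \<epsilon> / 8)" and
      Zl: "\<And>T H s t. T3 \<le> T \<Longrightarrow> H = T powr (1/6 + 2 * \<epsilon>) \<Longrightarrow> \<bar>s - T\<bar> \<le> 2 * H - 1 \<Longrightarrow> \<bar>t - T\<bar> \<le> 2 * H - 1 \<Longrightarrow>
      norm (Z s - Z t) \<le> CZ * T powr (1/6 + 5 * \<epsilon> / 8) * T powr (1/8) * \<bar>s - t\<bar>"
    \<comment> \<open>For target values below \<open>theta t0\<close> nothing is known about
      \<open>gram\<close>. There are finitely many such indices, and T is taken beyond all their
      values \<open>gram \<kappa> 0\<close>, so that none of them is counted.\<close>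
    define K0 where "K0 = {\<kappa>::nat. pi * real \<kappa> < theta t0}"
    have fK: "finite K0"
    proof (rule finite_subset)
      show "K0 \<subseteq> {..nat \<lceil>theta t0\<rceil>}"
      proof
        fix \<kappa> assume "\<kappa> \<in> K0"
        then have "pi * real \<kappa> < theta t0" by (simp add: K0_def)
        moreover have "1 * real \<kappa> \<le> pi * real \<kappa>" using pi_gt3 by (intro mult_right_mono) auto
        ultimately have "real \<kappa> < theta t0" by simp
        then show "\<kappa> \<in> {..nat \<lceil>theta t0\<rceil>}" by (simp add: le_nat_iff) linarith
      qed
    qed simp
    define M0 where "M0 = Max (insert 0 ((\<lambda>\<kappa>. gram \<kappa> 0) ` K0))"
    have M0: "gram \<kappa> 0 \<le> M0" if "\<kappa> \<in> K0" for \<kappa> unfolding M0_def using that fK by (intro Max_ge) auto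
    \<comment> \<open>10^6 yields H >= 10. The last entry yields \<open>theta T\<close> >= 20, which
      keeps the index 0 out, and puts t0 below T - 2.\<close>
    define T0 where "T0 = Max {T2, T3, 10^6, M0 + 1, t0 + 20 + \<bar>theta t0\<bar>}"
    define C where "C = 8 * CZ + 384 * c * CZ + 2 * CL + 8"
    have C0: "0 < C" using CZ CL c by (simp add: C_def add_pos_pos)
    show ?thesis
    proof (rule exI[of _ C], rule exI[of _ T0], intro conjI allI impI)
      show "0 < C" by (rule C0)
      have "10^6 \<le> T0" unfolding T0_def by (rule Max_ge) auto
      then show "0 < T0" by simp
    next
      fix T H x :: real
      assume T0: "T0 \<le> T" and H: "H = T powr (1/6 + 2 * \<epsilon>)" and x: "0 < x" "x \<le> pi / 2"
      have T: "T2 \<le> T" "T3 \<le> T" "10^6 \<le> T" "M0 + 1 \<le> T" "t0 + 20 + \<bar>theta t0\<bar> \<le> T"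
      proof -
        have "v \<le> T" if "v \<in> {T2, T3, 10^6, M0 + 1, t0 + 20 + \<bar>theta t0\<bar>}" for v
        proof -
          have "v \<le> T0" unfolding T0_def by (rule Max_ge[OF _ that]) simp
          then show ?thesis using T0 by simp
        qed
        then show "T2 \<le> T" "T3 \<le> T" "10^6 \<le> T" "M0 + 1 \<le> T" "t0 + 20 + \<bar>theta t0\<bar> \<le> T" by blast+
      qed
      have T': "21000 \<le> T" using T by simp
      note W = window_length_bounds[OF \<epsilon> T', folded H]
      have H10: "10 \<le> H"
      proof -
        have "(10::real) = (10 powr 6) powr (1/6)" by (simp only: powr_powr) simp
        also have "\<dots> \<le> T powr (1/6)" using T by (intro powr_mono2) auto
        also have "\<dots> \<le> H" unfolding H using T' \<epsilon> by (intro powr_mono) auto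
        finally show ?thesis .
      qed
      define L where "L = theta1 T"
      have L: "1 \<le> L" "exp L \<le> c * T powr (1/2)" using th0 T t0 by (auto simp: L_def)
      define Q where "Q = T powr (1/8)"
      have Q: "1 \<le> Q" unfolding Q_def using T' by (intro ge_one_powr_ge_zero) auto
      have LQ: "L \<le> 4 * c * Q"
      proof -
        have "L / 4 \<le> exp (L / 4)" using exp_ge_add_one_self[of "L / 4"] by linarith
        also have "\<dots> \<le> c * Q" unfolding Q_def using L c T' by (intro exp_quarter_le) auto
        finally show ?thesis by simp
      qed
      define S where "S = T powr (1/6 + 5 * \<epsilon> / 8)"
      have S: "1 \<le> S" unfolding S_def using T' \<epsilon> by (intro ge_one_powr_ge_zero) auto
      \<comment> \<open>The Lipschitz factor Q times the displacement H^2/T. There are O(Q H)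
        windows, so Q H D <= 1 is what makes the displacements cost O(x S) in total; in exponents
        this says 1/4 + 1/2 + 6\<epsilon> <= 1.\<close>
      define D where "D = Q * H\<^sup>2 / T"
      have D: "0 \<le> D" "H\<^sup>2 / T \<le> D" "H / T \<le> D" "Q * H * D \<le> 1"
      proof -
        have H2: "H \<le> H\<^sup>2" using W(1) by (simp add: power2_eq_square)
        have "1 * H\<^sup>2 \<le> Q * H\<^sup>2" using Q by (intro mult_right_mono) auto
        then have "H\<^sup>2 \<le> Q * H\<^sup>2" by simp
        then show "0 \<le> D" "H\<^sup>2 / T \<le> D" "H / T \<le> D" unfolding D_def using H2 T' Q by (auto intro!: divide_right_mono)
        have "Q * H * D = (Q * Q * (H * (H * H))) * T powr (- 1)" using T' by (simp add: D_def power2_eq_square powr_minus_divide)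
        also have "\<dots> = T powr (1/8 + 1/8 + ((1/6 + 2 * \<epsilon>) + ((1/6 + 2 * \<epsilon>) + (1/6 + 2 * \<epsilon>))) + - 1)"
          by (simp only: Q_def H powr_add)
        also have "\<dots> \<le> T powr 0" using T' \<epsilon> by (intro powr_mono) auto
        finally show "Q * H * D \<le> 1" using T' by simp
      qed
      have x2: "x \<le> 2" using x pi_less_4 by simp
      have thT: "20 \<le> theta T"
      proof -
        have "t0 \<le> T" using T by linarith
        then have "T - t0 \<le> theta T - theta t0" using ex[of t0 T] by simp
        then show ?thesis using T by linarith
      qed
      define \<kappa> where "\<kappa> \<nu> = pi * real (2 * \<nu> + e)" for \<nu> :: nat
      define p where "p \<nu> = gram (2 * \<nu> + e) (- x)" for \<nu> :: nat
      define q where "q \<nu> = gram (2 * \<nu> + e) x" for \<nu> :: nat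
      define m where "m \<nu> = gram (2 * \<nu> + e) 0" for \<nu> :: nat
      define I where "I = {\<nu>. 1 \<le> \<nu> \<and> T \<le> m \<nu> \<and> m \<nu> \<le> T + H}"
      have tt: "t0 \<le> T - 2" "t0 \<le> T" "t0 \<le> T + H" using T H10 by auto
      \<comment> \<open>Membership is expressed through the phase, which increases beyond t0. The
        choice of T0 rules out the uncontrolled indices, and \<open>theta T\<close> >= 20 rules out
        \<nu> = 0.\<close>
      have I_iff: "\<nu> \<in> I \<longleftrightarrow> theta T \<le> \<kappa> \<nu> \<and> \<kappa> \<nu> \<le> theta (T + H)" for \<nu>
      proof
        assume \<nu>: "\<nu> \<in> I"
        have "2 * \<nu> + e \<notin> K0" using M0[of "2 * \<nu> + e"] \<nu> T by (auto simp: I_def m_def)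
        then have k: "theta t0 \<le> \<kappa> \<nu>" by (simp add: K0_def \<kappa>_def)
        have "\<kappa> \<nu> \<le> theta (t0 + (\<kappa> \<nu> - theta t0))" using ex[of t0 "t0 + (\<kappa> \<nu> - theta t0)"] k by simp
        then have g: "t0 \<le> m \<nu>" "theta (m \<nu>) = \<kappa> \<nu>"
          using gb[of t0 "t0 + (\<kappa> \<nu> - theta t0)" "2 * \<nu> + e" 0] k by (auto simp: m_def \<kappa>_def)
        show "theta T \<le> \<kappa> \<nu> \<and> \<kappa> \<nu> \<le> theta (T + H)"
          using ex[of T "m \<nu>"] ex[of "m \<nu>" "T + H"] g \<nu> tt by (auto simp: I_def)
      next
        assume k: "theta T \<le> \<kappa> \<nu> \<and> \<kappa> \<nu> \<le> theta (T + H)"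
        have g: "T \<le> m \<nu>" "m \<nu> \<le> T + H"
          using gb[of T "T + H" "2 * \<nu> + e" 0] k tt H10 by (auto simp: m_def \<kappa>_def)
        have "\<nu> \<noteq> 0"
        proof
          assume "\<nu> = 0"
          then have "\<kappa> \<nu> \<le> pi * 1" using e unfolding \<kappa>_def by (intro mult_left_mono) auto
          then show False using k thT pi_less_4 by linarith
        qed
        then show "\<nu> \<in> I" using g by (simp add: I_def)
      qed
      \<comment> \<open>The slope is at least 1 and x <= 2, so the ends of a window stay within 2 of
        [T, T + H].\<close>
      have pq: "T - 2 \<le> p \<nu>" "q \<nu> \<le> T + H + 2" "theta (p \<nu>) = \<kappa> \<nu> - x" "theta (q \<nu>) = \<kappa> \<nu> + x" "T - 2 \<le> q \<nu>" "p \<nu> \<le> T + H + 2"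
        if "\<nu> \<in> I" for \<nu>
      proof -
        have k: "theta T \<le> \<kappa> \<nu>" "\<kappa> \<nu> \<le> theta (T + H)" using that I_iff by auto
        have "theta (T - 2) \<le> theta T - 2" "theta (T + H) + 2 \<le> theta (T + H + 2)"
          using ex[of "T - 2" T] ex[of "T + H" "T + H + 2"] tt by auto
        then show "T - 2 \<le> p \<nu>" "q \<nu> \<le> T + H + 2" "theta (p \<nu>) = \<kappa> \<nu> - x" "theta (q \<nu>) = \<kappa> \<nu> + x" "T - 2 \<le> q \<nu>" "p \<nu> \<le> T + H + 2"
          using gb[of "T - 2" "T + H + 2" "2 * \<nu> + e" x] gb[of "T - 2" "T + H + 2" "2 * \<nu> + e" "- x"] k x x2 tt H10
          by (auto simp: p_def q_def \<kappa>_def)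
      qed
      have inc: "s \<le> t" if "t0 \<le> s" "t0 \<le> t" "theta s \<le> theta t" for s t
        using ex[of t s] that by linarith
      have pql: "p \<nu> \<le> q \<nu>" "q \<nu> - p \<nu> \<le> 2 * x" if "\<nu> \<in> I" for \<nu>
      proof -
        have ge: "t0 \<le> p \<nu>" "t0 \<le> q \<nu>" using pq[OF that] tt by auto
        show "p \<nu> \<le> q \<nu>" using inc[of "p \<nu>" "q \<nu>"] ge pq[OF that] x by simp
        then show "q \<nu> - p \<nu> \<le> 2 * x" using ex[of "p \<nu>" "q \<nu>"] ge pq[OF that] by simp
      qed
      \<comment> \<open>The integers a < \<nu> <= b are the indices in \<open>I\<close>; the
        half-open form, hence the - 1, is the one in which the residue formula sums.\<close>
      define a where "a = \<lceil>(theta T - pi * e) / (2 * pi)\<rceil> - 1"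
      define b where "b = \<lfloor>(theta (T + H) - pi * e) / (2 * pi)\<rfloor>"
      have ab_iff: "a < \<nu> \<longleftrightarrow> theta T \<le> 2 * pi * of_int \<nu> + pi * e" "\<nu> \<le> b \<longleftrightarrow> 2 * pi * of_int \<nu> + pi * e \<le> theta (T + H)" for \<nu> :: int
      proof -
        have "a < \<nu> \<longleftrightarrow> (theta T - pi * e) / (2 * pi) \<le> of_int \<nu>" by (simp add: a_def ceiling_le_iff[symmetric] less_eq_int_code) linarith
        also have "\<dots> \<longleftrightarrow> theta T \<le> 2 * pi * of_int \<nu> + pi * e" by (simp add: pos_divide_le_eq algebra_simps)
        finally show "a < \<nu> \<longleftrightarrow> theta T \<le> 2 * pi * of_int \<nu> + pi * e" .
        have "\<nu> \<le> b \<longleftrightarrow> of_int \<nu> \<le> (theta (T + H) - pi * e) / (2 * pi)" by (simp add: b_def le_floor_iff)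
        also have "\<dots> \<longleftrightarrow> 2 * pi * of_int \<nu> + pi * e \<le> theta (T + H)" by (simp add: pos_le_divide_eq algebra_simps)
        finally show "\<nu> \<le> b \<longleftrightarrow> 2 * pi * of_int \<nu> + pi * e \<le> theta (T + H)" .
      qed
      have \<kappa>_int: "\<kappa> \<nu> = 2 * pi * of_int (int \<nu>) + pi * e" for \<nu> by (simp add: \<kappa>_def algebra_simps)
      have I_int: "\<nu> \<in> I \<longleftrightarrow> a < int \<nu> \<and> int \<nu> \<le> b" for \<nu> unfolding I_iff ab_iff \<kappa>_int by simp
      have nonneg: "0 \<le> \<nu>" if "a < \<nu>" for \<nu>
      proof (rule ccontr)
        assume "\<not> 0 \<le> \<nu>"
        then have "2 * pi * of_int \<nu> \<le> 2 * pi * 0" by (intro mult_left_mono) auto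
        moreover have "pi * e \<le> pi * 1" using e by (intro mult_left_mono) auto
        ultimately show False using ab_iff(1)[of \<nu>] that thT pi_less_4 by linarith
      qed
      have reindex: "(\<Sum>\<nu>\<in>I. f (int \<nu>)) = (\<Sum>\<nu>\<in>{a<..b}. f \<nu>)" for f :: "int \<Rightarrow> complex"
        by (rule sum.reindex_bij_witness[of _ nat int]) (use I_int nonneg in auto)
      have finI: "finite I"
      proof (rule finite_subset)
        show "I \<subseteq> {..nat b}" using I_int by auto
      qed simp
      define J where "J = real_of_int (b - a)"
      have cardI: "real (card I) \<le> \<bar>J\<bar>"
      proof -
        have "card I = card {a<..b}" by (rule bij_betw_same_card[of int], rule bij_betwI[of _ _ _ nat]) (use I_int nonneg in auto)
        then show ?thesis by (simp add: J_def)
      qed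
      have lin: "\<bar>theta (T + H) - theta T - L * H\<bar> \<le> 1"
      proof -
        have "\<bar>theta (T + H) - theta T - L * H\<bar> \<le> 8 / T * H\<^sup>2" using theta_linear(1)[of T "T + H"] T' H10 by (simp add: L_def)
        also have "\<dots> = 8 * (H\<^sup>2 / T)" by simp
        also have "\<dots> \<le> 1" using W(5) by simp
        finally show ?thesis .
      qed
      have Ja: "theta T - 2 * pi \<le> 2 * pi * a + pi * e" "2 * pi * a + pi * e < theta T"
      proof -
        show "2 * pi * a + pi * e < theta T" using ab_iff(1)[of a] by simp
        show "theta T - 2 * pi \<le> 2 * pi * a + pi * e" using ab_iff(1)[of "a + 1"] by (simp add: algebra_simps)
      qed
      have Jb: "theta (T + H) - 2 * pi < 2 * pi * b + pi * e" "2 * pi * b + pi * e \<le> theta (T + H)"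
      proof -
        show "2 * pi * b + pi * e \<le> theta (T + H)" using ab_iff(2)[of b] by simp
        show "theta (T + H) - 2 * pi < 2 * pi * b + pi * e" using ab_iff(2)[of "b + 1"] by (simp add: algebra_simps)
      qed
      have J2: "2 * pi * J = 2 * pi * b - 2 * pi * a" by (simp add: J_def algebra_simps)
      \<comment> \<open>The two roundings cost at most 2 pi together and linearisation at most 1;
        bounding pi by 4 gives 9.\<close>
      have JLH: "\<bar>2 * pi * J - L * H\<bar> \<le> 9" using Ja Jb J2 lin pi_less_4 by linarith
      have LH: "H \<le> L * H" using L H10 mult_right_mono[of 1 L H] by simp
      have Jpos: "0 < 2 * pi * J" using JLH LH H10 by linarith
      then have J0: "0 < J" by (simp add: zero_less_mult_iff)
      then have ab: "a < b" by (simp add: J_def)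
      have JL: "J \<le> L * H"
      proof -
        have "6 * J \<le> 2 * pi * J" using pi_gt3 J0 by (intro mult_right_mono) auto
        then show ?thesis using JLH LH H10 by linarith
      qed
      \<comment> \<open>\<open>g t\<close> is the point at which the tangent to \<open>theta\<close>
        at T takes the value \<open>theta t\<close>. It differs from t by O(H^2/T) and carries the
        windows of \<open>theta\<close> to those of the linear phase.\<close>
      define \<alpha> where "\<alpha> = theta T - L * T"
      define g where "g t = (theta t - \<alpha>) / L" for t
      have Zc: "continuous_on {u..v} Z" if "0 < u" for u v
      proof -
        have "continuous_on {u..v} (\<lambda>t. FZ (Complex (1/2) t))"
          by (rule continuous_on_compose2[OF holomorphic_on_imp_continuous_on[OF FZ_holomorphic]]) (use that in \<open>auto intro!: continuous_on_Complex continuous_intros\<close>)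
        then show ?thesis by (rule continuous_on_eq) (use that in \<open>simp add: FZ_critical\<close>)
      qed
      have gt: "\<bar>g t - t\<bar> \<le> 32 * (H\<^sup>2 / T)" "\<bar>theta1 t / L - 1\<bar> \<le> 16 * (H / T)" if t: "\<bar>t - T\<bar> \<le> 2 * H" for t
      proof -
        have tT: "T / 2 \<le> t" using t W by (auto simp: abs_le_iff)
        have "g t - t = (theta t - theta T - theta1 T * (t - T)) / L" using L by (simp add: g_def \<alpha>_def L_def field_simps)
        then have "\<bar>g t - t\<bar> = \<bar>theta t - theta T - theta1 T * (t - T)\<bar> / L" using L by simp
        also have "\<dots> \<le> \<bar>theta t - theta T - theta1 T * (t - T)\<bar> / 1" using L by (intro divide_left_mono) auto
        also have "\<dots> \<le> 8 / T * (t - T)\<^sup>2" using theta_linear(1)[of T t] T' tT by simp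
        also have "\<dots> = 8 / T * \<bar>t - T\<bar>\<^sup>2" by simp
        also have "\<dots> \<le> 8 / T * (2 * H)\<^sup>2" using t T' by (intro mult_left_mono power_mono) auto
        finally show "\<bar>g t - t\<bar> \<le> 32 * (H\<^sup>2 / T)" by (simp add: power_mult_distrib)
        have "theta1 t / L - 1 = (theta1 t - theta1 T) / L" using L by (simp add: L_def field_simps)
        then have "\<bar>theta1 t / L - 1\<bar> = \<bar>theta1 t - theta1 T\<bar> / L" using L by simp
        also have "\<dots> \<le> \<bar>theta1 t - theta1 T\<bar> / 1" using L by (intro divide_left_mono) auto
        also have "\<dots> \<le> 8 / T * \<bar>t - T\<bar>" using theta_linear(2)[of T t] T' tT by simp
        also have "\<dots> \<le> 8 / T * (2 * H)" using t T' by (intro mult_left_mono) auto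
        finally show "\<bar>theta1 t / L - 1\<bar> \<le> 16 * (H / T)" by simp
      qed
      have h1: "32 * (H\<^sup>2 / T) \<le> 1" using W(5) by simp
      define w where "w \<nu> = integral {p \<nu>..q \<nu>} Z" for \<nu>
      define w' where "w' \<nu> = integral {g (p \<nu>)..g (q \<nu>)} Z" for \<nu>
      have near: "\<bar>t - T\<bar> \<le> 2 * H - 2" if "\<nu> \<in> I" "p \<nu> \<le> t" "t \<le> q \<nu>" for \<nu> t
        using pq[OF that(1)] that H10 by linarith
      have gnear: "\<bar>g t - T\<bar> \<le> 2 * H - 1" if "\<nu> \<in> I" "p \<nu> \<le> t" "t \<le> q \<nu>" for \<nu> t
        using near[OF that] gt(1)[of t] h1 by linarith
      \<comment> \<open>Substituting g t in \<open>w'\<close> brings both integrals to the same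
        interval. The integrands differ by the displacement of the argument, which costs 32 D, and
        by the distortion \<open>theta1 t / L - 1\<close>, which costs 16 D.\<close>
      have wdiff: "norm (w \<nu> - w' \<nu>) \<le> 48 * CZ * S * D * (2 * x)" if \<nu>: "\<nu> \<in> I" for \<nu>
      proof -
        have s: "((\<lambda>t. (theta1 t / L) *\<^sub>R Z (g t)) has_integral w' \<nu>) {p \<nu>..q \<nu>}"
          unfolding w'_def
        proof (rule has_integral_substitution[where f = Z and g = g and g' = "\<lambda>t. theta1 t / L" and c = "T / 2" and d = "2 * T"])
          show "p \<nu> \<le> q \<nu>" by (rule pql[OF \<nu>])
          show "g (p \<nu>) \<le> g (q \<nu>)" unfolding g_def using pq[OF \<nu>] x L by (intro divide_right_mono) auto
          show "g ` {p \<nu>..q \<nu>} \<subseteq> {T / 2..2 * T}"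
          proof
            fix y assume "y \<in> g ` {p \<nu>..q \<nu>}"
            then obtain t where "y = g t" "p \<nu> \<le> t" "t \<le> q \<nu>" by auto
            then have "\<bar>y - T\<bar> \<le> 2 * H - 1" using gnear[OF \<nu>] by simp
            moreover have "2 * H \<le> T / 2" by (rule W)
            ultimately show "y \<in> {T / 2..2 * T}" unfolding atLeastAtMost_iff by linarith
          qed
          show "continuous_on {T / 2..2 * T} Z" by (rule Zc) (use T' in simp)
          fix t assume "t \<in> {p \<nu>..q \<nu>}"
          then have "0 < t" using pq(1)[OF \<nu>] T' by simp
          then have "(theta has_real_derivative theta1 t) (at t within {p \<nu>..q \<nu>})" by (rule has_field_derivative_at_within[OF theta_deriv(1)])
          then show "(g has_real_derivative theta1 t / L) (at t within {p \<nu>..q \<nu>})"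
            unfolding g_def using L by (auto intro!: derivative_eq_intros)
        qed
        have Zi: "(Z has_integral w \<nu>) {p \<nu>..q \<nu>}"
          unfolding w_def by (intro integrable_integral integrable_continuous_real Zc) (use pq(1)[OF \<nu>] T' in simp)
        have hd: "((\<lambda>t. Z t - (theta1 t / L) *\<^sub>R Z (g t)) has_integral (w \<nu> - w' \<nu>)) {p \<nu>..q \<nu>}" by (rule has_integral_diff[OF Zi s])
        have "norm (integral {p \<nu>..q \<nu>} (\<lambda>t. Z t - (theta1 t / L) *\<^sub>R Z (g t))) \<le> 48 * CZ * S * D * (q \<nu> - p \<nu>)"
        proof (rule norm_integral_le)
          show "(\<lambda>t. Z t - (theta1 t / L) *\<^sub>R Z (g t)) integrable_on {p \<nu>..q \<nu>}" using hd by blast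
          show "p \<nu> \<le> q \<nu>" by (rule pql[OF \<nu>])
          fix t assume t: "t \<in> {p \<nu>..q \<nu>}"
          have t1: "\<bar>t - T\<bar> \<le> 2 * H - 2" "\<bar>g t - T\<bar> \<le> 2 * H - 1" using near[OF \<nu>, of t] gnear[OF \<nu>, of t] t by auto
          then have t2: "\<bar>t - T\<bar> \<le> 2 * H" "\<bar>t - T\<bar> \<le> 2 * H - 1" by linarith+
          have "Z t - (theta1 t / L) *\<^sub>R Z (g t) = (Z t - Z (g t)) - (theta1 t / L - 1) *\<^sub>R Z (g t)" by (simp add: algebra_simps)
          then have "norm (Z t - (theta1 t / L) *\<^sub>R Z (g t)) \<le> norm (Z t - Z (g t)) + \<bar>theta1 t / L - 1\<bar> * norm (Z (g t))"
            by (metis norm_triangle_ineq4 norm_scaleR)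
          moreover have "norm (Z t - Z (g t)) \<le> CZ * S * (32 * D)"
          proof -
            have "norm (Z t - Z (g t)) \<le> CZ * S * Q * \<bar>t - g t\<bar>" unfolding S_def Q_def by (rule Zl[OF T(2) H t2(2) t1(2)])
            also have "\<dots> \<le> CZ * S * Q * (32 * (H\<^sup>2 / T))" using gt(1)[OF t2(1)] CZ S Q by (intro mult_left_mono) (auto simp: abs_minus_commute)
            also have "\<dots> = CZ * S * (32 * D)" by (simp add: D_def)
            finally show ?thesis .
          qed
          moreover have "\<bar>theta1 t / L - 1\<bar> * norm (Z (g t)) \<le> (16 * D) * (CZ * S)"
          proof (rule mult_mono)
            show "\<bar>theta1 t / L - 1\<bar> \<le> 16 * D" using gt(2)[OF t2(1)] D(3) by linarith
            have "T / 2 \<le> g t" "g t \<le> 2 * T" using t1(2) W(3) by linarith+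
            then show "norm (Z (g t)) \<le> CZ * S" unfolding S_def by (rule Zb[OF T(2)])
          qed (use D in auto)
          ultimately show "norm (Z t - (theta1 t / L) *\<^sub>R Z (g t)) \<le> 48 * CZ * S * D" by (simp add: algebra_simps)
        qed
        then have "norm (w \<nu> - w' \<nu>) \<le> 48 * CZ * S * D * (q \<nu> - p \<nu>)" unfolding integral_unique[OF hd] .
        also have "\<dots> \<le> 48 * CZ * S * D * (2 * x)" using pql(2)[OF \<nu>] CZ S D by (intro mult_left_mono) auto
        finally show ?thesis .
      qed
      have E2: "norm ((\<Sum>\<nu>\<in>I. w \<nu>) - (\<Sum>\<nu>\<in>I. w' \<nu>)) \<le> 384 * c * CZ * (x * S)"
      proof -
        have "norm ((\<Sum>\<nu>\<in>I. w \<nu>) - (\<Sum>\<nu>\<in>I. w' \<nu>)) \<le> real (card I) * (48 * CZ * S * D * (2 * x))"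
          unfolding sum_subtractf[symmetric] by (rule sum_norm_bound[OF wdiff])
        also have "\<dots> \<le> (4 * c * Q * H) * (48 * CZ * S * D * (2 * x))"
        proof (rule mult_right_mono)
          have "L * H \<le> 4 * c * Q * H" using LQ H10 by (intro mult_right_mono) auto
          then show "real (card I) \<le> 4 * c * Q * H" using cardI JL J0 by simp
        qed (use CZ S D x in simp)
        also have "\<dots> = 384 * c * CZ * (x * S) * (Q * H * D)" by simp
        also have "\<dots> \<le> 384 * c * CZ * (x * S) * 1" using D(4) c CZ x S by (intro mult_left_mono) auto
        finally show ?thesis by simp
      qed
      have E3: "norm ((\<Sum>\<nu>\<in>I. w' \<nu>) - of_real (4 * J / L * (- 1) ^ e * sin x)) \<le> 2 * CL * (x * S)"
      proof -
        \<comment> \<open>On a window of the linear phase \<tau> itself serves as the variable, with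
          dt = d\<tau>/L; summing over \<nu> inside the integral then gives the sums at fixed
          \<tau>.\<close>
        define h where "h \<tau> = (\<Sum>\<nu>\<in>I. (1 / L) *\<^sub>R Z ((\<kappa> \<nu> + \<tau> - \<alpha>) / L))" for \<tau>
        have h1: "(h has_integral (\<Sum>\<nu>\<in>I. w' \<nu>)) {- x..x}"
          unfolding h_def
        proof (rule has_integral_sum[OF finI])
          fix \<nu> assume \<nu>: "\<nu> \<in> I"
          define k where "k \<tau> = (\<kappa> \<nu> + \<tau> - \<alpha>) / L" for \<tau>
          have k: "k (- x) = g (p \<nu>)" "k x = g (q \<nu>)" using pq[OF \<nu>] by (simp_all add: k_def g_def)
          have kr: "g (p \<nu>) \<le> k \<tau> \<and> k \<tau> \<le> g (q \<nu>)" if "- x \<le> \<tau>" "\<tau> \<le> x" for \<tau>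
            unfolding k[symmetric] k_def using that L by (auto intro!: divide_right_mono)
          have "((\<lambda>\<tau>. (1 / L) *\<^sub>R Z (k \<tau>)) has_integral (integral {k (- x)..k x} Z)) {- x..x}"
          proof (rule has_integral_substitution[where f = Z and g = k and g' = "\<lambda>_. 1 / L" and c = "g (p \<nu>)" and d = "g (q \<nu>)"])
            show "- x \<le> x" using x by simp
            show "k (- x) \<le> k x" using kr[of x] k x by simp
            show "k ` {- x..x} \<subseteq> {g (p \<nu>)..g (q \<nu>)}" using kr by auto
            have "T / 2 \<le> g (p \<nu>)" using gnear[OF \<nu>, of "p \<nu>"] pql(1)[OF \<nu>] W(3) by linarith
            then show "continuous_on {g (p \<nu>)..g (q \<nu>)} Z" by (intro Zc) (use T' in simp)
            fix \<tau> show "(k has_real_derivative 1 / L) (at \<tau> within {- x..x})"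
              unfolding k_def using L by (auto intro!: derivative_eq_intros)
          qed
          then have "((\<lambda>\<tau>. (1 / L) *\<^sub>R Z (k \<tau>)) has_integral w' \<nu>) {- x..x}" unfolding w'_def k .
          then show "((\<lambda>\<tau>. (1 / L) *\<^sub>R Z ((\<kappa> \<nu> + \<tau> - \<alpha>) / L)) has_integral w' \<nu>) {- x..x}"
            unfolding k_def .
        qed
        define f where "f \<tau> = 2 * J / L * (- 1) ^ e * cos \<tau>" for \<tau>
        have "(cos has_integral (sin x - sin (- x))) {- x..x}"
          by (rule fundamental_theorem_of_calculus[where f = sin])
            (use x in \<open>auto simp: has_real_derivative_iff_has_vector_derivative[symmetric] intro!: derivative_eq_intros\<close>)
        then have "(f has_integral 2 * J / L * (- 1) ^ e * (sin x - sin (- x))) {- x..x}"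
          unfolding f_def by (rule has_integral_mult_right)
        then have "((of_real \<circ> f) has_integral complex_of_real (2 * J / L * (- 1) ^ e * (sin x - sin (- x)))) {- x..x}"
          by (rule has_integral_linear) (rule bounded_linear_of_real)
        then have h2: "((\<lambda>\<tau>. complex_of_real (f \<tau>)) has_integral of_real (4 * J / L * (- 1) ^ e * sin x)) {- x..x}"
          by (simp add: o_def mult_ac)
        have hd: "((\<lambda>\<tau>. h \<tau> - of_real (f \<tau>)) has_integral ((\<Sum>\<nu>\<in>I. w' \<nu>) - of_real (4 * J / L * (- 1) ^ e * sin x))) {- x..x}"
          by (rule has_integral_diff[OF h1 h2])
        have "norm (integral {- x..x} (\<lambda>\<tau>. h \<tau> - of_real (f \<tau>))) \<le> CL * S * (x - - x)"
        proof (rule norm_integral_le)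
          show "(\<lambda>\<tau>. h \<tau> - of_real (f \<tau>)) integrable_on {- x..x}" using hd by blast
          show "- x \<le> x" using x by simp
          fix \<tau> assume \<tau>: "\<tau> \<in> {- x..x}"
          define \<beta> where "\<beta> = theta T - theta1 T * T - (pi * e + \<tau>)"
          have \<beta>: "\<kappa> \<nu> + \<tau> - \<alpha> = 2 * pi * of_int (int \<nu>) - \<beta>" for \<nu> by (simp add: \<kappa>_int \<beta>_def \<alpha>_def L_def)
          have LT: "L * (T - H) = L * T - L * H" by (simp add: algebra_simps)
          have LT2: "L * (T + 2 * H) = L * T + L * H + L * H" by (simp add: algebra_simps)
          have \<tau>1: "- x \<le> \<tau>" "\<tau> \<le> x" using \<tau> by auto
          have lin1: "theta (T + H) - theta T - L * H \<le> 1" using lin by (rule abs_le_D1)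
          have \<beta>e: "\<beta> = theta T - L * T - pi * e - \<tau>" by (simp add: \<beta>_def L_def)
          \<comment> \<open>Roundings, the half-spacing pi and \<tau> move the ends by a bounded
            amount of phase, which L H >= H >= 10 absorbs.\<close>
          have y: "T - H \<le> (2 * pi * of_int a + pi - \<beta>) / L" "(2 * pi * of_int b + pi - \<beta>) / L \<le> T + 2 * H"
          proof -
            have "L * (T - H) \<le> 2 * pi * of_int a + pi - \<beta>" unfolding LT \<beta>e using Ja(1) \<tau>1 x2 LH H10 pi_less_4 by linarith
            then show "T - H \<le> (2 * pi * of_int a + pi - \<beta>) / L" using L by (simp add: pos_le_divide_eq mult.commute)
            have "2 * pi * of_int b + pi - \<beta> \<le> L * (T + 2 * H)" unfolding LT2 \<beta>e using Jb(2) lin1 \<tau>1 x2 LH H10 pi_less_4 by linarith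
            then show "(2 * pi * of_int b + pi - \<beta>) / L \<le> T + 2 * H" using L by (simp add: pos_divide_le_eq mult.commute)
          qed
          have "h \<tau> = (1 / L) *\<^sub>R (\<Sum>\<nu>\<in>{a<..b}. Z ((2 * pi * of_int \<nu> - \<beta>) / L))"
            unfolding h_def \<beta> scaleR_sum_right[symmetric] by (rule arg_cong[where f = "scaleR (1 / L)"]) (rule reindex)
          moreover have "complex_of_real (f \<tau>) = (1 / L) *\<^sub>R of_real (2 * of_int (b - a) * cos (pi * e + \<tau>))"
          proof -
            have "cos (pi * e + \<tau>) = (- 1) ^ e * cos \<tau>" using e by (cases "e = 0") (auto simp: cos_add le_Suc_eq)
            then show ?thesis by (simp add: f_def J_def scaleR_conv_of_real)
          qed
          ultimately have "h \<tau> - of_real (f \<tau>) = (1 / L) *\<^sub>R ((\<Sum>\<nu>\<in>{a<..b}. Z ((2 * pi * of_int \<nu> - \<beta>) / L)) - of_real (2 * of_int (b - a) * cos (pi * e + \<tau>)))"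
            by (simp only: scaleR_diff_right)
          then have "norm (h \<tau> - of_real (f \<tau>)) = 1 / L * norm ((\<Sum>\<nu>\<in>{a<..b}. Z ((2 * pi * of_int \<nu> - \<beta>) / L)) - of_real (2 * of_int (b - a) * cos (pi * e + \<tau>)))"
            using L by (simp only: norm_scaleR) simp
          also have "\<dots> \<le> 1 / L * (CL * (L * S))"
            unfolding S_def using L by (intro mult_left_mono lgs[OF T(1) H L_def \<beta>_def ab y]) auto
          also have "\<dots> = CL * S" using L by simp
          finally show "norm (h \<tau> - of_real (f \<tau>)) \<le> CL * S" .
        qed
        then show ?thesis unfolding integral_unique[OF hd] by (simp add: mult_ac)
      qed
      have E4: "norm (complex_of_real (4 * J / L * (- 1) ^ e * sin x) - of_real ((- 1) ^ e * (2 / pi * H * sin x))) \<le> 8 * (x * S)"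
      proof -
        have eq: "4 * J / L * (- 1) ^ e * sin x - (- 1) ^ e * (2 / pi * H * sin x) = (- 1) ^ e * (2 / (pi * L) * (2 * pi * J - L * H) * sin x)"
          using L by (simp add: field_simps)
        have gen: "\<bar>(- 1) ^ e * (k * d * y)\<bar> = k * \<bar>d\<bar> * \<bar>y\<bar>" if "0 \<le> k" for k d y :: real
          using that by (simp add: abs_mult power_abs)
        have "norm (complex_of_real (4 * J / L * (- 1) ^ e * sin x) - of_real ((- 1) ^ e * (2 / pi * H * sin x))) = 2 / (pi * L) * \<bar>2 * pi * J - L * H\<bar> * \<bar>sin x\<bar>"
          unfolding of_real_diff[symmetric] norm_of_real eq by (rule gen) (use L in simp)
        \<comment> \<open>The lower bound 2.25 for pi L is chosen so that 2 * 9 / 2.25 = 8.\<close>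
        also have "\<dots> \<le> 2 / (2.25 * 1) * 9 * x"
        proof (intro mult_mono)
          have "2.25 * 1 \<le> pi * L" using L pi_gt3 by (intro mult_mono) auto
          then show "2 / (pi * L) \<le> 2 / (2.25 * 1)" by (intro divide_left_mono) auto
          show "\<bar>sin x\<bar> \<le> x" using abs_sin_x_le_abs_x[of x] x by simp
        qed (rule JLH | (use x L in simp))+
        also have "\<dots> = 8 * (x * 1)" by simp
        also have "\<dots> \<le> 8 * (x * S)" using S x by (intro mult_left_mono) auto
        finally show ?thesis .
      qed
      define v where "v \<nu> = integral {max (p \<nu>) T..min (q \<nu>) (T + H)} Z" for \<nu>
      have vi: "(Z has_integral v \<nu>) ({t. p \<nu> < t \<and> t < q \<nu>} \<inter> {T..T + H})" for \<nu>
        unfolding v_def using T' by (intro has_integral_open_inter integrable_continuous_real Zc) auto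
      have disj: "{t. p \<nu> < t \<and> t < q \<nu>} \<inter> {T..T + H} \<inter> ({t. p \<nu>' < t \<and> t < q \<nu>'} \<inter> {T..T + H}) = {}"
        if "\<nu> \<in> I" "\<nu>' \<in> I" "\<nu> < \<nu>'" for \<nu> \<nu>'
      proof -
        have "real (2 * \<nu> + e) + 1 \<le> real (2 * \<nu>' + e)" using that(3) by simp
        then have "pi * (real (2 * \<nu> + e) + 1) \<le> pi * real (2 * \<nu>' + e)" by (intro mult_left_mono) auto
        then have "\<kappa> \<nu> + pi \<le> \<kappa> \<nu>'" by (simp only: \<kappa>_def distrib_left mult_1_right)
        then have "theta (q \<nu>) \<le> theta (p \<nu>')" using pq(4)[OF that(1)] pq(3)[OF that(2)] x by linarith
        moreover have "t0 \<le> q \<nu>" "t0 \<le> p \<nu>'" using pq(5)[OF that(1)] pq(1)[OF that(2)] tt by linarith+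
        ultimately have "q \<nu> \<le> p \<nu>'" by (rule inc[rotated 2])
        then show ?thesis by auto
      qed
      have vI: "(Z has_integral (\<Sum>\<nu>\<in>I. v \<nu>)) (\<Union>\<nu>\<in>I. {t. p \<nu> < t \<and> t < q \<nu>} \<inter> {T..T + H})"
      proof (rule has_integral_UN[OF finI vi])
        show "pairwise (\<lambda>\<nu> \<nu>'. negligible ({t. p \<nu> < t \<and> t < q \<nu>} \<inter> {T..T + H} \<inter> ({t. p \<nu>' < t \<and> t < q \<nu>'} \<inter> {T..T + H}))) I"
        proof (rule pairwiseI)
          fix \<nu> \<nu>' assume n: "\<nu> \<in> I" "\<nu>' \<in> I" "\<nu> \<noteq> \<nu>'"
          then consider "\<nu> < \<nu>'" | "\<nu>' < \<nu>" by linarith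
          then have "{t. p \<nu> < t \<and> t < q \<nu>} \<inter> {T..T + H} \<inter> ({t. p \<nu>' < t \<and> t < q \<nu>'} \<inter> {T..T + H}) = {}"
            using disj[of \<nu> \<nu>'] disj[of \<nu>' \<nu>] n by cases (simp_all add: Int_commute)
          then show "negligible ({t. p \<nu> < t \<and> t < q \<nu>} \<inter> {T..T + H} \<inter> ({t. p \<nu>' < t \<and> t < q \<nu>'} \<inter> {T..T + H}))" by (simp only: negligible_empty)
        qed
      qed
      have E0: "integral ((\<Union>\<nu>\<in>I. {t. p \<nu> < t \<and> t < q \<nu>}) \<inter> {T..T + H}) Z = (\<Sum>\<nu>\<in>I. v \<nu>)"
      proof -
        have "(\<Union>\<nu>\<in>I. {t. p \<nu> < t \<and> t < q \<nu>}) \<inter> {T..T + H} = (\<Union>\<nu>\<in>I. {t. p \<nu> < t \<and> t < q \<nu>} \<inter> {T..T + H})" by blast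
        then show ?thesis using vI by (simp only: integral_unique)
      qed
      have Ib: "norm (integral {u..u'} Z) \<le> CZ * S * (2 * x)" if "T - 2 \<le> u" "u \<le> u'" "u' \<le> T + H + 2" "u' - u \<le> 2 * x" for u u'
      proof -
        have "norm (integral {u..u'} Z) \<le> CZ * S * (u' - u)"
        proof (rule norm_integral_le)
          show "Z integrable_on {u..u'}" using that T' by (intro integrable_continuous_real Zc) auto
          fix t assume "t \<in> {u..u'}"
          then have "T / 2 \<le> t" "t \<le> 2 * T" using that T' W(3) H10 by auto
          then show "norm (Z t) \<le> CZ * S" unfolding S_def by (rule Zb[OF T(2)])
        qed (rule that)
        also have "\<dots> \<le> CZ * S * (2 * x)" using that CZ S by (intro mult_left_mono) auto
        finally show ?thesis .
      qed
      define B where "B = 4 * CZ * (x * S)"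
      have B0: "0 \<le> B" using CZ x S by (simp add: B_def)
      \<comment> \<open>Only the extreme indices a + 1 and b can have a clipped window; for every
        other index both neighbours at phase distance 2 pi are still counted, while the window
        reaches at most pi/2. \<open>B\<close> adds the bounds for the clipped and the full
        window.\<close>
      have vw: "norm (v \<nu> - w \<nu>) \<le> (if \<nu> = nat (a + 1) then B else 0) + (if \<nu> = nat b then B else 0)" if \<nu>: "\<nu> \<in> I" for \<nu>
      proof (cases "T \<le> p \<nu> \<and> q \<nu> \<le> T + H")
        case True
        then show ?thesis using B0 by (simp add: v_def w_def max_absorb1 min_absorb1)
      next
        case False
        have k: "theta T \<le> \<kappa> \<nu>" "\<kappa> \<nu> \<le> theta (T + H)" using \<nu> I_iff by auto
        have th: "theta T \<le> theta (q \<nu>)" "theta (p \<nu>) \<le> theta (T + H)" using k x pq(3,4)[OF \<nu>] by linarith+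
        have ge: "t0 \<le> q \<nu>" "t0 \<le> p \<nu>" using pq(1,5)[OF \<nu>] tt by linarith+
        have c1: "T \<le> q \<nu>" "p \<nu> \<le> T + H" by (rule inc[OF tt(2) ge(1) th(1)], rule inc[OF ge(2) tt(3) th(2)])
        have le: "max (p \<nu>) T \<le> min (q \<nu>) (T + H)" using c1 pql(1)[OF \<nu>] H10 by simp
        have "norm (v \<nu>) \<le> CZ * S * (2 * x)" unfolding v_def
          using le pq[OF \<nu>] pql[OF \<nu>] by (intro Ib) auto
        moreover have "norm (w \<nu>) \<le> CZ * S * (2 * x)" unfolding w_def
          using pq[OF \<nu>] pql[OF \<nu>] by (intro Ib) auto
        ultimately have n: "norm (v \<nu> - w \<nu>) \<le> B" using norm_triangle_ineq4[of "v \<nu>" "w \<nu>"] by (simp add: B_def mult_ac)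
        have ends: "\<nu> = nat (a + 1) \<or> \<nu> = nat b"
        proof (rule ccontr)
          assume ne: "\<not> (\<nu> = nat (a + 1) \<or> \<nu> = nat b)"
          have r: "a < int \<nu>" "int \<nu> \<le> b" using \<nu> I_int by auto
          have "a < int \<nu> - 1" "int \<nu> + 1 \<le> b" using ne r by auto
          then have "theta T \<le> 2 * pi * of_int (int \<nu> - 1) + pi * e" "2 * pi * of_int (int \<nu> + 1) + pi * e \<le> theta (T + H)"
            by (simp_all only: ab_iff)
          then have "theta T \<le> \<kappa> \<nu> - 2 * pi" "\<kappa> \<nu> + 2 * pi \<le> theta (T + H)" unfolding \<kappa>_int by (simp_all add: algebra_simps)
          then have th': "theta T \<le> theta (p \<nu>)" "theta (q \<nu>) \<le> theta (T + H)" using pq(3,4)[OF \<nu>] x pi_gt_zero by linarith+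
          have "T \<le> p \<nu>" "q \<nu> \<le> T + H" by (rule inc[OF tt(2) ge(2) th'(1)], rule inc[OF ge(1) tt(3) th'(2)])
          then show False using False by simp
        qed
        have "B \<le> (if P then B else 0) + (if R then B else 0)" if "P \<or> R" for P R
          using that B0 by auto
        from this[OF ends] have "B \<le> (if \<nu> = nat (a + 1) then B else 0) + (if \<nu> = nat b then B else 0)" .
        with n show ?thesis by (rule order_trans)
      qed
      have E1: "norm ((\<Sum>\<nu>\<in>I. v \<nu>) - (\<Sum>\<nu>\<in>I. w \<nu>)) \<le> 8 * CZ * (x * S)"
      proof -
        have "norm ((\<Sum>\<nu>\<in>I. v \<nu>) - (\<Sum>\<nu>\<in>I. w \<nu>)) \<le> (\<Sum>\<nu>\<in>I. (if \<nu> = nat (a + 1) then B else 0) + (if \<nu> = nat b then B else 0))"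
          unfolding sum_subtractf[symmetric] by (rule sum_norm_le[OF vw])
        also have "\<dots> \<le> B + B" unfolding sum.distrib sum.delta[OF finI] using B0 by (intro add_mono) auto
        finally show ?thesis by (simp add: B_def mult_ac)
      qed
      have tri: "norm (z1 - z5) \<le> norm (z1 - z2) + norm (z2 - z3) + norm (z3 - z4) + norm (z4 - z5)" for z1 z2 z3 z4 z5 :: complex
        by norm
      have "norm ((\<Sum>\<nu>\<in>I. v \<nu>) - of_real ((- 1) ^ e * (2 / pi * H * sin x))) \<le>
          norm ((\<Sum>\<nu>\<in>I. v \<nu>) - (\<Sum>\<nu>\<in>I. w \<nu>)) + norm ((\<Sum>\<nu>\<in>I. w \<nu>) - (\<Sum>\<nu>\<in>I. w' \<nu>))
          + norm ((\<Sum>\<nu>\<in>I. w' \<nu>) - of_real (4 * J / L * (- 1) ^ e * sin x))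
          + norm (complex_of_real (4 * J / L * (- 1) ^ e * sin x) - of_real ((- 1) ^ e * (2 / pi * H * sin x)))"
        by (rule tri)
      also have "\<dots> \<le> 8 * CZ * (x * S) + 384 * c * CZ * (x * S) + 2 * CL * (x * S) + 8 * (x * S)"
        by (intro add_mono E1 E2 E3 E4)
      also have "\<dots> = C * (x * S)" by (simp add: C_def algebra_simps)
      finally have fin: "norm ((\<Sum>\<nu>\<in>I. v \<nu>) - of_real ((- 1) ^ e * (2 / pi * H * sin x))) \<le> C * (x * S)" .
      show "norm (integral ((\<Union>\<nu>\<in>{\<nu>. 1 \<le> \<nu> \<and> T \<le> gram (2 * \<nu> + e) 0 \<and> gram (2 * \<nu> + e) 0 \<le> T + H}.
        {t. gram (2 * \<nu> + e) (- x) < t \<and> t < gram (2 * \<nu> + e) x}) \<inter> {T..T + H}) Z - of_real ((- 1) ^ e * (2 / pi * H * sin x)))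
     \<le> C * (x * T powr (1/6 + 5 * \<epsilon> / 8))"
        unfolding m_def[symmetric] p_def[symmetric] q_def[symmetric] I_def[symmetric] E0 S_def[symmetric] by (rule fin)
    qed
  qed
qed

theorem theorem1:
  "\<exists>\<epsilon>0 > (0::real). \<forall>\<epsilon>. 0 < \<epsilon> \<and> \<epsilon> < \<epsilon>0 \<longrightarrow>
     (\<exists>(C::real) (T0::real). 0 < C \<and> 0 < T0 \<and>
       (\<forall>T \<ge> T0. let H = T powr (1 / 6 + 2 * \<epsilon>) in
          (\<forall>x. 0 < x \<and> x \<le> pi / 2 \<longrightarrow>
             norm (integral (G1 x T H) Z - complex_of_real (2 / pi * H * sin x))
               \<le> C * (x * T powr (1 / 6 + \<epsilon>))) \<and>
          (\<forall>y. 0 < y \<and> y \<le> pi / 2 \<longrightarrow>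
             norm (integral (G2 y T H) Z - complex_of_real (- (2 / pi * H * sin y)))
               \<le> C * (y * T powr (1 / 6 + \<epsilon>)))))"
proof (rule exI[of _ "1/100"], intro conjI allI impI)
  fix \<epsilon> :: real assume "0 < \<epsilon> \<and> \<epsilon> < 1 / 100"
  \<comment> \<open>Below 1/100 all comparisons of exponents hold with room, for instance 1/3 +
    4\<epsilon> <= 1/2 and 3/4 + 6\<epsilon> <= 1.\<close>
  then have \<epsilon>: "0 < \<epsilon>" "\<epsilon> \<le> 1 / 100" by auto
  obtain C1 T1 where 1: "0 < C1" "0 < T1" and b1: "\<forall>T H x. T1 \<le> T \<longrightarrow> H = T powr (1/6 + 2 * \<epsilon>) \<longrightarrow> 0 < x \<longrightarrow> x \<le> pi / 2 \<longrightarrow>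
     norm (integral ((\<Union>\<nu>\<in>{\<nu>. 1 \<le> \<nu> \<and> T \<le> gram (2 * \<nu> + 0) 0 \<and> gram (2 * \<nu> + 0) 0 \<le> T + H}.
        {t. gram (2 * \<nu> + 0) (- x) < t \<and> t < gram (2 * \<nu> + 0) x}) \<inter> {T..T + H}) Z - of_real ((- 1) ^ 0 * (2 / pi * H * sin x)))
     \<le> C1 * (x * T powr (1/6 + 5 * \<epsilon> / 8))"
    using gram_windows_integral[OF \<epsilon>, of 0] by blast
  obtain C2 T2 where 2: "0 < C2" "0 < T2" and b2: "\<forall>T H x. T2 \<le> T \<longrightarrow> H = T powr (1/6 + 2 * \<epsilon>) \<longrightarrow> 0 < x \<longrightarrow> x \<le> pi / 2 \<longrightarrow>
     norm (integral ((\<Union>\<nu>\<in>{\<nu>. 1 \<le> \<nu> \<and> T \<le> gram (2 * \<nu> + 1) 0 \<and> gram (2 * \<nu> + 1) 0 \<le> T + H}.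
        {t. gram (2 * \<nu> + 1) (- x) < t \<and> t < gram (2 * \<nu> + 1) x}) \<inter> {T..T + H}) Z - of_real ((- 1) ^ 1 * (2 / pi * H * sin x)))
     \<le> C2 * (x * T powr (1/6 + 5 * \<epsilon> / 8))"
    using gram_windows_integral[OF \<epsilon>, of 1] by blast
  \<comment> \<open>The proved exponent 5\<epsilon>/8 is below \<epsilon>, and T >= 1 makes the
    power monotone in it; C1 + C2 serves both families of windows.\<close>
  have wk: "D * (x * T powr (1/6 + 5 * \<epsilon> / 8)) \<le> (C1 + C2) * (x * T powr (1 / 6 + \<epsilon>))"
    if "D \<le> C1 + C2" "max (max T1 T2) 1 \<le> T" "0 < x" for D T x
    using that 1 2 \<epsilon> by (intro mult_mono powr_mono mult_left_mono) auto
  show "\<exists>(C::real) (T0::real). 0 < C \<and> 0 < T0 \<and>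
       (\<forall>T \<ge> T0. let H = T powr (1 / 6 + 2 * \<epsilon>) in
          (\<forall>x. 0 < x \<and> x \<le> pi / 2 \<longrightarrow>
             norm (integral (G1 x T H) Z - complex_of_real (2 / pi * H * sin x))
               \<le> C * (x * T powr (1 / 6 + \<epsilon>))) \<and>
          (\<forall>y. 0 < y \<and> y \<le> pi / 2 \<longrightarrow>
             norm (integral (G2 y T H) Z - complex_of_real (- (2 / pi * H * sin y)))
               \<le> C * (y * T powr (1 / 6 + \<epsilon>))))"
    unfolding Let_def
  proof (rule exI[of _ "C1 + C2"], rule exI[of _ "max (max T1 T2) 1"], intro conjI allI impI)
    fix T assume T: "max (max T1 T2) 1 \<le> T"
    let ?H = "T powr (1 / 6 + 2 * \<epsilon>)"
    show "norm (integral (G1 x T ?H) Z - complex_of_real (2 / pi * ?H * sin x)) \<le> (C1 + C2) * (x * T powr (1 / 6 + \<epsilon>))"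
      if x: "0 < x \<and> x \<le> pi / 2" for x
    proof -
      have "norm (integral (G1 x T ?H) Z - complex_of_real (2 / pi * ?H * sin x)) \<le> C1 * (x * T powr (1/6 + 5 * \<epsilon> / 8))"
        unfolding G1_def using b1[rule_format, of T ?H x] T x by (simp only: add_0_right power_0 mult_1_left)
      also have "\<dots> \<le> (C1 + C2) * (x * T powr (1 / 6 + \<epsilon>))" using T x 2 by (intro wk) auto
      finally show ?thesis .
    qed
    show "norm (integral (G2 x T ?H) Z - complex_of_real (- (2 / pi * ?H * sin x))) \<le> (C1 + C2) * (x * T powr (1 / 6 + \<epsilon>))"
      if x: "0 < x \<and> x \<le> pi / 2" for x
    proof -
      have "norm (integral (G2 x T ?H) Z - complex_of_real (- (2 / pi * ?H * sin x))) \<le> C2 * (x * T powr (1/6 + 5 * \<epsilon> / 8))"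
        unfolding G2_def using b2[rule_format, of T ?H x] T x by ((simp only: power_one_right mult_minus1; fail) | simp)
      also have "\<dots> \<le> (C1 + C2) * (x * T powr (1 / 6 + \<epsilon>))" using T x 1 by (intro wk) auto
      finally show ?thesis .
    qed
  qed (use 1 2 in auto)
qed simp

end
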